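(* Let $n\in\{2,3\}$, let $\Gamma$ be a bounded, non-empty, relatively open subset of $\Gamma_\infty=\{x\in\mathbb{R}^n:x_n=0\}$, and let $L:=\operatorname{diam}\Gamma$. The sesquilinear form on $\tilde H^{1/2}(\Gamma)\times\tilde H^{1/2}(\Gamma)$ defined by $$b(\phi,\psi):=\langle T_k\phi,\psi\rangle_{H^{-1/2}(\Gamma)\times\tilde H^{1/2}(\Gamma)},\qquad\phi,\psi\in\tilde H^{1/2}(\Gamma),$$ satisfies, for any $k_0>0$, the coercivity estimate $$|b(\phi,\phi)|\ge C(kL)^\beta\,\|\phi\|^2_{\tilde H^{1/2}_k(\Gamma)},\qquad\phi\in\tilde H^{1/2}(\Gamma),\ k\ge k_0,$$ where $C>0$ is a constant depending only on $k_0$, and $\beta=-\tfrac23$ if $n=3$, $\beta=-\tfrac12$ if $n=2$.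
   Context: $\Gamma_\infty$ is identified with $\mathbb{R}^{n-1}$, and Sobolev spaces on $\Gamma_\infty,\Gamma$ are defined through this identification. Sobolev spaces: with $m=n-1$ and $\hat u(\xi)=(2\pi)^{-m/2}\int_{\mathbb{R}^m}e^{-i\xi\cdot x}u(x)\,dx$ (extended to tempered distributions), $H^s(\mathbb{R}^m)$ is the space of tempered distributions $u$ with $\hat u$ locally integrable and $\|u\|_{H^s_k(\mathbb{R}^m)}^2=\int(k^2+|\xi|^2)^s|\hat u(\xi)|^2\,d\xi<\infty$. For $\Omega$ open, $\tilde H^s(\Omega)$ is the closure of $C_c^\infty(\Omega)$ in $H^s(\mathbb{R}^m)$, with $\|\cdot\|_{\tilde H^s_k(\Omega)}=\|\cdot\|_{H^s_k(\mathbb{R}^m)}$, and $H^s(\Omega)=\{U|_\Omega:U\in H^s(\mathbb{R}^m)\}$. For $u\in H^{-s}(\Omega)$, $v\in\tilde H^s(\Omega)$, $\langle u,v\rangle_{H^{-s}(\Omega)\times\tilde H^s(\Omega)}=\int\hat U(\xi)\overline{\hat v(\xi)}\,d\xi$, where $U\in H^{-s}(\mathbb{R}^m)$ is any extension of $u$ (the value is independent of the choice). Hypersingular operator ($k>0$): $\Phi(x,y)=e^{ik|x-y|}/(4\pi|x-y|)$ if $n=3$, $\Phi(x,y)=\frac i4H_0^{(1)}(k|x-y|)$ if $n=2$. For $\phi\in C_c^\infty(\Gamma)$, $T_k\phi(x)=\frac{\partial}{\partial x_n}\int_\Gamma\frac{\partial\Phi(x,y)}{\partial y_n}\phi(y)\,ds(y)$,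 $x\in\Gamma$, where the derivative $\partial/\partial x_n$ on $\Gamma$ is understood as the limit, as $x_n\to0^+$ or equivalently $x_n\to0^-$, of its values off $\Gamma_\infty$; $T_k:\tilde H^{1/2}(\Gamma)\to H^{-1/2}(\Gamma)$ is the unique continuous extension of this operator.
   Formalization: C is a positive function of k_0 L (the same for all Γ and both n) rather than of k_0 alone: since |b(φ,φ)| ≤ ½‖φ‖², taking k = k_0 and L → 0 makes (kL)^β → ∞, so no C depending only on k_0 can serve every Γ. *)

theory Defs
  imports "HOL-Analysis.Analysis"
begin

text \<open>
  A Euclidean space \<^typ>\<open>'a\<close> of dimension m = n - 1 plays the role of R^(n-1), and
  R^n is \<^typ>\<open>'a \<times> real\<close> (with its Euclidean norm), the second component being x_n.  The
  hyperplane x_n = 0 is identified with \<^typ>\<open>'a\<close> through \<^const>\<open>fst\<close>, under which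
  surface measure becomes Lebesgue measure.
\<close>

section \<open>Test functions and distributions\<close>

text \<open>Iterated partial derivative, one for each entry of a list of coordinate directions.\<close>

fun iter_deriv :: "'a list \<Rightarrow> ('a::euclidean_space \<Rightarrow> complex) \<Rightarrow> 'a \<Rightarrow> complex" where
  "iter_deriv [] f = f"
| "iter_deriv (b # bs) f = (\<lambda>x. frechet_derivative (iter_deriv bs f) (at x) b)"

definition smooth :: "('a::euclidean_space \<Rightarrow> complex) \<Rightarrow> bool" where
  "smooth f \<longleftrightarrow> (\<forall>bs. set bs \<subseteq> Basis \<longrightarrow> (\<forall>x. iter_deriv bs f differentiable (at x)))"

definition test_functions :: "'a::euclidean_space set \<Rightarrow> ('a \<Rightarrow> complex) set" where
  "test_functions \<Omega> =
     {f. smooth f \<and> compact (closure {x. f x \<noteq> 0}) \<and> closure {x. f x \<noteq> 0} \<subseteq> \<Omega>}"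

definition schwartz :: "('a::euclidean_space \<Rightarrow> complex) set" where
  "schwartz = {f. smooth f \<and>
     (\<forall>N bs. set bs \<subseteq> Basis \<longrightarrow> (\<exists>M. \<forall>x. (1 + norm x) ^ N * cmod (iter_deriv bs f x) \<le> M))}"

text \<open>
  Distributions are functionals on functions, normalised to be 0 outside the relevant test space
  so that equality of distributions is equality of HOL functions.
\<close>

type_synonym 'a distr = "('a \<Rightarrow> complex) \<Rightarrow> complex"

text \<open>
  Linear functionals on the Schwartz space, continuous for its usual topology, that is, bounded by
  a finite combination of the defining seminorms.
\<close>

definition tempered :: "'a::euclidean_space distr set" where
  "tempered = {u.
     (\<forall>f. f \<notin> schwartz \<longrightarrow> u f = 0) \<and>
     (\<forall>f\<in>schwartz. \<forall>g\<in>schwartz. \<forall>a b. u (\<lambda>x. a * f x + b * g x) = a * u f + b * u g) \<and>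
     (\<exists>C N. \<forall>f\<in>schwartz. \<forall>M.
        (\<forall>bs x. set bs \<subseteq> Basis \<and> length bs \<le> N \<longrightarrow>
           (1 + norm x) ^ N * cmod (iter_deriv bs f x) \<le> M)
        \<longrightarrow> cmod (u f) \<le> C * M)}"

definition tempered_of_fun :: "('a::euclidean_space \<Rightarrow> complex) \<Rightarrow> 'a distr" where
  "tempered_of_fun g = (\<lambda>f. if f \<in> schwartz then (LINT x|lborel. g x * f x) else 0)"

definition distr_of_fun_on :: "'a::euclidean_space set \<Rightarrow> ('a \<Rightarrow> complex) \<Rightarrow> 'a distr" where
  "distr_of_fun_on \<Omega> g =
     (\<lambda>f. if f \<in> test_functions \<Omega> then (LINT x:\<Omega>|lborel. g x * f x) else 0)"

definition restrict_distr :: "'a::euclidean_space set \<Rightarrow> 'a distr \<Rightarrow> 'a distr" where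
  "restrict_distr \<Omega> U = (\<lambda>f. if f \<in> test_functions \<Omega> then U f else 0)"

definition locally_integrable :: "('a::euclidean_space \<Rightarrow> complex) \<Rightarrow> bool" where
  "locally_integrable g \<longleftrightarrow> (\<forall>K. compact K \<longrightarrow> set_integrable lborel K g)"

section \<open>Fourier transform\<close>

definition fourier :: "('a::euclidean_space \<Rightarrow> complex) \<Rightarrow> 'a \<Rightarrow> complex" where
  "fourier f \<xi> = of_real ((2 * pi) powr (- real DIM('a) / 2)) *
     (LINT x|lborel. exp (- \<i> * of_real (\<xi> \<bullet> x)) * f x)"

definition fourier_distr :: "'a::euclidean_space distr \<Rightarrow> 'a distr" where
  "fourier_distr u = (\<lambda>f. if f \<in> schwartz then u (fourier f) else 0)"

definition is_fourier_fun :: "'a::euclidean_space distr \<Rightarrow> ('a \<Rightarrow> complex) \<Rightarrow> bool" where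
  "is_fourier_fun u g \<longleftrightarrow> locally_integrable g \<and>
     (\<forall>f\<in>test_functions UNIV. fourier_distr u f = (LINT \<xi>|lborel. g \<xi> * f \<xi>))"

text \<open>The Fourier transform as a function, determined up to a null set when it exists.\<close>

definition fourier_fun :: "'a::euclidean_space distr \<Rightarrow> 'a \<Rightarrow> complex" where
  "fourier_fun u = (SOME g. is_fourier_fun u g)"

section \<open>Sobolev spaces\<close>

text \<open>
  For each s the norms with different k > 0 are equivalent; k = 1 is used wherever only
  finiteness or the topology matters.
\<close>

definition sobolev_norm :: "real \<Rightarrow> real \<Rightarrow> 'a::euclidean_space distr \<Rightarrow> real" where
  "sobolev_norm k s u =
     sqrt (LINT \<xi>|lborel. (k\<^sup>2 + (norm \<xi>)\<^sup>2) powr s * (cmod (fourier_fun u \<xi>))\<^sup>2)"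

definition sobolev :: "real \<Rightarrow> 'a::euclidean_space distr set" where
  "sobolev s = {u \<in> tempered. (\<exists>g. is_fourier_fun u g) \<and>
     integrable lborel (\<lambda>\<xi>. (1 + (norm \<xi>)\<^sup>2) powr s * (cmod (fourier_fun u \<xi>))\<^sup>2)}"

definition sobolev_tilde :: "real \<Rightarrow> 'a::euclidean_space set \<Rightarrow> 'a distr set" where
  "sobolev_tilde s \<Omega> = {u \<in> sobolev s. \<forall>\<epsilon>>0. \<exists>\<phi>\<in>test_functions \<Omega>.
     sobolev_norm 1 s (\<lambda>f. u f - tempered_of_fun \<phi> f) < \<epsilon>}"

definition sobolev_on :: "real \<Rightarrow> 'a::euclidean_space set \<Rightarrow> 'a distr set" where
  "sobolev_on s \<Omega> = restrict_distr \<Omega> ` sobolev s"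

text \<open>The quotient norm on the space of restrictions.\<close>

definition sobolev_on_norm :: "real \<Rightarrow> 'a::euclidean_space set \<Rightarrow> 'a distr \<Rightarrow> real" where
  "sobolev_on_norm s \<Omega> u = Inf (sobolev_norm 1 s ` {U \<in> sobolev s. restrict_distr \<Omega> U = u})"

text \<open>The pairing of H^(-s) and tilde-H^s on \<open>\<Omega>\<close>; it does not depend on the extension chosen.\<close>

definition duality :: "real \<Rightarrow> 'a::euclidean_space set \<Rightarrow> 'a distr \<Rightarrow> 'a distr \<Rightarrow> complex" where
  "duality s \<Omega> u v =
     (let U = (SOME U. U \<in> sobolev (- s) \<and> restrict_distr \<Omega> U = u)
      in LINT \<xi>|lborel. fourier_fun U \<xi> * cnj (fourier_fun v \<xi>))"

section \<open>The hypersingular operator\<close>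

text \<open>Hankel function of the first kind and order 0 on the positive reals, J_0 + i Y_0, by the
  standard ascending series.\<close>

definition bessel_J0 :: "real \<Rightarrow> real" where
  "bessel_J0 z = (\<Sum>j. (- 1) ^ j * (z\<^sup>2 / 4) ^ j / (fact j)\<^sup>2)"

definition bessel_Y0 :: "real \<Rightarrow> real" where
  "bessel_Y0 z = 2 / pi * (ln (z / 2) + euler_mascheroni) * bessel_J0 z
     + 2 / pi * (\<Sum>j. (- 1) ^ (j + 1) * harm j * (z\<^sup>2 / 4) ^ j / (fact j)\<^sup>2)"

definition hankel1_0 :: "real \<Rightarrow> complex" where
  "hankel1_0 z = Complex (bessel_J0 z) (bessel_Y0 z)"

text \<open>Only dimensions 2 and 3 are intended; the value in other dimensions is irrelevant.\<close>

definition fund_sol :: "real \<Rightarrow> 'b::euclidean_space \<Rightarrow> 'b \<Rightarrow> complex" where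
  "fund_sol k x y =
     (if DIM('b) = 3 then exp (\<i> * of_real (k * dist x y)) / of_real (4 * pi * dist x y)
      else \<i> / 4 * hankel1_0 (k * dist x y))"

definition double_layer ::
  "real \<Rightarrow> 'a::euclidean_space set \<Rightarrow> ('a \<Rightarrow> complex) \<Rightarrow> 'a \<times> real \<Rightarrow> complex" where
  "double_layer k \<Omega> \<phi> x =
     (LINT y:\<Omega>|lborel. vector_derivative (\<lambda>t. fund_sol k x (y, t)) (at 0) * \<phi> y)"

text \<open>The hypersingular operator on test functions.\<close>

definition hypersingular_test ::
  "real \<Rightarrow> 'a::euclidean_space set \<Rightarrow> ('a \<Rightarrow> complex) \<Rightarrow> 'a \<Rightarrow> complex" where
  "hypersingular_test k \<Omega> \<phi> x =
     Lim (at_right 0) (\<lambda>h. vector_derivative (\<lambda>t. double_layer k \<Omega> \<phi> (x, t)) (at h))"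

definition is_hypersingular ::
  "real \<Rightarrow> 'a::euclidean_space set \<Rightarrow> ('a distr \<Rightarrow> 'a distr) \<Rightarrow> bool" where
  "is_hypersingular k \<Omega> T \<longleftrightarrow>
     (\<forall>u\<in>sobolev_tilde (1/2) \<Omega>. T u \<in> sobolev_on (- 1/2) \<Omega>) \<and>
     (\<forall>u\<in>sobolev_tilde (1/2) \<Omega>. \<forall>v\<in>sobolev_tilde (1/2) \<Omega>. \<forall>a b.
        T (\<lambda>f. a * u f + b * v f) = (\<lambda>f. a * T u f + b * T v f)) \<and>
     (\<exists>M. \<forall>u\<in>sobolev_tilde (1/2) \<Omega>.
        sobolev_on_norm (- 1/2) \<Omega> (T u) \<le> M * sobolev_norm 1 (1/2) u) \<and>
     (\<forall>\<phi>\<in>test_functions \<Omega>.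
        T (tempered_of_fun \<phi>) = distr_of_fun_on \<Omega> (hypersingular_test k \<Omega> \<phi>))"

text \<open>The continuous extension, whose values on tilde-H^(1/2) are uniquely determined.\<close>

definition hypersingular :: "real \<Rightarrow> 'a::euclidean_space set \<Rightarrow> 'a distr \<Rightarrow> 'a distr" where
  "hypersingular k \<Omega> = (SOME T. is_hypersingular k \<Omega> T)"

definition hypersingular_form ::
  "real \<Rightarrow> 'a::euclidean_space set \<Rightarrow> 'a distr \<Rightarrow> 'a distr \<Rightarrow> complex" where
  "hypersingular_form k \<Omega> \<phi> \<psi> = duality (1/2) \<Omega> (hypersingular k \<Omega> \<phi>) \<psi>"

definition Gamma_inf :: "('a::euclidean_space \<times> real) set" where
  "Gamma_inf = {x. snd x = 0}"

end

theory Submission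
  imports Defs "HOL-Complex_Analysis.Complex_Analysis" "HOL-Probability.Characteristic_Functions" "HOL-Probability.Sinc_Integral" "HOL-Real_Asymp.Real_Asymp"
begin

text \<open>
  In Fourier space the hypersingular operator is multiplication by a symbol of modulus half the
  square root of \<open>\<bar>k\<^sup>2 - \<bar>\<xi>\<bar>\<^sup>2\<bar>\<close>, real for \<open>\<bar>\<xi>\<bar> > k\<close> and imaginary for \<open>\<bar>\<xi>\<bar> < k\<close>, so that the
  form is bounded below by the integral of that modulus against the squared modulus of the transform of \<open>\<phi>\<close>, up to a constant.  The symbol
  degenerates only at the sphere of radius k.  As \<open>\<phi>\<close> is supported in a ball of radius L, its
  transform changes little under translations by a small multiple of 1/L (after a modulation),
  hence the mass in a shell of width of order 1/L about the sphere is controlled by the mass outside.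
  This loses a factor \<open>(k L)\<^bsup>-1/2\<^esup>\<close> in every dimension, and for n = 3 the remaining
  \<open>(k L)\<^bsup>1/6\<^esup>\<close> is absorbed into the constant, since k L is bounded below.

  The symbol is found for wave numbers \<open>k = \<i> \<kappa>\<close> with \<open>\<kappa> > 0\<close>, where the fundamental solution is a
  superposition of Gaussians whose transforms are explicit; both sides are continued
  analytically in \<open>\<kappa>\<close> to \<open>- \<i> k\<close>.  In two dimensions this requires
  the ascending series of the Macdonald function, because the Hankel function is given by its series.
\<close>

section \<open>Differentiation under the integral sign\<close>

text \<open>The operator, the extension in the duality pairing and the transform of a distribution
  are all chosen by \<open>SOME\<close>, so each has to be pinned down before anything can be
  computed: transforms agree almost everywhere, density of test functions makes the pairing
  independent of the extension, and the operator exists as a Fourier multiplier while its form is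
  forced by its values on test functions. The symbol is derived from the double layer kernel at
  height h > 0. For k = i \<kappa> this kernel is a mixture of heat kernels with a Levy density, and
  its transform exp(- h sqrt(\<kappa>^2 + |\<xi>|^2)) / 2 stays bounded when \<kappa> approaches the
  imaginary axis. Against the rapidly decreasing transform of a test function both limits, in
  \<kappa> and then in h, are therefore dominated. In the form the frequencies inside and outside
  the sphere feed the imaginary and the real part with a fixed sign each, so they cannot cancel. The
  constant is a function of k0 L, since the shell must be thin compared with k while its width is a
  multiple of 1/L.\<close>

lemma has_derivative_lebesgue_integral:
  fixes f :: "'p::{real_normed_vector, perfect_space} \<Rightarrow> 'x \<Rightarrow> 'b::{banach, second_countable_topology}"
  assumes S: "open S" "convex S" "t0 \<in> S"
    and int: "\<And>t. t \<in> S \<Longrightarrow> integrable M (f t)"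
    and der: "\<And>t y. t \<in> S \<Longrightarrow> y \<in> space M \<Longrightarrow> ((\<lambda>t. f t y) has_derivative F t y) (at t)"
    and bd: "\<And>t y v. t \<in> S \<Longrightarrow> y \<in> space M \<Longrightarrow> norm (F t y v) \<le> g y * norm v"
    and g: "integrable M g"
  shows "integrable M (\<lambda>y. F t0 y v)"
    and "((\<lambda>t. \<integral>y. f t y \<partial>M) has_derivative (\<lambda>v. \<integral>y. F t0 y v \<partial>M)) (at t0)"
proof -
  \<comment> \<open>By the mean value inequality on the convex set, the integrable bound
    \<open>g\<close> on the derivative is also a Lipschitz constant in \<open>t\<close>; it
    dominates the difference quotients below.\<close>
  have lip: "norm (f t y - f t0 y) \<le> g y * norm (t - t0)" if "t \<in> S" "y \<in> space M" for t y
  proof (rule differentiable_bound[OF S(2)])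
    show "((\<lambda>t. f t y) has_derivative F x y) (at x within S)" if "x \<in> S" for x
      using der[OF that \<open>y \<in> space M\<close>] has_derivative_at_withinI by blast
    show "onorm (F x y) \<le> g y" if "x \<in> S" for x
      using bd[OF that \<open>y \<in> space M\<close>] by (intro onorm_le)
  qed (use that S in auto)
  obtain e where e: "e > 0" "ball t0 e \<subseteq> S" using S open_contains_ball by blast
  have blin: "bounded_linear (F t0 y)" if "y \<in> space M" for y
    using der[OF S(3) that] has_derivative_bounded_linear by blast
  have int_F: "integrable M (\<lambda>y. F t0 y v)" for v
  proof (cases "v = 0")
    case True
    have "integrable M (\<lambda>y. F t0 y v) \<longleftrightarrow> integrable M (\<lambda>y. 0::'b)"
      by (rule Bochner_Integration.integrable_cong) (use blin True in \<open>auto simp: linear_simps\<close>)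
    then show ?thesis by simp
  next
    case False
    \<comment> \<open>A positive null sequence that keeps \<open>t0 + s n *\<^sub>R v\<close> inside
      the open ball; \<open>n + 2\<close> makes the inequality strict already for n = 0.\<close>
    define s where "s n = e / norm v / real (n + 2)" for n
    have s_pos: "s n > 0" for n using e False by (simp add: s_def)
    have s_lim: "s \<longlonglongrightarrow> 0"
      unfolding s_def by real_asymp
    have s_in: "t0 + s n *\<^sub>R v \<in> S" for n
    proof -
      have "norm (s n *\<^sub>R v) = e / real (n + 2)" using e False by (simp add: s_def)
      also have "\<dots> < e / 1" using e by (intro divide_strict_left_mono) auto
      finally have "t0 + s n *\<^sub>R v \<in> ball t0 e" by (simp add: dist_norm)
      then show ?thesis using e by blast
    qed
    have lim: "(\<lambda>n. (1 / s n) *\<^sub>R (f (t0 + s n *\<^sub>R v) y - f t0 y)) \<longlonglongrightarrow> F t0 y v" if y: "y \<in> space M" for y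
    proof -
      have "((\<lambda>h. norm (f (t0 + h) y - f t0 y - F t0 y h) / norm h) \<longlongrightarrow> 0) (at 0)"
        using der[OF S(3) y] unfolding has_derivative_at by blast
      moreover have "filterlim (\<lambda>n. s n *\<^sub>R v) (at 0) sequentially"
        unfolding filterlim_at using s_pos False less_imp_neq
        by (auto intro!: tendsto_eq_intros s_lim simp: less_imp_neq[symmetric])
      ultimately have "(\<lambda>n. norm (f (t0 + s n *\<^sub>R v) y - f t0 y - F t0 y (s n *\<^sub>R v)) / norm (s n *\<^sub>R v)) \<longlonglongrightarrow> 0"
        by (rule filterlim_compose)
      then have "(\<lambda>n. norm v * (norm (f (t0 + s n *\<^sub>R v) y - f t0 y - F t0 y (s n *\<^sub>R v)) / norm (s n *\<^sub>R v))) \<longlonglongrightarrow> norm v * 0"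
        by (intro tendsto_intros)
      moreover have "norm v * (norm (f (t0 + s n *\<^sub>R v) y - f t0 y - F t0 y (s n *\<^sub>R v)) / norm (s n *\<^sub>R v))
          = norm ((1 / s n) *\<^sub>R (f (t0 + s n *\<^sub>R v) y - f t0 y) - F t0 y v)" for n
      proof -
        have "(1 / s n) *\<^sub>R (f (t0 + s n *\<^sub>R v) y - f t0 y) - F t0 y v
           = (1 / s n) *\<^sub>R (f (t0 + s n *\<^sub>R v) y - f t0 y - F t0 y (s n *\<^sub>R v))"
          using s_pos[of n] blin[OF y] by (simp add: linear_simps scaleR_diff_right)
        then show ?thesis using s_pos[of n] False by simp
      qed
      ultimately show ?thesis by (simp add: LIM_zero_iff tendsto_norm_zero_iff)
    qed
    \<comment> \<open>Measurability of the derivative comes from that of the difference quotients,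
      whose pointwise limit it is.\<close>
    have [measurable]: "(\<lambda>y. F t0 y v) \<in> borel_measurable M"
      by (rule borel_measurable_LIMSEQ_metric[OF _ lim])
         (use int[OF s_in] int[OF S(3)] in \<open>auto intro!: borel_measurable_scaleR borel_measurable_diff\<close>)
    show ?thesis
      by (rule Bochner_Integration.integrable_bound[of _ "\<lambda>y. g y * norm v"])
         (use g bd[OF S(3)] in \<open>auto intro!: AE_I2 order_trans[OF _ abs_ge_self]\<close>)
  qed
  show "integrable M (\<lambda>y. F t0 y v)" by (rule int_F)
  show "((\<lambda>t. \<integral>y. f t y \<partial>M) has_derivative (\<lambda>v. \<integral>y. F t0 y v \<partial>M)) (at t0)"
    unfolding has_derivative_at
  proof
    show "bounded_linear (\<lambda>v. \<integral>y. F t0 y v \<partial>M)"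
    proof (rule bounded_linear_intro[where K = "\<integral>y. g y \<partial>M"])
      fix u v
      have "(\<integral>y. F t0 y (u + v) \<partial>M) = (\<integral>y. F t0 y u + F t0 y v \<partial>M)"
        by (rule Bochner_Integration.integral_cong) (use blin in \<open>auto simp: linear_simps\<close>)
      then show "(\<integral>y. F t0 y (u + v) \<partial>M) = (\<integral>y. F t0 y u \<partial>M) + (\<integral>y. F t0 y v \<partial>M)"
        using int_F by simp
    next
      fix r v
      have "(\<integral>y. F t0 y (r *\<^sub>R v) \<partial>M) = (\<integral>y. r *\<^sub>R F t0 y v \<partial>M)"
        by (rule Bochner_Integration.integral_cong) (use blin in \<open>auto simp: linear_simps\<close>)
      then show "(\<integral>y. F t0 y (r *\<^sub>R v) \<partial>M) = r *\<^sub>R (\<integral>y. F t0 y v \<partial>M)" by simp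
    next
      fix v
      have "norm (\<integral>y. F t0 y v \<partial>M) \<le> (\<integral>y. norm (F t0 y v) \<partial>M)" by simp
      also have "\<dots> \<le> (\<integral>y. g y * norm v \<partial>M)"
        by (rule integral_mono) (use int_F g bd[OF S(3)] in auto)
      finally show "norm (\<integral>y. F t0 y v \<partial>M) \<le> norm v * (\<integral>y. g y \<partial>M)" by (simp add: mult.commute)
    qed
    show "((\<lambda>h. norm ((\<integral>y. f (t0 + h) y \<partial>M) - (\<integral>y. f t0 y \<partial>M) - (\<integral>y. F t0 y h \<partial>M)) / norm h) \<longlongrightarrow> 0) (at 0)"
      unfolding tendsto_at_iff_sequentially
    proof (intro allI impI)
      fix X :: "nat \<Rightarrow> 'p" assume X: "\<forall>i. X i \<in> UNIV - {0}" and X0: "X \<longlonglongrightarrow> 0"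
      then have nz: "X i \<noteq> 0" for i by auto
      from X0 e obtain N where N: "\<And>n. n \<ge> N \<Longrightarrow> norm (X n) < e"
        unfolding LIMSEQ_iff by (metis diff_zero)
      define Y where "Y n = X (n + N)" for n
      have Yin: "t0 + Y n \<in> S" for n
        using N[of "n + N"] e by (auto simp: Y_def dist_norm subset_iff)
      have Ynz: "Y n \<noteq> 0" for n using nz by (simp add: Y_def)
      have Ylim: "Y \<longlonglongrightarrow> 0" unfolding Y_def using X0 by (rule LIMSEQ_ignore_initial_segment)
      \<comment> \<open>The remainder quotient tends to 0 pointwise and is at most
        \<open>2 * g\<close>: one \<open>g\<close> from the Lipschitz bound, one from the bound on
        \<open>F\<close>.\<close>
      define q where "q n y = norm (f (t0 + Y n) y - f t0 y - F t0 y (Y n)) / norm (Y n)" for n y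
      have meas [measurable]: "q n \<in> borel_measurable M" for n
        unfolding q_def
        using borel_measurable_integrable[OF int[OF Yin[of n]]] borel_measurable_integrable[OF int[OF S(3)]]
          borel_measurable_integrable[OF int_F[of "Y n"]] by simp
      have "(\<lambda>n. \<integral>y. q n y \<partial>M) \<longlonglongrightarrow> (\<integral>y. 0 \<partial>M)"
      proof (rule integral_dominated_convergence[where w = "\<lambda>y. 2 * g y"])
        show "integrable M (\<lambda>y. 2 * g y)" using g by simp
        show "AE y in M. (\<lambda>n. q n y) \<longlonglongrightarrow> 0"
        proof (rule AE_I2)
          fix y assume y: "y \<in> space M"
          have "((\<lambda>h. norm (f (t0 + h) y - f t0 y - F t0 y h) / norm h) \<longlongrightarrow> 0) (at 0)"
            using der[OF S(3) y] unfolding has_derivative_at by blast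
          moreover have "filterlim Y (at 0) sequentially"
            unfolding filterlim_at using Ylim Ynz by auto
          ultimately show "(\<lambda>n. q n y) \<longlonglongrightarrow> 0" unfolding q_def by (rule filterlim_compose)
        qed
        show "AE y in M. norm (q n y) \<le> 2 * g y" for n
        proof (rule AE_I2)
          fix y assume y: "y \<in> space M"
          have "norm (f (t0 + Y n) y - f t0 y - F t0 y (Y n)) \<le> norm (f (t0 + Y n) y - f t0 y) + norm (F t0 y (Y n))"
            by (rule norm_triangle_ineq4)
          also have "\<dots> \<le> g y * norm (Y n) + g y * norm (Y n)"
            using lip[OF Yin[of n] y] bd[OF S(3) y, of "Y n"] by simp
          finally show "norm (q n y) \<le> 2 * g y" using Ynz[of n] by (simp add: q_def divide_simps)
        qed
      qed auto
      then have lim0: "(\<lambda>n. \<integral>y. q n y \<partial>M) \<longlonglongrightarrow> 0" by simp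
      have "(\<lambda>n. norm ((\<integral>y. f (t0 + Y n) y \<partial>M) - (\<integral>y. f t0 y \<partial>M) - (\<integral>y. F t0 y (Y n) \<partial>M)) / norm (Y n)) \<longlonglongrightarrow> 0"
      proof (rule tendsto_sandwich[OF always_eventually always_eventually tendsto_const lim0]; intro allI)
        fix n
        have "(\<integral>y. f (t0 + Y n) y \<partial>M) - (\<integral>y. f t0 y \<partial>M) - (\<integral>y. F t0 y (Y n) \<partial>M)
           = (\<integral>y. f (t0 + Y n) y - f t0 y - F t0 y (Y n) \<partial>M)"
          using int[OF Yin[of n]] int[OF S(3)] int_F by simp
        also have "norm \<dots> \<le> (\<integral>y. norm (f (t0 + Y n) y - f t0 y - F t0 y (Y n)) \<partial>M)" by simp
        finally show "norm ((\<integral>y. f (t0 + Y n) y \<partial>M) - (\<integral>y. f t0 y \<partial>M) - (\<integral>y. F t0 y (Y n) \<partial>M)) / norm (Y n)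
          \<le> (\<integral>y. q n y \<partial>M)" by (simp add: q_def divide_right_mono)
      qed simp
      then show "((\<lambda>h. norm ((\<integral>y. f (t0 + h) y \<partial>M) - (\<integral>y. f t0 y \<partial>M) - (\<integral>y. F t0 y h \<partial>M)) / norm h) \<circ> X) \<longlonglongrightarrow> 0"
        unfolding Y_def o_def by (rule LIMSEQ_offset[of _ N])
    qed
  qed
qed

lemma has_vector_derivative_lebesgue_integral:
  fixes f :: "real \<Rightarrow> 'x \<Rightarrow> 'b::{banach, second_countable_topology}"
  assumes "a < t0" "t0 < b"
    and "\<And>t. a < t \<Longrightarrow> t < b \<Longrightarrow> integrable M (f t)"
    and der: "\<And>t y. a < t \<Longrightarrow> t < b \<Longrightarrow> y \<in> space M \<Longrightarrow> ((\<lambda>t. f t y) has_vector_derivative f' t y) (at t)"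
    and bd: "\<And>t y. a < t \<Longrightarrow> t < b \<Longrightarrow> y \<in> space M \<Longrightarrow> norm (f' t y) \<le> g y"
    and "integrable M g"
  shows "integrable M (f' t0)"
    and "((\<lambda>t. \<integral>y. f t y \<partial>M) has_vector_derivative (\<integral>y. f' t0 y \<partial>M)) (at t0)"
proof -
  have *: "open {a<..<b}" "convex {a<..<b}" "t0 \<in> {a<..<b}"
    "\<And>t. t \<in> {a<..<b} \<Longrightarrow> integrable M (f t)"
    "\<And>t y. t \<in> {a<..<b} \<Longrightarrow> y \<in> space M \<Longrightarrow> ((\<lambda>t. f t y) has_derivative (\<lambda>v. v *\<^sub>R f' t y)) (at t)"
    "\<And>t y v. t \<in> {a<..<b} \<Longrightarrow> y \<in> space M \<Longrightarrow> norm (v *\<^sub>R f' t y) \<le> g y * norm v" "integrable M g"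
    using assms by (auto simp: has_vector_derivative_def mult.commute[of "norm _"] intro: mult_right_mono)
       (metis abs_ge_zero mult.commute mult_left_mono)+
  show "integrable M (f' t0)" using has_derivative_lebesgue_integral(1)[OF *, of 1] by simp
  show "((\<lambda>t. \<integral>y. f t y \<partial>M) has_vector_derivative (\<integral>y. f' t0 y \<partial>M)) (at t0)"
    using has_derivative_lebesgue_integral(2)[OF *] unfolding has_vector_derivative_def by simp
qed

text \<open>Domination of \<open>f\<close> itself suffices: on discs of half the radius Cauchy's
  inequality turns the bound \<open>g\<close> into the bound \<open>g / (r/2)\<close> for the
  complex derivative. The real theorem on differentiation under the integral then applies, and the
  derivative it gives is multiplication by a complex number.\<close>

lemma holomorphic_on_lebesgue_integral:
  fixes f :: "complex \<Rightarrow> 'x \<Rightarrow> complex"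
  assumes U: "open U"
    and hol: "\<And>y. y \<in> space M \<Longrightarrow> (\<lambda>z. f z y) holomorphic_on U"
    and meas: "\<And>z. z \<in> U \<Longrightarrow> f z \<in> borel_measurable M"
    and dom: "\<And>z0. z0 \<in> U \<Longrightarrow> \<exists>r>0. \<exists>g. cball z0 r \<subseteq> U \<and> integrable M g \<and>
        (\<forall>z\<in>cball z0 r. \<forall>y\<in>space M. norm (f z y) \<le> g y)"
  shows "(\<lambda>z. \<integral>y. f z y \<partial>M) holomorphic_on U"
  unfolding holomorphic_on_open[OF U]
proof
  fix z0 assume z0: "z0 \<in> U"
  obtain r g where r: "r > 0" "cball z0 r \<subseteq> U" and g: "integrable M g"
    and fg: "\<And>z y. z \<in> cball z0 r \<Longrightarrow> y \<in> space M \<Longrightarrow> norm (f z y) \<le> g y"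
    using dom[OF z0] by blast
  let ?S = "ball z0 (r/2)"
  have sub: "cball z (r/2) \<subseteq> cball z0 r" if "z \<in> ?S" for z
  proof
    fix x assume "x \<in> cball z (r/2)"
    then show "x \<in> cball z0 r" using that dist_triangle[of z0 x z] by (simp add: mem_ball mem_cball)
  qed
  have "((\<lambda>z. \<integral>y. f z y \<partial>M) has_derivative (\<lambda>v. \<integral>y. deriv (\<lambda>z. f z y) z0 * v \<partial>M)) (at z0)"
  proof (rule has_derivative_lebesgue_integral(2)[where S = ?S and g = "\<lambda>y. g y / (r/2)" and F = "\<lambda>z y v. deriv (\<lambda>z. f z y) z * v"])
    fix t assume t: "t \<in> ?S"
    then have tU: "t \<in> U" using r by auto
    show "integrable M (f t)"
      using g by (rule Bochner_Integration.integrable_bound)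
        (use meas[OF tU] t r in \<open>auto intro!: AE_I2 order_trans[OF fg[of t] abs_ge_self]\<close>)
    fix y assume y: "y \<in> space M"
    show "((\<lambda>t. f t y) has_derivative (*) (deriv (\<lambda>z. f z y) t)) (at t)"
      using holomorphic_derivI[OF hol[OF y] U tU] by (simp add: has_field_derivative_def)
    have "norm ((deriv ^^ 1) (\<lambda>z. f z y) t) \<le> fact 1 * g y / (r/2)^1"
    proof (rule Cauchy_inequality)
      have 1: "cball t (r/2) \<subseteq> U" using sub[OF t] r by blast
      show "(\<lambda>z. f z y) holomorphic_on ball t (r/2)"
        using 1 by (intro holomorphic_on_subset[OF hol[OF y]]) auto
      show "continuous_on (cball t (r/2)) (\<lambda>z. f z y)"
        using 1 holomorphic_on_subset[OF hol[OF y]] holomorphic_on_imp_continuous_on by blast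
      show "norm (f x y) \<le> g y" if "norm (t - x) = r/2" for x
        using sub[OF t] that by (intro fg y) (auto simp: dist_norm subset_iff)
    qed (use r in auto)
    then have "norm (deriv (\<lambda>z. f z y) t) \<le> g y / (r/2)" by simp
    then show "norm (deriv (\<lambda>z. f z y) t * v) \<le> g y / (r/2) * norm v" for v
      by (simp only: norm_mult) (intro mult_right_mono; simp)
  qed (use r g in auto)
  then have "((\<lambda>z. \<integral>y. f z y \<partial>M) has_derivative (\<lambda>v. (\<integral>y. deriv (\<lambda>z. f z y) z0 \<partial>M) * v)) (at z0)"
    by simp
  then show "\<exists>f'. ((\<lambda>z. \<integral>y. f z y \<partial>M) has_field_derivative f') (at z0)"
    unfolding has_field_derivative_def by blast
qed

section \<open>Smooth functions\<close>

lemma iter_deriv_append: "iter_deriv (bs @ cs) f = iter_deriv bs (iter_deriv cs f)"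
  by (induction bs) auto

lemma smooth_differentiable: "smooth f \<Longrightarrow> f differentiable (at x)"
  unfolding smooth_def by (drule spec[of _ "[]"]) simp

lemma smooth_iter_deriv: "smooth f \<Longrightarrow> set bs \<subseteq> Basis \<Longrightarrow> smooth (iter_deriv bs f)"
  unfolding smooth_def iter_deriv_append[symmetric] by auto

lemma smooth_frechet: "smooth f \<Longrightarrow> b \<in> Basis \<Longrightarrow> smooth (\<lambda>x. frechet_derivative f (at x) b)"
  using smooth_iter_deriv[of f "[b]"] by simp

text \<open>Every iterated derivative of \<open>f\<close> stays in \<open>S\<close>, by induction on
  the list of directions. Exhibiting such an invariant set is how bumps, exponentials and conjugates
  are shown to be smooth.\<close>

lemma smooth_coinduct:
  assumes "f \<in> S" and "\<And>g x. g \<in> S \<Longrightarrow> g differentiable (at x)"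
    and "\<And>g b. g \<in> S \<Longrightarrow> b \<in> Basis \<Longrightarrow> (\<lambda>x. frechet_derivative g (at x) b) \<in> S"
  shows "smooth f"
proof -
  have "iter_deriv bs f \<in> S" if "set bs \<subseteq> Basis" for bs
    using that by (induction bs) (use assms in auto)
  then show ?thesis unfolding smooth_def using assms by blast
qed

lemma has_derivative_frechet: "(f has_derivative D) (at x) \<Longrightarrow> frechet_derivative f (at x) = D"
  using frechet_derivative_at by metis

text \<open>The algebra generated by \<open>A\<close> is the smallest family in which the product
  rule can be carried out, so for smoothness it is enough to find the derivatives of the generators
  in it.\<close>

inductive_set alg_span :: "('a \<Rightarrow> complex) set \<Rightarrow> ('a \<Rightarrow> complex) set" for A where
  base: "f \<in> A \<Longrightarrow> f \<in> alg_span A"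
| const: "(\<lambda>x. c) \<in> alg_span A"
| add: "f \<in> alg_span A \<Longrightarrow> g \<in> alg_span A \<Longrightarrow> (\<lambda>x. f x + g x) \<in> alg_span A"
| mult: "f \<in> alg_span A \<Longrightarrow> g \<in> alg_span A \<Longrightarrow> (\<lambda>x. f x * g x) \<in> alg_span A"

lemma smooth_alg_span:
  fixes A :: "('a::euclidean_space \<Rightarrow> complex) set"
  assumes d: "\<And>g x. g \<in> A \<Longrightarrow> g differentiable (at x)"
    and D: "\<And>g b. g \<in> A \<Longrightarrow> b \<in> Basis \<Longrightarrow> (\<lambda>x. frechet_derivative g (at x) b) \<in> alg_span A"
    and f: "f \<in> alg_span A"
  shows "smooth f"
proof (rule smooth_coinduct[OF f])
  have *: "(\<forall>x. g differentiable (at x)) \<and> (\<forall>b\<in>Basis. (\<lambda>x. frechet_derivative g (at x) b) \<in> alg_span A)"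
    if "g \<in> alg_span A" for g
    using that
  proof induction
    case (base f) then show ?case using d D by auto
  next
    case (const c)
    have "frechet_derivative (\<lambda>x::'a. c) (at x) = (\<lambda>_. 0)" for x by (rule has_derivative_frechet) simp
    then show ?case by (auto intro: alg_span.const)
  next
    case (add f g)
    have "frechet_derivative (\<lambda>x. f x + g x) (at x) = (\<lambda>v. frechet_derivative f (at x) v + frechet_derivative g (at x) v)" for x
      by (rule has_derivative_frechet) (use add.IH in \<open>auto intro!: derivative_eq_intros simp: frechet_derivative_works\<close>)
    then show ?case using add by (auto intro: alg_span.add)
  next
    case (mult f g)
    have "frechet_derivative (\<lambda>x. f x * g x) (at x) = (\<lambda>v. f x * frechet_derivative g (at x) v + frechet_derivative f (at x) v * g x)" for x
      by (rule has_derivative_frechet) (use mult.IH in \<open>auto intro!: derivative_eq_intros simp: frechet_derivative_works\<close>)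
    then show ?case using mult by (auto intro!: alg_span.add alg_span.mult)
  qed
  show "\<And>g x. g \<in> alg_span A \<Longrightarrow> g differentiable at x"
    and "\<And>g b. g \<in> alg_span A \<Longrightarrow> b \<in> Basis \<Longrightarrow> (\<lambda>x. frechet_derivative g (at x) b) \<in> alg_span A"
    using * by blast+
qed

lemma smooth_alg_span_smooth: "f \<in> alg_span (Collect smooth) \<Longrightarrow> smooth f"
  by (erule smooth_alg_span[rotated 2]) (auto intro: smooth_differentiable smooth_frechet alg_span.base)

section \<open>Closure properties of smooth functions\<close>

lemma smooth_const: "smooth (\<lambda>x. c)" by (intro smooth_alg_span_smooth alg_span.const)
lemma smooth_add: "smooth f \<Longrightarrow> smooth g \<Longrightarrow> smooth (\<lambda>x. f x + g x)"
  by (intro smooth_alg_span_smooth alg_span.add alg_span.base) auto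
lemma smooth_mult: "smooth f \<Longrightarrow> smooth g \<Longrightarrow> smooth (\<lambda>x. f x * g x)"
  by (intro smooth_alg_span_smooth alg_span.mult alg_span.base) auto
lemma smooth_diff: "smooth f \<Longrightarrow> smooth g \<Longrightarrow> smooth (\<lambda>x. f x - g x)"
  using smooth_add[of f "\<lambda>x. -1 * g x"] smooth_mult[OF smooth_const[of "-1"], of g] by simp
lemma smooth_prod: "finite I \<Longrightarrow> (\<And>i. i \<in> I \<Longrightarrow> smooth (f i)) \<Longrightarrow> smooth (\<lambda>x. \<Prod>i\<in>I. f i x)"
  by (induction I rule: finite_induct) (auto intro: smooth_const smooth_mult)

lemma alg_span_sum: "finite I \<Longrightarrow> (\<And>i. i \<in> I \<Longrightarrow> f i \<in> alg_span A) \<Longrightarrow> (\<lambda>x. \<Sum>i\<in>I. f i x) \<in> alg_span A"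
  by (induction I rule: finite_induct) (auto intro: alg_span.const alg_span.add)

lemma smooth_bounded_linear_id:
  fixes l :: "'a::euclidean_space \<Rightarrow> complex"
  assumes "bounded_linear l"
  shows "smooth l"
proof (rule smooth_alg_span[of "{l}"])
  have "(l has_derivative l) (at x)" for x
    using assms by (rule bounded_linear_imp_has_derivative)
  then show "g differentiable at x" if "g \<in> {l}" for g x
    using that by (auto intro: differentiableI)
  have "frechet_derivative l (at x) = l" for x
    using \<open>\<And>x. (l has_derivative l) (at x)\<close> by (rule has_derivative_frechet)
  then show "(\<lambda>x. frechet_derivative g (at x) b) \<in> alg_span {l}" if "g \<in> {l}" for g b
    using that by (auto intro: alg_span.const)
qed (auto intro: alg_span.base)

text \<open>The chain rule gives the derivative of \<open>f\<close> in the direction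
  \<open>L b\<close>, a combination of partial derivatives of \<open>f\<close> with constant
  coefficients; this leaves the set of compositions, but not the algebra that they generate.\<close>

lemma smooth_affine:
  fixes f :: "'b::euclidean_space \<Rightarrow> complex" and L :: "'a::euclidean_space \<Rightarrow> 'b"
  assumes f: "smooth f" and L: "linear L"
  shows "smooth (\<lambda>x. f (c + L x))"
proof (rule smooth_alg_span[where A = "{\<lambda>x. f (c + L x) | f. smooth f}"])
  have L': "bounded_linear L" using L linear_conv_bounded_linear by blast
  have D: "((\<lambda>x. f (c + L x)) has_derivative (\<lambda>v. frechet_derivative f (at (c + L x)) (L v))) (at x)"
    if "smooth f" for f :: "'b \<Rightarrow> complex" and x
  proof -
    have "(f has_derivative frechet_derivative f (at (c + L x))) (at (c + L x))"
      using smooth_differentiable[OF that] by (simp add: frechet_derivative_works)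
    moreover have "((\<lambda>x. c + L x) has_derivative L) (at x)"
      using bounded_linear_imp_has_derivative[OF L'] by (auto intro!: derivative_eq_intros)
    ultimately show ?thesis using diff_chain_at[of "\<lambda>x. c + L x"] by (simp add: o_def)
  qed
  fix g :: "'a \<Rightarrow> complex" assume "g \<in> {\<lambda>x. f (c + L x) | f. smooth f}"
  then obtain f where g: "g = (\<lambda>x. f (c + L x))" and f: "smooth f" by blast
  show "g differentiable at x" for x using differentiableI[OF D[OF f]] g by simp
  fix b :: 'a assume "b \<in> Basis"
  have lin: "linear (frechet_derivative f (at y))" for y
    using smooth_differentiable[OF f] by (rule linear_frechet_derivative)
  have "frechet_derivative g (at x) b = (\<Sum>i\<in>Basis. of_real (L b \<bullet> i) * frechet_derivative f (at (c + L x)) i)" for x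
  proof -
    have "frechet_derivative g (at x) b = frechet_derivative f (at (c + L x)) (L b)"
      using has_derivative_frechet[OF D[OF f, of x]] g by simp
    also have "\<dots> = frechet_derivative f (at (c + L x)) (\<Sum>i\<in>Basis. (L b \<bullet> i) *\<^sub>R i)"
      by (simp add: euclidean_representation)
    also have "\<dots> = (\<Sum>i\<in>Basis. of_real (L b \<bullet> i) * frechet_derivative f (at (c + L x)) i)"
      by (simp add: linear_sum[OF lin] linear_cmul[OF lin] scaleR_conv_of_real)
    finally show ?thesis .
  qed
  moreover have "(\<lambda>x. frechet_derivative f (at (c + L x)) i) \<in> alg_span {\<lambda>x. f (c + L x) | f. smooth f}"
    if "i \<in> Basis" for i
    using smooth_frechet[OF f that] by (intro alg_span.base CollectI exI[of _ "\<lambda>y. frechet_derivative f (at y) i"]) simp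
  ultimately show "(\<lambda>x. frechet_derivative g (at x) b) \<in> alg_span {\<lambda>x. f (c + L x) | f. smooth f}"
    by (auto intro!: alg_span_sum alg_span.mult alg_span.const)
qed (use f in \<open>auto intro: alg_span.base\<close>)

lemma smooth_cnj:
  fixes f :: "'a::euclidean_space \<Rightarrow> complex"
  assumes "smooth f" shows "smooth (\<lambda>x. cnj (f x))"
proof (rule smooth_coinduct[where S = "{\<lambda>x. cnj (f x) | f. smooth f}"])
  fix g :: "'a \<Rightarrow> complex" assume "g \<in> {\<lambda>x. cnj (f x) | f. smooth f}"
  then obtain f where g: "g = (\<lambda>x. cnj (f x))" and f: "smooth f" by blast
  have D: "(g has_derivative (\<lambda>v. cnj (frechet_derivative f (at x) v))) (at x)" for x
    unfolding g by (rule bounded_linear.has_derivative[OF bounded_linear_cnj])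
      (use smooth_differentiable[OF f] in \<open>simp add: frechet_derivative_works\<close>)
  then show "g differentiable at x" for x by (rule differentiableI)
  fix b :: 'a assume "b \<in> Basis"
  then show "(\<lambda>x. frechet_derivative g (at x) b) \<in> {\<lambda>x. cnj (f x) | f. smooth f}"
    using has_derivative_frechet[OF D] smooth_frechet[OF f] by auto
qed (use assms in auto)

lemma smooth_continuous: "smooth f \<Longrightarrow> continuous_on UNIV f"
  by (intro continuous_at_imp_continuous_on ballI differentiable_imp_continuous_within smooth_differentiable)

lemma smooth_measurable [measurable_dest]: "smooth f \<Longrightarrow> f \<in> borel_measurable borel"
  by (intro borel_measurable_continuous_onI smooth_continuous)

section \<open>Test functions\<close>

text \<open>A compact set outside which the function vanishes is easier to carry through sums,
  products and derivatives than the closure of its nonzero set; this rule and its elimination form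
  exchange the two.\<close>

lemma test_functionsI:
  assumes "smooth g" "compact K" "K \<subseteq> \<Omega>" "\<And>x. x \<notin> K \<Longrightarrow> g x = 0"
  shows "g \<in> test_functions \<Omega>"
proof -
  have "{x. g x \<noteq> 0} \<subseteq> K" using assms(4) by blast
  then have "closure {x. g x \<noteq> 0} \<subseteq> K" "bounded {x. g x \<noteq> 0}"
    using assms(2) closure_minimal[OF _ compact_imp_closed] bounded_subset[OF compact_imp_bounded] by blast+
  then show ?thesis using assms(1,3) unfolding test_functions_def by (auto simp: compact_closure)
qed

lemma test_functionsE:
  assumes "g \<in> test_functions \<Omega>"
  obtains K where "smooth g" "compact K" "K \<subseteq> \<Omega>" "\<And>x. x \<notin> K \<Longrightarrow> g x = 0"
proof (rule that[of "closure {x. g x \<noteq> 0}"])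
  show "g x = 0" if "x \<notin> closure {x. g x \<noteq> 0}" for x
    using that closure_subset[of "{x. g x \<noteq> 0}"] by blast
qed (use assms in \<open>auto simp: test_functions_def\<close>)

lemma test_functions_frechet:
  assumes "g \<in> test_functions \<Omega>" "b \<in> Basis"
  shows "(\<lambda>x. frechet_derivative g (at x) b) \<in> test_functions \<Omega>"
proof -
  obtain K where K: "smooth g" "compact K" "K \<subseteq> \<Omega>" "\<And>x. x \<notin> K \<Longrightarrow> g x = 0"
    by (rule test_functionsE[OF assms(1)], rule that)
  show ?thesis
  proof (rule test_functionsI[OF smooth_frechet[OF K(1) assms(2)] K(2,3)])
    fix x assume "x \<notin> K"
    \<comment> \<open>Off \<open>K\<close> the function vanishes on an open set, hence so does its
      derivative.\<close>
    then have "x \<in> -K" "open (-K)" using K(2) compact_imp_closed by auto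
    then have "(g has_derivative (\<lambda>_. 0)) (at x)"
      by (intro has_derivative_transform_within_open[of "\<lambda>_. 0" _ x UNIV "-K" g]) (use K in auto)
    then show "frechet_derivative g (at x) b = 0" by (simp add: has_derivative_frechet)
  qed
qed

lemma test_functions_iter_deriv:
  "g \<in> test_functions \<Omega> \<Longrightarrow> set bs \<subseteq> Basis \<Longrightarrow> iter_deriv bs g \<in> test_functions \<Omega>"
  by (induction bs) (auto intro: test_functions_frechet)

lemma test_functions_mult:
  assumes "g \<in> test_functions \<Omega>" "smooth f"
  shows "(\<lambda>x. f x * g x) \<in> test_functions \<Omega>"
proof -
  obtain K where K: "smooth g" "compact K" "K \<subseteq> \<Omega>" "\<And>x. x \<notin> K \<Longrightarrow> g x = 0"
    by (rule test_functionsE[OF assms(1)], rule that)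
  then show ?thesis
    by (intro test_functionsI[of _ K] smooth_mult assms(2)) auto
qed

lemma test_functions_add:
  assumes "g \<in> test_functions \<Omega>" "f \<in> test_functions \<Omega>"
  shows "(\<lambda>x. f x + g x) \<in> test_functions \<Omega>"
proof -
  obtain K where K: "smooth g" "compact K" "K \<subseteq> \<Omega>" "\<And>x. x \<notin> K \<Longrightarrow> g x = 0"
    by (rule test_functionsE[OF assms(1)], rule that)
  obtain L where L: "smooth f" "compact L" "L \<subseteq> \<Omega>" "\<And>x. x \<notin> L \<Longrightarrow> f x = 0"
    by (rule test_functionsE[OF assms(2)], rule that)
  from K L show ?thesis by (intro test_functionsI[of _ "K \<union> L"] smooth_add) auto
qed

lemma test_functions_cnj: "g \<in> test_functions \<Omega> \<Longrightarrow> (\<lambda>x. cnj (g x)) \<in> test_functions \<Omega>"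
  by (erule test_functionsE, rule test_functionsI) (auto intro: smooth_cnj)

lemma test_functions_diff:
  assumes "f \<in> test_functions \<Omega>" "g \<in> test_functions \<Omega>"
  shows "(\<lambda>x. f x - g x) \<in> test_functions \<Omega>"
  using test_functions_add[OF test_functions_mult[OF assms(2) smooth_const[of "-1"]] assms(1)] by simp

lemma test_functions_bounded:
  assumes "g \<in> test_functions \<Omega>"
  obtains M where "\<And>x. cmod (g x) \<le> M"
proof -
  obtain K where K: "smooth g" "compact K" "K \<subseteq> \<Omega>" "\<And>x. x \<notin> K \<Longrightarrow> g x = 0"
    by (rule test_functionsE[OF assms], rule that)
  have "compact (g ` K)"
    by (intro compact_continuous_image continuous_on_subset[OF smooth_continuous] K subset_UNIV)
  then obtain M where M: "\<forall>y\<in>g ` K. cmod y \<le> M" using compact_imp_bounded[of "g ` K"] bounded_iff[of "g ` K"] by blast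
  have "cmod (g x) \<le> max M 0" for x
    using K(4)[of x] bspec[OF M, of "g x"] by (cases "x \<in> K") (auto simp: le_max_iff_disj)
  then show ?thesis using that by blast
qed

lemma test_functions_support:
  assumes "g \<in> test_functions \<Omega>"
  obtains R where "R > 0" "\<And>x. norm x > R \<Longrightarrow> g x = 0"
proof -
  obtain K where K: "smooth g" "compact K" "K \<subseteq> \<Omega>" "\<And>x. x \<notin> K \<Longrightarrow> g x = 0"
    by (rule test_functionsE[OF assms], rule that)
  then obtain R where R: "R > 0" "\<forall>x\<in>K. norm x \<le> R"
    using compact_imp_bounded[OF K(2)] bounded_pos[of K] by blast
  show ?thesis
  proof (rule that[OF R(1)])
    fix x :: 'a assume "norm x > R"
    then have "x \<notin> K" using R(2) by force
    then show "g x = 0" by (rule K(4))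
  qed
qed

lemma test_functions_schwartz:
  assumes g: "g \<in> test_functions \<Omega>"
  shows "g \<in> schwartz"
  unfolding schwartz_def
proof (intro CollectI conjI allI impI)
  show "smooth g" using g by (elim test_functionsE)
  fix N :: nat and bs :: "'a list" assume bs: "set bs \<subseteq> Basis"
  have t: "iter_deriv bs g \<in> test_functions \<Omega>" using g bs by (rule test_functions_iter_deriv)
  obtain M where M: "\<And>x. cmod (iter_deriv bs g x) \<le> M" by (rule test_functions_bounded[OF t], rule that)
  obtain R where R: "R > 0" "\<And>x. norm x > R \<Longrightarrow> iter_deriv bs g x = 0"
    by (rule test_functions_support[OF t], rule that)
  have "(1 + norm x) ^ N * cmod (iter_deriv bs g x) \<le> (1 + R) ^ N * M" for x
  proof (cases "norm x > R")
    case True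
    then show ?thesis using R M[of 0] by (auto intro!: mult_nonneg_nonneg order_trans[OF norm_ge_zero M])
  next
    case False
    then show ?thesis using M[of x] by (intro mult_mono power_mono) (auto simp: R less_imp_le)
  qed
  then show "\<exists>M. \<forall>x. (1 + norm x) ^ N * cmod (iter_deriv bs g x) \<le> M" by blast
qed

section \<open>Integrals over Euclidean space\<close>

text \<open>Lebesgue measure is the image of a product of one-dimensional Lebesgue measures under
  the coordinate map, so Fubini's theorem for finite products applies.\<close>

lemma lborel_prod:
  fixes f :: "'a::euclidean_space \<Rightarrow> real \<Rightarrow> 'b::{real_normed_field,banach,second_countable_topology}"
  assumes int: "\<And>b. b \<in> Basis \<Longrightarrow> integrable lborel (f b)"
  shows "integrable lborel (\<lambda>x::'a. \<Prod>b\<in>Basis. f b (x \<bullet> b))"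
    and "(\<integral>x. (\<Prod>b\<in>Basis. f b (x \<bullet> b)) \<partial>(lborel :: 'a measure)) = (\<Prod>b\<in>Basis. integral\<^sup>L lborel (f b))"
proof -
  interpret product_sigma_finite "\<lambda>_::'a. lborel :: real measure" by standard
  let ?T = "\<lambda>y. \<Sum>b\<in>Basis. y b *\<^sub>R b :: 'a"
  let ?P = "\<Pi>\<^sub>M b\<in>(Basis :: 'a set). (lborel :: real measure)"
  have eq: "(lborel :: 'a measure) = distr ?P borel ?T" by (rule lborel_eq)
  have T [measurable]: "?T \<in> ?P \<rightarrow>\<^sub>M borel" by measurable
  have [measurable]: "b \<in> Basis \<Longrightarrow> f b \<in> borel_measurable borel" for b
    using borel_measurable_integrable[OF int[of b]] by simp
  have m: "(\<lambda>x::'a. \<Prod>b\<in>Basis. f b (x \<bullet> b)) \<in> borel_measurable borel" by measurable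
  have c: "(\<Prod>b\<in>Basis. f b (?T y \<bullet> b)) = (\<Prod>b\<in>Basis. f b (y b))" for y
    by (rule prod.cong) (auto simp: inner_sum_left_Basis)
  show "integrable lborel (\<lambda>x::'a. \<Prod>b\<in>Basis. f b (x \<bullet> b))"
    unfolding eq integrable_distr_eq[OF T m] c
    by (rule product_integrable_prod) (use int in auto)
  show "(\<integral>x. (\<Prod>b\<in>Basis. f b (x \<bullet> b)) \<partial>(lborel :: 'a measure)) = (\<Prod>b\<in>Basis. integral\<^sup>L lborel (f b))"
    unfolding eq integral_distr[OF T m] c
    by (rule product_integral_prod) (use int in auto)
qed

text \<open>A negative \<open>c\<close> is allowed: \<open>c = -1\<close> gives the reflections that
  accompany Fourier inversion.\<close>

lemma lborel_affine_integral:
  fixes f :: "'a::euclidean_space \<Rightarrow> 'b::{banach, second_countable_topology}"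
  assumes c: "c \<noteq> 0" and f: "integrable lborel f"
  shows "integrable lborel (\<lambda>x. f (t + c *\<^sub>R x))"
    and "(\<integral>x. f (t + c *\<^sub>R x) \<partial>lborel) = (1 / \<bar>c\<bar> ^ DIM('a)) *\<^sub>R (\<integral>x. f x \<partial>lborel)"
proof -
  let ?D = "distr lborel borel (\<lambda>x::'a. t + c *\<^sub>R x)"
  have [measurable]: "f \<in> borel_measurable borel" using f by auto
  have i1: "integrable (density ?D (\<lambda>_. ennreal (\<bar>c\<bar> ^ DIM('a)))) f"
    using f by (subst (asm) lborel_affine[OF c, of t]) (simp add: ennreal_power)
  then have "integrable ?D (\<lambda>x. \<bar>c\<bar> ^ DIM('a) *\<^sub>R f x)"
    by (subst (asm) integrable_density) auto
  then have "integrable lborel (\<lambda>x. \<bar>c\<bar> ^ DIM('a) *\<^sub>R f (t + c *\<^sub>R x))"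
    by (subst (asm) integrable_distr_eq) auto
  from integrable_scaleR_right[of "1 / \<bar>c\<bar> ^ DIM('a)", OF this]
  show 1: "integrable lborel (\<lambda>x. f (t + c *\<^sub>R x))" using c by simp
  have "(\<integral>x. f x \<partial>lborel) = (\<integral>x. f x \<partial>density ?D (\<lambda>_. ennreal (\<bar>c\<bar> ^ DIM('a))))"
    by (subst lborel_affine[OF c, of t]) (simp add: ennreal_power)
  also have "\<dots> = (\<integral>x. \<bar>c\<bar> ^ DIM('a) *\<^sub>R f x \<partial>?D)" by (subst integral_density) auto
  also have "\<dots> = (\<integral>x. \<bar>c\<bar> ^ DIM('a) *\<^sub>R f (t + c *\<^sub>R x) \<partial>lborel)" by (subst integral_distr) auto
  finally show "(\<integral>x. f (t + c *\<^sub>R x) \<partial>lborel) = (1 / \<bar>c\<bar> ^ DIM('a)) *\<^sub>R (\<integral>x. f x \<partial>lborel)"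
    using c by simp
qed

text \<open>The exponent \<open>2 * DIM('a)\<close> makes the bound factorise: each of the
  \<open>DIM('a)\<close> factors (1 + |x|)^2 is at least 1 + x_b^2 for one coordinate x_b, and 1 /
  (1 + x_b^2) is integrable on the line.\<close>

lemma integrable_inverse_one_plus_norm:
  "integrable lborel (\<lambda>x::'a::euclidean_space. inverse ((1 + norm x) ^ (2 * DIM('a))))"
proof (rule Bochner_Integration.integrable_bound)
  have "integrable lborel (\<lambda>x::real. inverse (1 + x\<^sup>2))"
    using integrable_inverse_1_plus_square by (simp add: set_integrable_def)
  then show "integrable lborel (\<lambda>x::'a. \<Prod>b\<in>Basis. inverse (1 + (x \<bullet> b)\<^sup>2))"
    by (intro lborel_prod(1)[where f = "\<lambda>_ x. inverse (1 + x\<^sup>2)"])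
  have "inverse ((1 + norm x) ^ (2 * DIM('a))) \<le> (\<Prod>b\<in>Basis. inverse (1 + (x \<bullet> b)\<^sup>2))" for x :: 'a
  proof -
    have "inverse ((1 + norm x) ^ (2 * DIM('a))) = (\<Prod>b\<in>(Basis::'a set). inverse ((1 + norm x)\<^sup>2))"
      by (simp add: power_mult power_inverse)
    also have "\<dots> \<le> (\<Prod>b\<in>Basis. inverse (1 + (x \<bullet> b)\<^sup>2))"
    proof (intro prod_mono conjI le_imp_inverse_le)
      fix b :: 'a assume b: "b \<in> Basis"
      have "(x \<bullet> b)\<^sup>2 \<le> (norm x)\<^sup>2" using Basis_le_norm[OF b, of x] abs_le_square_iff[of "x \<bullet> b" "norm x"] by simp
      then show "1 + (x \<bullet> b)\<^sup>2 \<le> (1 + norm x)\<^sup>2"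
        unfolding power2_sum one_power2 using norm_ge_zero[of x] by linarith
    qed (auto simp: add_pos_nonneg)
    finally show ?thesis .
  qed
  then show "AE x in lborel. norm (inverse ((1 + norm (x::'a)) ^ (2 * DIM('a))))
      \<le> norm (\<Prod>b\<in>Basis. inverse (1 + (x \<bullet> b)\<^sup>2))"
    by (auto intro!: AE_I2 order_trans[OF _ abs_ge_self])
qed auto

text \<open>A rescaled characteristic function of the standard normal distribution.\<close>

lemma gaussian_fourier_real:
  assumes t: "t > 0"
  shows "integrable lborel (\<lambda>x::real. exp (\<i> * of_real (x * s)) * of_real (exp (- t * x\<^sup>2)))"
    and "(\<integral>x. exp (\<i> * of_real (x * s)) * of_real (exp (- t * x\<^sup>2)) \<partial>lborel) = of_real (sqrt (pi / t) * exp (- s\<^sup>2 / (4 * t)))"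
proof -
  \<comment> \<open>With r^2 = 2 t the normal exponent (r x)^2 / 2 becomes t x^2.\<close>
  define r where "r = sqrt (2 * t)"
  have r: "r > 0" "r\<^sup>2 = 2 * t" using t by (auto simp: r_def)
  define h where "h x = std_normal_density x *\<^sub>R exp (\<i> * of_real (s / r * x))" for x
  have inth: "integrable lborel h"
    using integrable_std_normal_moment[of 0]
    by (rule Bochner_Integration.integrable_bound) (auto simp: h_def[abs_def])
  have "char std_normal_distribution (s / r) = (\<integral>x. h x \<partial>lborel)"
    unfolding char_def h_def by (subst integral_density) (auto simp: normal_density_nonneg)
  then have *: "(\<integral>x. h x \<partial>lborel) = of_real (exp (- (s / r)\<^sup>2 / 2))"
    by (simp add: char_std_normal_distribution)
  have hr: "h (0 + r * x) = (1 / sqrt (2 * pi)) *\<^sub>R (exp (\<i> * of_real (x * s)) * of_real (exp (- t * x\<^sup>2)))" for x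
    using r by (simp add: h_def std_normal_density_def power_mult_distrib scaleR_conv_of_real field_simps)
  have i: "integrable lborel (\<lambda>x. h (0 + r * x))"
    using lborel_integrable_real_affine[OF inth, of r 0] r by simp
  from integrable_scaleR_right[of "sqrt (2 * pi)", OF this]
  show "integrable lborel (\<lambda>x::real. exp (\<i> * of_real (x * s)) * of_real (exp (- t * x\<^sup>2)))"
    unfolding hr by simp
  have "(\<integral>x. h x \<partial>lborel) = \<bar>r\<bar> *\<^sub>R (\<integral>x. h (0 + r * x) \<partial>lborel)"
    by (rule lborel_integral_real_affine) (use r in auto)
  then have **: "of_real (exp (- (s / r)\<^sup>2 / 2)) = of_real (r / sqrt (2 * pi)) * (\<integral>x. exp (\<i> * of_real (x * s)) * of_real (exp (- t * x\<^sup>2)) \<partial>lborel)"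
    unfolding * hr using r by (simp add: scaleR_conv_of_real)
  have e: "- (s / r)\<^sup>2 / 2 = - s\<^sup>2 / (4 * t)" using r by (simp add: power_divide)
  have q: "sqrt (pi / t) * (r / sqrt (2 * pi)) = 1"
    unfolding r_def using t by (simp add: real_sqrt_mult real_sqrt_divide)
  have "of_real (sqrt (pi / t)) * of_real (exp (- s\<^sup>2 / (4 * t))) = complex_of_real (sqrt (pi / t) * (r / sqrt (2 * pi))) * (\<integral>x. exp (\<i> * of_real (x * s)) * of_real (exp (- t * x\<^sup>2)) \<partial>lborel)"
    unfolding of_real_mult[of "sqrt (pi/t)" "r / sqrt (2*pi)"] using ** e by (simp only: mult.assoc)
  then show "(\<integral>x. exp (\<i> * of_real (x * s)) * of_real (exp (- t * x\<^sup>2)) \<partial>lborel) = of_real (sqrt (pi / t) * exp (- s\<^sup>2 / (4 * t)))"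
    unfolding q by simp
qed

lemma gaussian_fourier:
  fixes z :: "'a::euclidean_space"
  assumes t: "t > 0"
  shows "integrable lborel (\<lambda>x::'a. exp (\<i> * of_real (x \<bullet> z)) * of_real (exp (- t * (norm x)\<^sup>2)))"
    and "(\<integral>x. exp (\<i> * of_real (x \<bullet> z)) * of_real (exp (- t * (norm x)\<^sup>2)) \<partial>lborel)
      = of_real ((pi / t) powr (DIM('a) / 2) * exp (- (norm z)\<^sup>2 / (4 * t)))"
proof -
  have eq: "exp (\<i> * of_real (x \<bullet> z)) * of_real (exp (- t * (norm x)\<^sup>2))
      = (\<Prod>b\<in>Basis. exp (\<i> * of_real ((x \<bullet> b) * (z \<bullet> b))) * complex_of_real (exp (- t * (x \<bullet> b)\<^sup>2)))" for x :: 'a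
  proof -
    have "x \<bullet> z = (\<Sum>b\<in>Basis. (x \<bullet> b) * (z \<bullet> b))" by (rule euclidean_inner)
    moreover have "(norm x)\<^sup>2 = (\<Sum>b\<in>Basis. (x \<bullet> b)\<^sup>2)"
      unfolding power2_norm_eq_inner by (subst euclidean_inner) (simp add: power2_eq_square)
    ultimately show ?thesis
      by (simp only: prod.distrib of_real_prod[symmetric] exp_sum[symmetric, OF finite_Basis]
          sum_distrib_left[symmetric] of_real_sum[symmetric])
  qed
  show "integrable lborel (\<lambda>x::'a. exp (\<i> * of_real (x \<bullet> z)) * of_real (exp (- t * (norm x)\<^sup>2)))"
    unfolding eq by (intro lborel_prod(1) gaussian_fourier_real(1) t)
  have "(\<Prod>b\<in>(Basis::'a set). sqrt (pi / t)) = (pi / t) powr (DIM('a) / 2)"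
    using t by (simp add: powr_half_sqrt[symmetric] powr_powr flip: powr_realpow)
  moreover have "(\<Prod>b\<in>Basis. exp (- (z \<bullet> b)\<^sup>2 / (4 * t))) = exp (- (norm z)\<^sup>2 / (4 * t))"
  proof -
    have "(norm z)\<^sup>2 = (\<Sum>b\<in>Basis. (z \<bullet> b)\<^sup>2)"
      unfolding power2_norm_eq_inner by (subst euclidean_inner) (simp add: power2_eq_square)
    then show ?thesis
      by (simp add: exp_sum[symmetric, OF finite_Basis] sum_divide_distrib sum_negf)
  qed
  ultimately show "(\<integral>x. exp (\<i> * of_real (x \<bullet> z)) * of_real (exp (- t * (norm x)\<^sup>2)) \<partial>lborel)
      = of_real ((pi / t) powr (DIM('a) / 2) * exp (- (norm z)\<^sup>2 / (4 * t)))"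
    unfolding eq lborel_prod(2)[OF gaussian_fourier_real(1)[OF t]] gaussian_fourier_real(2)[OF t]
    by (simp only: of_real_prod[symmetric] prod.distrib)
qed

section \<open>Bump functions\<close>

text \<open>The family p(1/s) exp(-1/s), extended by 0, is closed under differentiation; the plain
  bump is the case p = 1.\<close>

definition bump_poly :: "real poly \<Rightarrow> real \<Rightarrow> real" where
  "bump_poly p s = (if s > 0 then poly p (1 / s) * exp (- (1 / s)) else 0)"

lemma poly_exp_tendsto_0: "((\<lambda>u. poly p u * exp (- u)) \<longlongrightarrow> (0::real)) at_top"
proof -
  have "((\<lambda>u. \<Sum>i\<le>degree p. coeff p i * (u ^ i / exp u)) \<longlongrightarrow> (\<Sum>i\<le>degree p. coeff p i * 0)) at_top"
    by (intro tendsto_intros tendsto_power_div_exp_0)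
  then show ?thesis by (simp add: poly_altdef sum_distrib_right exp_minus divide_inverse mult.assoc)
qed

lemma bump_poly_tendsto_0: "(bump_poly p \<longlongrightarrow> 0) (at 0)"
proof -
  have "((\<lambda>s. poly p (inverse s) * exp (- inverse s)) \<longlongrightarrow> 0) (at_right 0)"
    using filterlim_compose[OF poly_exp_tendsto_0 filterlim_inverse_at_top_right] .
  then have "(bump_poly p \<longlongrightarrow> 0) (at_right 0)"
    by (rule Lim_transform_eventually)
      (auto simp: bump_poly_def eventually_at_filter inverse_eq_divide)
  moreover have "(bump_poly p \<longlongrightarrow> 0) (at_left 0)"
    by (rule Lim_transform_eventually[OF tendsto_const])
      (auto simp: bump_poly_def eventually_at_filter)
  ultimately show ?thesis by (simp add: filterlim_split_at)
qed

lemma bump_poly_has_derivative: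
  "(bump_poly p has_real_derivative bump_poly ([:0,0,1:] * (p - pderiv p)) s) (at s)"
proof -
  consider "s > 0" | "s < 0" | "s = 0" by linarith
  then show ?thesis
  proof cases
    case 1
    have "((\<lambda>s. poly p (1 / s) * exp (- (1 / s))) has_real_derivative
       poly p (1/s) * (exp (- (1 / s)) * (1 / s\<^sup>2)) + poly (pderiv p) (1/s) * (- (1 / s\<^sup>2)) * exp (- (1/s))) (at s)"
      using 1 by (auto intro!: derivative_eq_intros DERIV_chain2[OF poly_DERIV] simp: power2_eq_square)
    moreover have "eventually (\<lambda>s. s \<in> {0<..}) (nhds s)"
      using 1 by (intro eventually_nhds_in_open) auto
    ultimately have "(bump_poly p has_real_derivative
       poly p (1/s) * (exp (- (1 / s)) * (1 / s\<^sup>2)) + poly (pderiv p) (1/s) * (- (1 / s\<^sup>2)) * exp (- (1/s))) (at s)"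
      by (subst DERIV_cong_ev[OF refl _ refl]) (auto simp: bump_poly_def elim: eventually_mono)
    moreover have "poly p (1/s) * (exp (- (1 / s)) * (1 / s\<^sup>2)) + poly (pderiv p) (1/s) * (- (1 / s\<^sup>2)) * exp (- (1/s))
        = bump_poly ([:0,0,1:] * (p - pderiv p)) s" using 1
      by (simp add: bump_poly_def algebra_simps power2_eq_square add_divide_distrib diff_divide_distrib)
    ultimately show ?thesis by simp
  next
    case 2
    have "eventually (\<lambda>s. s \<in> {..<0}) (nhds s)"
      using 2 by (intro eventually_nhds_in_open) auto
    then have "(bump_poly p has_real_derivative 0) (at s)"
      by (subst DERIV_cong_ev[OF refl, where g = "\<lambda>_. 0"]) (auto simp: bump_poly_def elim: eventually_mono)
    then show ?thesis using 2 by (simp add: bump_poly_def)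
  next
    case 3
    \<comment> \<open>The difference quotient at 0 is again a member of the family, for the
      polynomial X p, because dividing by \<open>y\<close> multiplies p(1/y) by 1/y.\<close>
    have "((\<lambda>y. (bump_poly p y - bump_poly p 0) / (y - 0)) \<longlongrightarrow> 0) (at 0)"
      using bump_poly_tendsto_0[of "[:0,1:] * p"]
      by (rule Lim_transform_eventually) (auto simp: bump_poly_def eventually_at_filter)
    then show ?thesis using 3 by (simp add: has_field_derivative_iff bump_poly_def)
  qed
qed

definition bump :: "real \<Rightarrow> real" where "bump s = (if s > 0 then exp (- (1 / s)) else 0)"

lemma bump_eq: "bump = bump_poly 1" by (auto simp: bump_def bump_poly_def)

lemma smooth_bump: "smooth (\<lambda>s. complex_of_real (bump s))"
proof (rule smooth_coinduct[where S = "{\<lambda>s. complex_of_real (bump_poly p s) | p. True}"])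
  show "(\<lambda>s. complex_of_real (bump s)) \<in> {\<lambda>s. complex_of_real (bump_poly p s) | p. True}"
    unfolding bump_eq by blast
  fix g assume "g \<in> {\<lambda>s. complex_of_real (bump_poly p s) | p. True}"
  then obtain p where g: "g = (\<lambda>s. complex_of_real (bump_poly p s))" by blast
  have D: "(g has_derivative (\<lambda>v. v *\<^sub>R complex_of_real (bump_poly ([:0,0,1:] * (p - pderiv p)) s))) (at s)" for s
    using has_vector_derivative_of_real[OF bump_poly_has_derivative[of p s]]
    unfolding g has_vector_derivative_def .
  show "g differentiable at x" for x using D by (rule differentiableI)
  fix b :: real assume "b \<in> Basis"
  then have "(\<lambda>x. frechet_derivative g (at x) b) = (\<lambda>s. complex_of_real (bump_poly ([:0,0,1:] * (p - pderiv p)) s))"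
    by (auto simp: has_derivative_frechet[OF D])
  then show "(\<lambda>x. frechet_derivative g (at x) b) \<in> {\<lambda>s. complex_of_real (bump_poly p s) | p. True}"
    by blast
qed

text \<open>The factor \<open>n\<close> sharpens the edges: as \<open>n\<close> grows the values
  increase to the indicator of the open box, while the support stays in the closed box.\<close>

definition box_bump :: "'a::euclidean_space \<Rightarrow> 'a \<Rightarrow> real \<Rightarrow> 'a \<Rightarrow> real" where
  "box_bump a b n x = (\<Prod>i\<in>Basis. bump (n * (x \<bullet> i - a \<bullet> i)) * bump (n * (b \<bullet> i - x \<bullet> i)))"

lemma bump_bounds: "0 \<le> bump s" "bump s \<le> 1" by (auto simp: bump_def)

lemma box_bump_bounds: "0 \<le> box_bump a b n x" "box_bump a b n x \<le> 1"
  unfolding box_bump_def by (auto intro!: prod_nonneg prod_le_1 mult_le_one mult_nonneg_nonneg simp: bump_bounds)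

lemma box_bump_zero:
  assumes "n > 0" "x \<notin> box a b" shows "box_bump a b n x = 0"
proof -
  obtain i where i: "i \<in> Basis" "x \<bullet> i \<le> a \<bullet> i \<or> b \<bullet> i \<le> x \<bullet> i"
    using assms(2) unfolding mem_box by (auto simp: not_less)
  then have "bump (n * (x \<bullet> i - a \<bullet> i)) * bump (n * (b \<bullet> i - x \<bullet> i)) = 0"
    using assms(1) by (auto simp: bump_def zero_less_mult_iff)
  then show ?thesis unfolding box_bump_def using i(1) by (meson finite_Basis prod_zero)
qed

lemma smooth_box_bump: "smooth (\<lambda>x. complex_of_real (box_bump a b n x))"
  unfolding box_bump_def of_real_prod of_real_mult
proof (intro smooth_prod smooth_mult finite_Basis)
  fix i :: 'a
  have "linear (\<lambda>x. (n * (x \<bullet> i)))" by (intro linearI) (auto simp: algebra_simps)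
  from smooth_affine[OF smooth_bump this, of "- n * (a \<bullet> i)"]
  show "smooth (\<lambda>x. complex_of_real (bump (n * (x \<bullet> i - a \<bullet> i))))"
    by (simp add: algebra_simps)
  have "linear (\<lambda>x. - (n * (x \<bullet> i)))" by (intro linearI) (auto simp: algebra_simps)
  from smooth_affine[OF smooth_bump this, of "n * (b \<bullet> i)"]
  show "smooth (\<lambda>x. complex_of_real (bump (n * (b \<bullet> i - x \<bullet> i))))"
    by (simp add: algebra_simps)
qed

lemma box_bump_test: "n > 0 \<Longrightarrow> (\<lambda>x. complex_of_real (box_bump a b n x)) \<in> test_functions UNIV"
  by (rule test_functionsI[of _ "cbox a b"])
    (use box_subset_cbox in \<open>auto simp: smooth_box_bump intro!: box_bump_zero\<close>)

lemma box_bump_tendsto: "(\<lambda>n. box_bump a b (real (Suc n)) x) \<longlonglongrightarrow> indicator (box a b) x"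
proof (cases "x \<in> box a b")
  case False then show ?thesis by (simp add: box_bump_zero)
next
  case True
  have *: "(\<lambda>n. bump (real (Suc n) * s)) \<longlonglongrightarrow> 1" if "s > 0" for s
    using that unfolding bump_def by (simp del: of_nat_Suc) real_asymp
  have "(\<lambda>n. box_bump a b (real (Suc n)) x) \<longlonglongrightarrow> (\<Prod>i\<in>(Basis::'a set). 1 * 1)"
    unfolding box_bump_def by (intro tendsto_intros *) (use True in \<open>auto simp: mem_box\<close>)
  then show ?thesis using True by simp
qed

section \<open>The Fourier transform on Schwartz functions\<close>

lemma integrable_product_bound:
  fixes h :: "'a::euclidean_space \<Rightarrow> 'b::euclidean_space \<Rightarrow> complex" and f :: "'a \<Rightarrow> complex" and g :: "'b \<Rightarrow> complex"
  assumes f: "integrable lborel f" and g: "integrable lborel g"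
    and [measurable]: "case_prod h \<in> borel_measurable (lborel \<Otimes>\<^sub>M lborel)"
    and bd: "\<And>x y. cmod (h x y) \<le> cmod (f x) * cmod (g y)"
  shows "integrable (lborel \<Otimes>\<^sub>M lborel) (case_prod h)"
proof (rule Bochner_Integration.integrable_bound)
  have [measurable]: "f \<in> borel_measurable lborel" "g \<in> borel_measurable lborel" using f g by auto
  show "integrable (lborel \<Otimes>\<^sub>M lborel) (\<lambda>(x, y). f x * g y)"
    by (rule lborel_pair.Fubini_integrable) (use f g in \<open>auto simp: norm_mult\<close>)
  show "AE z in lborel \<Otimes>\<^sub>M lborel. norm (case_prod h z) \<le> norm (case z of (x, y) \<Rightarrow> f x * g y)"
    by (rule AE_I2) (auto simp: norm_mult bd)
qed auto

lemma cmod_exp_i [simp]: "cmod (exp (\<i> * complex_of_real t)) = 1" "cmod (exp (- (\<i> * complex_of_real t))) = 1"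
  by (simp_all add: norm_exp_eq_Re)

lemma schwartz_smooth: "f \<in> schwartz \<Longrightarrow> smooth f" unfolding schwartz_def by blast

lemma schwartz_frechet:
  assumes f: "f \<in> schwartz" and b: "b \<in> Basis"
  shows "(\<lambda>x. frechet_derivative f (at x) b) \<in> schwartz"
  unfolding schwartz_def
proof (intro CollectI conjI allI impI)
  show "smooth (\<lambda>x. frechet_derivative f (at x) b)" using smooth_frechet[OF schwartz_smooth[OF f] b] .
  fix N :: nat and bs :: "'a list" assume bs: "set bs \<subseteq> Basis"
  have "iter_deriv bs (\<lambda>x. frechet_derivative f (at x) b) = iter_deriv (bs @ [b]) f"
    by (simp add: iter_deriv_append)
  moreover have "\<exists>M. \<forall>x. (1 + norm x) ^ N * cmod (iter_deriv (bs @ [b]) f x) \<le> M"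
    using f bs b unfolding schwartz_def by (auto simp del: iter_deriv.simps)
  ultimately show "\<exists>M. \<forall>x. (1 + norm x) ^ N * cmod (iter_deriv bs (\<lambda>x. frechet_derivative f (at x) b) x) \<le> M"
    by simp
qed

lemma schwartz_iter_deriv: "f \<in> schwartz \<Longrightarrow> set bs \<subseteq> Basis \<Longrightarrow> iter_deriv bs f \<in> schwartz"
  by (induction bs) (auto intro: schwartz_frechet)

lemma schwartz_bound:
  assumes "f \<in> schwartz"
  obtains M where "\<And>x. (1 + norm x) ^ N * cmod (f x) \<le> M"
proof -
  have "\<exists>M. \<forall>x. (1 + norm x) ^ N * cmod (iter_deriv [] f x) \<le> M"
    using assms unfolding schwartz_def by (auto simp del: iter_deriv.simps)
  then show ?thesis using that by auto
qed

text \<open>The type argument records the dimension on which the constant depends.\<close>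

definition decay_integral :: "'a::euclidean_space itself \<Rightarrow> real" where
  "decay_integral _ = (\<integral>x. inverse ((1 + norm x) ^ (2 * DIM('a))) \<partial>(lborel :: 'a measure))"

lemma integrable_decay:
  fixes f :: "'a::euclidean_space \<Rightarrow> complex"
  assumes [measurable]: "f \<in> borel_measurable borel"
    and bd: "\<And>x. (1 + norm x) ^ (2 * DIM('a)) * cmod (f x) \<le> M"
  shows "integrable lborel f" and "(\<integral>x. cmod (f x) \<partial>lborel) \<le> M * decay_integral TYPE('a)"
proof -
  have *: "cmod (f x) \<le> M * inverse ((1 + norm x) ^ (2 * DIM('a)))" for x
  proof -
    have "(1 + norm x) ^ (2 * DIM('a)) > 0" by (intro zero_less_power) (auto simp: add_pos_nonneg)
    then show ?thesis using bd[of x] by (simp add: field_simps)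
  qed
  have i: "integrable lborel (\<lambda>x::'a. M * inverse ((1 + norm x) ^ (2 * DIM('a))))"
    using integrable_inverse_one_plus_norm[where 'a = 'a] by simp
  then show 1: "integrable lborel f"
    by (rule Bochner_Integration.integrable_bound) (auto intro!: order_trans[OF * abs_ge_self])
  have "(\<integral>x. cmod (f x) \<partial>lborel) \<le> (\<integral>x. M * inverse ((1 + norm x) ^ (2 * DIM('a))) \<partial>(lborel :: 'a measure))"
    by (rule Bochner_Integration.integral_mono) (use 1 i * in auto)
  then show "(\<integral>x. cmod (f x) \<partial>lborel) \<le> M * decay_integral TYPE('a)"
    by (simp add: decay_integral_def)
qed

lemma schwartz_measurable: "f \<in> schwartz \<Longrightarrow> f \<in> borel_measurable borel"
  by (intro smooth_measurable schwartz_smooth)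

lemma schwartz_integrable:
  fixes f :: "'a::euclidean_space \<Rightarrow> complex"
  assumes "f \<in> schwartz" shows "integrable lborel f"
proof -
  obtain M where "\<And>x. (1 + norm x) ^ (2 * DIM('a)) * cmod (f x) \<le> M"
    by (rule schwartz_bound[OF assms], rule that)
  then show ?thesis by (intro integrable_decay(1) schwartz_measurable assms)
qed

lemma test_functions_integrable: "f \<in> test_functions \<Omega> \<Longrightarrow> integrable lborel f"
  by (intro schwartz_integrable test_functions_schwartz)

lemma integrable_exp_mult:
  fixes f :: "'a::euclidean_space \<Rightarrow> complex"
  assumes "integrable lborel f"
  shows "integrable lborel (\<lambda>x. exp (- \<i> * of_real (\<xi> \<bullet> x)) * f x)"
    "integrable lborel (\<lambda>x. exp (\<i> * of_real (\<xi> \<bullet> x)) * f x)"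
proof -
  have [measurable]: "f \<in> borel_measurable lborel" using assms by auto
  show "integrable lborel (\<lambda>x. exp (- \<i> * of_real (\<xi> \<bullet> x)) * f x)"
    "integrable lborel (\<lambda>x. exp (\<i> * of_real (\<xi> \<bullet> x)) * f x)"
    by (rule Bochner_Integration.integrable_bound[OF assms]; simp add: norm_mult)+
qed

abbreviation fourier_const :: "'a::euclidean_space itself \<Rightarrow> real" where
  "fourier_const _ \<equiv> (2 * pi) powr (- real DIM('a) / 2)"

lemma fourier_bound: "cmod (fourier (f :: 'a::euclidean_space \<Rightarrow> complex) \<xi>) \<le> fourier_const TYPE('a) * (\<integral>x. cmod (f x) \<partial>lborel)"
proof -
  have "cmod (\<integral>x. exp (- \<i> * of_real (\<xi> \<bullet> x)) * f x \<partial>lborel) \<le> (\<integral>x. cmod (exp (- \<i> * of_real (\<xi> \<bullet> x)) * f x) \<partial>lborel)"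
    by simp
  then show ?thesis unfolding fourier_def norm_mult by (simp add: norm_mult mult_left_mono)
qed

lemma fourier_reflect:
  fixes f :: "'a::euclidean_space \<Rightarrow> complex"
  assumes "integrable lborel f"
  shows "fourier (\<lambda>x. f (- x)) \<xi> = fourier f (- \<xi>)"
  using lborel_affine_integral(2)[of "-1" "\<lambda>x. exp (- \<i> * of_real (- \<xi> \<bullet> x)) * f x" 0] integrable_exp_mult[OF assms, of "- \<xi>"]
  by (simp add: fourier_def)

lemma fourier_cnj: "fourier (\<lambda>x. cnj (f x)) \<xi> = cnj (fourier f (- \<xi>))"
proof -
  have "cnj (\<integral>x. exp (- \<i> * of_real (- \<xi> \<bullet> x)) * f x \<partial>lborel)
      = (\<integral>x. cnj (exp (- \<i> * of_real (- \<xi> \<bullet> x)) * f x) \<partial>lborel)"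
    by (rule Bochner_Integration.integral_cnj[symmetric])
  then show ?thesis by (simp add: fourier_def exp_cnj)
qed

lemma fourier_add:
  assumes "integrable lborel f" "integrable lborel g"
  shows "fourier (\<lambda>x. f x + g x) \<xi> = fourier f \<xi> + fourier g \<xi>"
  using integrable_exp_mult[OF assms(1), of \<xi>] integrable_exp_mult[OF assms(2), of \<xi>]
  by (simp add: fourier_def distrib_left)

lemma fourier_mult: "fourier (\<lambda>x. c * f x) \<xi> = c * fourier f \<xi>"
proof -
  have "(\<integral>x. exp (- \<i> * of_real (\<xi> \<bullet> x)) * (c * f x) \<partial>lborel) = (\<integral>x. c * (exp (- \<i> * of_real (\<xi> \<bullet> x)) * f x) \<partial>lborel)"
    by (simp add: mult_ac)
  then show ?thesis by (simp add: fourier_def mult_ac)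
qed

text \<open>Translating \<open>f\<close> by t b multiplies its transform by exp(i t \<xi>.b); the
  claim is the derivative of this identity at t = 0, which takes the place of an integration by
  parts.\<close>

lemma fourier_deriv:
  fixes f :: "'a::euclidean_space \<Rightarrow> complex"
  assumes f: "f \<in> schwartz" and b: "b \<in> Basis"
  shows "fourier (\<lambda>x. frechet_derivative f (at x) b) \<xi> = \<i> * of_real (\<xi> \<bullet> b) * fourier f \<xi>"
proof -
  let ?e = "\<lambda>x. exp (- \<i> * of_real (\<xi> \<bullet> x))"
  define f' where "f' x = frechet_derivative f (at x) b" for x
  have f': "f' \<in> schwartz" using schwartz_frechet[OF f b] by (simp add: f'_def[abs_def])
  obtain M where M: "\<And>x. (1 + norm x) ^ (2 * DIM('a)) * cmod (f' x) \<le> M"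
    by (rule schwartz_bound[OF f'], rule that)
  have M0: "M \<ge> 0" using order_trans[OF _ M[of 0]] by simp
  \<comment> \<open>Majorant for all translates with |t| < 1: a shift of length at most 1 costs a
    factor 2 in \<open>1 + norm x\<close>.\<close>
  let ?g = "\<lambda>x::'a. M * 2 ^ (2 * DIM('a)) * inverse ((1 + norm x) ^ (2 * DIM('a)))"
  have intf: "integrable lborel (\<lambda>x. ?e x * f (t *\<^sub>R b + x))"
    and valf: "(\<integral>x. ?e x * f (t *\<^sub>R b + x) \<partial>lborel) = exp (\<i> * of_real (\<xi> \<bullet> b * t)) * (\<integral>x. ?e x * f x \<partial>lborel)" for t
  proof -
    have "integrable lborel (\<lambda>x. exp (\<i> * of_real (\<xi> \<bullet> b * t)) * (?e x * f x))"
      using integrable_exp_mult[OF schwartz_integrable[OF f]] by simp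
    note * = lborel_affine_integral[OF _ this, of 1 "t *\<^sub>R b"]
    have e: "exp (\<i> * of_real (\<xi> \<bullet> b * t)) * (?e (t *\<^sub>R b + 1 *\<^sub>R x) * f (t *\<^sub>R b + 1 *\<^sub>R x)) = ?e x * f (t *\<^sub>R b + x)" for x
    proof -
      have "exp (\<i> * of_real (\<xi> \<bullet> b * t)) * ?e (t *\<^sub>R b + x) = ?e x"
        unfolding exp_add[symmetric] by (simp add: inner_add_right algebra_simps)
      then show ?thesis by (simp add: mult.assoc[symmetric])
    qed
    show "integrable lborel (\<lambda>x. ?e x * f (t *\<^sub>R b + x))" using *(1) unfolding e by simp
    show "(\<integral>x. ?e x * f (t *\<^sub>R b + x) \<partial>lborel) = exp (\<i> * of_real (\<xi> \<bullet> b * t)) * (\<integral>x. ?e x * f x \<partial>lborel)"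
      using *(2) unfolding e by simp
  qed
  have "((\<lambda>t. \<integral>x. ?e x * f (t *\<^sub>R b + x) \<partial>lborel) has_vector_derivative (\<integral>x. ?e x * f' (0 *\<^sub>R b + x) \<partial>lborel)) (at 0)"
  proof (rule has_vector_derivative_lebesgue_integral(2)[where a = "-1" and b = 1 and g = ?g])
    show "integrable lborel (\<lambda>x. ?e x * f (t *\<^sub>R b + x))" for t by (rule intf)
    show "integrable lborel ?g" using integrable_inverse_one_plus_norm[where 'a = 'a] by simp
    fix t x assume t: "- 1 < t" "t < (1::real)"
    have "(f has_derivative frechet_derivative f (at (t *\<^sub>R b + x))) (at (t *\<^sub>R b + x))"
      using smooth_differentiable[OF schwartz_smooth[OF f]] by (simp add: frechet_derivative_works)
    moreover have "((\<lambda>t. t *\<^sub>R b + x) has_derivative (\<lambda>t. t *\<^sub>R b)) (at t)" by (auto intro!: derivative_eq_intros)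
    ultimately have "((\<lambda>t. f (t *\<^sub>R b + x)) has_derivative (\<lambda>v. frechet_derivative f (at (t *\<^sub>R b + x)) (v *\<^sub>R b))) (at t)"
      using diff_chain_at[of "\<lambda>t. t *\<^sub>R b + x" "\<lambda>t. t *\<^sub>R b" t f] by (simp add: o_def)
    moreover have "frechet_derivative f (at (t *\<^sub>R b + x)) (v *\<^sub>R b) = v *\<^sub>R f' (t *\<^sub>R b + x)" for v
      unfolding f'_def by (intro linear_cmul linear_frechet_derivative smooth_differentiable schwartz_smooth f)
    ultimately have "((\<lambda>t. f (t *\<^sub>R b + x)) has_vector_derivative f' (t *\<^sub>R b + x)) (at t)"
      by (simp add: has_vector_derivative_def)
    then show "((\<lambda>t. ?e x * f (t *\<^sub>R b + x)) has_vector_derivative ?e x * f' (t *\<^sub>R b + x)) (at t)"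
      by (rule has_vector_derivative_mult_right)
    have 1: "norm x \<le> norm (t *\<^sub>R b + x) + norm (t *\<^sub>R b)" using norm_triangle_ineq4[of "t *\<^sub>R b + x" "t *\<^sub>R b"] by simp
    have "norm (t *\<^sub>R b) \<le> 1" using t b by (simp add: norm_Basis)
    moreover have "a \<le> n + c \<Longrightarrow> c \<le> 1 \<Longrightarrow> 0 \<le> n \<Longrightarrow> 1 + a \<le> 2 * (1 + n)" for a n c :: real by simp
    ultimately have "1 + norm x \<le> 2 * (1 + norm (t *\<^sub>R b + x))" using 1 norm_ge_zero by blast
    then have "(1 + norm x) ^ (2 * DIM('a)) \<le> 2 ^ (2 * DIM('a)) * (1 + norm (t *\<^sub>R b + x)) ^ (2 * DIM('a))"
      unfolding power_mult_distrib[symmetric] by (intro power_mono) auto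
    then have "(1 + norm x) ^ (2 * DIM('a)) * cmod (f' (t *\<^sub>R b + x)) \<le> 2 ^ (2 * DIM('a)) * (1 + norm (t *\<^sub>R b + x)) ^ (2 * DIM('a)) * cmod (f' (t *\<^sub>R b + x))"
      by (intro mult_right_mono) auto
    also have "\<dots> \<le> 2 ^ (2 * DIM('a)) * M"
      unfolding mult.assoc by (intro mult_left_mono M) auto
    finally have "cmod (f' (t *\<^sub>R b + x)) * (1 + norm x) ^ (2 * DIM('a)) \<le> M * 2 ^ (2 * DIM('a))" by (simp add: mult_ac)
    moreover have "(1 + norm x) ^ (2 * DIM('a)) > 0" by (intro zero_less_power) (auto simp: add_pos_nonneg)
    ultimately have "cmod (f' (t *\<^sub>R b + x)) \<le> ?g x" by (simp add: field_simps)
    then show "cmod (?e x * f' (t *\<^sub>R b + x)) \<le> ?g x" by (simp add: norm_mult)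
  qed auto
  then have "((\<lambda>t. exp (\<i> * of_real (\<xi> \<bullet> b * t)) * (\<integral>x. ?e x * f x \<partial>lborel)) has_vector_derivative (\<integral>x. ?e x * f' x \<partial>lborel)) (at 0)"
    unfolding valf by simp
  moreover have "((\<lambda>t. exp (\<i> * of_real (\<xi> \<bullet> b * t)) * (\<integral>x. ?e x * f x \<partial>lborel)) has_vector_derivative (\<i> * of_real (\<xi> \<bullet> b)) * (\<integral>x. ?e x * f x \<partial>lborel)) (at 0)"
  proof (rule has_vector_derivative_mult_left)
    have "((\<lambda>z. exp (\<i> * of_real (\<xi> \<bullet> b) * z)) has_field_derivative \<i> * of_real (\<xi> \<bullet> b)) (at (of_real 0))"
      by (auto intro!: derivative_eq_intros)
    then have "((\<lambda>t. exp (\<i> * of_real (\<xi> \<bullet> b) * of_real t)) has_vector_derivative \<i> * of_real (\<xi> \<bullet> b)) (at 0)"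
      by (rule has_vector_derivative_real_field)
    then show "((\<lambda>t. exp (\<i> * of_real (\<xi> \<bullet> b * t))) has_vector_derivative \<i> * of_real (\<xi> \<bullet> b)) (at 0)"
      by (simp add: mult.assoc)
  qed
  ultimately have "(\<integral>x. ?e x * f' x \<partial>lborel) = (\<i> * of_real (\<xi> \<bullet> b)) * (\<integral>x. ?e x * f x \<partial>lborel)"
    by (rule vector_derivative_unique_at)
  then show ?thesis by (simp add: fourier_def f'_def)
qed

lemma fourier_deriv_replicate:
  fixes f :: "'a::euclidean_space \<Rightarrow> complex"
  assumes f: "f \<in> schwartz" and b: "b \<in> Basis"
  shows "fourier (iter_deriv (replicate N b) f) \<xi> = (\<i> * of_real (\<xi> \<bullet> b)) ^ N * fourier f \<xi>"
proof (induction N)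
  case (Suc N)
  have "iter_deriv (replicate N b) f \<in> schwartz" using f b by (intro schwartz_iter_deriv) auto
  from fourier_deriv[OF this b, of \<xi>] Suc show ?case by simp
qed simp

text \<open>At high frequency one differentiates \<open>N\<close> times in the direction of the
  largest coordinate of \<open>\<xi>\<close>. The bound is explicit and linear in \<open>M\<close>
  because it later provides the continuity estimate of a tempered distribution.\<close>

lemma fourier_decay:
  fixes f :: "'a::euclidean_space \<Rightarrow> complex"
  assumes f: "f \<in> schwartz"
    and M: "\<And>bs x. set bs \<subseteq> Basis \<Longrightarrow> length bs \<le> max N (2 * DIM('a)) \<Longrightarrow>
      (1 + norm x) ^ max N (2 * DIM('a)) * cmod (iter_deriv bs f x) \<le> M"
  shows "(1 + norm \<xi>) ^ N * cmod (fourier f \<xi>)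
    \<le> ((1 + real DIM('a)) ^ N * fourier_const TYPE('a) * decay_integral TYPE('a)) * M"
proof -
  let ?c = "fourier_const TYPE('a) * (M * decay_integral TYPE('a))"
  have bd: "cmod (fourier (iter_deriv bs f) \<xi>) \<le> ?c"
    if bs: "set bs \<subseteq> Basis" "length bs \<le> max N (2 * DIM('a))" for bs
  proof -
    have "(\<integral>x. cmod (iter_deriv bs f x) \<partial>lborel) \<le> M * decay_integral TYPE('a)"
    proof (rule integrable_decay(2))
      show "iter_deriv bs f \<in> borel_measurable borel"
        by (intro schwartz_measurable schwartz_iter_deriv f bs)
      show "(1 + norm x) ^ (2 * DIM('a)) * cmod (iter_deriv bs f x) \<le> M" for x
        by (rule order_trans[OF _ M[OF bs, of x]]) (intro mult_right_mono power_increasing; simp)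
    qed
    then show ?thesis by (intro order_trans[OF fourier_bound] mult_left_mono) auto
  qed
  have "finite ((\<lambda>b. \<bar>\<xi> \<bullet> b\<bar>) ` Basis)" "(\<lambda>b. \<bar>\<xi> \<bullet> b\<bar>) ` Basis \<noteq> {}" by auto
  from Max_in[OF this] obtain b where b: "Max ((\<lambda>b. \<bar>\<xi> \<bullet> b\<bar>) ` Basis) = \<bar>\<xi> \<bullet> b\<bar>" "b \<in> Basis" by (rule imageE)
  then have b': "\<bar>\<xi> \<bullet> c\<bar> \<le> \<bar>\<xi> \<bullet> b\<bar>" if "c \<in> Basis" for c
    using that b(1)[symmetric] by (auto intro: Max_ge)
  \<comment> \<open>Truncation at 1 covers low frequencies, where the bound on the transform itself
    is enough.\<close>
  define t where "t = max 1 \<bar>\<xi> \<bullet> b\<bar>"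
  have "norm \<xi> \<le> (\<Sum>c\<in>Basis. \<bar>\<xi> \<bullet> c\<bar>)" by (rule norm_le_l1)
  also have "\<dots> \<le> (\<Sum>c\<in>(Basis::'a set). t)" by (intro sum_mono) (use b' in \<open>auto simp: t_def le_max_iff_disj\<close>)
  finally have "1 + norm \<xi> \<le> (1 + real DIM('a)) * t" by (simp add: t_def distrib_right)
  then have "(1 + norm \<xi>) ^ N \<le> (1 + real DIM('a)) ^ N * t ^ N"
    unfolding power_mult_distrib[symmetric] by (intro power_mono) auto
  then have "(1 + norm \<xi>) ^ N * cmod (fourier f \<xi>) \<le> (1 + real DIM('a)) ^ N * t ^ N * cmod (fourier f \<xi>)"
    by (intro mult_right_mono) auto
  also have "t ^ N * cmod (fourier f \<xi>) \<le> ?c"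
  proof (cases "\<bar>\<xi> \<bullet> b\<bar> \<le> 1")
    case True then show ?thesis using bd[of "[]"] by (simp add: t_def)
  next
    case False
    have "cmod (fourier (iter_deriv (replicate N b) f) \<xi>) \<le> ?c" by (rule bd) (use b in auto)
    then show ?thesis using False by (simp add: fourier_deriv_replicate[OF f b(2)] norm_mult norm_power t_def)
  qed
  then have "(1 + real DIM('a)) ^ N * t ^ N * cmod (fourier f \<xi>) \<le> (1 + real DIM('a)) ^ N * ?c"
    unfolding mult.assoc by (intro mult_left_mono) auto
  finally show ?thesis by (simp add: mult_ac)
qed

lemma fourier_has_derivative:
  fixes g :: "'a::euclidean_space \<Rightarrow> complex"
  assumes g: "integrable lborel g" and g1: "integrable lborel (\<lambda>x. norm x * cmod (g x))"
  shows "(fourier g has_derivative (\<lambda>v. fourier (\<lambda>x. - \<i> * of_real (v \<bullet> x) * g x) \<xi>)) (at \<xi>)"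
proof -
  have "((\<lambda>\<xi>. \<integral>x. exp (- \<i> * of_real (\<xi> \<bullet> x)) * g x \<partial>lborel) has_derivative
     (\<lambda>v. \<integral>x. (- \<i> * of_real (v \<bullet> x)) * exp (- \<i> * of_real (\<xi> \<bullet> x)) * g x \<partial>lborel)) (at \<xi>)"
  proof (rule has_derivative_lebesgue_integral(2)[where S = UNIV and g = "\<lambda>x. norm x * cmod (g x)"])
    show "integrable lborel (\<lambda>x. exp (- \<i> * of_real (\<xi> \<bullet> x)) * g x)" for \<xi>
      by (rule integrable_exp_mult(1)[OF g])
    show "((\<lambda>\<xi>. exp (- \<i> * of_real (\<xi> \<bullet> x)) * g x) has_derivative
        (\<lambda>v. (- \<i> * of_real (v \<bullet> x)) * exp (- \<i> * of_real (\<xi> \<bullet> x)) * g x)) (at \<xi>)" for \<xi> x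
    proof -
      have "((\<lambda>\<xi>. - \<i> * of_real (\<xi> \<bullet> x)) has_derivative (\<lambda>v. - \<i> * of_real (v \<bullet> x))) (at \<xi>)"
        by (intro bounded_linear_imp_has_derivative bounded_linear_const_mult
            bounded_linear_compose[OF bounded_linear_of_real] bounded_linear_inner_left)
      from has_derivative_mult_left[OF has_derivative_compose[OF this DERIV_exp[unfolded has_field_derivative_def]], of "g x"]
      show ?thesis by (simp add: mult_ac)
    qed
    fix \<xi> x v :: 'a
    have "\<bar>v \<bullet> x\<bar> \<le> norm v * norm x" by (rule Cauchy_Schwarz_ineq2)
    then have "\<bar>v \<bullet> x\<bar> * cmod (g x) \<le> norm v * norm x * cmod (g x)" by (rule mult_right_mono) simp
    then show "cmod ((- \<i> * of_real (v \<bullet> x)) * exp (- \<i> * of_real (\<xi> \<bullet> x)) * g x) \<le> norm x * cmod (g x) * norm v"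
      by (simp add: norm_mult mult_ac)
  qed (use g1 in auto)
  then have "((\<lambda>\<xi>. fourier_const TYPE('a) *\<^sub>R (\<integral>x. exp (- \<i> * of_real (\<xi> \<bullet> x)) * g x \<partial>lborel)) has_derivative
     (\<lambda>v. fourier_const TYPE('a) *\<^sub>R (\<integral>x. (- \<i> * of_real (v \<bullet> x)) * exp (- \<i> * of_real (\<xi> \<bullet> x)) * g x \<partial>lborel))) (at \<xi>)"
    by (rule has_derivative_scaleR_right)
  then show ?thesis by (simp add: fourier_def[abs_def] scaleR_conv_of_real mult_ac)
qed

lemma test_functions_mult_inner:
  assumes "g \<in> test_functions \<Omega>"
  shows "(\<lambda>x. - \<i> * of_real (v \<bullet> x) * g x) \<in> test_functions \<Omega>"
proof (rule test_functions_mult[OF assms smooth_bounded_linear_id])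
  show "bounded_linear (\<lambda>x. - \<i> * complex_of_real (v \<bullet> x))"
    by (intro bounded_linear_const_mult bounded_linear_compose[OF bounded_linear_of_real] bounded_linear_inner_right)
qed

lemma fourier_test_derivative:
  fixes g :: "'a::euclidean_space \<Rightarrow> complex"
  assumes g: "g \<in> test_functions \<Omega>"
  shows "(fourier g has_derivative (\<lambda>v. fourier (\<lambda>x. - \<i> * of_real (v \<bullet> x) * g x) \<xi>)) (at \<xi>)"
proof (rule fourier_has_derivative)
  show i: "integrable lborel g" using g by (rule test_functions_integrable)
  obtain R where R: "R > 0" "\<And>x. norm x > R \<Longrightarrow> g x = 0"
    by (rule test_functions_support[OF g], rule that)
  have [measurable]: "g \<in> borel_measurable borel" using i by auto
  show "integrable lborel (\<lambda>x. norm x * cmod (g x))"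
  proof (rule Bochner_Integration.integrable_bound)
    show "integrable lborel (\<lambda>x. R * cmod (g x))" using i by auto
    have "norm x * cmod (g x) \<le> R * cmod (g x)" for x
      using R(2)[of x] by (cases "norm x > R") (auto intro: mult_right_mono)
    then show "AE x in lborel. norm (norm x * cmod (g x)) \<le> norm (R * cmod (g x))"
      by (auto intro!: AE_I2 order_trans[OF _ abs_ge_self])
  qed auto
qed

text \<open>Differentiating a transform multiplies the original by a linear function, so every
  derivative is again the transform of a test function; decay of transforms thus yields decay of all
  derivatives at once.\<close>

lemma iter_deriv_fourier:
  assumes "g \<in> test_functions \<Omega>" "set bs \<subseteq> Basis"
  obtains h where "h \<in> test_functions \<Omega>" "iter_deriv bs (fourier g) = fourier h"
proof -
  have "\<exists>h\<in>test_functions \<Omega>. iter_deriv bs (fourier g) = fourier h"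
    using assms(2)
  proof (induction bs)
    case Nil then show ?case using assms(1) by (intro bexI[of _ g]) simp_all
  next
    case (Cons b bs)
    then have "\<exists>h\<in>test_functions \<Omega>. iter_deriv bs (fourier g) = fourier h" by simp
    then obtain h where h: "h \<in> test_functions \<Omega>" "iter_deriv bs (fourier g) = fourier h" by (elim bexE)
    have "iter_deriv (b # bs) (fourier g) = fourier (\<lambda>x. - \<i> * of_real (b \<bullet> x) * h x)"
      by (simp only: iter_deriv.simps h(2) has_derivative_frechet[OF fourier_test_derivative[OF h(1)]])
    then show ?case by (intro bexI[OF _ test_functions_mult_inner[OF h(1)]])
  qed
  then show ?thesis by (elim bexE) (rule that)
qed

lemma fourier_schwartz_decay:
  fixes f :: "'a::euclidean_space \<Rightarrow> complex"
  assumes f: "f \<in> schwartz"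
  obtains M where "\<And>\<xi>. (1 + norm \<xi>) ^ N * cmod (fourier f \<xi>) \<le> M"
proof -
  let ?K = "max N (2 * DIM('a))"
  let ?B = "{bs. set bs \<subseteq> (Basis::'a set) \<and> length bs \<le> ?K}"
  have "\<forall>bs\<in>?B. \<exists>M. \<forall>x. (1 + norm x) ^ ?K * cmod (iter_deriv bs f x) \<le> M"
    using f unfolding schwartz_def by blast
  from bchoice[OF this] obtain M
    where M: "\<forall>bs\<in>?B. \<forall>x. (1 + norm x) ^ ?K * cmod (iter_deriv bs f x) \<le> M bs" by (elim exE)
  \<comment> \<open>There are finitely many lists of bounded length over a finite basis, so the
    individual bounds have a maximum.\<close>
  have fin: "finite ?B" by (rule finite_lists_length_le) simp
  have "(1 + norm x) ^ ?K * cmod (iter_deriv bs f x) \<le> Max (M ` ?B)" if "set bs \<subseteq> Basis" "length bs \<le> ?K" for bs x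
    proof (rule order_trans)
    show "(1 + norm x) ^ ?K * cmod (iter_deriv bs f x) \<le> M bs" using M that by blast
    show "M bs \<le> Max (M ` ?B)" by (rule Max_ge[OF finite_imageI[OF fin] imageI]) (use that in auto)
  qed
  from fourier_decay[OF f this] show ?thesis by (rule that)
qed

lemma fourier_test_smooth:
  assumes g: "g \<in> test_functions \<Omega>"
  shows "smooth (fourier g)"
  unfolding smooth_def
proof (intro allI impI)
  fix bs :: "'a list" and x assume bs: "set bs \<subseteq> Basis"
  obtain h where h: "h \<in> test_functions \<Omega>" "iter_deriv bs (fourier g) = fourier h"
    by (rule iter_deriv_fourier[OF g bs], rule that)
  then show "iter_deriv bs (fourier g) differentiable at x"
    using differentiableI[OF fourier_test_derivative[OF h(1)]] by simp
qed

lemma fourier_test_schwartz: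
  assumes g: "g \<in> test_functions \<Omega>"
  shows "fourier g \<in> schwartz"
  unfolding schwartz_def
proof (intro CollectI conjI allI impI)
  show "smooth (fourier g)" using g by (rule fourier_test_smooth)
  fix N :: nat and bs :: "'a list" assume bs: "set bs \<subseteq> Basis"
  obtain h where h: "h \<in> test_functions \<Omega>" "iter_deriv bs (fourier g) = fourier h"
    by (rule iter_deriv_fourier[OF g bs], rule that)
  obtain M where "\<And>\<xi>. (1 + norm \<xi>) ^ N * cmod (fourier h \<xi>) \<le> M"
    by (rule fourier_schwartz_decay[OF test_functions_schwartz[OF h(1)]], rule that)
  then show "\<exists>M. \<forall>x. (1 + norm x) ^ N * cmod (iter_deriv bs (fourier g) x) \<le> M"
    using h(2) by auto
qed

section \<open>Fourier inversion and Plancherel\<close>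

lemma fourier_measurable [measurable]:
  fixes g :: "'a::euclidean_space \<Rightarrow> complex"
  assumes [measurable]: "g \<in> borel_measurable borel"
  shows "fourier g \<in> borel_measurable borel"
  unfolding fourier_def[abs_def] by measurable

lemma fourier_multiplication:
  fixes f g :: "'a::euclidean_space \<Rightarrow> complex"
  assumes f: "integrable lborel f" and g: "integrable lborel g"
  shows "(\<integral>x. fourier f x * g x \<partial>lborel) = (\<integral>x. f x * fourier g x \<partial>lborel)"
proof -
  have [measurable]: "f \<in> borel_measurable borel" "g \<in> borel_measurable borel" using f g by auto
  let ?h = "\<lambda>x y. exp (- \<i> * of_real (x \<bullet> y)) * f x * g y"
  have "integrable (lborel \<Otimes>\<^sub>M lborel) (\<lambda>(x, y). ?h x y)"
    by (rule integrable_product_bound[OF f g]) (auto simp: norm_mult)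
  then have eq: "(\<integral>y. (\<integral>x. ?h x y \<partial>lborel) \<partial>lborel) = (\<integral>x. (\<integral>y. ?h x y \<partial>lborel) \<partial>lborel)"
    by (rule lborel_pair.Fubini_integral)
  have 1: "fourier f y * g y = of_real (fourier_const TYPE('a)) * (\<integral>x. ?h x y \<partial>lborel)" for y
  proof -
    have "(\<integral>x. ?h x y \<partial>lborel) = (\<integral>x. exp (- \<i> * of_real (x \<bullet> y)) * f x \<partial>lborel) * g y"
      by (rule integral_mult_left_zero)
    then show ?thesis by (simp add: fourier_def inner_commute mult.assoc)
  qed
  have 2: "f x * fourier g x = of_real (fourier_const TYPE('a)) * (\<integral>y. ?h x y \<partial>lborel)" for x
  proof -
    have "(\<integral>y. ?h x y \<partial>lborel) = (\<integral>y. f x * (exp (- \<i> * of_real (x \<bullet> y)) * g y) \<partial>lborel)"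
      by (simp add: mult_ac)
    then show ?thesis by (simp add: fourier_def mult_ac)
  qed
  show ?thesis unfolding 1 2 using eq by simp
qed

text \<open>The heat kernel at time \<open>t\<close>. It serves first as approximate identity for
  Fourier inversion, and later as the Gaussian from which the layer kernels are mixed.\<close>

definition heat :: "real \<Rightarrow> 'a::euclidean_space \<Rightarrow> real" where
  "heat t z = (4 * pi * t) powr (- real DIM('a) / 2) * exp (- (norm z)\<^sup>2 / (4 * t))"

text \<open>The multiplication formula against a modulated Gaussian, whose transform is a Gaussian
  centred at \<open>x\<close>; the two normalising constants and the factor from the Gaussian
  integral combine into that of the heat kernel.\<close>

lemma fourier_heat:
  fixes g :: "'a::euclidean_space \<Rightarrow> complex"
  assumes g: "integrable lborel g" and t: "t > 0"
  shows "of_real (fourier_const TYPE('a)) * (\<integral>\<xi>. exp (\<i> * of_real (\<xi> \<bullet> x)) * of_real (exp (- t * (norm \<xi>)\<^sup>2)) * fourier g \<xi> \<partial>lborel)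
    = (\<integral>y. of_real (heat t (x - y)) * g y \<partial>lborel)"
proof -
  have [measurable]: "g \<in> borel_measurable borel" using g by auto
  let ?f = "\<lambda>\<xi>::'a. exp (\<i> * of_real (\<xi> \<bullet> x)) * complex_of_real (exp (- t * (norm \<xi>)\<^sup>2))"
  have f: "integrable lborel ?f" by (rule gaussian_fourier(1)[OF t])
  have "(\<integral>\<xi>. ?f \<xi> * fourier g \<xi> \<partial>lborel) = (\<integral>\<xi>. fourier ?f \<xi> * g \<xi> \<partial>lborel)"
    by (rule fourier_multiplication[OF f g, symmetric])
  moreover have "fourier ?f y = of_real (fourier_const TYPE('a) * ((pi / t) powr (DIM('a) / 2) * exp (- (norm (x - y))\<^sup>2 / (4 * t))))" for y
  proof -
    have "(\<integral>\<xi>. exp (- \<i> * of_real (y \<bullet> \<xi>)) * ?f \<xi> \<partial>lborel) = (\<integral>\<xi>. exp (\<i> * of_real (\<xi> \<bullet> (x - y))) * complex_of_real (exp (- t * (norm \<xi>)\<^sup>2)) \<partial>lborel)"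
      by (rule Bochner_Integration.integral_cong) (auto simp: mult.assoc[symmetric] exp_add[symmetric] inner_diff_right inner_commute algebra_simps simp del: mult.assoc)
    then show ?thesis by (simp only: fourier_def gaussian_fourier(2)[OF t] of_real_mult)
  qed
  moreover have "fourier_const TYPE('a) * (fourier_const TYPE('a) * ((pi / t) powr (DIM('a) / 2) * exp (- (norm z)\<^sup>2 / (4 * t)))) = heat t z" for z :: 'a
  proof -
    have "fourier_const TYPE('a) * fourier_const TYPE('a) = (2 * pi) powr (- real DIM('a) / 2 + - real DIM('a) / 2)"
      by (rule powr_add[symmetric])
    also have "\<dots> = ((2 * pi)\<^sup>2) powr (- real DIM('a) / 2)"
    proof -
      have "((2 * pi) powr 2) powr (- real DIM('a) / 2) = (2 * pi) powr (2 * (- real DIM('a) / 2))" by (rule powr_powr)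
      moreover have "(2 * pi) powr 2 = (2 * pi)\<^sup>2" by (rule powr_numeral) simp
      ultimately show ?thesis by simp
    qed
    finally have 1: "fourier_const TYPE('a) * fourier_const TYPE('a) = ((2 * pi)\<^sup>2) powr (- real DIM('a) / 2)" .
    have "((2 * pi)\<^sup>2) powr (- real DIM('a) / 2) * (pi / t) powr (DIM('a) / 2) = ((2 * pi)\<^sup>2) powr (- real DIM('a) / 2) * (t / pi) powr (- real DIM('a) / 2)"
      using t by (simp add: powr_minus powr_divide field_simps)
    also have "\<dots> = ((2 * pi)\<^sup>2 * (t / pi)) powr (- real DIM('a) / 2)"
      using t by (intro powr_mult[symmetric]; simp)
    also have "(2 * pi)\<^sup>2 * (t / pi) = 4 * pi * t" by (simp add: power2_eq_square)
    finally show ?thesis unfolding heat_def mult.assoc[symmetric] 1 by simp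
  qed
  ultimately show ?thesis
    by (simp add: mult.assoc[symmetric] flip: of_real_mult Bochner_Integration.integral_mult_right_zero)
qed

text \<open>Regularise by a Gaussian and remove it: on one side dominated convergence gives the
  double transform, on the other the heat kernel concentrates at \<open>x\<close>.\<close>

lemma fourier_inversion:
  fixes g :: "'a::euclidean_space \<Rightarrow> complex"
  assumes g: "integrable lborel g" and cont: "continuous_on UNIV g" and bdd: "\<And>x. cmod (g x) \<le> M"
    and fg: "integrable lborel (fourier g)"
  shows "fourier (fourier g) (- x) = g x"
proof (rule LIMSEQ_unique)
  have [measurable]: "g \<in> borel_measurable borel" using g by auto
  \<comment> \<open>With time s^2 / 4 the substitution y = x + s z turns the heat kernel into a
    Gaussian that does not depend on s, so the limit concerns \<open>g\<close> alone.\<close>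
  let ?s = "\<lambda>n. 1 / real (Suc n)"
  let ?G = "\<lambda>n. of_real (fourier_const TYPE('a)) * (\<integral>\<xi>. exp (\<i> * of_real (\<xi> \<bullet> x)) * of_real (exp (- ((?s n)\<^sup>2 / 4) * (norm \<xi>)\<^sup>2)) * fourier g \<xi> \<partial>lborel)"
  have "?G \<longlonglongrightarrow> of_real (fourier_const TYPE('a)) * (\<integral>\<xi>. exp (\<i> * of_real (\<xi> \<bullet> x)) * fourier g \<xi> \<partial>lborel)"
  proof (rule tendsto_mult[OF tendsto_const], rule integral_dominated_convergence[where w = "\<lambda>\<xi>. cmod (fourier g \<xi>)"]; (rule AE_I2)?)
    fix \<xi> :: 'a
    have "(\<lambda>n. - ((?s n)\<^sup>2 / 4) * (norm \<xi>)\<^sup>2) \<longlonglongrightarrow> 0" by real_asymp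
    from tendsto_exp[OF this] have "(\<lambda>n. exp (- ((?s n)\<^sup>2 / 4) * (norm \<xi>)\<^sup>2)) \<longlonglongrightarrow> 1" by simp
    from tendsto_of_real[OF this] have "(\<lambda>n. complex_of_real (exp (- ((?s n)\<^sup>2 / 4) * (norm \<xi>)\<^sup>2))) \<longlonglongrightarrow> 1" by simp
    from tendsto_mult[OF tendsto_mult[OF tendsto_const this] tendsto_const, of "exp (\<i> * of_real (\<xi> \<bullet> x))" "fourier g \<xi>"]
    show "(\<lambda>n. exp (\<i> * of_real (\<xi> \<bullet> x)) * of_real (exp (- ((?s n)\<^sup>2 / 4) * (norm \<xi>)\<^sup>2)) * fourier g \<xi>) \<longlonglongrightarrow> exp (\<i> * of_real (\<xi> \<bullet> x)) * fourier g \<xi>" by simp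
    show "norm (exp (\<i> * of_real (\<xi> \<bullet> x)) * of_real (exp (- ((?s n)\<^sup>2 / 4) * (norm \<xi>)\<^sup>2)) * fourier g \<xi>) \<le> cmod (fourier g \<xi>)" for n
      unfolding norm_mult cmod_exp_i by (auto intro!: mult_left_le_one_le)
  qed (use fg in auto)
  then show "?G \<longlonglongrightarrow> fourier (fourier g) (- x)"
    by (simp add: fourier_def[of "fourier g"] inner_commute)
  let ?k = "\<lambda>z::'a. complex_of_real (pi powr (- real DIM('a) / 2) * exp (- (norm z)\<^sup>2))"
  have ki: "integrable lborel ?k" and kv: "(\<integral>z. ?k z \<partial>lborel) = 1"
  proof -
    have "integrable lborel (\<lambda>z::'a. complex_of_real (pi powr (- real DIM('a) / 2)) * (exp (\<i> * of_real (z \<bullet> 0)) * of_real (exp (- 1 * (norm z)\<^sup>2))))"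
      by (intro Bochner_Integration.integrable_mult_right gaussian_fourier(1)) simp
    then show "integrable lborel ?k" by simp
    have "(\<integral>z. ?k z \<partial>lborel) = of_real (pi powr (- real DIM('a) / 2)) * (\<integral>z. (exp (\<i> * of_real (z \<bullet> (0::'a))) * of_real (exp (- 1 * (norm z)\<^sup>2))) \<partial>lborel)" by simp
    also have "\<dots> = 1" by (subst gaussian_fourier(2)) (auto simp: powr_minus simp flip: of_real_mult)
    finally show "(\<integral>z. ?k z \<partial>lborel) = 1" .
  qed
  have A: "?G = (\<lambda>n. \<integral>z. ?k z * g (x + ?s n *\<^sub>R z) \<partial>lborel)"
  proof
    fix n
    define s where "s = ?s n"
    have s: "s > 0" by (simp add: s_def)
    have "?G n = (\<integral>y. of_real (heat (s\<^sup>2 / 4) (x - y)) * g y \<partial>lborel)"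
      using fourier_heat[OF g, of "s\<^sup>2 / 4" x] s unfolding s_def[symmetric] by simp
    also have "\<dots> = \<bar>s\<bar> ^ DIM('a) *\<^sub>R (\<integral>z. of_real (heat (s\<^sup>2 / 4) (x - (x + s *\<^sub>R z))) * g (x + s *\<^sub>R z) \<partial>lborel)"
    proof (subst lborel_affine_integral(2)[where f = "\<lambda>y. of_real (heat (s\<^sup>2 / 4) (x - y)) * g y"])
      show "integrable lborel (\<lambda>y. complex_of_real (heat (s\<^sup>2 / 4) (x - y)) * g y)"
      proof (rule Bochner_Integration.integrable_bound)
        show "integrable lborel (\<lambda>y. complex_of_real ((4 * pi * (s\<^sup>2/4)) powr (- real DIM('a) / 2)) * g y)" using g by simp
      qed (use s in \<open>auto simp: heat_def norm_mult abs_mult intro!: AE_I2 mult_right_mono mult_left_le mult_left_le_one_le\<close>)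
    qed (use s in auto)
    also have "\<dots> = (\<integral>z. s ^ DIM('a) *\<^sub>R (of_real (heat (s\<^sup>2 / 4) (s *\<^sub>R z)) * g (x + s *\<^sub>R z)) \<partial>lborel)"
    proof -
      have "heat (s\<^sup>2 / 4) (x - (x + s *\<^sub>R z)) = heat (s\<^sup>2 / 4) (s *\<^sub>R z)" for z :: 'a by (simp add: heat_def)
      then show ?thesis using s by simp
    qed
    also have "\<dots> = (\<integral>z. ?k z * g (x + s *\<^sub>R z) \<partial>lborel)"
    proof (rule Bochner_Integration.integral_cong[OF refl])
      fix z :: 'a
      have "(4 * pi * (s\<^sup>2 / 4)) powr (- real DIM('a) / 2) = pi powr (- real DIM('a) / 2) * (s\<^sup>2) powr (- real DIM('a) / 2)"
        by (simp add: powr_mult)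
      also have "(s\<^sup>2) powr (- real DIM('a) / 2) = s powr (2 * (- real DIM('a) / 2))"
        using s by (simp add: powr_powr flip: powr_numeral)
      also have "\<dots> = inverse (s ^ DIM('a))" using s by (simp add: powr_minus powr_realpow)
      finally have "s ^ DIM('a) * heat (s\<^sup>2 / 4) (s *\<^sub>R z) = pi powr (- real DIM('a) / 2) * exp (- (norm z)\<^sup>2)"
        using s by (simp add: heat_def power_mult_distrib)
      then show "s ^ DIM('a) *\<^sub>R (of_real (heat (s\<^sup>2 / 4) (s *\<^sub>R z)) * g (x + s *\<^sub>R z)) = ?k z * g (x + s *\<^sub>R z)"
        by (simp add: scaleR_conv_of_real mult.assoc[symmetric] flip: of_real_mult of_real_power)
    qed
    finally show "?G n = (\<integral>z. ?k z * g (x + ?s n *\<^sub>R z) \<partial>lborel)" by (simp add: s_def)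
  qed
  have B: "(\<lambda>n. \<integral>z. ?k z * g (x + ?s n *\<^sub>R z) \<partial>lborel) \<longlonglongrightarrow> (\<integral>z. ?k z * g x \<partial>lborel)"
  proof (rule integral_dominated_convergence[where w = "\<lambda>z. cmod (?k z) * M"])
    show "integrable lborel (\<lambda>z::'a. cmod (?k z) * M)" using ki by (intro integrable_mult_left integrable_norm)
    show "AE z in lborel. (\<lambda>n. ?k z * g (x + ?s n *\<^sub>R z)) \<longlonglongrightarrow> ?k z * g x"
    proof (intro AE_I2 tendsto_intros)
      fix z :: 'a
      have "(\<lambda>n. x + ?s n *\<^sub>R z) \<longlonglongrightarrow> x + 0 *\<^sub>R z"
        by (intro tendsto_intros) real_asymp
      then show "(\<lambda>n. g (x + ?s n *\<^sub>R z)) \<longlonglongrightarrow> g x"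
        using cont by (intro continuous_on_tendsto_compose[OF cont]) auto
    qed
    show "AE z in lborel. norm (?k z * g (x + ?s n *\<^sub>R z)) \<le> cmod (?k z) * M" for n
      by (intro AE_I2) (simp only: norm_mult, intro mult_left_mono bdd norm_ge_zero)
  qed auto
  have C: "(\<integral>z. ?k z * g x \<partial>lborel) = g x"
    using kv by (subst integral_mult_left_zero) (simp only: mult_1_left)
  show "?G \<longlonglongrightarrow> g x" unfolding A using B unfolding C .
qed

lemma fourier_inversion_test:
  assumes "g \<in> test_functions \<Omega>"
  shows "fourier (fourier g) (- x) = g x"
proof -
  obtain M where M: "\<And>x. cmod (g x) \<le> M" by (rule test_functions_bounded[OF assms], rule that)
  have "smooth g" by (rule test_functionsE[OF assms])
  then show ?thesis
    by (intro fourier_inversion[OF _ _ M] test_functions_integrable[OF assms] smooth_continuous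
        schwartz_integrable fourier_test_schwartz[OF assms])
qed

lemma fourier_test_integrable: "g \<in> test_functions \<Omega> \<Longrightarrow> integrable lborel (fourier g)"
  by (intro schwartz_integrable fourier_test_schwartz)

lemma fourier_inversion_test':
  assumes "g \<in> test_functions \<Omega>"
  shows "fourier (\<lambda>\<xi>. fourier g (- \<xi>)) x = g x"
  using fourier_reflect[OF fourier_test_integrable[OF assms]] fourier_inversion_test[OF assms] by simp

text \<open>The conjugated transform of \<open>h\<close> is the reflected transform of its
  conjugate; the multiplication formula moves it across, where inversion undoes it.\<close>

lemma plancherel_test:
  fixes g h :: "'a::euclidean_space \<Rightarrow> complex"
  assumes g: "g \<in> test_functions \<Omega>" and h: "h \<in> test_functions \<Omega>'"
  shows "(\<integral>\<xi>. fourier g \<xi> * cnj (fourier h \<xi>) \<partial>lborel) = (\<integral>x. g x * cnj (h x) \<partial>lborel)"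
proof -
  have "cnj (fourier h \<xi>) = fourier (\<lambda>x. cnj (h x)) (- \<xi>)" for \<xi> by (simp add: fourier_cnj)
  then have "(\<integral>\<xi>. fourier g \<xi> * cnj (fourier h \<xi>) \<partial>lborel) = (\<integral>\<xi>. fourier g \<xi> * fourier (\<lambda>x. cnj (h x)) (- \<xi>) \<partial>lborel)"
    by simp
  also have "\<dots> = (\<integral>x. g x * fourier (\<lambda>\<xi>. fourier (\<lambda>x. cnj (h x)) (- \<xi>)) x \<partial>lborel)"
    using lborel_affine_integral(1)[of "-1" "fourier (\<lambda>x. cnj (h x))" 0]
    by (intro fourier_multiplication test_functions_integrable[OF g])
      (simp add: fourier_test_integrable[OF test_functions_cnj[OF h]])
  also have "\<dots> = (\<integral>x. g x * cnj (h x) \<partial>lborel)"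
    by (simp add: fourier_inversion_test'[OF test_functions_cnj[OF h]])
  finally show ?thesis .
qed

section \<open>Fourier transforms of distributions\<close>

lemma locally_integrable_measurable:
  assumes "locally_integrable g" shows "g \<in> borel_measurable borel"
proof (rule borel_measurable_LIMSEQ_metric)
  show "(\<lambda>x. indicator (cball 0 (real n)) x *\<^sub>R g x) \<in> borel_measurable borel" for n
    using assms unfolding locally_integrable_def set_integrable_def
    by (auto dest: spec[of _ "cball 0 (real n)"] borel_measurable_integrable)
  show "(\<lambda>n. indicator (cball 0 (real n)) x *\<^sub>R g x) \<longlonglongrightarrow> g x" for x
  proof (rule tendsto_eventually)
    obtain n0 :: nat where n0: "norm x \<le> real n0" using real_arch_simple by blast
    show "\<forall>\<^sub>F n in sequentially. indicator (cball 0 (real n)) x *\<^sub>R g x = g x"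
      using eventually_ge_at_top[of n0]
    proof eventually_elim
      case (elim n)
      then have "norm x \<le> real n" using n0 by (meson of_nat_mono order_trans)
      then show ?case by simp
    qed
  qed
qed

lemma locally_integrable_linear:
  assumes "locally_integrable g" "locally_integrable h"
  shows "locally_integrable (\<lambda>x. a * g x + b * h x)"
  using assms unfolding locally_integrable_def
  by (auto intro!: set_integral_add set_integrable_mult_right)

lemma integrable_locally_integrable_mult:
  assumes g: "locally_integrable g" and f: "f \<in> test_functions \<Omega>"
  shows "integrable lborel (\<lambda>x. g x * f x)"
proof -
  obtain R where R: "R > 0" "\<And>x. norm x > R \<Longrightarrow> f x = 0" by (rule test_functions_support[OF f], rule that)
  obtain M where M: "\<And>x. cmod (f x) \<le> M" by (rule test_functions_bounded[OF f], rule that)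
  have [measurable]: "g \<in> borel_measurable borel" "f \<in> borel_measurable borel"
    using locally_integrable_measurable[OF g] test_functions_integrable[OF f] by auto
  have "integrable lborel (\<lambda>x. indicator (cball 0 R) x *\<^sub>R g x)"
    using g compact_cball unfolding locally_integrable_def set_integrable_def by blast
  from integrable_mult_right[OF this, of "of_real M"]
  show ?thesis
  proof (rule Bochner_Integration.integrable_bound)
    have "cmod (g x * f x) \<le> cmod (of_real M * (indicator (cball 0 R) x *\<^sub>R g x))" for x
    proof (cases "norm x > R")
      case False
      then have "cmod (g x * f x) \<le> cmod (g x) * \<bar>M\<bar>"
        unfolding norm_mult using M[of x] by (intro mult_left_mono) auto
      then show ?thesis using False by (simp add: norm_mult mult.commute)
    qed (simp add: R)
    then show "AE x in lborel. cmod (g x * f x) \<le> cmod (of_real M * (indicator (cball 0 R) x *\<^sub>R g x))" by auto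
  qed auto
qed

text \<open>The positive and the negative part of \<open>r\<close> are densities of two measures
  that agree on boxes. Boxes are stable under intersection and generate the Borel sets, so the
  measures coincide, and then so do the densities.\<close>

lemma AE_zero_if_box_integrals_zero:
  fixes r :: "'a::euclidean_space \<Rightarrow> real"
  assumes int: "\<And>a b. integrable lborel (\<lambda>x. indicator (box a b) x * r x)"
    and zero: "\<And>a b. (\<integral>x. indicator (box a b) x * r x \<partial>lborel) = 0"
    and [measurable]: "r \<in> borel_measurable borel"
  shows "AE x in lborel. r x = 0"
proof -
  \<comment> \<open>\<open>ennreal\<close> truncates at 0, so these measures have the positive and
    the negative part of \<open>r\<close> as densities.\<close>
  let ?M = "density lborel (\<lambda>x. ennreal (r x))" and ?N = "density lborel (\<lambda>x. ennreal (- r x))"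
  have p: "emeasure ?M (box a b) = ennreal (\<integral>x. max 0 (indicator (box a b) x * r x) \<partial>lborel)" for a b
  proof -
    have "emeasure ?M (box a b) = (\<integral>\<^sup>+x. ennreal (max 0 (indicator (box a b) x * r x)) \<partial>lborel)"
      by (subst emeasure_density) (auto intro!: nn_integral_cong simp: indicator_def ennreal_neg max_def)
    then show ?thesis using int by (subst (asm) nn_integral_eq_integral) auto
  qed
  have q: "emeasure ?N (box a b) = ennreal (\<integral>x. max 0 (- (indicator (box a b) x * r x)) \<partial>lborel)" for a b
  proof -
    have "emeasure ?N (box a b) = (\<integral>\<^sup>+x. ennreal (max 0 (- (indicator (box a b) x * r x))) \<partial>lborel)"
      by (subst emeasure_density) (auto intro!: nn_integral_cong simp: indicator_def ennreal_neg max_def)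
    then show ?thesis using int by (subst (asm) nn_integral_eq_integral) auto
  qed
  have eq: "emeasure ?M (box a b) = emeasure ?N (box a b)" for a b
  proof -
    have "(\<integral>x. max 0 (indicator (box a b) x * r x) \<partial>lborel) - (\<integral>x. max 0 (- (indicator (box a b) x * r x)) \<partial>lborel)
      = (\<integral>x. max 0 (indicator (box a b) x * r x) - max 0 (- (indicator (box a b) x * r x)) \<partial>lborel)"
      using int[of a b] by (subst Bochner_Integration.integral_diff) auto
    also have "\<dots> = (\<integral>x. indicator (box a b) x * r x \<partial>lborel)"
      by (rule Bochner_Integration.integral_cong) auto
    finally show ?thesis unfolding p q using zero by simp
  qed
  have "?M = ?N"
  proof (rule measure_eqI_generator_eq)
    let ?E = "range (\<lambda>(a, b). box a b::'a set)"
    show "Int_stable ?E" by (auto simp: Int_stable_def box_Int_box)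
    show "?E \<subseteq> Pow UNIV" "sets ?M = sigma_sets UNIV ?E" "sets ?N = sigma_sets UNIV ?E"
      by (simp_all add: borel_eq_box)
    let ?A = "\<lambda>n::nat. box (- (real n *\<^sub>R One)) (real n *\<^sub>R One) :: 'a set"
    show "range ?A \<subseteq> ?E" "(\<Union>i. ?A i) = UNIV" unfolding UN_box_eq_UNIV by auto
    show "emeasure ?M (?A i) \<noteq> \<infinity>" for i unfolding p by simp
    show "emeasure ?M X = emeasure ?N X" if "X \<in> ?E" for X using that eq by auto
  qed
  then have "AE x in lborel. ennreal (r x) = ennreal (- r x)"
    by (subst (asm) sigma_finite_measure.density_unique_iff[OF lborel.sigma_finite_measure_axioms]) auto
  then show ?thesis
    proof eventually_elim
    case (elim x)
    then show ?case by (cases "r x \<ge> 0") (auto simp: ennreal_neg)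
  qed
qed

text \<open>Smoothed indicators of boxes are test functions dominated by the indicator of the closed
  box, so vanishing test integrals pass to vanishing box integrals.\<close>

lemma AE_zero_if_test_integrals_zero:
  fixes d :: "'a::euclidean_space \<Rightarrow> complex"
  assumes d: "locally_integrable d"
    and zero: "\<And>f. f \<in> test_functions UNIV \<Longrightarrow> (\<integral>x. d x * f x \<partial>lborel) = 0"
  shows "AE x in lborel. d x = 0"
proof -
  have [measurable]: "d \<in> borel_measurable borel" using locally_integrable_measurable[OF d] .
  have int: "integrable lborel (\<lambda>x. indicator (cbox a b) x *\<^sub>R d x)" for a b
    using d compact_cbox unfolding locally_integrable_def set_integrable_def by blast
  have box_int: "integrable lborel (\<lambda>x. indicator (box a b) x *\<^sub>R d x)" for a b
    by (rule Bochner_Integration.integrable_bound[OF int[of a b]]) (auto simp: indicator_def intro!: AE_I2 subsetD[OF box_subset_cbox])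
  have z: "(\<integral>x. indicator (box a b) x *\<^sub>R d x \<partial>lborel) = 0" for a b
  proof (rule LIMSEQ_unique)
    show "(\<lambda>n. \<integral>x. d x * of_real (box_bump a b (real (Suc n)) x) \<partial>lborel) \<longlonglongrightarrow> (\<integral>x. indicator (box a b) x *\<^sub>R d x \<partial>lborel)"
    proof (rule integral_dominated_convergence[where w = "\<lambda>x. cmod (indicator (cbox a b) x *\<^sub>R d x)"])
      show "integrable lborel (\<lambda>x. cmod (indicator (cbox a b) x *\<^sub>R d x))" by (rule integrable_norm[OF int])
      show "(\<lambda>x. d x * of_real (box_bump a b (real (Suc n)) x)) \<in> borel_measurable lborel" for n
        using smooth_measurable[OF smooth_box_bump[of a b "real (Suc n)"]] by measurable
      show "AE x in lborel. (\<lambda>n. d x * of_real (box_bump a b (real (Suc n)) x)) \<longlonglongrightarrow> indicator (box a b) x *\<^sub>R d x"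
      proof (rule AE_I2)
        fix x
        show "(\<lambda>n. d x * of_real (box_bump a b (real (Suc n)) x)) \<longlonglongrightarrow> indicator (box a b) x *\<^sub>R d x"
          using tendsto_mult[OF tendsto_const tendsto_of_real[OF box_bump_tendsto[of a b x]], of "d x"]
          by (simp add: scaleR_conv_of_real mult.commute)
      qed
      show "AE x in lborel. norm (d x * of_real (box_bump a b (real (Suc n)) x)) \<le> cmod (indicator (cbox a b) x *\<^sub>R d x)" for n
      proof (rule AE_I2)
        fix x
        show "norm (d x * of_real (box_bump a b (real (Suc n)) x)) \<le> cmod (indicator (cbox a b) x *\<^sub>R d x)"
        proof (cases "x \<in> box a b")
          case True
          then have "x \<in> cbox a b" using box_subset_cbox by blast
          then show ?thesis using box_bump_bounds[of a b "real (Suc n)" x] by (simp add: norm_mult mult_left_le)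
        qed (simp add: box_bump_zero)
      qed
    qed auto
    show "(\<lambda>n. \<integral>x. d x * of_real (box_bump a b (real (Suc n)) x) \<partial>lborel) \<longlonglongrightarrow> 0"
      by (simp add: zero[OF box_bump_test])
  qed
  have "AE x in lborel. Re (d x) = 0"
  proof (rule AE_zero_if_box_integrals_zero)
    show "integrable lborel (\<lambda>x. indicator (box a b) x * Re (d x))" for a b
      using integrable_Re[OF box_int[of a b]] by simp
    show "(\<integral>x. indicator (box a b) x * Re (d x) \<partial>lborel) = 0" for a b
      using integral_Re[OF box_int[of a b]] z[of a b] by simp
  qed auto
  moreover have "AE x in lborel. Im (d x) = 0"
  proof (rule AE_zero_if_box_integrals_zero)
    show "integrable lborel (\<lambda>x. indicator (box a b) x * Im (d x))" for a b
      using integrable_Im[OF box_int[of a b]] by simp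
    show "(\<integral>x. indicator (box a b) x * Im (d x) \<partial>lborel) = 0" for a b
      using integral_Im[OF box_int[of a b]] z[of a b] by simp
  qed auto
  ultimately show ?thesis by eventually_elim (simp add: complex_eq_iff)
qed

section \<open>Transforms of distributions as functions\<close>

lemma is_fourier_funD:
  assumes "is_fourier_fun u g"
  shows "locally_integrable g" "g \<in> borel_measurable borel"
    and "\<And>f. f \<in> test_functions UNIV \<Longrightarrow> u (fourier f) = (\<integral>\<xi>. g \<xi> * f \<xi> \<partial>lborel)"
proof -
  show *: "locally_integrable g" using assms unfolding is_fourier_fun_def by blast
  show "g \<in> borel_measurable borel" by (rule locally_integrable_measurable[OF *])
  show "u (fourier f) = (\<integral>\<xi>. g \<xi> * f \<xi> \<partial>lborel)" if "f \<in> test_functions UNIV" for f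
  proof -
    have "fourier_distr u f = (\<integral>\<xi>. g \<xi> * f \<xi> \<partial>lborel)" using assms that unfolding is_fourier_fun_def by blast
    then show ?thesis by (simp add: fourier_distr_def test_functions_schwartz[OF that])
  qed
qed

lemma is_fourier_funI:
  assumes "locally_integrable g" "\<And>f. f \<in> test_functions UNIV \<Longrightarrow> u (fourier f) = (\<integral>\<xi>. g \<xi> * f \<xi> \<partial>lborel)"
  shows "is_fourier_fun u g"
  unfolding is_fourier_fun_def fourier_distr_def using assms by (simp add: test_functions_schwartz)

lemma is_fourier_fun_linear:
  assumes u: "is_fourier_fun u g" and v: "is_fourier_fun v h"
  shows "is_fourier_fun (\<lambda>f. a * u f + b * v f) (\<lambda>\<xi>. a * g \<xi> + b * h \<xi>)"
proof (rule is_fourier_funI)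
  show "locally_integrable (\<lambda>\<xi>. a * g \<xi> + b * h \<xi>)"
    by (intro locally_integrable_linear is_fourier_funD(1)[OF u] is_fourier_funD(1)[OF v])
  fix f :: "'a \<Rightarrow> complex" assume f: "f \<in> test_functions UNIV"
  note i = integrable_locally_integrable_mult[OF is_fourier_funD(1)[OF u] f]
    integrable_locally_integrable_mult[OF is_fourier_funD(1)[OF v] f]
  have "(\<integral>\<xi>. (a * g \<xi> + b * h \<xi>) * f \<xi> \<partial>lborel) = (\<integral>\<xi>. a * (g \<xi> * f \<xi>) + b * (h \<xi> * f \<xi>) \<partial>lborel)"
    by (simp add: algebra_simps)
  also have "\<dots> = a * (\<integral>\<xi>. g \<xi> * f \<xi> \<partial>lborel) + b * (\<integral>\<xi>. h \<xi> * f \<xi> \<partial>lborel)"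
    using i by simp
  finally show "a * u (fourier f) + b * v (fourier f) = (\<integral>\<xi>. (a * g \<xi> + b * h \<xi>) * f \<xi> \<partial>lborel)"
    using is_fourier_funD(3)[OF u f] is_fourier_funD(3)[OF v f] by simp
qed

text \<open>The zero functional \<open>u - u\<close> has \<open>g - h\<close> as a transform, and a
  locally integrable function with vanishing test integrals is zero almost everywhere.\<close>

lemma is_fourier_fun_unique:
  assumes u: "is_fourier_fun u g" and v: "is_fourier_fun u h"
  shows "AE \<xi> in lborel. g \<xi> = h \<xi>"
proof -
  have d: "is_fourier_fun (\<lambda>f. 1 * u f + -1 * u f) (\<lambda>\<xi>. 1 * g \<xi> + -1 * h \<xi>)"
    by (rule is_fourier_fun_linear[OF u v])
  have "AE \<xi> in lborel. 1 * g \<xi> + -1 * h \<xi> = 0"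
    by (rule AE_zero_if_test_integrals_zero[OF is_fourier_funD(1)[OF d]])
      (use is_fourier_funD(3)[OF d] in simp)
  then show ?thesis by eventually_elim simp
qed

text \<open>Resolves the choice in \<open>fourier_fun\<close>: inside integrals the chosen function
  may be exchanged with any explicit transform.\<close>

lemma is_fourier_fun_fourier_fun:
  assumes "is_fourier_fun u g"
  shows "is_fourier_fun u (fourier_fun u)" "AE \<xi> in lborel. fourier_fun u \<xi> = g \<xi>"
proof -
  show *: "is_fourier_fun u (fourier_fun u)"
    unfolding fourier_fun_def using assms by (rule someI[of "is_fourier_fun u"])
  show "AE \<xi> in lborel. fourier_fun u \<xi> = g \<xi>"
    by (rule is_fourier_fun_unique[OF * assms])
qed

lemma continuous_locally_integrable:
  assumes "continuous_on UNIV g"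
  shows "locally_integrable g"
  unfolding locally_integrable_def set_integrable_def
  by (intro allI impI borel_integrable_compact continuous_on_subset[OF assms]) auto

lemma is_fourier_fun_test:
  assumes \<phi>: "\<phi> \<in> test_functions \<Omega>"
  shows "is_fourier_fun (tempered_of_fun \<phi>) (fourier \<phi>)"
proof (rule is_fourier_funI)
  show "locally_integrable (fourier \<phi>)"
    by (intro continuous_locally_integrable smooth_continuous fourier_test_smooth[OF \<phi>])
  fix f :: "'a \<Rightarrow> complex" assume f: "f \<in> test_functions UNIV"
  show "tempered_of_fun \<phi> (fourier f) = (\<integral>\<xi>. fourier \<phi> \<xi> * f \<xi> \<partial>lborel)"
    using fourier_test_schwartz[OF f] fourier_multiplication[OF test_functions_integrable[OF \<phi>] test_functions_integrable[OF f]]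
    by (simp add: tempered_of_fun_def)
qed

section \<open>Linear structure and seminorm bounds of tempered distributions\<close>

lemma schwartz_linear:
  assumes f: "f \<in> schwartz" and g: "g \<in> schwartz"
  shows "(\<lambda>x. a * f x + b * g x) \<in> schwartz"
    and "set bs \<subseteq> Basis \<Longrightarrow> iter_deriv bs (\<lambda>x. a * f x + b * g x) x = a * iter_deriv bs f x + b * iter_deriv bs g x"
proof -
  have *: "iter_deriv bs (\<lambda>x. a * f x + b * g x) = (\<lambda>x. a * iter_deriv bs f x + b * iter_deriv bs g x)" if "set bs \<subseteq> Basis" for bs
    using that
  proof (induction bs)
    case (Cons c bs)
    then have 1: "iter_deriv bs f \<in> schwartz" "iter_deriv bs g \<in> schwartz"
      using f g by (auto intro: schwartz_iter_deriv)
    have "frechet_derivative (\<lambda>x. a * iter_deriv bs f x + b * iter_deriv bs g x) (at x) =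
      (\<lambda>v. a * frechet_derivative (iter_deriv bs f) (at x) v + b * frechet_derivative (iter_deriv bs g) (at x) v)" for x
      using smooth_differentiable[OF schwartz_smooth[OF 1(1)], of x] smooth_differentiable[OF schwartz_smooth[OF 1(2)], of x]
      by (intro has_derivative_frechet has_derivative_add has_derivative_mult_right) (simp_all add: frechet_derivative_works)
    with Cons show ?case by simp
  qed simp
  show "iter_deriv bs (\<lambda>x. a * f x + b * g x) x = a * iter_deriv bs f x + b * iter_deriv bs g x" if "set bs \<subseteq> Basis"
    using *[OF that] by simp
  show "(\<lambda>x. a * f x + b * g x) \<in> schwartz"
    unfolding schwartz_def
  proof (intro CollectI conjI allI impI)
    show "smooth (\<lambda>x. a * f x + b * g x)"
      by (intro smooth_add smooth_mult smooth_const schwartz_smooth f g)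
    fix N :: nat and bs :: "'a list" assume bs: "set bs \<subseteq> Basis"
    obtain M1 where M1: "\<And>x. (1 + norm x) ^ N * cmod (iter_deriv bs f x) \<le> M1"
      by (rule schwartz_bound[OF schwartz_iter_deriv[OF f bs]], rule that)
    obtain M2 where M2: "\<And>x. (1 + norm x) ^ N * cmod (iter_deriv bs g x) \<le> M2"
      by (rule schwartz_bound[OF schwartz_iter_deriv[OF g bs]], rule that)
    have "(1 + norm x) ^ N * cmod (iter_deriv bs (\<lambda>x. a * f x + b * g x) x) \<le> cmod a * M1 + cmod b * M2" for x
    proof -
      have "(1 + norm x) ^ N * cmod (iter_deriv bs (\<lambda>x. a * f x + b * g x) x)
        \<le> (1 + norm x) ^ N * (cmod a * cmod (iter_deriv bs f x) + cmod b * cmod (iter_deriv bs g x))"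
        unfolding *[OF bs] by (intro mult_left_mono order_trans[OF norm_triangle_ineq]) (auto simp: norm_mult)
      also have "\<dots> = cmod a * ((1 + norm x) ^ N * cmod (iter_deriv bs f x)) + cmod b * ((1 + norm x) ^ N * cmod (iter_deriv bs g x))"
        by (simp add: algebra_simps)
      also have "\<dots> \<le> cmod a * M1 + cmod b * M2" by (intro add_mono mult_left_mono M1 M2) auto
      finally show ?thesis .
    qed
    then show "\<exists>M. \<forall>x. (1 + norm x) ^ N * cmod (iter_deriv bs (\<lambda>x. a * f x + b * g x) x) \<le> M" by blast
  qed
qed

lemma temperedD_linear:
  assumes "u \<in> tempered" "f \<in> schwartz" "g \<in> schwartz"
  shows "u (\<lambda>x. a * f x + b * g x) = a * u f + b * u g"
  using assms unfolding tempered_def by blast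

text \<open>Names the premise of the continuity clause of \<open>tempered\<close>: one bound for all
  seminorms up to level \<open>N\<close>.\<close>

definition seminorm_le :: "nat \<Rightarrow> ('a::euclidean_space \<Rightarrow> complex) \<Rightarrow> real \<Rightarrow> bool" where
  "seminorm_le N f M \<longleftrightarrow> (\<forall>bs x. set bs \<subseteq> Basis \<and> length bs \<le> N \<longrightarrow>
     (1 + norm x) ^ N * cmod (iter_deriv bs f x) \<le> M)"

lemma seminorm_leD:
  "seminorm_le N f M \<Longrightarrow> set bs \<subseteq> Basis \<Longrightarrow> length bs \<le> N \<Longrightarrow> (1 + norm x) ^ N * cmod (iter_deriv bs f x) \<le> M"
  unfolding seminorm_le_def by blast

lemma seminorm_le_nonneg: "seminorm_le N f M \<Longrightarrow> 0 \<le> M"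
  using order_trans[OF _ seminorm_leD[of N f M "[]" 0]] by simp

lemma seminorm_le_mono:
  assumes "seminorm_le L f M" "N \<le> L" shows "seminorm_le N f M"
  unfolding seminorm_le_def
proof (intro allI impI; elim conjE)
  fix bs :: "'a list" and x :: 'a assume bs: "set bs \<subseteq> Basis" "length bs \<le> N"
  have "(1 + norm x) ^ N * cmod (iter_deriv bs f x) \<le> (1 + norm x) ^ L * cmod (iter_deriv bs f x)"
    using assms(2) by (intro mult_right_mono power_increasing) auto
  also have "\<dots> \<le> M" using bs assms(2) by (intro seminorm_leD[OF assms(1)]) auto
  finally show "(1 + norm x) ^ N * cmod (iter_deriv bs f x) \<le> M" .
qed

lemma tempered_iff:
  "u \<in> tempered \<longleftrightarrow> (\<forall>f. f \<notin> schwartz \<longrightarrow> u f = 0) \<and>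
     (\<forall>f\<in>schwartz. \<forall>g\<in>schwartz. \<forall>a b. u (\<lambda>x. a * f x + b * g x) = a * u f + b * u g) \<and>
     (\<exists>C N. \<forall>f\<in>schwartz. \<forall>M. seminorm_le N f M \<longrightarrow> cmod (u f) \<le> C * M)"
  unfolding tempered_def seminorm_le_def by (rule mem_Collect_eq)

lemma temperedD_bound:
  assumes "u \<in> tempered"
  obtains C N where "C \<ge> 0" "\<forall>f\<in>schwartz. \<forall>M. seminorm_le N f M \<longrightarrow> cmod (u f) \<le> C * M"
proof -
  obtain C N where CN: "\<forall>f\<in>schwartz. \<forall>M. seminorm_le N f M \<longrightarrow> cmod (u f) \<le> C * M"
    using assms unfolding tempered_iff by blast
  show ?thesis
  proof (rule that[of "\<bar>C\<bar>" N]; (intro ballI allI impI)?)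
    fix f :: "'a \<Rightarrow> complex" and M assume f: "f \<in> schwartz" and M: "seminorm_le N f M"
    have "cmod (u f) \<le> C * M" using CN f M by blast
    also have "\<dots> \<le> \<bar>C\<bar> * M" using seminorm_le_nonneg[OF M] by (intro mult_right_mono) auto
    finally show "cmod (u f) \<le> \<bar>C\<bar> * M" .
  qed simp
qed

lemma temperedI:
  assumes "\<And>f. f \<notin> schwartz \<Longrightarrow> u f = 0"
    and "\<And>f g a b. f \<in> schwartz \<Longrightarrow> g \<in> schwartz \<Longrightarrow> u (\<lambda>x. a * f x + b * g x) = a * u f + b * u g"
    and "\<And>f M. f \<in> schwartz \<Longrightarrow> seminorm_le N f M \<Longrightarrow> cmod (u f) \<le> C * M"
  shows "u \<in> tempered"
  unfolding tempered_iff
  using assms by (intro conjI ballI allI impI exI[of _ C] exI[of _ N])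

lemma tempered_linear:
  assumes u: "u \<in> tempered" and v: "v \<in> tempered"
  shows "(\<lambda>f. a * u f + b * v f) \<in> tempered"
proof -
  obtain C N where C: "C \<ge> 0" "\<forall>f\<in>schwartz. \<forall>M. seminorm_le N f M \<longrightarrow> cmod (u f) \<le> C * M"
    by (rule temperedD_bound[OF u], rule that)
  obtain D L where D: "D \<ge> 0" "\<forall>f\<in>schwartz. \<forall>M. seminorm_le L f M \<longrightarrow> cmod (v f) \<le> D * M"
    by (rule temperedD_bound[OF v], rule that)
  show ?thesis
  proof (rule temperedI[where C = "cmod a * C + cmod b * D" and N = "max N L"])
    show "a * u f + b * v f = 0" if "f \<notin> schwartz" for f
      using u v that unfolding tempered_def by simp
    show "a * u (\<lambda>x. c * f x + d * g x) + b * v (\<lambda>x. c * f x + d * g x) = c * (a * u f + b * v f) + d * (a * u g + b * v g)"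
      if "f \<in> schwartz" "g \<in> schwartz" for f g c d
      using temperedD_linear[OF u that] temperedD_linear[OF v that] by (simp add: algebra_simps)
    fix f :: "'a \<Rightarrow> complex" and M assume f: "f \<in> schwartz" and M: "seminorm_le (max N L) f M"
    have "cmod (a * u f + b * v f) \<le> cmod a * cmod (u f) + cmod b * cmod (v f)"
      by (rule order_trans[OF norm_triangle_ineq]) (simp add: norm_mult)
    also have "\<dots> \<le> cmod a * (C * M) + cmod b * (D * M)"
      using C(2) D(2) f seminorm_le_mono[OF M] by (intro add_mono mult_left_mono) auto
    finally show "cmod (a * u f + b * v f) \<le> (cmod a * C + cmod b * D) * M" by (simp add: algebra_simps)
  qed
qed

lemma tempered_of_fun_tempered:
  fixes \<phi> :: "'a::euclidean_space \<Rightarrow> complex"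
  assumes \<phi>: "\<phi> \<in> test_functions \<Omega>"
  shows "tempered_of_fun \<phi> \<in> tempered"
proof (rule temperedI[where C = "\<integral>x. cmod (\<phi> x) \<partial>lborel" and N = 0])
  have int: "integrable lborel (\<lambda>x. \<phi> x * f x)" and bd: "cmod (\<integral>x. \<phi> x * f x \<partial>lborel) \<le> (\<integral>x. cmod (\<phi> x) \<partial>lborel) * M"
    if f: "f \<in> schwartz" and M: "\<And>x. cmod (f x) \<le> M" for f M
  proof -
    have [measurable]: "f \<in> borel_measurable borel" "\<phi> \<in> borel_measurable borel"
      using schwartz_measurable[OF f] test_functions_integrable[OF \<phi>] by auto
    have le: "cmod (\<phi> x * f x) \<le> cmod (\<phi> x) * M" for x
      unfolding norm_mult using M[of x] by (intro mult_left_mono) auto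
    have i: "integrable lborel (\<lambda>x. cmod (\<phi> x) * M)" using test_functions_integrable[OF \<phi>] by simp
    show 1: "integrable lborel (\<lambda>x. \<phi> x * f x)"
      by (rule Bochner_Integration.integrable_bound[OF i]) (auto intro!: AE_I2 order_trans[OF le])
    have "cmod (\<integral>x. \<phi> x * f x \<partial>lborel) \<le> (\<integral>x. cmod (\<phi> x * f x) \<partial>lborel)" by simp
    also have "\<dots> \<le> (\<integral>x. cmod (\<phi> x) * M \<partial>lborel)"
      by (rule Bochner_Integration.integral_mono) (use 1 i le in auto)
    finally show "cmod (\<integral>x. \<phi> x * f x \<partial>lborel) \<le> (\<integral>x. cmod (\<phi> x) \<partial>lborel) * M" by simp
  qed
  have int': "integrable lborel (\<lambda>x. \<phi> x * f x)" if f: "f \<in> schwartz" for f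
  proof -
    obtain M where "\<And>x. (1 + norm x) ^ 0 * cmod (f x) \<le> M" by (rule schwartz_bound[OF f], rule that)
    then show ?thesis by (intro int[OF f, of M]) simp
  qed
  show "tempered_of_fun \<phi> f = 0" if "f \<notin> schwartz" for f using that by (simp add: tempered_of_fun_def)
  show "tempered_of_fun \<phi> (\<lambda>x. a * f x + b * g x) = a * tempered_of_fun \<phi> f + b * tempered_of_fun \<phi> g"
    if "f \<in> schwartz" "g \<in> schwartz" for f g a b
  proof -
    have "(\<integral>x. \<phi> x * (a * f x + b * g x) \<partial>lborel) = (\<integral>x. a * (\<phi> x * f x) + b * (\<phi> x * g x) \<partial>lborel)"
      by (simp add: algebra_simps)
    also have "\<dots> = a * (\<integral>x. \<phi> x * f x \<partial>lborel) + b * (\<integral>x. \<phi> x * g x \<partial>lborel)"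
      using int'[OF that(1)] int'[OF that(2)] by simp
    finally show ?thesis using that schwartz_linear(1)[OF that] by (simp add: tempered_of_fun_def)
  qed
  show "cmod (tempered_of_fun \<phi> f) \<le> (\<integral>x. cmod (\<phi> x) \<partial>lborel) * M"
    if f: "f \<in> schwartz" and M: "seminorm_le 0 f M" for f M
    using bd[OF f, of M] seminorm_leD[OF M, of "[]"] f by (simp add: tempered_of_fun_def)
qed

lemma tempered_of_fun_diff:
  assumes "f \<in> test_functions \<Omega>" "g \<in> test_functions \<Omega>'"
  shows "tempered_of_fun (\<lambda>x. f x - g x) h = tempered_of_fun f h - tempered_of_fun g h"
proof (cases "h \<in> schwartz")
  case True
  have "continuous_on UNIV h" using schwartz_smooth[OF True] by (rule smooth_continuous)
  then have "integrable lborel (\<lambda>x. h x * f x)" "integrable lborel (\<lambda>x. h x * g x)"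
    using integrable_locally_integrable_mult[OF continuous_locally_integrable] assms by blast+
  then show ?thesis using True by (simp add: tempered_of_fun_def left_diff_distrib mult.commute[of _ "h _"] right_diff_distrib)
qed (simp add: tempered_of_fun_def)

section \<open>Weighted square-integrable functions\<close>

text \<open>Splitting the weight into \<open>w\<close> and its inverse is the duality of the orders
  1/2 and -1/2. The inequality comes from that of arithmetic and geometric means with a free
  parameter \<open>t\<close>, optimised at the end.\<close>

lemma weighted_cauchy_schwarz:
  fixes a b :: "'a \<Rightarrow> complex" and w :: "'a \<Rightarrow> real"
  assumes [measurable]: "a \<in> borel_measurable M" "b \<in> borel_measurable M" "w \<in> borel_measurable M"
    and w: "\<And>x. w x > 0"
    and a: "integrable M (\<lambda>x. inverse (w x) * (cmod (a x))\<^sup>2)" and b: "integrable M (\<lambda>x. w x * (cmod (b x))\<^sup>2)"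
  shows "integrable M (\<lambda>x. a x * b x)"
    and "cmod (\<integral>x. a x * b x \<partial>M) \<le> sqrt (\<integral>x. inverse (w x) * (cmod (a x))\<^sup>2 \<partial>M) * sqrt (\<integral>x. w x * (cmod (b x))\<^sup>2 \<partial>M)"
proof -
  let ?A = "\<integral>x. inverse (w x) * (cmod (a x))\<^sup>2 \<partial>M" and ?B = "\<integral>x. w x * (cmod (b x))\<^sup>2 \<partial>M"
  have A0: "?A \<ge> 0" and B0: "?B \<ge> 0"
    using w by (auto intro!: integral_nonneg_AE AE_I2 simp: less_imp_le)
  have le: "cmod (a x * b x) \<le> (t * (inverse (w x) * (cmod (a x))\<^sup>2) + inverse t * (w x * (cmod (b x))\<^sup>2)) / 2" if t: "t > 0" for x t
  proof -
    have "2 * (t * cmod (a x)) * (w x * cmod (b x)) \<le> (t * cmod (a x))\<^sup>2 + (w x * cmod (b x))\<^sup>2"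
      by (rule sum_squares_bound)
    then show ?thesis using t w[of x] by (simp add: norm_mult field_simps power2_eq_square)
  qed
  have i: "integrable M (\<lambda>x. (t * (inverse (w x) * (cmod (a x))\<^sup>2) + inverse t * (w x * (cmod (b x))\<^sup>2)) / 2)" for t
    using a b by simp
  show 1: "integrable M (\<lambda>x. a x * b x)"
  proof (rule Bochner_Integration.integrable_bound[OF i[of 1]])
    show "AE x in M. norm (a x * b x) \<le> norm ((1 * (inverse (w x) * (cmod (a x))\<^sup>2) + inverse 1 * (w x * (cmod (b x))\<^sup>2)) / 2)"
      unfolding real_norm_def by (intro AE_I2 order_trans[OF le[of 1] abs_ge_self]) simp
  qed measurable
  have bd: "cmod (\<integral>x. a x * b x \<partial>M) \<le> (t * ?A + inverse t * ?B) / 2" if t: "t > 0" for t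
  proof -
    have "cmod (\<integral>x. a x * b x \<partial>M) \<le> (\<integral>x. cmod (a x * b x) \<partial>M)" by simp
    also have "\<dots> \<le> (\<integral>x. (t * (inverse (w x) * (cmod (a x))\<^sup>2) + inverse t * (w x * (cmod (b x))\<^sup>2)) / 2 \<partial>M)"
      by (rule Bochner_Integration.integral_mono) (use 1 i le[OF t] in \<open>auto simp del: norm_mult\<close>)
    also have "\<dots> = (t * ?A + inverse t * ?B) / 2" using a b by simp
    finally show ?thesis .
  qed
  show "cmod (\<integral>x. a x * b x \<partial>M) \<le> sqrt ?A * sqrt ?B"
  proof (cases "?A = 0 \<or> ?B = 0")
    case False
    then have AB: "?A > 0" "?B > 0" using A0 B0 by auto
    define \<alpha> \<beta> where "\<alpha> = sqrt ?A" and "\<beta> = sqrt ?B"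
    have ab: "\<alpha> > 0" "\<beta> > 0" "?A = \<alpha>\<^sup>2" "?B = \<beta>\<^sup>2" using AB by (auto simp: \<alpha>_def \<beta>_def)
    \<comment> \<open>The optimal parameter balances the two terms.\<close>
    have "((\<beta> / \<alpha>) * ?A + inverse (\<beta> / \<alpha>) * ?B) / 2 = \<alpha> * \<beta>"
      unfolding ab(3,4) using ab(1,2) by (simp add: power2_eq_square field_simps)
    then show ?thesis using bd[of "\<beta> / \<alpha>"] ab(1,2) unfolding \<alpha>_def \<beta>_def by simp
  next
    case True
    have "cmod (\<integral>x. a x * b x \<partial>M) \<le> 0"
    proof (rule field_le_epsilon)
      fix e :: real assume e: "e > 0"
      from True show "cmod (\<integral>x. a x * b x \<partial>M) \<le> 0 + e"
      proof
        assume A: "?A = 0"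
        \<comment> \<open>When \<open>?A\<close> vanishes only the term with the inverse of the
          parameter remains, so a large parameter makes it small; the summand 1 keeps the parameter
          positive if \<open>?B\<close> vanishes as well.\<close>
        have p: "(?B + 1) / e > 0" using B0 e by simp
        have "inverse ((?B + 1) / e) * ?B / 2 \<le> e" using B0 e by (simp add: field_simps)
        then show ?thesis using bd[OF p] unfolding A by simp
      next
        assume B: "?B = 0"
        have p: "e / (?A + 1) > 0" using A0 e by simp
        have "e / (?A + 1) * ?A / 2 \<le> e" using A0 e by (simp add: field_simps)
        then show ?thesis using bd[OF p] unfolding B by simp
      qed
    qed
    then show ?thesis using A0 B0 by (meson mult_nonneg_nonneg order_trans real_sqrt_ge_zero)
  qed
qed

section \<open>The Fourier representation of a distribution on test functions\<close>

lemma fourier_scale: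
  fixes h :: "'a::euclidean_space \<Rightarrow> complex"
  assumes h: "integrable lborel h" and s: "s > 0"
  shows "fourier (\<lambda>\<xi>. h (s *\<^sub>R \<xi>)) y = of_real (1 / s ^ DIM('a)) * fourier h ((1 / s) *\<^sub>R y)"
  using lborel_affine_integral(2)[OF _ integrable_exp_mult(1)[OF h, of "(1 / s) *\<^sub>R y"], of s 0] s
  by (simp add: fourier_def scaleR_conv_of_real)

lemma fourier_modulate: "fourier (\<lambda>\<xi>. exp (- \<i> * of_real (x \<bullet> \<xi>)) * h \<xi>) y = fourier h (x + y)"
proof -
  have "exp (- \<i> * of_real (y \<bullet> \<xi>)) * (exp (- \<i> * of_real (x \<bullet> \<xi>)) * h \<xi>)
      = exp (- \<i> * of_real ((x + y) \<bullet> \<xi>)) * h \<xi>" for \<xi>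
  proof -
    have "- \<i> * of_real (y \<bullet> \<xi>) + - \<i> * of_real (x \<bullet> \<xi>) = - \<i> * complex_of_real ((x + y) \<bullet> \<xi>)"
      by (simp add: inner_add_left algebra_simps)
    then show ?thesis unfolding mult.assoc[symmetric] exp_add[symmetric] by (simp only:)
  qed
  then show ?thesis unfolding fourier_def by (simp only:)
qed

text \<open>Partial derivatives of a test function are test functions and hence bounded; the sum of
  their bounds is a Lipschitz constant.\<close>

lemma test_lipschitz:
  fixes h :: "'a::euclidean_space \<Rightarrow> complex"
  assumes h: "h \<in> test_functions \<Omega>"
  obtains L where "L \<ge> 0" "\<And>y v. cmod (frechet_derivative h (at y) v) \<le> L * norm v"
    "\<And>x y. cmod (h x - h y) \<le> L * norm (x - y)"
proof -
  have sm: "smooth h" by (rule test_functionsE[OF h])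
  have "\<forall>b\<in>Basis. \<exists>M. \<forall>x. cmod (frechet_derivative h (at x) b) \<le> M"
  proof
    fix b :: 'a assume b: "b \<in> Basis"
    obtain M where "\<And>x. cmod (frechet_derivative h (at x) b) \<le> M"
      by (rule test_functions_bounded[OF test_functions_frechet[OF h b]], rule that)
    then show "\<exists>M. \<forall>x. cmod (frechet_derivative h (at x) b) \<le> M" by blast
  qed
  from bchoice[OF this] obtain M where M: "\<forall>b\<in>Basis. \<forall>x. cmod (frechet_derivative h (at x) b) \<le> M b" by (elim exE)
  define L where "L = (\<Sum>b\<in>Basis. \<bar>M b\<bar>)"
  have D: "(h has_derivative frechet_derivative h (at y)) (at y)" for y
    using smooth_differentiable[OF sm] by (simp add: frechet_derivative_works)
  have bd: "cmod (frechet_derivative h (at y) v) \<le> L * norm v" for y v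
  proof -
    have lin: "linear (frechet_derivative h (at y))" by (rule linear_frechet_derivative[OF smooth_differentiable[OF sm]])
    have "frechet_derivative h (at y) v = frechet_derivative h (at y) (\<Sum>b\<in>Basis. (v \<bullet> b) *\<^sub>R b)"
      by (simp add: euclidean_representation)
    also have "\<dots> = (\<Sum>b\<in>Basis. (v \<bullet> b) *\<^sub>R frechet_derivative h (at y) b)"
      by (simp add: linear_sum[OF lin] linear_cmul[OF lin])
    also have "cmod \<dots> \<le> (\<Sum>b\<in>Basis. norm v * \<bar>M b\<bar>)"
    proof (rule sum_norm_le)
      fix b :: 'a assume b: "b \<in> Basis"
      have "cmod (frechet_derivative h (at y) b) \<le> \<bar>M b\<bar>" using M b by (meson abs_ge_self order_trans)
      then show "cmod ((v \<bullet> b) *\<^sub>R frechet_derivative h (at y) b) \<le> norm v * \<bar>M b\<bar>"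
        unfolding norm_scaleR using Basis_le_norm[OF b, of v] by (intro mult_mono) auto
    qed
    finally show ?thesis by (simp add: L_def sum_distrib_left mult.commute)
  qed
  show ?thesis
  proof (rule that[of L])
    show "L \<ge> 0" by (auto simp: L_def intro: sum_nonneg)
    show "cmod (frechet_derivative h (at y) v) \<le> L * norm v" for y v by (rule bd)
    show "cmod (h x - h y) \<le> L * norm (x - y)" for x y
      by (rule differentiable_bound[of UNIV h "\<lambda>y. frechet_derivative h (at y)"])
        (use bd D in \<open>auto intro: onorm_le\<close>)
  qed
qed

text \<open>The error of mollification: if the normalised integral of \<open>\<eta>\<close> is 1,
  this is the convolution of \<open>h\<close> with \<open>\<eta>\<close> at scale \<open>s\<close>,
  minus \<open>h\<close>. Keeping the difference under the integral makes its smallness in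
  \<open>s\<close> visible.\<close>

definition smear :: "('a::euclidean_space \<Rightarrow> complex) \<Rightarrow> real \<Rightarrow> ('a \<Rightarrow> complex) \<Rightarrow> 'a \<Rightarrow> complex" where
  "smear \<eta> s h x = of_real (fourier_const TYPE('a)) * (\<integral>z. \<eta> z * (h (x - s *\<^sub>R z) - h x) \<partial>lborel)"

lemma schwartz_integrable_weight:
  fixes f :: "'a::euclidean_space \<Rightarrow> complex"
  assumes f: "f \<in> schwartz"
  shows "integrable lborel (\<lambda>x. (1 + norm x) ^ N * cmod (f x))"
proof -
  have [measurable]: "f \<in> borel_measurable borel" by (rule schwartz_measurable[OF f])
  obtain M where M: "\<And>x. (1 + norm x) ^ (2 * DIM('a) + N) * cmod (f x) \<le> M"
    by (rule schwartz_bound[OF f], rule that)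
  have "integrable lborel (\<lambda>x. of_real ((1 + norm x) ^ N) * f x)"
  proof (rule integrable_decay(1)[where M = M])
    show "(1 + norm x) ^ (2 * DIM('a)) * cmod (of_real ((1 + norm x) ^ N) * f x) \<le> M" for x
    proof -
      have "cmod (of_real ((1 + norm x) ^ N) * f x) = (1 + norm x) ^ N * cmod (f x)"
        by (simp only: norm_mult norm_of_real) simp
      then show ?thesis using M[of x] by (simp only: power_add mult.assoc)
    qed
  qed measurable
  from integrable_norm[OF this] show ?thesis by (simp only: norm_mult norm_of_real) simp
qed

text \<open>The integrand vanishes unless x or x - s z lies in the ball of radius \<open>R\<close>,
  and then |x| \<le> R + |z|; the weight in \<open>x\<close> is thereby shifted to
  \<open>\<eta>\<close>, whose decay absorbs it. The factor \<open>s\<close> is the Lipschitz bound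
  for \<open>h\<close>.\<close>

lemma smear_bound:
  fixes h \<eta> :: "'a::euclidean_space \<Rightarrow> complex"
  assumes h: "h \<in> test_functions \<Omega>" and \<eta>: "\<eta> \<in> schwartz"
  shows "\<exists>C. \<forall>s x. 0 < s \<and> s \<le> 1 \<longrightarrow> (1 + norm x) ^ N * cmod (smear \<eta> s h x) \<le> s * C"
proof -
  obtain R where R: "R > 0" "\<And>x. norm x > R \<Longrightarrow> h x = 0" by (rule test_functions_support[OF h], rule that)
  obtain L where L: "L \<ge> 0" "\<And>y v. cmod (frechet_derivative h (at y) v) \<le> L * norm v"
    "\<And>x y. cmod (h x - h y) \<le> L * norm (x - y)" by (rule test_lipschitz[OF h], rule that)
  have [measurable]: "h \<in> borel_measurable borel" "\<eta> \<in> borel_measurable borel"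
    using schwartz_measurable[OF \<eta>] test_functions_integrable[OF h] by auto
  let ?J = "\<integral>z. (1 + norm z) ^ Suc N * cmod (\<eta> z) \<partial>lborel"
  let ?K = "(1 + R) ^ N * L"
  have "(1 + norm x) ^ N * cmod (smear \<eta> s h x) \<le> s * (fourier_const TYPE('a) * (?K * ?J))" if s: "0 < s" "s \<le> 1" for s x
  proof -
    have pt: "(1 + norm x) ^ N * cmod (\<eta> z * (h (x - s *\<^sub>R z) - h x)) \<le> s * ?K * ((1 + norm z) ^ Suc N * cmod (\<eta> z))" for z
    proof (cases "norm x > R \<and> norm (x - s *\<^sub>R z) > R")
      case True
      then show ?thesis using R L s by simp
    next
      case False
      have "norm x \<le> norm (x - s *\<^sub>R z) + norm (s *\<^sub>R z)" using norm_triangle_ineq[of "x - s *\<^sub>R z" "s *\<^sub>R z"] by simp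
      moreover have "norm (s *\<^sub>R z) \<le> norm z" using s by (simp add: mult_left_le_one_le)
      moreover have "norm x \<le> R \<or> norm (x - s *\<^sub>R z) \<le> R" using False by linarith
      ultimately have "norm x \<le> R + norm z" using norm_ge_zero[of z] by (elim disjE) linarith+
      moreover have "0 \<le> R * norm z" using R by simp
      ultimately have "1 + norm x \<le> (1 + R) * (1 + norm z)" by (simp add: algebra_simps)
      then have 1: "(1 + norm x) ^ N \<le> (1 + R) ^ N * (1 + norm z) ^ N"
        unfolding power_mult_distrib[symmetric] by (intro power_mono) auto
      have "cmod (h (x - s *\<^sub>R z) - h x) \<le> L * (s * norm z)" using L(3)[of "x - s *\<^sub>R z" x] s by simp
      also have "\<dots> \<le> L * (s * (1 + norm z))" using L s by (intro mult_left_mono) auto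
      finally have "(1 + norm x) ^ N * cmod (h (x - s *\<^sub>R z) - h x) \<le> ((1 + R) ^ N * (1 + norm z) ^ N) * (L * (s * (1 + norm z)))"
        using 1 R by (intro mult_mono) auto
      then have "(1 + norm x) ^ N * cmod (h (x - s *\<^sub>R z) - h x) * cmod (\<eta> z) \<le> ((1 + R) ^ N * (1 + norm z) ^ N) * (L * (s * (1 + norm z))) * cmod (\<eta> z)"
        by (rule mult_right_mono) simp
      then show ?thesis by (simp add: norm_mult mult_ac)
    qed
    have i: "integrable lborel (\<lambda>z. s * ?K * ((1 + norm z) ^ Suc N * cmod (\<eta> z)))"
      using schwartz_integrable_weight[OF \<eta>, of "Suc N"] by simp
    have "(1 + norm x) ^ N * cmod (\<integral>z. \<eta> z * (h (x - s *\<^sub>R z) - h x) \<partial>lborel) \<le> (1 + norm x) ^ N * (\<integral>z. cmod (\<eta> z * (h (x - s *\<^sub>R z) - h x)) \<partial>lborel)"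
      by (intro mult_left_mono) auto
    also have "\<dots> = (\<integral>z. (1 + norm x) ^ N * cmod (\<eta> z * (h (x - s *\<^sub>R z) - h x)) \<partial>lborel)" by simp
    also have "\<dots> \<le> (\<integral>z. s * ?K * ((1 + norm z) ^ Suc N * cmod (\<eta> z)) \<partial>lborel)"
    proof (rule Bochner_Integration.integral_mono[OF _ i pt])
      show "integrable lborel (\<lambda>z. (1 + norm x) ^ N * cmod (\<eta> z * (h (x - s *\<^sub>R z) - h x)))"
      proof (rule Bochner_Integration.integrable_bound[OF i])
        show "AE z in lborel. norm ((1 + norm x) ^ N * cmod (\<eta> z * (h (x - s *\<^sub>R z) - h x))) \<le> norm (s * ?K * ((1 + norm z) ^ Suc N * cmod (\<eta> z)))"
          unfolding real_norm_def
          by (intro AE_I2 order_trans[OF _ abs_ge_self], subst abs_of_nonneg) (auto intro!: pt simp del: power_Suc)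
      qed measurable
    qed
    finally have "(1 + norm x) ^ N * cmod (\<integral>z. \<eta> z * (h (x - s *\<^sub>R z) - h x) \<partial>lborel) \<le> s * (?K * ?J)" by simp
    then have "fourier_const TYPE('a) * ((1 + norm x) ^ N * cmod (\<integral>z. \<eta> z * (h (x - s *\<^sub>R z) - h x) \<partial>lborel)) \<le> fourier_const TYPE('a) * (s * (?K * ?J))"
      by (rule mult_left_mono) simp
    then show ?thesis by (simp add: smear_def norm_mult mult_ac)
  qed
  then show ?thesis by blast
qed

lemma smear_derivative:
  fixes h \<eta> :: "'a::euclidean_space \<Rightarrow> complex"
  assumes h: "h \<in> test_functions \<Omega>" and \<eta>: "\<eta> \<in> schwartz"
  shows "(smear \<eta> s h has_derivative (\<lambda>v. smear \<eta> s (\<lambda>y. frechet_derivative h (at y) v) x)) (at x)"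
proof -
  have sm: "smooth h" by (rule test_functionsE[OF h])
  have D: "(h has_derivative frechet_derivative h (at y)) (at y)" for y
    using smooth_differentiable[OF sm] by (simp add: frechet_derivative_works)
  obtain M where M: "\<And>x. cmod (h x) \<le> M" by (rule test_functions_bounded[OF h], rule that)
  obtain L where L: "L \<ge> 0" "\<And>y v. cmod (frechet_derivative h (at y) v) \<le> L * norm v"
    "\<And>x y. cmod (h x - h y) \<le> L * norm (x - y)" by (rule test_lipschitz[OF h], rule that)
  have [measurable]: "h \<in> borel_measurable borel" "\<eta> \<in> borel_measurable borel"
    using schwartz_measurable[OF \<eta>] test_functions_integrable[OF h] by auto
  have i\<eta>: "integrable lborel \<eta>" by (rule schwartz_integrable[OF \<eta>])
  have "((\<lambda>x. \<integral>z. \<eta> z * (h (x - s *\<^sub>R z) - h x) \<partial>lborel) has_derivative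
      (\<lambda>v. \<integral>z. \<eta> z * (frechet_derivative h (at (x - s *\<^sub>R z)) v - frechet_derivative h (at x) v) \<partial>lborel)) (at x)"
  proof (rule has_derivative_lebesgue_integral(2)[where S = UNIV and g = "\<lambda>z. 2 * L * cmod (\<eta> z)"])
    show "integrable lborel (\<lambda>z. \<eta> z * (h (x - s *\<^sub>R z) - h x))" for x
    proof (rule Bochner_Integration.integrable_bound)
      show "integrable lborel (\<lambda>z. of_real (2 * M) * \<eta> z)" using i\<eta> by simp
      show "AE z in lborel. norm (\<eta> z * (h (x - s *\<^sub>R z) - h x)) \<le> norm (of_real (2 * M) * \<eta> z)"
      proof (rule AE_I2)
        fix z
        have "cmod (h (x - s *\<^sub>R z) - h x) \<le> 2 * M"
          using M[of x] M[of "x - s *\<^sub>R z"] norm_triangle_ineq4[of "h (x - s *\<^sub>R z)" "h x"] by linarith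
        then show "norm (\<eta> z * (h (x - s *\<^sub>R z) - h x)) \<le> norm (of_real (2 * M) * \<eta> z)"
          unfolding norm_mult[of "\<eta> z"] norm_mult[of "of_real (2 * M)"] norm_of_real by (subst mult.commute) (intro mult_right_mono; simp)
      qed
    qed measurable
    show "((\<lambda>x. \<eta> z * (h (x - s *\<^sub>R z) - h x)) has_derivative
      (\<lambda>v. \<eta> z * (frechet_derivative h (at (x - s *\<^sub>R z)) v - frechet_derivative h (at x) v))) (at x)" for x z
    proof (intro has_derivative_mult_right has_derivative_diff D)
      have "((\<lambda>x. x - s *\<^sub>R z) has_derivative (\<lambda>v. v)) (at x)" by (auto intro!: derivative_eq_intros)
      from diff_chain_at[OF this D] show "((\<lambda>x. h (x - s *\<^sub>R z)) has_derivative frechet_derivative h (at (x - s *\<^sub>R z))) (at x)"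
        by (simp add: o_def)
    qed
    show "norm (\<eta> z * (frechet_derivative h (at (x - s *\<^sub>R z)) v - frechet_derivative h (at x) v)) \<le> 2 * L * cmod (\<eta> z) * norm v" for x z v
    proof -
      have "cmod (frechet_derivative h (at (x - s *\<^sub>R z)) v - frechet_derivative h (at x) v) \<le> 2 * L * norm v"
        using L(2)[of "x - s *\<^sub>R z" v] L(2)[of x v] norm_triangle_ineq4[of "frechet_derivative h (at (x - s *\<^sub>R z)) v" "frechet_derivative h (at x) v"] by linarith
      from mult_left_mono[OF this, of "cmod (\<eta> z)"] show ?thesis by (simp add: norm_mult mult_ac)
    qed
    show "integrable lborel (\<lambda>z. 2 * L * cmod (\<eta> z))" using i\<eta> by simp
  qed auto
  from has_derivative_mult_right[OF this, of "of_real (fourier_const TYPE('a))"] show ?thesis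
    by (simp add: smear_def[abs_def])
qed

lemma smear_iter_deriv:
  assumes h: "h \<in> test_functions \<Omega>" and \<eta>: "\<eta> \<in> schwartz" and bs: "set bs \<subseteq> Basis"
  shows "iter_deriv bs (smear \<eta> s h) = smear \<eta> s (iter_deriv bs h)"
  using bs
proof (induction bs)
  case (Cons b bs)
  then have IH: "iter_deriv bs (smear \<eta> s h) = smear \<eta> s (iter_deriv bs h)" by simp
  have "iter_deriv bs h \<in> test_functions \<Omega>" using Cons.prems by (intro test_functions_iter_deriv h) simp
  from has_derivative_frechet[OF smear_derivative[OF this \<eta>]]
  show ?case by (simp only: iter_deriv.simps IH)
qed simp

lemma smear_schwartz:
  fixes h \<eta> :: "'a::euclidean_space \<Rightarrow> complex"
  assumes h: "h \<in> test_functions \<Omega>" and \<eta>: "\<eta> \<in> schwartz" and s: "0 < s" "s \<le> 1"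
  shows "smear \<eta> s h \<in> schwartz"
  unfolding schwartz_def
proof (intro CollectI conjI allI impI)
  have t: "iter_deriv bs h \<in> test_functions \<Omega>" if "set bs \<subseteq> Basis" for bs
    using h that by (rule test_functions_iter_deriv)
  show "smooth (smear \<eta> s h)"
    unfolding smooth_def
  proof (intro allI impI)
    fix bs :: "'a list" and x assume bs: "set bs \<subseteq> Basis"
    show "iter_deriv bs (smear \<eta> s h) differentiable at x"
      unfolding smear_iter_deriv[OF h \<eta> bs] by (rule differentiableI[OF smear_derivative[OF t[OF bs] \<eta>]])
  qed
  fix N and bs :: "'a list" assume bs: "set bs \<subseteq> Basis"
  show "\<exists>M. \<forall>x. (1 + norm x) ^ N * cmod (iter_deriv bs (smear \<eta> s h) x) \<le> M"
    using smear_bound[OF t[OF bs] \<eta>, of N] s unfolding smear_iter_deriv[OF h \<eta> bs] by blast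
qed

text \<open>\<open>smear\<close> commutes with differentiation, so every seminorm of the error is of
  order \<open>s\<close>, and \<open>U\<close> is bounded by finitely many of them.\<close>

lemma tempered_smear_tendsto_0:
  fixes h \<eta> :: "'a::euclidean_space \<Rightarrow> complex"
  assumes U: "U \<in> tempered" and h: "h \<in> test_functions \<Omega>" and \<eta>: "\<eta> \<in> schwartz"
  shows "(\<lambda>n. U (smear \<eta> (1 / real (Suc n)) h)) \<longlonglongrightarrow> 0"
proof -
  obtain C N where C: "C \<ge> 0" "\<forall>f\<in>schwartz. \<forall>M. seminorm_le N f M \<longrightarrow> cmod (U f) \<le> C * M"
    by (rule temperedD_bound[OF U], rule that)
  let ?B = "{bs. set bs \<subseteq> (Basis::'a set) \<and> length bs \<le> N}"
  have "\<forall>bs\<in>?B. \<exists>K. \<forall>s x. 0 < s \<and> s \<le> 1 \<longrightarrow> (1 + norm x) ^ N * cmod (smear \<eta> s (iter_deriv bs h) x) \<le> s * K"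
    using smear_bound[OF test_functions_iter_deriv[OF h] \<eta>] by simp
  from bchoice[OF this] obtain K
    where K: "\<forall>bs\<in>?B. \<forall>s x. 0 < s \<and> s \<le> 1 \<longrightarrow> (1 + norm x) ^ N * cmod (smear \<eta> s (iter_deriv bs h) x) \<le> s * K bs" by (elim exE)
  have fin: "finite ?B" by (rule finite_lists_length_le) simp
  define M where "M = Max (K ` ?B)"
  have le: "cmod (U (smear \<eta> s h)) \<le> C * (s * M)" if s: "0 < s" "s \<le> 1" for s
  proof -
    have "seminorm_le N (smear \<eta> s h) (s * M)"
      unfolding seminorm_le_def
    proof (intro allI impI)
      fix bs :: "'a list" and x assume bs: "set bs \<subseteq> Basis \<and> length bs \<le> N"
      have "(1 + norm x) ^ N * cmod (iter_deriv bs (smear \<eta> s h) x) \<le> s * K bs"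
        using K bs s by (simp add: smear_iter_deriv[OF h \<eta>])
      also have "\<dots> \<le> s * M"
        unfolding M_def using s bs by (intro mult_left_mono Max_ge finite_imageI fin imageI) auto
      finally show "(1 + norm x) ^ N * cmod (iter_deriv bs (smear \<eta> s h) x) \<le> s * M" .
    qed
    then show ?thesis using C smear_schwartz[OF h \<eta> s] by blast
  qed
  show ?thesis
  proof (rule Lim_null_comparison)
    show "\<forall>\<^sub>F n in sequentially. cmod (U (smear \<eta> (1 / real (Suc n)) h)) \<le> C * (1 / real (Suc n) * M)"
      by (intro always_eventually allI le) auto
    show "(\<lambda>n. C * (1 / real (Suc n) * M)) \<longlonglongrightarrow> 0" by real_asymp
  qed
qed

lemma integrable_scaled: 
  fixes h :: "'a::euclidean_space \<Rightarrow> complex"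
  assumes "integrable lborel h" "s > 0" shows "integrable lborel (\<lambda>\<xi>. h (s *\<^sub>R \<xi>))"
  using lborel_affine_integral(1)[of s h 0] assms by simp

text \<open>The multiplier \<theta>(s \<xi>) acts as convolution with a rescaled transform of
  \<open>\<theta>\<close>, whose normalised mass is \<open>\<theta> 0 = 1\<close> by inversion at
  the origin; so \<open>\<psi>\<close> splits off and the mollification error is left.\<close>

lemma fourier_cutoff:
  fixes \<psi> \<theta> :: "'a::euclidean_space \<Rightarrow> complex"
  assumes \<psi>: "\<psi> \<in> test_functions \<Omega>" and \<theta>: "\<theta> \<in> test_functions \<Omega>'" and s: "s > 0" and \<theta>0: "\<theta> 0 = 1"
  shows "fourier (\<lambda>\<xi>. \<theta> (s *\<^sub>R \<xi>) * fourier \<psi> (- \<xi>)) x = \<psi> x + smear (fourier \<theta>) s \<psi> x"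
proof -
  let ?c = "complex_of_real (fourier_const TYPE('a))"
  have i\<psi>: "integrable lborel \<psi>" and i\<theta>: "integrable lborel \<theta>" and i\<eta>: "integrable lborel (fourier \<theta>)"
    using \<psi> \<theta> by (auto intro: test_functions_integrable fourier_test_integrable)
  have i\<psi>r: "integrable lborel (\<lambda>y. \<psi> (- y))" using lborel_affine_integral(1)[of "-1" \<psi> 0] i\<psi> by simp
  have [measurable]: "\<psi> \<in> borel_measurable borel" "\<theta> \<in> borel_measurable borel" using i\<psi> i\<theta> by auto
  obtain M where M: "\<And>x. cmod (\<psi> x) \<le> M" by (rule test_functions_bounded[OF \<psi>], rule that)
  have prod_i: "integrable lborel (\<lambda>z. fourier \<theta> z * \<psi> (x + t *\<^sub>R z))" for x t
  proof (rule Bochner_Integration.integrable_bound)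
    show "integrable lborel (\<lambda>z. fourier \<theta> z * of_real M)" using i\<eta> by simp
    show "AE z in lborel. norm (fourier \<theta> z * \<psi> (x + t *\<^sub>R z)) \<le> norm (fourier \<theta> z * of_real M)"
      unfolding norm_mult norm_of_real by (intro AE_I2 mult_left_mono order_trans[OF M abs_ge_self]) auto
  qed measurable
  have one: "?c * (\<integral>z. fourier \<theta> z \<partial>lborel) = 1"
    using fourier_inversion_test[OF \<theta>, of 0] \<theta>0 by (simp add: fourier_def[of "fourier \<theta>"])
  have "fourier (\<lambda>\<xi>. \<theta> (s *\<^sub>R \<xi>) * fourier \<psi> (- \<xi>)) x
     = ?c * (\<integral>\<xi>. (exp (- \<i> * of_real (x \<bullet> \<xi>)) * \<theta> (s *\<^sub>R \<xi>)) * fourier (\<lambda>y. \<psi> (- y)) \<xi> \<partial>lborel)"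
    unfolding fourier_reflect[OF i\<psi>] by (simp add: fourier_def[of "\<lambda>\<xi>. \<theta> (s *\<^sub>R \<xi>) * fourier \<psi> (- \<xi>)"] mult.assoc)
  also have "(\<integral>\<xi>. (exp (- \<i> * of_real (x \<bullet> \<xi>)) * \<theta> (s *\<^sub>R \<xi>)) * fourier (\<lambda>y. \<psi> (- y)) \<xi> \<partial>lborel)
     = (\<integral>y. fourier (\<lambda>\<xi>. exp (- \<i> * of_real (x \<bullet> \<xi>)) * \<theta> (s *\<^sub>R \<xi>)) y * \<psi> (- y) \<partial>lborel)"
    by (rule fourier_multiplication[symmetric]) (intro integrable_exp_mult integrable_scaled i\<theta> s i\<psi>r)+
  also have "\<dots> = (\<integral>y. of_real (1 / s ^ DIM('a)) * fourier \<theta> ((1 / s) *\<^sub>R (x + y)) * \<psi> (- y) \<partial>lborel)"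
    unfolding fourier_modulate fourier_scale[OF i\<theta> s] ..
  also have "\<dots> = (\<integral>z. fourier \<theta> z * \<psi> (x - s *\<^sub>R z) \<partial>lborel)"
  proof -
    let ?G = "\<lambda>z. fourier \<theta> z * \<psi> (x + (- s) *\<^sub>R z)"
    have e: "?G ((1 / s) *\<^sub>R x + (1 / s) *\<^sub>R y) = fourier \<theta> ((1 / s) *\<^sub>R (x + y)) * \<psi> (- y)" for y
      using s by (simp add: scaleR_add_right)
    have "(\<integral>y. ?G ((1 / s) *\<^sub>R x + (1 / s) *\<^sub>R y) \<partial>lborel) = (1 / \<bar>1 / s\<bar> ^ DIM('a)) *\<^sub>R (\<integral>z. ?G z \<partial>lborel)"
      by (rule lborel_affine_integral(2)[OF _ prod_i]) (use s in auto)
    then show ?thesis unfolding e using s by (simp add: mult.assoc scaleR_conv_of_real power_one_over)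
  qed
  also have "\<dots> = (\<integral>z. fourier \<theta> z * \<psi> x + fourier \<theta> z * (\<psi> (x - s *\<^sub>R z) - \<psi> x) \<partial>lborel)"
    by (simp add: algebra_simps)
  also have "\<dots> = (\<integral>z. fourier \<theta> z \<partial>lborel) * \<psi> x + (\<integral>z. fourier \<theta> z * (\<psi> (x - s *\<^sub>R z) - \<psi> x) \<partial>lborel)"
    using i\<eta> prod_i[of x "-s"] by (subst Bochner_Integration.integral_add) (auto simp: right_diff_distrib)
  finally show ?thesis using one by (simp add: smear_def distrib_left mult.assoc[symmetric])
qed

lemma box_bump_0: "box_bump (- One) (One :: 'a::euclidean_space) 1 0 > 0"
  unfolding box_bump_def by (intro prod_pos) (auto simp: bump_def)

definition cutoff :: "'a::euclidean_space \<Rightarrow> complex" where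
  "cutoff x = of_real (inverse (box_bump (- One) (One :: 'a) 1 0)) * of_real (box_bump (- One) One 1 x)"

lemma cutoff:
  shows "(cutoff :: 'a::euclidean_space \<Rightarrow> complex) \<in> test_functions UNIV" and "cutoff (0::'a) = 1"
proof -
  show "(cutoff :: 'a \<Rightarrow> complex) \<in> test_functions UNIV"
    unfolding cutoff_def[abs_def] by (rule test_functions_mult[OF box_bump_test smooth_const]) simp
  show "cutoff (0::'a) = 1"
    using box_bump_0[where 'a = 'a] unfolding cutoff_def of_real_mult[symmetric] by simp
qed

text \<open>\<open>is_fourier_fun\<close> tests only against compactly supported functions, whereas
  the transform of \<open>\<psi>\<close> is merely a Schwartz function. Cutting off at frequencies
  of order 1/s and letting s vanish bridges the gap: one side changes by a mollification error, the
  other converges by domination.\<close>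

theorem tempered_test_representation:
  fixes \<psi> :: "'a::euclidean_space \<Rightarrow> complex"
  assumes U: "U \<in> tempered" "is_fourier_fun U g" and \<psi>: "\<psi> \<in> test_functions \<Omega>"
    and int: "integrable lborel (\<lambda>\<xi>. g \<xi> * fourier \<psi> (- \<xi>))"
  shows "U \<psi> = (\<integral>\<xi>. g \<xi> * fourier \<psi> (- \<xi>) \<partial>lborel)"
proof (rule LIMSEQ_unique)
  let ?s = "\<lambda>n. 1 / real (Suc n)"
  let ?\<theta> = "cutoff :: 'a \<Rightarrow> complex"
  let ?f = "\<lambda>n \<xi>. ?\<theta> (?s n *\<^sub>R \<xi>) * fourier \<psi> (- \<xi>)"
  have [measurable]: "g \<in> borel_measurable borel" by (rule is_fourier_funD(2)[OF U(2)])
  have [measurable]: "\<psi> \<in> borel_measurable borel" "?\<theta> \<in> borel_measurable borel"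
    using test_functions_integrable[OF \<psi>] test_functions_integrable[OF cutoff(1)[where 'a = 'a]] by auto
  have f: "?f n \<in> test_functions UNIV" for n
  proof -
    obtain R where R: "R > 0" "\<And>x::'a. norm x > R \<Longrightarrow> cutoff x = 0" by (rule test_functions_support[OF cutoff(1)], rule that)
    have sm: "smooth ?\<theta>" by (rule test_functionsE[OF cutoff(1)])
    have "smooth (\<lambda>\<xi>. ?\<theta> (0 + ?s n *\<^sub>R \<xi>))" by (rule smooth_affine[OF sm]) (auto intro!: linearI simp: scaleR_add_right)
    moreover have "smooth (\<lambda>\<xi>. fourier \<psi> (0 + (- \<xi>)))"
      by (rule smooth_affine[OF fourier_test_smooth[OF \<psi>]]) (auto intro!: linearI)
    ultimately show ?thesis
    proof (intro test_functionsI[of _ "cball 0 (R * real (Suc n))"])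
      fix \<xi> :: 'a assume "\<xi> \<notin> cball 0 (R * real (Suc n))"
      then have "norm (?s n *\<^sub>R \<xi>) > R" by (simp add: field_simps)
      then show "?f n \<xi> = 0" using R(2) by simp
    qed (auto intro: smooth_mult)
  qed
  have "U (fourier (?f n)) = U \<psi> + U (smear (fourier ?\<theta>) (?s n) \<psi>)" for n
  proof -
    have "fourier (?f n) = (\<lambda>x. 1 * \<psi> x + 1 * smear (fourier ?\<theta>) (?s n) \<psi> x)"
      using fourier_cutoff[OF \<psi> cutoff(1) _ cutoff(2), of "?s n"] by (simp add: fun_eq_iff)
    then show ?thesis
      using temperedD_linear[OF U(1) test_functions_schwartz[OF \<psi>] smear_schwartz[OF \<psi> fourier_test_schwartz[OF cutoff(1)]], of "?s n" 1 1] by simp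
  qed
  moreover have "(\<lambda>n. U \<psi> + U (smear (fourier ?\<theta>) (?s n) \<psi>)) \<longlonglongrightarrow> U \<psi> + 0"
    by (intro tendsto_add tendsto_const tempered_smear_tendsto_0[OF U(1) \<psi> fourier_test_schwartz[OF cutoff(1)]])
  ultimately show "(\<lambda>n. U (fourier (?f n))) \<longlonglongrightarrow> U \<psi>" by simp
  obtain B where B: "\<And>x::'a. cmod (cutoff x) \<le> B" by (rule test_functions_bounded[OF cutoff(1)], rule that)
  have "(\<lambda>n. \<integral>\<xi>. g \<xi> * ?f n \<xi> \<partial>lborel) \<longlonglongrightarrow> (\<integral>\<xi>. g \<xi> * fourier \<psi> (- \<xi>) \<partial>lborel)"
  proof (rule integral_dominated_convergence[where w = "\<lambda>\<xi>. B * cmod (g \<xi> * fourier \<psi> (- \<xi>))"])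
    show "integrable lborel (\<lambda>\<xi>. B * cmod (g \<xi> * fourier \<psi> (- \<xi>)))" using integrable_norm[OF int] by (intro integrable_mult_right)
    show "AE \<xi> in lborel. (\<lambda>n. g \<xi> * ?f n \<xi>) \<longlonglongrightarrow> g \<xi> * fourier \<psi> (- \<xi>)"
    proof (rule AE_I2)
      fix \<xi> :: 'a
      have "continuous_on UNIV ?\<theta>" by (rule smooth_continuous, rule test_functionsE[OF cutoff(1)])
      moreover have "(\<lambda>n. ?s n *\<^sub>R \<xi>) \<longlonglongrightarrow> 0 *\<^sub>R \<xi>" by (intro tendsto_intros) real_asymp
      ultimately have "(\<lambda>n. ?\<theta> (?s n *\<^sub>R \<xi>)) \<longlonglongrightarrow> ?\<theta> (0 *\<^sub>R \<xi>)" by (intro continuous_on_tendsto_compose[of UNIV ?\<theta>]) auto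
      then have "(\<lambda>n. ?\<theta> (?s n *\<^sub>R \<xi>)) \<longlonglongrightarrow> 1" by (simp add: cutoff(2))
      from tendsto_mult[OF tendsto_const tendsto_mult[OF this tendsto_const], of "g \<xi>" "fourier \<psi> (- \<xi>)"]
      show "(\<lambda>n. g \<xi> * ?f n \<xi>) \<longlonglongrightarrow> g \<xi> * fourier \<psi> (- \<xi>)" by simp
    qed
    show "AE \<xi> in lborel. norm (g \<xi> * ?f n \<xi>) \<le> B * cmod (g \<xi> * fourier \<psi> (- \<xi>))" for n
    proof (rule AE_I2)
      fix \<xi> :: 'a
      show "norm (g \<xi> * ?f n \<xi>) \<le> B * cmod (g \<xi> * fourier \<psi> (- \<xi>))"
        using mult_right_mono[OF B[of "?s n *\<^sub>R \<xi>"], of "cmod (g \<xi> * fourier \<psi> (- \<xi>))"] by (simp add: norm_mult mult_ac)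
    qed
  qed measurable
  then show "(\<lambda>n. U (fourier (?f n))) \<longlonglongrightarrow> (\<integral>\<xi>. g \<xi> * fourier \<psi> (- \<xi>) \<partial>lborel)"
    using is_fourier_funD(3)[OF U(2) f] by simp
qed

section \<open>Sobolev spaces\<close>

lemma borel_measurable_cnj [measurable]:
  assumes [measurable]: "f \<in> borel_measurable M"
  shows "(\<lambda>x. cnj (f x)) \<in> borel_measurable M"
proof -
  have [measurable]: "cnj \<in> borel_measurable borel" by (intro borel_measurable_continuous_onI continuous_intros)
  show ?thesis by measurable
qed

text \<open>For k = 1 the weights of the Sobolev norms of order 1/2 and -1/2 are this function and
  its inverse.\<close>

definition jb :: "'a::euclidean_space \<Rightarrow> real" where "jb \<xi> = sqrt (1 + (norm \<xi>)\<^sup>2)"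

lemma jb_pos [simp]: "jb \<xi> > 0" by (auto simp: jb_def add_pos_nonneg)
lemma jb_nonneg [simp]: "jb \<xi> \<ge> 0" using jb_pos[of \<xi>] by linarith
lemma jb_measurable [measurable]: "jb \<in> borel_measurable borel" unfolding jb_def[abs_def] by measurable
lemma jb_le: "jb \<xi> \<le> 1 + norm \<xi>"
  unfolding jb_def by (rule real_le_lsqrt) (auto simp: power2_sum)
lemma jb_powr: "(1 + (norm \<xi>)\<^sup>2) powr (1/2) = jb \<xi>" "(1 + (norm \<xi>)\<^sup>2) powr (- (1/2)) = inverse (jb \<xi>)"
  by (auto simp: jb_def powr_half_sqrt powr_minus)

text \<open>From |a - b|^2 \<le> 2 |a|^2 + 2 |b|^2; it stands in for the triangle inequality of the
  weighted norms.\<close>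

lemma weighted_sq_diff:
  fixes a b :: "'a \<Rightarrow> complex"
  assumes [measurable]: "a \<in> borel_measurable M" "b \<in> borel_measurable M" "w \<in> borel_measurable M"
    and w: "\<And>x. w x \<ge> (0::real)"
    and ia: "integrable M (\<lambda>x. w x * (cmod (a x))\<^sup>2)" and ib: "integrable M (\<lambda>x. w x * (cmod (b x))\<^sup>2)"
  shows "integrable M (\<lambda>x. w x * (cmod (a x - b x))\<^sup>2)"
    and "(\<integral>x. w x * (cmod (a x - b x))\<^sup>2 \<partial>M) \<le> 2 * (\<integral>x. w x * (cmod (a x))\<^sup>2 \<partial>M) + 2 * (\<integral>x. w x * (cmod (b x))\<^sup>2 \<partial>M)"
proof -
  have le: "w x * (cmod (a x - b x))\<^sup>2 \<le> 2 * (w x * (cmod (a x))\<^sup>2) + 2 * (w x * (cmod (b x))\<^sup>2)" for x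
  proof -
    have "(cmod (a x - b x))\<^sup>2 \<le> (cmod (a x) + cmod (b x))\<^sup>2" by (intro power_mono norm_triangle_ineq4) auto
    also have "\<dots> \<le> 2 * (cmod (a x))\<^sup>2 + 2 * (cmod (b x))\<^sup>2"
      using sum_squares_bound[of "cmod (a x)" "cmod (b x)"] unfolding power2_sum by linarith
    finally have "w x * (cmod (a x - b x))\<^sup>2 \<le> w x * (2 * (cmod (a x))\<^sup>2 + 2 * (cmod (b x))\<^sup>2)" using w by (rule mult_left_mono)
    then show ?thesis by (simp add: algebra_simps)
  qed
  have i: "integrable M (\<lambda>x. 2 * (w x * (cmod (a x))\<^sup>2) + 2 * (w x * (cmod (b x))\<^sup>2))" using ia ib by simp
  show 1: "integrable M (\<lambda>x. w x * (cmod (a x - b x))\<^sup>2)"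
  proof (rule Bochner_Integration.integrable_bound[OF i])
    show "AE x in M. norm (w x * (cmod (a x - b x))\<^sup>2) \<le> norm (2 * (w x * (cmod (a x))\<^sup>2) + 2 * (w x * (cmod (b x))\<^sup>2))"
      unfolding real_norm_def using w by (intro AE_I2 order_trans[OF _ abs_ge_self], subst abs_of_nonneg) (auto intro: le)
  qed measurable
  have "(\<integral>x. w x * (cmod (a x - b x))\<^sup>2 \<partial>M) \<le> (\<integral>x. 2 * (w x * (cmod (a x))\<^sup>2) + 2 * (w x * (cmod (b x))\<^sup>2) \<partial>M)"
    by (rule Bochner_Integration.integral_mono[OF 1 i le])
  then show "(\<integral>x. w x * (cmod (a x - b x))\<^sup>2 \<partial>M) \<le> 2 * (\<integral>x. w x * (cmod (a x))\<^sup>2 \<partial>M) + 2 * (\<integral>x. w x * (cmod (b x))\<^sup>2 \<partial>M)"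
    using ia ib by simp
qed

lemma fourier_fun_eqs:
  fixes g :: "'a::euclidean_space \<Rightarrow> complex" and w :: "'a \<Rightarrow> real"
  assumes u: "is_fourier_fun u g" and [measurable]: "w \<in> borel_measurable borel"
  shows "integrable lborel (\<lambda>\<xi>. w \<xi> * (cmod (fourier_fun u \<xi>))\<^sup>2) \<longleftrightarrow> integrable lborel (\<lambda>\<xi>. w \<xi> * (cmod (g \<xi>))\<^sup>2)"
    and "(\<integral>\<xi>. w \<xi> * (cmod (fourier_fun u \<xi>))\<^sup>2 \<partial>lborel) = (\<integral>\<xi>. w \<xi> * (cmod (g \<xi>))\<^sup>2 \<partial>lborel)"
proof -
  have [measurable]: "g \<in> borel_measurable borel" "fourier_fun u \<in> borel_measurable borel"
    using is_fourier_funD(2)[OF u] is_fourier_funD(2)[OF is_fourier_fun_fourier_fun(1)[OF u]] by auto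
  have ae: "AE \<xi> in lborel. w \<xi> * (cmod (fourier_fun u \<xi>))\<^sup>2 = w \<xi> * (cmod (g \<xi>))\<^sup>2"
    using is_fourier_fun_fourier_fun(2)[OF u] by eventually_elim simp
  show "integrable lborel (\<lambda>\<xi>. w \<xi> * (cmod (fourier_fun u \<xi>))\<^sup>2) \<longleftrightarrow> integrable lborel (\<lambda>\<xi>. w \<xi> * (cmod (g \<xi>))\<^sup>2)"
    by (rule integrable_cong_AE) (use ae in auto)
  show "(\<integral>\<xi>. w \<xi> * (cmod (fourier_fun u \<xi>))\<^sup>2 \<partial>lborel) = (\<integral>\<xi>. w \<xi> * (cmod (g \<xi>))\<^sup>2 \<partial>lborel)"
    by (rule integral_cong_AE) (use ae in auto)
qed

lemma sobolevD:
  assumes "u \<in> sobolev s"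
  shows "u \<in> tempered" "is_fourier_fun u (fourier_fun u)" "fourier_fun u \<in> borel_measurable borel"
    and "s = 1/2 \<Longrightarrow> integrable lborel (\<lambda>\<xi>. jb \<xi> * (cmod (fourier_fun u \<xi>))\<^sup>2)"
    and "s = - (1/2) \<Longrightarrow> integrable lborel (\<lambda>\<xi>. inverse (jb \<xi>) * (cmod (fourier_fun u \<xi>))\<^sup>2)"
proof -
  obtain g where g: "is_fourier_fun u g" using assms unfolding sobolev_def by blast
  show "u \<in> tempered" using assms unfolding sobolev_def by blast
  show *: "is_fourier_fun u (fourier_fun u)" by (rule is_fourier_fun_fourier_fun(1)[OF g])
  show "fourier_fun u \<in> borel_measurable borel" by (rule is_fourier_funD(2)[OF *])
  have i: "integrable lborel (\<lambda>\<xi>. (1 + (norm \<xi>)\<^sup>2) powr s * (cmod (fourier_fun u \<xi>))\<^sup>2)"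
    using assms unfolding sobolev_def by blast
  show "s = 1/2 \<Longrightarrow> integrable lborel (\<lambda>\<xi>. jb \<xi> * (cmod (fourier_fun u \<xi>))\<^sup>2)"
    using i by (simp only: jb_powr)
  show "s = - (1/2) \<Longrightarrow> integrable lborel (\<lambda>\<xi>. inverse (jb \<xi>) * (cmod (fourier_fun u \<xi>))\<^sup>2)"
    using i by (simp only: jb_powr)
qed

lemma sobolev_half:
  assumes g: "is_fourier_fun u g"
  shows "u \<in> tempered \<Longrightarrow> integrable lborel (\<lambda>\<xi>. jb \<xi> * (cmod (g \<xi>))\<^sup>2) \<Longrightarrow> u \<in> sobolev (1/2)"
    and "sobolev_norm 1 (1/2) u = sqrt (\<integral>\<xi>. jb \<xi> * (cmod (g \<xi>))\<^sup>2 \<partial>lborel)"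
  using g fourier_fun_eqs[OF g, of jb] unfolding sobolev_def sobolev_norm_def one_power2 jb_powr by auto

lemma sobolev_minus_half:
  assumes g: "is_fourier_fun u g"
  shows "u \<in> tempered \<Longrightarrow> integrable lborel (\<lambda>\<xi>. inverse (jb \<xi>) * (cmod (g \<xi>))\<^sup>2) \<Longrightarrow> u \<in> sobolev (- (1/2))"
    and "sobolev_norm 1 (- (1/2)) u = sqrt (\<integral>\<xi>. inverse (jb \<xi>) * (cmod (g \<xi>))\<^sup>2 \<partial>lborel)"
  using g fourier_fun_eqs[OF g, of "\<lambda>\<xi>. inverse (jb \<xi>)"] unfolding sobolev_def sobolev_norm_def one_power2 jb_powr by auto

lemma schwartz_weighted_sq_integrable:
  fixes f :: "'a::euclidean_space \<Rightarrow> complex" and w :: "'a \<Rightarrow> real"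
  assumes f: "f \<in> schwartz" and [measurable]: "w \<in> borel_measurable borel"
    and w: "\<And>\<xi>. 0 \<le> w \<xi>" "\<And>\<xi>. w \<xi> \<le> K * (1 + norm \<xi>)"
  shows "integrable lborel (\<lambda>\<xi>. w \<xi> * (cmod (f \<xi>))\<^sup>2)"
proof -
  obtain M where M: "\<And>x. (1 + norm x) ^ 0 * cmod (f x) \<le> M" by (rule schwartz_bound[OF f], rule that)
  have [measurable]: "f \<in> borel_measurable borel" by (rule schwartz_measurable[OF f])
  have "integrable lborel (\<lambda>\<xi>. K * M * ((1 + norm \<xi>) ^ 1 * cmod (f \<xi>)))"
    using schwartz_integrable_weight[OF f, of 1] by simp
  then show ?thesis
  proof (rule Bochner_Integration.integrable_bound)
    show "AE \<xi> in lborel. norm (w \<xi> * (cmod (f \<xi>))\<^sup>2) \<le> norm (K * M * ((1 + norm \<xi>) ^ 1 * cmod (f \<xi>)))"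
      unfolding real_norm_def
    proof (intro AE_I2 order_trans[OF _ abs_ge_self], subst abs_of_nonneg)
      fix \<xi> :: 'a
      have "w \<xi> * cmod (f \<xi>) \<le> (K * (1 + norm \<xi>)) * M" using w[of \<xi>] M[of \<xi>] by (intro mult_mono) auto
      from mult_right_mono[OF this, of "cmod (f \<xi>)"]
      show "w \<xi> * (cmod (f \<xi>))\<^sup>2 \<le> K * M * ((1 + norm \<xi>) ^ 1 * cmod (f \<xi>))" by (simp add: power2_eq_square mult_ac)
    qed (simp add: w)
  qed measurable
qed

section \<open>Test functions in the Sobolev spaces and approximation by them\<close>

lemma test_sobolev: 
  assumes \<phi>: "\<phi> \<in> test_functions \<Omega>"
  shows "tempered_of_fun \<phi> \<in> sobolev (1/2)" "integrable lborel (\<lambda>\<xi>. jb \<xi> * (cmod (fourier \<phi> \<xi>))\<^sup>2)"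
proof -
  show "integrable lborel (\<lambda>\<xi>. jb \<xi> * (cmod (fourier \<phi> \<xi>))\<^sup>2)"
    by (rule schwartz_weighted_sq_integrable[OF fourier_test_schwartz[OF \<phi>], where K = 1]) (use jb_le in auto)
  then show "tempered_of_fun \<phi> \<in> sobolev (1/2)"
    by (intro sobolev_half(1)[OF is_fourier_fun_test[OF \<phi>]] tempered_of_fun_tempered[OF \<phi>])
qed

lemma is_fourier_fun_diff:
  assumes "is_fourier_fun u g" "is_fourier_fun v h"
  shows "is_fourier_fun (\<lambda>f. u f - v f) (\<lambda>\<xi>. g \<xi> - h \<xi>)"
  using is_fourier_fun_linear[OF assms, of 1 "-1"] by simp

lemma tempered_diff: "u \<in> tempered \<Longrightarrow> v \<in> tempered \<Longrightarrow> (\<lambda>f. u f - v f) \<in> tempered"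
  using tempered_linear[of u v 1 "-1"] by simp

lemma sobolev_tildeD: "u \<in> sobolev_tilde s \<Omega> \<Longrightarrow> u \<in> sobolev s"
  unfolding sobolev_tilde_def by blast

lemma sobolev_tilde_approx:
  assumes u: "u \<in> sobolev_tilde (1/2) \<Omega>" and e: "e > 0"
  obtains \<phi> where "\<phi> \<in> test_functions \<Omega>" "(\<integral>\<xi>. jb \<xi> * (cmod (fourier_fun u \<xi> - fourier \<phi> \<xi>))\<^sup>2 \<partial>lborel) < e"
proof -
  have "sqrt e > 0" using e by simp
  then obtain \<phi> where \<phi>: "\<phi> \<in> test_functions \<Omega>" "sobolev_norm 1 (1/2) (\<lambda>f. u f - tempered_of_fun \<phi> f) < sqrt e"
    using u unfolding sobolev_tilde_def by blast
  have "is_fourier_fun (\<lambda>f. u f - tempered_of_fun \<phi> f) (\<lambda>\<xi>. fourier_fun u \<xi> - fourier \<phi> \<xi>)"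
    by (intro is_fourier_fun_diff sobolevD(2)[OF sobolev_tildeD[OF u]] is_fourier_fun_test[OF \<phi>(1)])
  from sobolev_half(2)[OF this] \<phi>(2) show ?thesis by (intro that[OF \<phi>(1)]) simp
qed

lemma sobolev_tilde_approx_integrable:
  assumes u: "u \<in> sobolev (1/2)" and \<phi>: "\<phi> \<in> test_functions \<Omega>"
  shows "integrable lborel (\<lambda>\<xi>. jb \<xi> * (cmod (fourier_fun u \<xi> - fourier \<phi> \<xi>))\<^sup>2)"
  by (rule weighted_sq_diff(1)[OF _ _ _ _ sobolevD(4)[OF u refl] test_sobolev(2)[OF \<phi>]])
    (use sobolevD(3)[OF u] is_fourier_funD(2)[OF is_fourier_fun_test[OF \<phi>]] in simp_all)

lemma sobolev_tilde_diff_test: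
  assumes u: "u \<in> sobolev_tilde (1/2) \<Omega>" and \<phi>: "\<phi> \<in> test_functions \<Omega>"
  shows "(\<lambda>f. u f - tempered_of_fun \<phi> f) \<in> sobolev_tilde (1/2) \<Omega>"
  unfolding sobolev_tilde_def
proof (intro CollectI conjI allI impI)
  note u' = sobolev_tildeD[OF u]
  have F: "is_fourier_fun (\<lambda>f. u f - tempered_of_fun \<phi> f) (\<lambda>\<xi>. fourier_fun u \<xi> - fourier \<phi> \<xi>)"
    by (intro is_fourier_fun_diff sobolevD(2)[OF u'] is_fourier_fun_test[OF \<phi>])
  show "(\<lambda>f. u f - tempered_of_fun \<phi> f) \<in> sobolev (1/2)"
    by (rule sobolev_half(1)[OF F]) (intro tempered_diff sobolevD(1)[OF u'] tempered_of_fun_tempered[OF \<phi>] sobolev_tilde_approx_integrable[OF u' \<phi>])+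
  fix e :: real assume "e > 0"
  then obtain \<psi> where \<psi>: "\<psi> \<in> test_functions \<Omega>" "sobolev_norm 1 (1/2) (\<lambda>f. u f - tempered_of_fun \<psi> f) < e"
    using u unfolding sobolev_tilde_def by blast
  have "(\<lambda>f. u f - tempered_of_fun \<phi> f - tempered_of_fun (\<lambda>x. \<psi> x - \<phi> x) f) = (\<lambda>f. u f - tempered_of_fun \<psi> f)"
    by (simp add: tempered_of_fun_diff[OF \<psi>(1) \<phi>])
  then show "\<exists>\<psi>\<in>test_functions \<Omega>. sobolev_norm 1 (1/2) (\<lambda>f. u f - tempered_of_fun \<phi> f - tempered_of_fun \<psi> f) < e"
    using \<psi>(2) by (intro bexI[OF _ test_functions_diff[OF \<psi>(1) \<phi>]]) simp
qed

lemma test_sobolev_tilde: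
  assumes \<phi>: "\<phi> \<in> test_functions \<Omega>"
  shows "tempered_of_fun \<phi> \<in> sobolev_tilde (1/2) \<Omega>"
  unfolding sobolev_tilde_def
proof (intro CollectI conjI allI impI)
  show "tempered_of_fun \<phi> \<in> sobolev (1/2)" by (rule test_sobolev(1)[OF \<phi>])
  fix e :: real assume "e > 0"
  then show "\<exists>\<psi>\<in>test_functions \<Omega>. sobolev_norm 1 (1/2) (\<lambda>f. tempered_of_fun \<phi> f - tempered_of_fun \<psi> f) < e"
    using sobolev_half(2)[OF is_fourier_fun_diff[OF is_fourier_fun_test[OF \<phi>] is_fourier_fun_test[OF \<phi>]]]
    by (intro bexI[OF _ \<phi>]) simp
qed

section \<open>The pairing of the orders -1/2 and 1/2\<close>

lemma sobolev_pairing: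
  assumes U: "U \<in> sobolev (- (1/2))" and [measurable]: "b \<in> borel_measurable borel"
    and b: "integrable lborel (\<lambda>\<xi>. jb \<xi> * (cmod (b \<xi>))\<^sup>2)"
  shows "integrable lborel (\<lambda>\<xi>. fourier_fun U \<xi> * b \<xi>)"
    and "cmod (\<integral>\<xi>. fourier_fun U \<xi> * b \<xi> \<partial>lborel) \<le> sobolev_norm 1 (- (1/2)) U * sqrt (\<integral>\<xi>. jb \<xi> * (cmod (b \<xi>))\<^sup>2 \<partial>lborel)"
proof -
  have [measurable]: "fourier_fun U \<in> borel_measurable borel" by (rule sobolevD(3)[OF U])
  note cs = weighted_cauchy_schwarz[OF _ _ _ _ sobolevD(5)[OF U refl] b]
  show "integrable lborel (\<lambda>\<xi>. fourier_fun U \<xi> * b \<xi>)" by (rule cs(1)) simp_all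
  show "cmod (\<integral>\<xi>. fourier_fun U \<xi> * b \<xi> \<partial>lborel) \<le> sobolev_norm 1 (- (1/2)) U * sqrt (\<integral>\<xi>. jb \<xi> * (cmod (b \<xi>))\<^sup>2 \<partial>lborel)"
    unfolding sobolev_minus_half(2)[OF sobolevD(2)[OF U]] by (rule cs(2)) simp_all
qed

text \<open>The link from frequency integrals back to distributions: the pairing with a test
  function on \<open>\<Omega>\<close> depends only on a value of \<open>U\<close> that its
  restriction to \<open>\<Omega>\<close> determines.\<close>

lemma sobolev_test_pairing:
  assumes U: "U \<in> sobolev (- (1/2))" and \<phi>: "\<phi> \<in> test_functions \<Omega>"
  shows "U (\<lambda>x. cnj (\<phi> x)) = (\<integral>\<xi>. fourier_fun U \<xi> * cnj (fourier \<phi> \<xi>) \<partial>lborel)"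
proof -
  have [measurable]: "fourier \<phi> \<in> borel_measurable borel" using is_fourier_funD(2)[OF is_fourier_fun_test[OF \<phi>]] .
  have i: "integrable lborel (\<lambda>\<xi>. fourier_fun U \<xi> * cnj (fourier \<phi> \<xi>))"
    using test_sobolev(2)[OF \<phi>] by (intro sobolev_pairing(1)[OF U]) auto
  have "fourier (\<lambda>x. cnj (\<phi> x)) (- \<xi>) = cnj (fourier \<phi> \<xi>)" for \<xi> by (simp add: fourier_cnj)
  then show ?thesis
    using tempered_test_representation[OF sobolevD(1,2)[OF U] test_functions_cnj[OF \<phi>]] i by simp
qed

text \<open>Two extensions agree on test functions, hence by density in the pairing with all of the space.\<close>

lemma duality_eq:
  assumes U: "U \<in> sobolev (- (1/2))" and v: "v \<in> sobolev_tilde (1/2) \<Omega>"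
  shows "duality (1/2) \<Omega> (restrict_distr \<Omega> U) v = (\<integral>\<xi>. fourier_fun U \<xi> * cnj (fourier_fun v \<xi>) \<partial>lborel)"
proof -
  define W where "W = (SOME W. W \<in> sobolev (- (1/2)) \<and> restrict_distr \<Omega> W = restrict_distr \<Omega> U)"
  have W: "W \<in> sobolev (- (1/2)) \<and> restrict_distr \<Omega> W = restrict_distr \<Omega> U"
    unfolding W_def by (rule someI[of _ U]) (simp add: U)
  then have WS: "W \<in> sobolev (- (1/2))" by simp
  note v' = sobolev_tildeD[OF v]
  let ?v = "fourier_fun v"
  have [measurable]: "?v \<in> borel_measurable borel" by (rule sobolevD(3)[OF v'])
  let ?P = "\<lambda>U b. \<integral>\<xi>. fourier_fun U \<xi> * cnj (b \<xi>) \<partial>lborel"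
  let ?N = "sobolev_norm 1 (- (1/2)) U + sobolev_norm 1 (- (1/2)) W"
  have "cmod (?P U ?v - ?P W ?v) \<le> 0"
  proof (rule field_le_epsilon)
    fix e :: real assume e: "e > 0"
    have N0: "?N \<ge> 0" by (simp add: sobolev_norm_def)
    \<comment> \<open>An accuracy for which both error pairings together are at most
      \<open>?N * (e / (?N + 1))\<close>, hence below \<open>e\<close>; the summand 1 avoids a zero
      denominator.\<close>
    have "(e / (?N + 1))\<^sup>2 > 0" using e N0 by simp
    then obtain \<phi> where \<phi>: "\<phi> \<in> test_functions \<Omega>" "(\<integral>\<xi>. jb \<xi> * (cmod (?v \<xi> - fourier \<phi> \<xi>))\<^sup>2 \<partial>lborel) < (e / (?N + 1))\<^sup>2"
      by (rule sobolev_tilde_approx[OF v])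
    have [measurable]: "fourier \<phi> \<in> borel_measurable borel" using is_fourier_funD(2)[OF is_fourier_fun_test[OF \<phi>(1)]] .
    have i\<phi>: "integrable lborel (\<lambda>\<xi>. jb \<xi> * (cmod (cnj (fourier \<phi> \<xi>)))\<^sup>2)" using test_sobolev(2)[OF \<phi>(1)] by simp
    have id: "integrable lborel (\<lambda>\<xi>. jb \<xi> * (cmod (cnj (?v \<xi> - fourier \<phi> \<xi>)))\<^sup>2)"
      using sobolev_tilde_approx_integrable[OF v' \<phi>(1)] unfolding complex_mod_cnj .
    have split: "?P X ?v = X (\<lambda>x. cnj (\<phi> x)) + ?P X (\<lambda>\<xi>. ?v \<xi> - fourier \<phi> \<xi>)" if X: "X \<in> sobolev (- (1/2))" for X
    proof -
      have "?P X ?v = (\<integral>\<xi>. fourier_fun X \<xi> * cnj (fourier \<phi> \<xi>) + fourier_fun X \<xi> * cnj (?v \<xi> - fourier \<phi> \<xi>) \<partial>lborel)"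
        by (simp add: algebra_simps)
      also have "\<dots> = ?P X (fourier \<phi>) + ?P X (\<lambda>\<xi>. ?v \<xi> - fourier \<phi> \<xi>)"
        by (rule Bochner_Integration.integral_add[OF sobolev_pairing(1)[OF X _ i\<phi>] sobolev_pairing(1)[OF X _ id]]) measurable
      finally show ?thesis unfolding sobolev_test_pairing[OF X \<phi>(1)] .
    qed
    have bd: "cmod (?P X (\<lambda>\<xi>. ?v \<xi> - fourier \<phi> \<xi>)) \<le> sobolev_norm 1 (- (1/2)) X * (e / (?N + 1))" if X: "X \<in> sobolev (- (1/2))" for X
    proof -
      have "sqrt (\<integral>\<xi>. jb \<xi> * (cmod (?v \<xi> - fourier \<phi> \<xi>))\<^sup>2 \<partial>lborel) \<le> sqrt ((e / (?N + 1))\<^sup>2)"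
        using \<phi>(2) by (intro real_sqrt_le_mono) simp
      also have "\<dots> = e / (?N + 1)" using e N0 by simp
      finally have 1: "sqrt (\<integral>\<xi>. jb \<xi> * (cmod (?v \<xi> - fourier \<phi> \<xi>))\<^sup>2 \<partial>lborel) \<le> e / (?N + 1)" .
      have "cmod (?P X (\<lambda>\<xi>. ?v \<xi> - fourier \<phi> \<xi>)) \<le> sobolev_norm 1 (- (1/2)) X * sqrt (\<integral>\<xi>. jb \<xi> * (cmod (cnj (?v \<xi> - fourier \<phi> \<xi>)))\<^sup>2 \<partial>lborel)"
        by (rule sobolev_pairing(2)[OF X _ id]) measurable
      also have "\<dots> \<le> sobolev_norm 1 (- (1/2)) X * (e / (?N + 1))"
        using 1 unfolding complex_mod_cnj by (intro mult_left_mono) (auto simp: sobolev_norm_def)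
      finally show ?thesis .
    qed
    have "(\<lambda>x. cnj (\<phi> x)) \<in> test_functions \<Omega>" by (rule test_functions_cnj[OF \<phi>(1)])
    then have "W (\<lambda>x. cnj (\<phi> x)) = U (\<lambda>x. cnj (\<phi> x))"
      using fun_cong[OF conjunct2[OF W], of "\<lambda>x. cnj (\<phi> x)"] by (simp add: restrict_distr_def)
    then have "?P U ?v - ?P W ?v = ?P U (\<lambda>\<xi>. ?v \<xi> - fourier \<phi> \<xi>) - ?P W (\<lambda>\<xi>. ?v \<xi> - fourier \<phi> \<xi>)"
      using split[OF U] split[OF WS] by simp
    then have "cmod (?P U ?v - ?P W ?v) \<le> cmod (?P U (\<lambda>\<xi>. ?v \<xi> - fourier \<phi> \<xi>)) + cmod (?P W (\<lambda>\<xi>. ?v \<xi> - fourier \<phi> \<xi>))"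
      by (simp only: norm_triangle_ineq4)
    also have "\<dots> \<le> ?N * (e / (?N + 1))" unfolding distrib_right by (intro add_mono bd U WS)
    also have "\<dots> \<le> e" using e N0 by (simp add: field_simps)
    finally show "cmod (?P U ?v - ?P W ?v) \<le> 0 + e" by simp
  qed
  then have "?P W ?v = ?P U ?v" by simp
  then show ?thesis unfolding duality_def Let_def W_def[symmetric] .
qed

lemma sobolev_on_norm_le:
  assumes "U \<in> sobolev s" shows "sobolev_on_norm s \<Omega> (restrict_distr \<Omega> U) \<le> sobolev_norm 1 s U"
  unfolding sobolev_on_norm_def
  by (rule cInf_lower) (use assms in \<open>auto simp: sobolev_norm_def intro!: bdd_belowI[of _ 0]\<close>)

text \<open>The quotient norm is an infimum, so the extension comes with an arbitrarily small
  excess.\<close>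

lemma sobolev_on_norm_approx:
  assumes u: "u \<in> sobolev_on s \<Omega>" and e: "e > 0"
  obtains U where "U \<in> sobolev s" "restrict_distr \<Omega> U = u" "sobolev_norm 1 s U < sobolev_on_norm s \<Omega> u + e"
proof -
  have ne: "sobolev_norm 1 s ` {U \<in> sobolev s. restrict_distr \<Omega> U = u} \<noteq> {}"
    using u unfolding sobolev_on_def by auto
  have "Inf (sobolev_norm 1 s ` {U \<in> sobolev s. restrict_distr \<Omega> U = u}) < sobolev_on_norm s \<Omega> u + e"
    using e by (simp add: sobolev_on_norm_def)
  from cInf_lessD[OF ne this] show ?thesis by (elim bexE imageE) (auto intro: that)
qed

text \<open>The inverse transform of a function, as a distribution. Transforming twice reflects the
  argument, so the reflection here is what makes \<open>g\<close> the transform.\<close>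

definition distr_of_fourier :: "('a::euclidean_space \<Rightarrow> complex) \<Rightarrow> 'a distr" where
  "distr_of_fourier g = (\<lambda>f. if f \<in> schwartz then (\<integral>\<xi>. g \<xi> * fourier f (- \<xi>) \<partial>lborel) else 0)"

text \<open>Continuity comes from the weighted Cauchy-Schwarz inequality and the decay of transforms
  of Schwartz functions. The decay exponent \<open>DIM('a) + 1\<close>, once squared, spends 2 on
  \<open>jb\<close> and leaves the integrable exponent \<open>2 * DIM('a)\<close>.\<close>

lemma distr_of_fourier:
  fixes g :: "'a::euclidean_space \<Rightarrow> complex"
  assumes [measurable]: "g \<in> borel_measurable borel"
    and g: "integrable lborel (\<lambda>\<xi>. inverse (jb \<xi>) * (cmod (g \<xi>))\<^sup>2)"
  shows "distr_of_fourier g \<in> sobolev (- (1/2))" "is_fourier_fun (distr_of_fourier g) g"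
proof -
  let ?m = "DIM('a)" let ?K = "DIM('a) + 1" let ?N = "max (DIM('a) + 1) (2 * DIM('a))"
  let ?C = "(1 + real DIM('a)) ^ ?K * fourier_const TYPE('a) * decay_integral TYPE('a)"
  let ?A = "\<integral>\<xi>. inverse (jb \<xi>) * (cmod (g \<xi>))\<^sup>2 \<partial>lborel"
  have key: "integrable lborel (\<lambda>\<xi>. g \<xi> * fourier f (- \<xi>))"
    "cmod (\<integral>\<xi>. g \<xi> * fourier f (- \<xi>) \<partial>lborel) \<le> sqrt ?A * sqrt (decay_integral TYPE('a)) * K"
    if f: "f \<in> schwartz" and K: "\<And>\<xi>. (1 + norm \<xi>) ^ ?K * cmod (fourier f \<xi>) \<le> K" for f K
  proof -
    have [measurable]: "f \<in> borel_measurable borel" by (rule schwartz_measurable[OF f])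
    have K0: "K \<ge> 0" using order_trans[OF _ K[of 0]] by simp
    have le: "jb \<xi> * (cmod (fourier f (- \<xi>)))\<^sup>2 \<le> K\<^sup>2 * inverse ((1 + norm \<xi>) ^ (2 * ?m))" for \<xi> :: 'a
    proof -
      have p: "1 + norm \<xi> > 0" by (simp add: add_pos_nonneg)
      have "jb \<xi> * (cmod (fourier f (- \<xi>)))\<^sup>2 * (1 + norm \<xi>) ^ (2 * ?m) \<le> (1 + norm \<xi>)\<^sup>2 * (cmod (fourier f (- \<xi>)))\<^sup>2 * (1 + norm \<xi>) ^ (2 * ?m)"
      proof (intro mult_right_mono)
        have "(1 + norm \<xi>) * 1 \<le> (1 + norm \<xi>) * (1 + norm \<xi>)" by (intro mult_left_mono) auto
        then show "jb \<xi> \<le> (1 + norm \<xi>)\<^sup>2" using jb_le[of \<xi>] by (simp add: power2_eq_square)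
      qed auto
      also have "\<dots> = ((1 + norm (- \<xi>)) ^ ?K * cmod (fourier f (- \<xi>)))\<^sup>2"
        by (simp add: power_even_eq power_mult_distrib)
      also have "\<dots> \<le> K\<^sup>2" by (intro power_mono K) auto
      finally show ?thesis using p by (simp add: field_simps)
    qed
    have i: "integrable lborel (\<lambda>\<xi>::'a. K\<^sup>2 * inverse ((1 + norm \<xi>) ^ (2 * ?m)))"
      using integrable_inverse_one_plus_norm[where 'a = 'a] by simp
    have i2: "integrable lborel (\<lambda>\<xi>. jb \<xi> * (cmod (fourier f (- \<xi>)))\<^sup>2)"
    proof (rule Bochner_Integration.integrable_bound[OF i])
      show "AE \<xi> in lborel. norm (jb \<xi> * (cmod (fourier f (- \<xi>)))\<^sup>2) \<le> norm (K\<^sup>2 * inverse ((1 + norm \<xi>) ^ (2 * ?m)))"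
        unfolding real_norm_def by (intro AE_I2 order_trans[OF _ abs_ge_self], subst abs_of_nonneg) (auto intro: le)
    qed measurable
    show "integrable lborel (\<lambda>\<xi>. g \<xi> * fourier f (- \<xi>))"
      by (rule weighted_cauchy_schwarz(1)[OF _ _ _ _ g i2]) auto
    have "(\<integral>\<xi>. jb \<xi> * (cmod (fourier f (- \<xi>)))\<^sup>2 \<partial>lborel) \<le> K\<^sup>2 * decay_integral TYPE('a)"
      using Bochner_Integration.integral_mono[OF i2 i le] by (simp add: decay_integral_def)
    then have "sqrt (\<integral>\<xi>. jb \<xi> * (cmod (fourier f (- \<xi>)))\<^sup>2 \<partial>lborel) \<le> sqrt (K\<^sup>2 * decay_integral TYPE('a))" by simp
    also have "\<dots> = sqrt (decay_integral TYPE('a)) * K" using K0 by (simp add: real_sqrt_mult)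
    finally have "sqrt ?A * sqrt (\<integral>\<xi>. jb \<xi> * (cmod (fourier f (- \<xi>)))\<^sup>2 \<partial>lborel) \<le> sqrt ?A * (sqrt (decay_integral TYPE('a)) * K)"
      by (intro mult_left_mono) (auto intro!: integral_nonneg_AE AE_I2)
    moreover have "cmod (\<integral>\<xi>. g \<xi> * fourier f (- \<xi>) \<partial>lborel) \<le> sqrt ?A * sqrt (\<integral>\<xi>. jb \<xi> * (cmod (fourier f (- \<xi>)))\<^sup>2 \<partial>lborel)"
      by (rule weighted_cauchy_schwarz(2)[OF _ _ _ _ g i2]) auto
    ultimately show "cmod (\<integral>\<xi>. g \<xi> * fourier f (- \<xi>) \<partial>lborel) \<le> sqrt ?A * sqrt (decay_integral TYPE('a)) * K"
      by (simp add: mult.assoc)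
  qed
  have int: "integrable lborel (\<lambda>\<xi>. g \<xi> * fourier f (- \<xi>))" if f: "f \<in> schwartz" for f
  proof -
    obtain M where M: "\<And>\<xi>. (1 + norm \<xi>) ^ ?K * cmod (fourier f \<xi>) \<le> M" by (rule fourier_schwartz_decay[OF f], rule that)
    show ?thesis by (rule key(1)[OF f M])
  qed
  have T: "distr_of_fourier g \<in> tempered"
  proof (rule temperedI[where C = "sqrt ?A * sqrt (decay_integral TYPE('a)) * ?C" and N = ?N])
    show "distr_of_fourier g f = 0" if "f \<notin> schwartz" for f using that by (simp add: distr_of_fourier_def)
    show "distr_of_fourier g (\<lambda>x. a * f x + b * h x) = a * distr_of_fourier g f + b * distr_of_fourier g h"
      if fh: "f \<in> schwartz" "h \<in> schwartz" for f h a b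
    proof -
      have ff: "fourier (\<lambda>x. a * f x + b * h x) \<xi> = a * fourier f \<xi> + b * fourier h \<xi>" for \<xi>
        using schwartz_integrable[OF fh(1)] schwartz_integrable[OF fh(2)] by (subst fourier_add) (auto simp: fourier_mult)
      have "(\<integral>\<xi>. g \<xi> * fourier (\<lambda>x. a * f x + b * h x) (- \<xi>) \<partial>lborel)
         = (\<integral>\<xi>. a * (g \<xi> * fourier f (- \<xi>)) + b * (g \<xi> * fourier h (- \<xi>)) \<partial>lborel)"
        unfolding ff by (simp add: algebra_simps)
      also have "\<dots> = a * (\<integral>\<xi>. g \<xi> * fourier f (- \<xi>) \<partial>lborel) + b * (\<integral>\<xi>. g \<xi> * fourier h (- \<xi>) \<partial>lborel)"
        using int[OF fh(1)] int[OF fh(2)] by simp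
      finally show ?thesis using fh schwartz_linear(1)[OF fh] by (simp add: distr_of_fourier_def)
    qed
    fix f :: "'a \<Rightarrow> complex" and M assume f: "f \<in> schwartz" and M: "seminorm_le ?N f M"
    have "(1 + norm \<xi>) ^ ?K * cmod (fourier f \<xi>) \<le> ?C * M" for \<xi>
      by (rule fourier_decay[OF f seminorm_leD[OF M]])
    from key(2)[OF f this] f show "cmod (distr_of_fourier g f) \<le> sqrt ?A * sqrt (decay_integral TYPE('a)) * ?C * M"
      by (simp add: distr_of_fourier_def mult_ac)
  qed
  show F: "is_fourier_fun (distr_of_fourier g) g"
  proof (rule is_fourier_funI)
    show "locally_integrable g"
      unfolding locally_integrable_def set_integrable_def
    proof (intro allI impI)
      fix S :: "'a set" assume S: "compact S"
      then have [measurable]: "S \<in> sets borel" by (simp add: borel_compact)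
      have "continuous_on S jb" unfolding jb_def[abs_def] by (intro continuous_intros)
      then have "integrable lborel (\<lambda>x. indicator S x *\<^sub>R jb x)" using S by (rule borel_integrable_compact[rotated])
      then have i: "integrable lborel (\<lambda>x. jb x * (cmod (indicator S x))\<^sup>2)"
        by (rule Bochner_Integration.integrable_cong[THEN iffD1, rotated -1]) (auto simp: indicator_def)
      have "integrable lborel (\<lambda>x. g x * indicator S x)"
        by (rule weighted_cauchy_schwarz(1)[OF _ _ _ _ g i]) auto
      then show "integrable lborel (\<lambda>x. indicator S x *\<^sub>R g x)"
        by (rule Bochner_Integration.integrable_cong[THEN iffD1, rotated -1]) (auto simp: indicator_def)
    qed
    fix f :: "'a \<Rightarrow> complex" assume f: "f \<in> test_functions UNIV"
    show "distr_of_fourier g (fourier f) = (\<integral>\<xi>. g \<xi> * f \<xi> \<partial>lborel)"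
      using fourier_test_schwartz[OF f] by (simp add: distr_of_fourier_def fourier_inversion_test[OF f])
  qed
  show "distr_of_fourier g \<in> sobolev (- (1/2))" by (rule sobolev_minus_half(1)[OF F T g])
qed

section \<open>The coercivity inequality on the Fourier side\<close>

text \<open>\<open>Wk\<close> is the weight of the k-dependent norm of order 1/2, and
  \<open>Dk\<close> is twice the modulus of the symbol, which is what the form controls. The two are
  comparable away from the sphere of radius \<open>k\<close>.\<close>

definition Wk :: "real \<Rightarrow> 'a::euclidean_space \<Rightarrow> real" where "Wk k \<xi> = sqrt (k\<^sup>2 + (norm \<xi>)\<^sup>2)"
definition Dk :: "real \<Rightarrow> 'a::euclidean_space \<Rightarrow> real" where "Dk k \<xi> = sqrt \<bar>k\<^sup>2 - (norm \<xi>)\<^sup>2\<bar>"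

lemma Wk_measurable [measurable]: "Wk k \<in> borel_measurable borel" unfolding Wk_def[abs_def] by measurable
lemma Dk_measurable [measurable]: "Dk k \<in> borel_measurable borel" unfolding Dk_def[abs_def] by measurable
lemma Wk_nonneg [simp]: "Wk k \<xi> \<ge> 0" by (simp add: Wk_def)
lemma Dk_nonneg [simp]: "Dk k \<xi> \<ge> 0" by (simp add: Dk_def)
lemma Dk_le_Wk: "Dk k \<xi> \<le> Wk k \<xi>" unfolding Dk_def Wk_def by (rule real_sqrt_le_mono) (simp add: abs_le_iff)

lemma Wk_le_jb: assumes "k > 0" shows "Wk k \<xi> \<le> (1 + k) * jb \<xi>"
proof -
  have "k\<^sup>2 + (norm \<xi>)\<^sup>2 \<le> (1 + k)\<^sup>2 * (1 + (norm \<xi>)\<^sup>2)"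
    using assms by (simp add: power2_eq_square algebra_simps)
  then have "Wk k \<xi> \<le> sqrt ((1 + k)\<^sup>2 * (1 + (norm \<xi>)\<^sup>2))" unfolding Wk_def by (rule real_sqrt_le_mono)
  also have "\<dots> = (1 + k) * jb \<xi>" using assms by (simp add: jb_def real_sqrt_mult)
  finally show ?thesis .
qed

section \<open>Frequency shifts and the mass near the critical sphere\<close>

lemma smooth_exp_inner: "smooth (\<lambda>x::'a::euclidean_space. exp (- \<i> * of_real (\<zeta> \<bullet> x)))"
proof (rule smooth_coinduct[where S = "{\<lambda>x. a * exp (- \<i> * of_real (\<zeta> \<bullet> x)) | a. True}"])
  show "(\<lambda>x::'a. exp (- \<i> * of_real (\<zeta> \<bullet> x))) \<in> {\<lambda>x. a * exp (- \<i> * of_real (\<zeta> \<bullet> x)) | a. True}"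
    by (intro CollectI exI[of _ 1]) simp
  fix g :: "'a \<Rightarrow> complex" assume "g \<in> {\<lambda>x. a * exp (- \<i> * of_real (\<zeta> \<bullet> x)) | a. True}"
  then obtain a where g: "g = (\<lambda>x. a * exp (- \<i> * of_real (\<zeta> \<bullet> x)))" by blast
  have D: "(g has_derivative (\<lambda>v. a * (exp (- \<i> * of_real (\<zeta> \<bullet> x)) * (- \<i> * of_real (\<zeta> \<bullet> v))))) (at x)" for x
  proof -
    have "((\<lambda>x. - \<i> * complex_of_real (\<zeta> \<bullet> x)) has_derivative (\<lambda>v. - \<i> * of_real (\<zeta> \<bullet> v))) (at x)"
      by (intro bounded_linear_imp_has_derivative bounded_linear_const_mult
          bounded_linear_compose[OF bounded_linear_of_real] bounded_linear_inner_right)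
    from has_derivative_mult_right[OF has_derivative_compose[OF this DERIV_exp[unfolded has_field_derivative_def]], of a]
    show ?thesis unfolding g .
  qed
  show "g differentiable at x" for x using D by (rule differentiableI)
  fix b :: 'a assume "b \<in> Basis"
  have "(\<lambda>x. frechet_derivative g (at x) b) = (\<lambda>x. (a * (- \<i> * of_real (\<zeta> \<bullet> b))) * exp (- \<i> * of_real (\<zeta> \<bullet> x)))"
    by (simp add: has_derivative_frechet[OF D] mult_ac)
  then show "(\<lambda>x. frechet_derivative g (at x) b) \<in> {\<lambda>x. a * exp (- \<i> * of_real (\<zeta> \<bullet> x)) | a. True}" by blast
qed

lemma fourier_L2_integrable:
  assumes "f \<in> schwartz" "A \<in> sets borel"
  shows "integrable lborel (\<lambda>\<xi>. indicator A \<xi> * (cmod (f \<xi>))\<^sup>2)"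
  by (rule schwartz_weighted_sq_integrable[OF assms(1), where K = 1]) (use assms(2) in \<open>auto simp: indicator_def add_increasing\<close>)

lemma plancherel_norm:
  assumes "g \<in> test_functions \<Omega>"
  shows "(\<integral>\<xi>. (cmod (fourier g \<xi>))\<^sup>2 \<partial>lborel) = (\<integral>x. (cmod (g x))\<^sup>2 \<partial>lborel)"
proof -
  have "complex_of_real (\<integral>\<xi>. (cmod (fourier g \<xi>))\<^sup>2 \<partial>lborel) = complex_of_real (\<integral>x. (cmod (g x))\<^sup>2 \<partial>lborel)"
    using plancherel_test[OF assms assms] unfolding complex_norm_square[symmetric] integral_complex_of_real .
  then show ?thesis by (simp only: of_real_eq_iff)
qed

text \<open>Translation in frequency is modulation in space. The phase recentres at
  \<open>x0\<close>, so the modulating factor differs from 1 by at most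
  \<open>norm \<zeta> * L\<close> on the support, and Plancherel's identity carries this over to the
  transform.\<close>

lemma fourier_shift_bound:
  fixes g :: "'a::euclidean_space \<Rightarrow> complex"
  assumes g: "g \<in> test_functions \<Omega>" and \<Omega>: "\<And>x. x \<in> \<Omega> \<Longrightarrow> norm (x - x0) \<le> L"
  shows "(\<integral>\<xi>. (cmod (exp (\<i> * of_real (\<zeta> \<bullet> x0)) * fourier g (\<zeta> + \<xi>) - fourier g \<xi>))\<^sup>2 \<partial>lborel)
    \<le> (norm \<zeta> * L)\<^sup>2 * (\<integral>\<xi>. (cmod (fourier g \<xi>))\<^sup>2 \<partial>lborel)"
proof -
  obtain K where K: "smooth g" "compact K" "K \<subseteq> \<Omega>" "\<And>x. x \<notin> K \<Longrightarrow> g x = 0"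
    by (rule test_functionsE[OF g], rule that)
  let ?m = "\<lambda>x. exp (\<i> * of_real (\<zeta> \<bullet> x0)) * exp (- \<i> * of_real (\<zeta> \<bullet> x)) - 1"
  let ?h = "\<lambda>x. ?m x * g x"
  have ig: "integrable lborel g" by (rule test_functions_integrable[OF g])
  have h: "?h \<in> test_functions \<Omega>"
    by (intro test_functions_mult[OF g] smooth_diff smooth_mult smooth_const smooth_exp_inner)
  have F: "fourier ?h \<xi> = exp (\<i> * of_real (\<zeta> \<bullet> x0)) * fourier g (\<zeta> + \<xi>) - fourier g \<xi>" for \<xi>
  proof -
    have "?h = (\<lambda>x. exp (\<i> * of_real (\<zeta> \<bullet> x0)) * (exp (- \<i> * of_real (\<zeta> \<bullet> x)) * g x) + (-1) * g x)"
      by (simp add: fun_eq_iff algebra_simps)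
    then have "fourier ?h \<xi> = fourier (\<lambda>x. exp (\<i> * of_real (\<zeta> \<bullet> x0)) * (exp (- \<i> * of_real (\<zeta> \<bullet> x)) * g x) + (-1) * g x) \<xi>"
      by (simp only:)
    also have "\<dots> = exp (\<i> * of_real (\<zeta> \<bullet> x0)) * fourier g (\<zeta> + \<xi>) + (-1) * fourier g \<xi>"
      by (subst fourier_add)
        (intro Bochner_Integration.integrable_mult_right integrable_exp_mult ig, intro Bochner_Integration.integrable_mult_right ig,
          simp only: fourier_mult fourier_modulate)
    finally show ?thesis by simp
  qed
  have le: "(cmod (?h x))\<^sup>2 \<le> (norm \<zeta> * L)\<^sup>2 * (cmod (g x))\<^sup>2" for x
  proof (cases "x \<in> K")
    case True
    then have xL: "norm (x - x0) \<le> L" using K(3) \<Omega> by blast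
    have "?m x = exp (\<i> * of_real (\<zeta> \<bullet> (x0 - x))) - 1"
      unfolding exp_add[symmetric] by (simp add: inner_diff_right algebra_simps)
    then have "cmod (?m x) \<le> \<bar>\<zeta> \<bullet> (x0 - x)\<bar>" using iexp_approx1[of "\<zeta> \<bullet> (x0 - x)" 0] by simp
    also have "\<dots> \<le> norm \<zeta> * norm (x0 - x)" by (rule Cauchy_Schwarz_ineq2)
    also have "\<dots> \<le> norm \<zeta> * L" using xL by (intro mult_left_mono) (auto simp: norm_minus_commute)
    finally have "cmod (?m x) \<le> norm \<zeta> * L" .
    then have "cmod (?h x) \<le> (norm \<zeta> * L) * cmod (g x)" unfolding norm_mult by (rule mult_right_mono) simp
    from power_mono[OF this, of 2] show ?thesis by (simp add: power_mult_distrib)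
  qed (simp add: K)
  have i2: "integrable lborel (\<lambda>x. (cmod (f x))\<^sup>2)" if "f \<in> test_functions \<Omega>" for f
    using fourier_L2_integrable[OF test_functions_schwartz[OF that], of UNIV] by simp
  have "(\<integral>\<xi>. (cmod (fourier ?h \<xi>))\<^sup>2 \<partial>lborel) \<le> (\<integral>x. (norm \<zeta> * L)\<^sup>2 * (cmod (g x))\<^sup>2 \<partial>lborel)"
    unfolding plancherel_norm[OF h]
    by (rule Bochner_Integration.integral_mono[OF i2[OF h] _ le]) (use i2[OF g] in simp)
  then show ?thesis unfolding F by (simp add: plancherel_norm[OF g])
qed

text \<open>Near a point of the sphere of radius k, a translation by a fraction of 1/L along a
  coordinate direction leaves a shell whose width is a smaller fraction of 1/L, while it
  changes the transform of a function supported in a ball of radius L only little.\<close>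

lemma shell_bound:
  fixes g :: "'a::euclidean_space \<Rightarrow> complex" and k \<delta> L :: real
  defines "S \<equiv> {\<xi>::'a. \<bar>norm \<xi> - k\<bar> < \<delta>}" and "m \<equiv> real DIM('a)"
  assumes g: "g \<in> test_functions \<Omega>" and \<Omega>: "\<And>x. x \<in> \<Omega> \<Longrightarrow> norm (x - x0) \<le> L" and L: "L > 0"
    and \<delta>: "0 < \<delta>" "\<delta> \<le> k / 4" "\<delta> \<le> 1 / sqrt (8 * m) / (4 * m * L)"
  shows "(\<integral>\<xi>. indicator S \<xi> * (cmod (fourier g \<xi>))\<^sup>2 \<partial>lborel)
    \<le> (8 * m + 1) * (\<integral>\<xi>. indicator (- S) \<xi> * (cmod (fourier g \<xi>))\<^sup>2 \<partial>lborel)"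
proof -
  \<comment> \<open>The shift has length s / L. The value is tuned so that over at most 2 m
    directions the errors \<open>2 * s\<^sup>2 * ?P\<close> add up to half of the total
    mass.\<close>
  define s where "s = 1 / sqrt (8 * m)"
  have m: "m \<ge> 1" using DIM_positive[where 'a = 'a] by (simp add: m_def Suc_leI)
  have s: "s > 0" "s\<^sup>2 = 1 / (8 * m)" using m by (auto simp: s_def power_divide)
  have k: "k > 0" using \<delta> by linarith
  have Sm [measurable]: "S \<in> sets borel" unfolding S_def by measurable
  let ?F = "fourier g"
  have FS: "?F \<in> schwartz" by (rule fourier_test_schwartz[OF g])
  have [measurable]: "?F \<in> borel_measurable borel" by (rule schwartz_measurable[OF FS])
  let ?I = "\<lambda>A. \<integral>\<xi>. indicator A \<xi> * (cmod (?F \<xi>))\<^sup>2 \<partial>lborel"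
  have iI: "integrable lborel (\<lambda>\<xi>. indicator A \<xi> * (cmod (?F \<xi>))\<^sup>2)" if "A \<in> sets borel" for A
    by (rule fourier_L2_integrable[OF FS that])
  let ?P = "\<integral>\<xi>. (cmod (?F \<xi>))\<^sup>2 \<partial>lborel"
  have P: "?P = ?I S + ?I (- S)"
  proof -
    have "?I S + ?I (- S) = (\<integral>\<xi>. indicator S \<xi> * (cmod (?F \<xi>))\<^sup>2 + indicator (- S) \<xi> * (cmod (?F \<xi>))\<^sup>2 \<partial>lborel)"
      using iI Sm by (subst Bochner_Integration.integral_add) auto
    also have "\<dots> = ?P" by (rule Bochner_Integration.integral_cong) (auto simp: indicator_def)
    finally show ?thesis by simp
  qed
  let ?E = "Basis \<union> uminus ` Basis :: 'a set"
  \<comment> \<open>Sectors of the shell in which the coordinate along \<open>e\<close> is at least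
    |\<xi>| / m. Both orientations of each axis are present, because the shift has to point
    outwards; the l1 bound on the norm shows that the sectors cover the shell.\<close>
  define T where "T e = {\<xi> \<in> S. norm \<xi> \<le> m * (\<xi> \<bullet> e)}" for e
  have Tm [measurable]: "T e \<in> sets borel" for e
  proof -
    have "T e = S \<inter> {\<xi>. norm \<xi> \<le> m * (\<xi> \<bullet> e)}" by (auto simp: T_def)
    then show ?thesis by simp
  qed
  have cover: "\<exists>e\<in>?E. \<xi> \<in> T e" if "\<xi> \<in> S" for \<xi>
  proof (rule ccontr)
    assume neg: "\<not> (\<exists>e\<in>?E. \<xi> \<in> T e)"
    have lt: "\<bar>\<xi> \<bullet> b\<bar> < norm \<xi> / m" if b: "b \<in> Basis" for b
    proof -
      have "b \<in> ?E" "- b \<in> ?E" using b by auto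
      then have "\<not> norm \<xi> \<le> m * (\<xi> \<bullet> b)" "\<not> norm \<xi> \<le> m * (\<xi> \<bullet> (- b))"
        using neg \<open>\<xi> \<in> S\<close> unfolding T_def by blast+
      then have "m * \<bar>\<xi> \<bullet> b\<bar> < norm \<xi>" by (auto simp: abs_if)
      then show ?thesis using m by (simp add: field_simps)
    qed
    have "norm \<xi> \<le> (\<Sum>b\<in>Basis. \<bar>\<xi> \<bullet> b\<bar>)" by (rule norm_le_l1)
    also have "\<dots> < (\<Sum>b\<in>(Basis::'a set). norm \<xi> / m)" by (rule sum_strict_mono) (auto intro: lt)
    also have "\<dots> = norm \<xi>" using m by (simp add: m_def)
    finally show False by simp
  qed
  have step: "?I (T e) \<le> 2 * ?I (- S) + 2 * s\<^sup>2 * ?P" if e: "e \<in> ?E" for e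
  proof -
    have ne: "norm e = 1" using e by (auto simp: norm_Basis)
    define \<zeta> where "\<zeta> = (s / L) *\<^sub>R e"
    have n\<zeta>: "norm \<zeta> * L = s" using s L ne by (simp add: \<zeta>_def)
    \<comment> \<open>The squared norm grows by at least twice the shift times the coordinate along
      \<open>e\<close>, whereas the squares of the two radii of the shell differ by
      \<open>4 * k * \<delta>\<close>; the third bound on \<open>\<delta>\<close> lets the growth
      win.\<close>
    have out: "\<zeta> + \<xi> \<notin> S" if \<xi>: "\<xi> \<in> T e" for \<xi>
    proof
      assume "\<zeta> + \<xi> \<in> S"
      then have up: "norm (\<zeta> + \<xi>) < k + \<delta>" by (auto simp: S_def)
      have lo: "norm \<xi> > k - \<delta>" and dir: "norm \<xi> \<le> m * (\<xi> \<bullet> e)" using \<xi> by (auto simp: T_def S_def)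
      have kd: "k - \<delta> \<ge> 3 / 4 * k" using \<delta> by linarith
      have "(norm (\<zeta> + \<xi>))\<^sup>2 = (norm \<xi>)\<^sup>2 + 2 * (s / L) * (\<xi> \<bullet> e) + (norm \<zeta>)\<^sup>2"
      proof -
        have "(norm (\<zeta> + \<xi>))\<^sup>2 = (norm \<xi>)\<^sup>2 + 2 * (\<zeta> \<bullet> \<xi>) + (norm \<zeta>)\<^sup>2"
          by (simp add: power2_norm_eq_inner inner_add_left inner_add_right inner_commute)
        then show ?thesis by (simp add: \<zeta>_def inner_commute)
      qed
      moreover have "\<xi> \<bullet> e \<ge> (k - \<delta>) / m" using lo dir m by (simp add: field_simps)
      then have "2 * (s / L) * (\<xi> \<bullet> e) \<ge> 2 * (s / L) * ((k - \<delta>) / m)" using s L by (intro mult_left_mono) auto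
      moreover have "(norm \<xi>)\<^sup>2 \<ge> (k - \<delta>)\<^sup>2" using lo kd k by (intro power_mono) auto
      moreover have "(norm (\<zeta> + \<xi>))\<^sup>2 < (k + \<delta>)\<^sup>2" using up by (intro power_strict_mono) auto
      ultimately have "2 * (s / L) * ((k - \<delta>) / m) + (k - \<delta>)\<^sup>2 < (k + \<delta>)\<^sup>2"
        using zero_le_power2[of "norm \<zeta>"] by linarith
      then have 1: "2 * (s / L) * ((k - \<delta>) / m) < 4 * k * \<delta>" by (simp add: power2_eq_square algebra_simps)
      have "\<delta> \<le> s / (4 * m * L)" using \<delta>(3) by (simp add: s_def)
      then have "4 * k * \<delta> \<le> 4 * k * (s / (4 * m * L))" using k by (intro mult_left_mono) auto
      also have "\<dots> = (s / L) * (k / m)" using L m by (simp add: field_simps)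
      also have "\<dots> \<le> (s / L) * (2 * ((k - \<delta>) / m))"
        using s L m kd k by (intro mult_left_mono) (auto simp: field_simps)
      also have "\<dots> = 2 * (s / L) * ((k - \<delta>) / m)" by simp
      finally show False using 1 leD by blast
    qed
    let ?c = "exp (\<i> * of_real (\<zeta> \<bullet> x0))"
    let ?D = "\<lambda>\<xi>. (cmod (?c * ?F (\<zeta> + \<xi>) - ?F \<xi>))\<^sup>2"
    have iS: "integrable lborel (\<lambda>\<xi>. indicator (- S) (\<zeta> + \<xi>) * (cmod (?F (\<zeta> + \<xi>)))\<^sup>2)"
      and vS: "(\<integral>\<xi>. indicator (- S) (\<zeta> + \<xi>) * (cmod (?F (\<zeta> + \<xi>)))\<^sup>2 \<partial>lborel) = ?I (- S)"
      using lborel_affine_integral[of 1 "\<lambda>\<xi>. indicator (- S) \<xi> * (cmod (?F \<xi>))\<^sup>2" \<zeta>] iI[of "- S"] Sm by auto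
    have iD: "integrable lborel ?D"
    proof -
      have "integrable lborel (\<lambda>\<xi>. 1 * (cmod (?c * ?F (\<zeta> + \<xi>) - ?F \<xi>))\<^sup>2)"
      proof (rule weighted_sq_diff(1))
        have "integrable lborel (\<lambda>\<xi>. (cmod (?F \<xi>))\<^sup>2)" using iI[of UNIV] by simp
        then show "integrable lborel (\<lambda>\<xi>. 1 * (cmod (?F \<xi>))\<^sup>2)" "integrable lborel (\<lambda>\<xi>. 1 * (cmod (?c * ?F (\<zeta> + \<xi>)))\<^sup>2)"
          using lborel_affine_integral(1)[of 1 "\<lambda>\<xi>. (cmod (?F \<xi>))\<^sup>2" \<zeta>] by (auto simp: norm_mult)
      qed measurable
      then show ?thesis by simp
    qed
    have le: "indicator (T e) \<xi> * (cmod (?F \<xi>))\<^sup>2 \<le> 2 * (indicator (- S) (\<zeta> + \<xi>) * (cmod (?F (\<zeta> + \<xi>)))\<^sup>2) + 2 * ?D \<xi>" for \<xi>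
    proof (cases "\<xi> \<in> T e")
      case True
      have "cmod (?F \<xi>) \<le> cmod (?F (\<zeta> + \<xi>)) + cmod (?c * ?F (\<zeta> + \<xi>) - ?F \<xi>)"
        using norm_triangle_ineq4[of "?c * ?F (\<zeta> + \<xi>)" "?c * ?F (\<zeta> + \<xi>) - ?F \<xi>"] by (simp add: norm_mult)
      then have "(cmod (?F \<xi>))\<^sup>2 \<le> (cmod (?F (\<zeta> + \<xi>)) + cmod (?c * ?F (\<zeta> + \<xi>) - ?F \<xi>))\<^sup>2" by (intro power_mono) auto
      also have "\<dots> \<le> 2 * (cmod (?F (\<zeta> + \<xi>)))\<^sup>2 + 2 * ?D \<xi>"
        using sum_squares_bound[of "cmod (?F (\<zeta> + \<xi>))" "cmod (?c * ?F (\<zeta> + \<xi>) - ?F \<xi>)"] unfolding power2_sum by linarith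
      finally show ?thesis using True out[OF True] by simp
    qed simp
    have "?I (T e) \<le> (\<integral>\<xi>. 2 * (indicator (- S) (\<zeta> + \<xi>) * (cmod (?F (\<zeta> + \<xi>)))\<^sup>2) + 2 * ?D \<xi> \<partial>lborel)"
      by (rule Bochner_Integration.integral_mono[OF iI[OF Tm] _ le]) (use iS iD in simp)
    also have "\<dots> = 2 * ?I (- S) + 2 * (\<integral>\<xi>. ?D \<xi> \<partial>lborel)" using iS iD vS by simp
    also have "(\<integral>\<xi>. ?D \<xi> \<partial>lborel) \<le> s\<^sup>2 * ?P" using fourier_shift_bound[OF g \<Omega>, of \<zeta>] unfolding n\<zeta> .
    finally show ?thesis by simp
  qed
  have "?I S \<le> (\<integral>\<xi>. (\<Sum>e\<in>?E. indicator (T e) \<xi> * (cmod (?F \<xi>))\<^sup>2) \<partial>lborel)"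
  proof (rule Bochner_Integration.integral_mono[OF iI[OF Sm]])
    show "integrable lborel (\<lambda>\<xi>. \<Sum>e\<in>?E. indicator (T e) \<xi> * (cmod (?F \<xi>))\<^sup>2)"
      by (intro Bochner_Integration.integrable_sum iI Tm)
    fix \<xi> :: 'a
    show "indicator S \<xi> * (cmod (?F \<xi>))\<^sup>2 \<le> (\<Sum>e\<in>?E. indicator (T e) \<xi> * (cmod (?F \<xi>))\<^sup>2)"
    proof (cases "\<xi> \<in> S")
      case True
      then obtain e where e: "e \<in> ?E" "\<xi> \<in> T e" using cover by blast
      have "indicator S \<xi> * (cmod (?F \<xi>))\<^sup>2 = indicator (T e) \<xi> * (cmod (?F \<xi>))\<^sup>2" using True e by simp
      also have "\<dots> \<le> (\<Sum>e\<in>?E. indicator (T e) \<xi> * (cmod (?F \<xi>))\<^sup>2)"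
        by (rule member_le_sum[OF e(1)]) auto
      finally show ?thesis .
    qed (auto intro: sum_nonneg)
  qed
  also have "\<dots> = (\<Sum>e\<in>?E. ?I (T e))" by (rule Bochner_Integration.integral_sum) (rule iI[OF Tm])
  also have "\<dots> \<le> (\<Sum>e\<in>?E. 2 * ?I (- S) + 2 * s\<^sup>2 * ?P)" by (rule sum_mono) (rule step)
  also have "\<dots> = real (card ?E) * (2 * ?I (- S) + 2 * s\<^sup>2 * ?P)" by simp
  also have "\<dots> \<le> (2 * m) * (2 * ?I (- S) + 2 * s\<^sup>2 * ?P)"
  proof (rule mult_right_mono)
    have "card ?E \<le> card (Basis :: 'a set) + card (uminus ` Basis :: 'a set)" by (rule card_Un_le)
    also have "\<dots> \<le> 2 * DIM('a)" using card_image_le[of "Basis :: 'a set" uminus] by simp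
    finally have "real (card ?E) \<le> real (2 * DIM('a))" by (simp only: of_nat_le_iff)
    then show "real (card ?E) \<le> 2 * m" by (simp add: m_def)
    show "0 \<le> 2 * ?I (- S) + 2 * s\<^sup>2 * ?P"
      by (intro add_nonneg_nonneg mult_nonneg_nonneg integral_nonneg_AE AE_I2) auto
  qed
  also have "\<dots> = 4 * m * ?I (- S) + ?P / 2" using m by (simp add: s(2) field_simps)
  \<comment> \<open>Half of the total mass contains half of the shell's mass, which is absorbed on
    the left.\<close>
  finally have "?I S \<le> 4 * m * ?I (- S) + (?I S + ?I (- S)) / 2" unfolding P .
  moreover have "a \<le> 4 * m * b + (a + b) / 2 \<Longrightarrow> a \<le> (8 * m + 1) * b" for a b :: real
    by (simp add: field_simps)
  ultimately show ?thesis by blast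
qed

text \<open>With \<delta> L equal to the minimum, \<delta> / (3 k) bounds the square of
  \<open>Dk\<close> / \<open>Wk\<close> from below outside a shell of half width \<delta>; together
  with (k L)^(-1/2) this gives the square root. The divisor 16 d + 3 is 1 plus the cost 2 (8 d + 1)
  of moving the shell's mass outside.\<close>

definition coercivity_const :: "nat \<Rightarrow> real \<Rightarrow> real" where
  "coercivity_const d \<tau> = sqrt (min (\<tau> / 4) (1 / sqrt (8 * real d) / (4 * real d)) / 3) / (16 * real d + 3)"

lemma coercivity_const_pos: "d > 0 \<Longrightarrow> \<tau> > 0 \<Longrightarrow> coercivity_const d \<tau> > 0"
  by (auto simp: coercivity_const_def)

text \<open>Outside a shell of half width proportional to 1/L the weights are comparable up to a
  multiple of the square root of k L. On the shell \<open>Wk\<close> is at most 2 k, outside it is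
  at least k, so the estimate for the mass of the shell transfers to the weighted integrals.\<close>

lemma coercive_test:
  fixes g :: "'a::euclidean_space \<Rightarrow> complex" and k L :: real
  assumes g: "g \<in> test_functions \<Omega>" and \<Omega>: "\<And>x. x \<in> \<Omega> \<Longrightarrow> norm (x - x0) \<le> L" and L: "L > 0"
    and \<tau>: "0 < \<tau>" "\<tau> \<le> k * L"
  shows "coercivity_const DIM('a) \<tau> * (k * L) powr (- (1/2)) * (\<integral>\<xi>. Wk k \<xi> * (cmod (fourier g \<xi>))\<^sup>2 \<partial>lborel)
    \<le> (\<integral>\<xi>. Dk k \<xi> * (cmod (fourier g \<xi>))\<^sup>2 \<partial>lborel)"
proof -
  define m where "m = real DIM('a)"
  have m: "m \<ge> 1" using DIM_positive[where 'a = 'a] by (simp add: m_def Suc_leI)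
  have kL: "k * L > 0" using \<tau> by linarith
  then have k: "k > 0" using L by (simp add: zero_less_mult_iff)
  define q where "q = 1 / sqrt (8 * m) / (4 * m)"
  have q: "q > 0" using m by (simp add: q_def)
  \<comment> \<open>The bound \<tau> / 4 ensures \<delta> \<le> k / 4, since \<tau> \<le> k L; the
    bound \<open>q\<close> is the smallness that the shift requires.\<close>
  define \<mu> where "\<mu> = min (\<tau> / 4) q"
  have \<mu>: "\<mu> > 0" using \<tau> q by (simp add: \<mu>_def)
  define \<delta> where "\<delta> = \<mu> / L"
  have \<delta>: "0 < \<delta>" "\<delta> \<le> k / 4" "\<delta> \<le> 1 / sqrt (8 * m) / (4 * m * L)"
  proof -
    show "0 < \<delta>" using \<mu> L by (simp add: \<delta>_def)
    have "\<mu> \<le> k * L / 4" using \<tau> by (simp add: \<mu>_def min_def)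
    then show "\<delta> \<le> k / 4" using L by (simp add: \<delta>_def field_simps)
    have "\<delta> \<le> q / L" unfolding \<delta>_def \<mu>_def using L by (intro divide_right_mono) auto
    then show "\<delta> \<le> 1 / sqrt (8 * m) / (4 * m * L)" by (simp add: q_def)
  qed
  define S where "S = {\<xi>::'a. \<bar>norm \<xi> - k\<bar> < \<delta>}"
  have Sm [measurable]: "S \<in> sets borel" unfolding S_def by measurable
  let ?F = "fourier g"
  have FS: "?F \<in> schwartz" by (rule fourier_test_schwartz[OF g])
  have [measurable]: "?F \<in> borel_measurable borel" by (rule schwartz_measurable[OF FS])
  \<comment> \<open>Compare k + r with |k - r|: for r \<le> 2 k the shell gives |k - r| \<ge>
    \<delta>, and for larger r the two are of the same size.\<close>
  have WD: "Wk k \<xi> \<le> sqrt (3 * k / \<delta>) * Dk k \<xi>" if "\<xi> \<notin> S" for \<xi> :: 'a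
  proof -
    define r where "r = norm \<xi>"
    have r: "r \<ge> 0" "\<bar>r - k\<bar> \<ge> \<delta>" using that by (auto simp: r_def S_def)
    have "\<delta> * (k + r) \<le> 3 * k * \<bar>k - r\<bar>"
    proof (cases "r \<le> 2 * k")
      case True
      have "\<delta> * (k + r) \<le> \<bar>k - r\<bar> * (3 * k)" using r True \<delta>(1,2) k by (intro mult_mono) auto
      then show ?thesis by (simp add: mult_ac)
    next
      case False
      have "\<delta> * (k + r) \<le> k * (3 * \<bar>k - r\<bar>)" using r False \<delta>(1,2) k by (intro mult_mono) auto
      then show ?thesis by (simp add: mult_ac)
    qed
    from mult_right_mono[OF this, of "k + r"] have 1: "\<delta> * (k + r)\<^sup>2 \<le> 3 * k * (\<bar>k - r\<bar> * (k + r))"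
      using k r by (simp add: power2_eq_square mult_ac)
    have 2: "\<bar>k - r\<bar> * (k + r) = \<bar>k\<^sup>2 - r\<^sup>2\<bar>"
    proof -
      have "\<bar>k\<^sup>2 - r\<^sup>2\<bar> = \<bar>(k - r) * (k + r)\<bar>" by (simp add: power2_eq_square algebra_simps)
      also have "\<dots> = \<bar>k - r\<bar> * (k + r)" using k r by (simp add: abs_mult)
      finally show ?thesis by simp
    qed
    have 3: "k\<^sup>2 + r\<^sup>2 \<le> (k + r)\<^sup>2" using k r by (simp add: power2_sum)
    have "\<delta> * (k\<^sup>2 + r\<^sup>2) \<le> \<delta> * (k + r)\<^sup>2" using 3 \<delta>(1,2) by (intro mult_left_mono) auto
    then have "\<delta> * (k\<^sup>2 + r\<^sup>2) \<le> 3 * k * \<bar>k\<^sup>2 - r\<^sup>2\<bar>" using 1 2 by simp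
    then have "k\<^sup>2 + r\<^sup>2 \<le> 3 * k / \<delta> * \<bar>k\<^sup>2 - r\<^sup>2\<bar>" using \<delta>(1,2) by (simp add: field_simps)
    then have "sqrt (k\<^sup>2 + r\<^sup>2) \<le> sqrt (3 * k / \<delta> * \<bar>k\<^sup>2 - r\<^sup>2\<bar>)" by (rule real_sqrt_le_mono)
    then show ?thesis by (simp only: Wk_def Dk_def r_def real_sqrt_mult)
  qed
  have W2: "Wk k \<xi> \<le> 2 * k" if "\<xi> \<in> S" for \<xi> :: 'a
  proof -
    have n: "norm \<xi> \<le> 5 / 4 * k" using that \<delta>(1,2) by (auto simp: S_def)
    have "(norm \<xi>)\<^sup>2 \<le> (5 / 4 * k)\<^sup>2" by (rule power_mono[OF n]) simp
    then have "k\<^sup>2 + (norm \<xi>)\<^sup>2 \<le> (2 * k)\<^sup>2"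
    proof -
      have "(norm \<xi>)\<^sup>2 \<le> 25 / 16 * k\<^sup>2" using \<open>(norm \<xi>)\<^sup>2 \<le> (5 / 4 * k)\<^sup>2\<close> by (simp add: power_mult_distrib power_divide)
      moreover have "(2 * k)\<^sup>2 = 4 * k\<^sup>2" by (simp add: power_mult_distrib)
      ultimately show ?thesis using zero_le_power2[of k] by linarith
    qed
    then show ?thesis unfolding Wk_def using k by (intro real_le_lsqrt) auto
  qed
  have kW: "k \<le> Wk k \<xi>" for \<xi> :: 'a unfolding Wk_def using k by (intro real_le_rsqrt) auto
  have iw: "integrable lborel (\<lambda>\<xi>. indicator A \<xi> * (w \<xi> * (cmod (?F \<xi>))\<^sup>2))"
    if [measurable]: "A \<in> sets borel" "w \<in> borel_measurable borel" and w: "\<And>\<xi>. 0 \<le> w \<xi>" "\<And>\<xi>. w \<xi> \<le> Wk k \<xi>" for A w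
  proof -
    have "integrable lborel (\<lambda>\<xi>. (indicator A \<xi> * w \<xi>) * (cmod (?F \<xi>))\<^sup>2)"
    proof (rule schwartz_weighted_sq_integrable[OF FS, where K = "1 + k"])
      fix \<xi> :: 'a
      have "indicator A \<xi> * w \<xi> \<le> Wk k \<xi>" using w[of \<xi>] by (auto simp: indicator_def intro: order_trans)
      also have "\<dots> \<le> (1 + k) * (1 + norm \<xi>)"
        by (rule order_trans[OF Wk_le_jb[OF k]]) (use k jb_le in \<open>auto intro!: mult_left_mono\<close>)
      finally show "indicator A \<xi> * w \<xi> \<le> (1 + k) * (1 + norm \<xi>)" .
    qed (auto simp: w)
    then show ?thesis by (simp add: mult.assoc)
  qed
  let ?I = "\<lambda>A w. \<integral>\<xi>. indicator A \<xi> * (w \<xi> * (cmod (?F \<xi>))\<^sup>2) \<partial>lborel"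
  have Sc: "- S \<in> sets borel" using Sm by (simp add: borel_comp)
  note iS = iw[OF Sm Wk_measurable Wk_nonneg order_refl]
    and iSc = iw[OF Sc Wk_measurable Wk_nonneg order_refl]
    and iDc = iw[OF Sc Dk_measurable Dk_nonneg Dk_le_Wk]
    and iDU = iw[OF sets.top[of borel, unfolded space_borel] Dk_measurable Dk_nonneg Dk_le_Wk]
  have ind: "integrable lborel (\<lambda>\<xi>. indicator A \<xi> * (cmod (?F \<xi>))\<^sup>2)" if "A \<in> sets borel" for A
    by (rule fourier_L2_integrable[OF FS that])
  have "?I S (Wk k) \<le> (\<integral>\<xi>. 2 * k * (indicator S \<xi> * (cmod (?F \<xi>))\<^sup>2) \<partial>lborel)"
  proof (rule Bochner_Integration.integral_mono[OF iS])
    show "indicator S \<xi> * (Wk k \<xi> * (cmod (?F \<xi>))\<^sup>2) \<le> 2 * k * (indicator S \<xi> * (cmod (?F \<xi>))\<^sup>2)" for \<xi>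
      using W2[of \<xi>] by (auto simp: indicator_def intro: mult_right_mono)
  qed (use ind[OF Sm] in simp)
  also have "\<dots> = 2 * k * (\<integral>\<xi>. indicator S \<xi> * (cmod (?F \<xi>))\<^sup>2 \<partial>lborel)" by simp
  also have "\<dots> \<le> 2 * k * ((8 * m + 1) * (\<integral>\<xi>. indicator (- S) \<xi> * (cmod (?F \<xi>))\<^sup>2 \<partial>lborel))"
    by (rule mult_left_mono[OF shell_bound[OF g \<Omega> L \<delta>(1,2) \<delta>(3)[unfolded m_def], folded S_def m_def]]) (use k in simp_all)
  also have "\<dots> = 2 * (8 * m + 1) * (\<integral>\<xi>. k * (indicator (- S) \<xi> * (cmod (?F \<xi>))\<^sup>2) \<partial>lborel)" by simp
  also have "\<dots> \<le> 2 * (8 * m + 1) * ?I (- S) (Wk k)"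
  proof (intro mult_left_mono Bochner_Integration.integral_mono iSc)
    show "k * (indicator (- S) \<xi> * (cmod (?F \<xi>))\<^sup>2) \<le> indicator (- S) \<xi> * (Wk k \<xi> * (cmod (?F \<xi>))\<^sup>2)" for \<xi>
      using kW[of \<xi>] by (auto simp: indicator_def intro: mult_right_mono)
  qed (use ind[of "- S"] Sm m in simp_all)
  finally have on: "?I S (Wk k) \<le> 2 * (8 * m + 1) * ?I (- S) (Wk k)" .
  have "(\<integral>\<xi>. Wk k \<xi> * (cmod (?F \<xi>))\<^sup>2 \<partial>lborel) = (\<integral>\<xi>. indicator S \<xi> * (Wk k \<xi> * (cmod (?F \<xi>))\<^sup>2) + indicator (- S) \<xi> * (Wk k \<xi> * (cmod (?F \<xi>))\<^sup>2) \<partial>lborel)"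
    by (rule Bochner_Integration.integral_cong) (auto simp: indicator_def)
  also have "\<dots> = ?I S (Wk k) + ?I (- S) (Wk k)" by (rule Bochner_Integration.integral_add[OF iS iSc])
  also have "\<dots> \<le> (16 * m + 3) * ?I (- S) (Wk k)" using on by (simp add: algebra_simps)
  also have "\<dots> \<le> (16 * m + 3) * (sqrt (3 * k / \<delta>) * (\<integral>\<xi>. Dk k \<xi> * (cmod (?F \<xi>))\<^sup>2 \<partial>lborel))"
  proof (rule mult_left_mono)
    have "?I (- S) (Wk k) \<le> (\<integral>\<xi>. sqrt (3 * k / \<delta>) * (indicator UNIV \<xi> * (Dk k \<xi> * (cmod (?F \<xi>))\<^sup>2)) \<partial>lborel)"
    proof (rule Bochner_Integration.integral_mono[OF iSc])
      show "integrable lborel (\<lambda>\<xi>. sqrt (3 * k / \<delta>) * (indicator UNIV \<xi> * (Dk k \<xi> * (cmod (?F \<xi>))\<^sup>2)))"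
        by (rule Bochner_Integration.integrable_mult_right[OF iDU])
      fix \<xi> :: 'a
      show "indicator (- S) \<xi> * (Wk k \<xi> * (cmod (?F \<xi>))\<^sup>2) \<le> sqrt (3 * k / \<delta>) * (indicator UNIV \<xi> * (Dk k \<xi> * (cmod (?F \<xi>))\<^sup>2))"
      proof (cases "\<xi> \<in> S")
        case True
        then show ?thesis using k \<delta>(1,2) by simp
      next
        case False
        then show ?thesis using mult_right_mono[OF WD[OF False], of "(cmod (?F \<xi>))\<^sup>2"] by (simp add: mult.assoc)
      qed
    qed
    then show "?I (- S) (Wk k) \<le> sqrt (3 * k / \<delta>) * (\<integral>\<xi>. Dk k \<xi> * (cmod (?F \<xi>))\<^sup>2 \<partial>lborel)" by simp
  qed (use m in simp)
  finally have main: "(\<integral>\<xi>. Wk k \<xi> * (cmod (?F \<xi>))\<^sup>2 \<partial>lborel) \<le> (16 * m + 3) * (sqrt (3 * k / \<delta>) * (\<integral>\<xi>. Dk k \<xi> * (cmod (?F \<xi>))\<^sup>2 \<partial>lborel))" .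
  have c: "coercivity_const DIM('a) \<tau> * (k * L) powr (- (1/2)) = sqrt (\<delta> / (3 * k)) / (16 * m + 3)"
  proof -
    have "(k * L) powr (- (1/2)) = inverse (sqrt (k * L))" using kL by (simp add: powr_minus powr_half_sqrt)
    then have "sqrt (\<mu> / 3) * (k * L) powr (- (1/2)) = sqrt (\<mu> / 3) / sqrt (k * L)"
      by (simp only: divide_inverse)
    also have "\<dots> = sqrt (\<mu> / 3 / (k * L))" by (rule real_sqrt_divide[symmetric])
    also have "\<mu> / 3 / (k * L) = \<delta> / (3 * k)" using L k by (simp add: \<delta>_def)
    finally have "sqrt (\<mu> / 3) * (k * L) powr (- (1/2)) = sqrt (\<delta> / (3 * k))" .
    moreover have "coercivity_const DIM('a) \<tau> = sqrt (\<mu> / 3) / (16 * m + 3)"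
      unfolding coercivity_const_def \<mu>_def q_def m_def ..
    ultimately show ?thesis by (simp only: times_divide_eq_left)
  qed
  have "sqrt (\<delta> / (3 * k)) / (16 * m + 3) * ((16 * m + 3) * (sqrt (3 * k / \<delta>) * X)) = X" for X
  proof -
    have "sqrt (\<delta> / (3 * k)) * sqrt (3 * k / \<delta>) = 1" unfolding real_sqrt_mult[symmetric] using \<delta>(1,2) k by simp
    then show ?thesis using m by (simp add: mult.assoc[symmetric])
  qed
  note X = this
  have "sqrt (\<delta> / (3 * k)) / (16 * m + 3) * (\<integral>\<xi>. Wk k \<xi> * (cmod (?F \<xi>))\<^sup>2 \<partial>lborel)
    \<le> sqrt (\<delta> / (3 * k)) / (16 * m + 3) * ((16 * m + 3) * (sqrt (3 * k / \<delta>) * (\<integral>\<xi>. Dk k \<xi> * (cmod (?F \<xi>))\<^sup>2 \<partial>lborel)))"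
    by (rule mult_left_mono[OF main]) (use m \<delta>(1) k in simp)
  then show ?thesis unfolding c X .
qed

text \<open>Both quadratic forms are passed to the limit with |a - b|^2 \<le> 2 |a|^2 + 2 |b|^2.
  This costs 2 twice, hence the factor 4, and asks only that the error be small in the norm of order
  1/2.\<close>

lemma coercive_sobolev:
  fixes u :: "'a::euclidean_space distr" and k L :: real
  assumes u: "u \<in> sobolev_tilde (1/2) \<Omega>" and \<Omega>: "\<And>x. x \<in> \<Omega> \<Longrightarrow> norm (x - x0) \<le> L" and L: "L > 0"
    and \<tau>: "0 < \<tau>" "\<tau> \<le> k * L"
  shows "coercivity_const DIM('a) \<tau> * (k * L) powr (- (1/2)) * (\<integral>\<xi>. Wk k \<xi> * (cmod (fourier_fun u \<xi>))\<^sup>2 \<partial>lborel)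
    \<le> 4 * (\<integral>\<xi>. Dk k \<xi> * (cmod (fourier_fun u \<xi>))\<^sup>2 \<partial>lborel)"
proof -
  have kL: "k * L > 0" using \<tau> by linarith
  then have k: "k > 0" using L by (simp add: zero_less_mult_iff)
  define c where "c = coercivity_const DIM('a) \<tau> * (k * L) powr (- (1/2))"
  have c: "c > 0" unfolding c_def using coercivity_const_pos[OF DIM_positive[where 'a = 'a] \<tau>(1)] kL by (intro mult_pos_pos) auto
  let ?u = "fourier_fun u"
  note u' = sobolev_tildeD[OF u]
  have [measurable]: "?u \<in> borel_measurable borel" by (rule sobolevD(3)[OF u'])
  let ?N = "\<lambda>f. \<integral>\<xi>. Wk k \<xi> * (cmod (f \<xi>))\<^sup>2 \<partial>lborel" and ?E = "\<lambda>f. \<integral>\<xi>. Dk k \<xi> * (cmod (f \<xi>))\<^sup>2 \<partial>lborel"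
  have wint: "integrable lborel (\<lambda>\<xi>. w \<xi> * (cmod (f \<xi>))\<^sup>2)"
    and wle: "(\<integral>\<xi>. w \<xi> * (cmod (f \<xi>))\<^sup>2 \<partial>lborel) \<le> (1 + k) * (\<integral>\<xi>. jb \<xi> * (cmod (f \<xi>))\<^sup>2 \<partial>lborel)"
    if [measurable]: "f \<in> borel_measurable borel" "w \<in> borel_measurable borel" and w: "\<And>\<xi>. 0 \<le> w \<xi>" "\<And>\<xi>. w \<xi> \<le> Wk k \<xi>"
      and f: "integrable lborel (\<lambda>\<xi>. jb \<xi> * (cmod (f \<xi>))\<^sup>2)" for f :: "'a \<Rightarrow> complex" and w
  proof -
    have le: "w \<xi> * (cmod (f \<xi>))\<^sup>2 \<le> (1 + k) * (jb \<xi> * (cmod (f \<xi>))\<^sup>2)" for \<xi>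
      using mult_right_mono[OF order_trans[OF w(2) Wk_le_jb[OF k]], of "(cmod (f \<xi>))\<^sup>2" \<xi>] by (simp add: mult.assoc)
    have i: "integrable lborel (\<lambda>\<xi>. (1 + k) * (jb \<xi> * (cmod (f \<xi>))\<^sup>2))" using f by simp
    show 1: "integrable lborel (\<lambda>\<xi>. w \<xi> * (cmod (f \<xi>))\<^sup>2)"
    proof (rule Bochner_Integration.integrable_bound[OF i])
      show "AE \<xi> in lborel. norm (w \<xi> * (cmod (f \<xi>))\<^sup>2) \<le> norm ((1 + k) * (jb \<xi> * (cmod (f \<xi>))\<^sup>2))"
        unfolding real_norm_def by (intro AE_I2 order_trans[OF _ abs_ge_self], subst abs_of_nonneg) (auto intro: le simp: w)
    qed measurable
    show "(\<integral>\<xi>. w \<xi> * (cmod (f \<xi>))\<^sup>2 \<partial>lborel) \<le> (1 + k) * (\<integral>\<xi>. jb \<xi> * (cmod (f \<xi>))\<^sup>2 \<partial>lborel)"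
      using Bochner_Integration.integral_mono[OF 1 i le] by simp
  qed
  have "c * ?N ?u \<le> 4 * ?E ?u"
  proof (rule field_le_epsilon)
    fix e :: real assume e: "e > 0"
    \<comment> \<open>The errors enter as \<open>4 * ?E ?d + 2 * c * ?N ?d\<close>, and each of the
      two weighted integrals is at most \<open>(1 + k) * e'\<close>.\<close>
    define e' where "e' = e / ((4 + 2 * c) * (1 + k))"
    have e': "e' > 0" using e c k by (simp add: e'_def)
    obtain \<phi> where \<phi>: "\<phi> \<in> test_functions \<Omega>" "(\<integral>\<xi>. jb \<xi> * (cmod (?u \<xi> - fourier \<phi> \<xi>))\<^sup>2 \<partial>lborel) < e'"
      by (rule sobolev_tilde_approx[OF u e'])
    let ?p = "fourier \<phi>"
    let ?d = "\<lambda>\<xi>. ?u \<xi> - ?p \<xi>"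
    have [measurable]: "?p \<in> borel_measurable borel" using is_fourier_funD(2)[OF is_fourier_fun_test[OF \<phi>(1)]] .
    note iu = sobolevD(4)[OF u' refl] and ip = test_sobolev(2)[OF \<phi>(1)] and idf = sobolev_tilde_approx_integrable[OF u' \<phi>(1)]
    note W = wint[OF _ Wk_measurable Wk_nonneg order_refl] and D = wint[OF _ Dk_measurable Dk_nonneg Dk_le_Wk]
    have d: "?N ?d \<le> (1 + k) * e'" "?E ?d \<le> (1 + k) * e'"
    proof -
      have "(1 + k) * (\<integral>\<xi>. jb \<xi> * (cmod (?d \<xi>))\<^sup>2 \<partial>lborel) \<le> (1 + k) * e'" using \<phi>(2) k by (intro mult_left_mono) auto
      then show "?N ?d \<le> (1 + k) * e'" "?E ?d \<le> (1 + k) * e'"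
        using wle[OF _ Wk_measurable Wk_nonneg order_refl idf] wle[OF _ Dk_measurable Dk_nonneg Dk_le_Wk idf] by auto
    qed
    have N: "?N ?u \<le> 2 * ?N ?p + 2 * ?N ?d"
    proof -
      have "integrable lborel (\<lambda>\<xi>. jb \<xi> * (cmod (- ?d \<xi>))\<^sup>2)" using idf unfolding norm_minus_cancel .
      then have "(\<integral>\<xi>. Wk k \<xi> * (cmod (?p \<xi> - (- ?d \<xi>)))\<^sup>2 \<partial>lborel) \<le> 2 * ?N ?p + 2 * (\<integral>\<xi>. Wk k \<xi> * (cmod (- ?d \<xi>))\<^sup>2 \<partial>lborel)"
        by (intro weighted_sq_diff(2)[where w = "Wk k"] W ip) auto
      then show ?thesis unfolding norm_minus_cancel by simp
    qed
    have E: "?E ?p \<le> 2 * ?E ?u + 2 * ?E ?d"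
    proof -
      have "(\<integral>\<xi>. Dk k \<xi> * (cmod (?u \<xi> - ?d \<xi>))\<^sup>2 \<partial>lborel) \<le> 2 * ?E ?u + 2 * ?E ?d"
        by (intro weighted_sq_diff(2)[where w = "Dk k"] D iu idf) auto
      then show ?thesis by simp
    qed
    have "c * ?N ?p \<le> ?E ?p" unfolding c_def by (rule coercive_test[OF \<phi>(1) \<Omega> L \<tau>])
    moreover have "c * ?N ?u \<le> c * (2 * ?N ?p + 2 * ?N ?d)" using N c by (intro mult_left_mono) auto
    moreover have "c * ?N ?d \<le> c * ((1 + k) * e')" using d(1) c by (intro mult_left_mono) auto
    ultimately have "c * ?N ?u \<le> 4 * ?E ?u + (4 + 2 * c) * ((1 + k) * e')"
      using E d(2) by (simp add: algebra_simps)
    also have "(4 + 2 * c) * ((1 + k) * e') = e" using c k by (simp add: e'_def)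
    finally show "c * ?N ?u \<le> 4 * ?E ?u + e" .
  qed
  then show ?thesis unfolding c_def .
qed

section \<open>Integrals on a half-line\<close>

lemma half_line_FTC:
  fixes f F :: "real \<Rightarrow> real"
  assumes F: "\<And>t. c < t \<Longrightarrow> (F has_real_derivative f t) (at t)" and cont: "\<And>t. c < t \<Longrightarrow> isCont f t"
    and A: "(F \<longlongrightarrow> A) (at_right c)" and B: "(F \<longlongrightarrow> B) at_top"
    and int: "integrable lborel (\<lambda>t. indicator {c<..} t * f t)"
  shows "(\<integral>t. indicator {c<..} t * f t \<partial>lborel) = B - A"
proof -
  have e: "einterval (ereal c) \<infinity> = {c<..}" by (auto simp: einterval_def)
  have "(LBINT t=ereal c..\<infinity>. f t) = B - A"
    by (rule interval_integral_FTC_integrable)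
      (use F cont A B int in \<open>auto simp: e ereal_tendsto_simps has_real_derivative_iff_has_vector_derivative set_integrable_def\<close>)
  then show ?thesis by (simp add: interval_lebesgue_integral_def e set_lebesgue_integral_def)
qed

lemma half_line_FTC_nonneg:
  fixes f F :: "real \<Rightarrow> real"
  assumes F: "\<And>t. c < t \<Longrightarrow> (F has_real_derivative f t) (at t)" and cont: "\<And>t. c < t \<Longrightarrow> isCont f t"
    and A: "(F \<longlongrightarrow> A) (at_right c)" and B: "(F \<longlongrightarrow> B) at_top" and nn: "\<And>t. c < t \<Longrightarrow> 0 \<le> f t"
  shows "integrable lborel (\<lambda>t. indicator {c<..} t * f t)"
proof -
  have e: "einterval (ereal c) \<infinity> = {c<..}" by (auto simp: einterval_def)
  have "set_integrable lborel (einterval (ereal c) \<infinity>) f"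
    by (rule interval_integral_FTC_nonneg(1)) (use F cont A B nn in \<open>auto simp: ereal_tendsto_simps\<close>)
  then show ?thesis by (simp add: e set_integrable_def)
qed

lemma exp_half_line_integrable:
  assumes "b > 0" shows "integrable lborel (\<lambda>t. indicator {0<..} t * exp (- b * t) :: real)"
proof (rule half_line_FTC_nonneg[where F = "\<lambda>t. - exp (- b * t) / b"])
  show "((\<lambda>t. - exp (- b * t) / b) has_real_derivative exp (- b * t)) (at t)" for t
    using assms by (auto intro!: derivative_eq_intros)
  show "((\<lambda>t. - exp (- b * t) / b) \<longlongrightarrow> - exp (- b * 0) / b) (at_right 0)"
    by (intro tendsto_intros) (use assms in auto)
  show "((\<lambda>t. - exp (- b * t) / b) \<longlongrightarrow> 0) at_top" using assms by real_asymp
qed (auto intro!: continuous_intros)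

text \<open>From (1 + x/N)^N \<le> exp x.\<close>

lemma power_le_exp: 
  fixes x :: real assumes "0 \<le> x" "N > 0" shows "x ^ N \<le> real N ^ N * exp x"
proof -
  have "(x / real N) ^ N \<le> (1 + x / real N) ^ N" using assms by (intro power_mono) auto
  also have "\<dots> \<le> exp x" using assms by (intro exp_ge_one_plus_x_over_n_power_n) auto
  finally have "real N ^ N * (x / real N) ^ N \<le> real N ^ N * exp x" by (intro mult_left_mono) auto
  then show ?thesis using assms by (simp add: power_divide)
qed

text \<open>The factor exp(- \<rho>/t) controls every power at 0, and half of the exponent b t
  controls every power at infinity; the other half is the majorant.\<close>

lemma powr_exp_half_line_integrable:
  assumes \<rho>: "\<rho> > 0" and b: "b > 0"
  shows "integrable lborel (\<lambda>t. indicator {0<..} t * (t powr (- s) * exp (- (\<rho> / t) - b * t)) :: real)"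
proof -
  obtain N :: nat where N: "\<bar>s\<bar> \<le> real N" "N > 0"
    using real_arch_simple[of "max 1 \<bar>s\<bar>"] by (auto simp: max_def split: if_splits)
  let ?C = "(1 / \<rho>) ^ N * real N ^ N + (2 / b) ^ N * real N ^ N"
  have le: "t powr (- s) * exp (- (\<rho> / t) - b * t) \<le> ?C * exp (- (b / 2) * t)" if t: "t > 0" for t
  proof -
    have 1: "(1 / t) ^ N * exp (- (\<rho> / t)) \<le> (1 / \<rho>) ^ N * real N ^ N"
    proof -
      have "(\<rho> / t) ^ N * exp (- (\<rho> / t)) \<le> real N ^ N"
        using power_le_exp[of "\<rho> / t" N] N t \<rho> by (simp add: exp_minus field_simps)
      then show ?thesis using \<rho> t by (simp add: power_divide field_simps)
    qed
    have 2: "t ^ N * exp (- (b / 2) * t) \<le> (2 / b) ^ N * real N ^ N"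
    proof -
      have "(b / 2 * t) ^ N * exp (- (b / 2 * t)) \<le> real N ^ N"
        using power_le_exp[of "b / 2 * t" N] N t b by (simp add: exp_minus field_simps)
      then show ?thesis using b t by (simp add: power_divide power_mult_distrib field_simps)
    qed
    have "t powr (- s) \<le> (1 / t) ^ N + t ^ N"
    proof (cases "t \<le> 1")
      case True
      have "t powr (- s) \<le> t powr (- real N)" using N t True by (intro powr_mono') auto
      also have "\<dots> = (1 / t) ^ N" using t by (simp add: powr_minus powr_realpow power_one_over inverse_eq_divide)
      finally show ?thesis using t by (simp add: add_increasing2)
    next
      case False
      have "t powr (- s) \<le> t powr (real N)" using N False by (intro powr_mono) auto
      also have "\<dots> = t ^ N" using t by (simp add: powr_realpow)
      finally show ?thesis using t by (simp add: add_increasing)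
    qed
    then have "t powr (- s) * exp (- (\<rho> / t) - b * t) \<le> ((1 / t) ^ N + t ^ N) * exp (- (\<rho> / t) - b * t)"
      by (rule mult_right_mono) simp
    also have "\<dots> = (1 / t) ^ N * exp (- (\<rho> / t)) * (exp (- (b / 2) * t) * exp (- (b / 2) * t)) + t ^ N * exp (- (b / 2) * t) * (exp (- (\<rho> / t)) * exp (- (b / 2) * t))"
      by (simp add: exp_add[symmetric] algebra_simps flip: exp_diff)
    also have "\<dots> \<le> (1 / \<rho>) ^ N * real N ^ N * (1 * exp (- (b / 2) * t)) + (2 / b) ^ N * real N ^ N * (1 * exp (- (b / 2) * t))"
      using t b \<rho> by (intro add_mono mult_mono 1 2) auto
    finally show ?thesis by (simp add: algebra_simps)
  qed
  have i: "integrable lborel (\<lambda>t. ?C * (indicator {0<..} t * exp (- (b / 2) * t)))"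
    using exp_half_line_integrable[of "b / 2"] b by (intro Bochner_Integration.integrable_mult_right) simp
  show ?thesis
  proof (rule Bochner_Integration.integrable_bound[OF i])
    show "AE t in lborel. norm (indicator {0<..} t * (t powr (- s) * exp (- (\<rho> / t) - b * t))) \<le> norm (?C * (indicator {0<..} t * exp (- (b / 2) * t)))"
      unfolding real_norm_def
    proof (intro AE_I2 order_trans[OF _ abs_ge_self], subst abs_of_nonneg)
      show "indicator {0<..} t * (t powr (- s) * exp (- (\<rho> / t) - b * t)) \<le> ?C * (indicator {0<..} t * exp (- (b / 2) * t))" for t
        by (cases "t > 0") (use le in auto)
    qed simp
  qed measurable
qed

text \<open>Equals 2 (\<rho>/b)^((1 - s)/2) K_(s-1)(2 sqrt(\<rho> b)) with the Macdonald function K.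
  Half-integral \<open>s\<close> gives elementary functions and belongs to n = 3, integral
  \<open>s\<close> belongs to n = 2.\<close>

definition macdonald_integral :: "real \<Rightarrow> real \<Rightarrow> real \<Rightarrow> real" where
  "macdonald_integral s \<rho> b = (\<integral>t. indicator {0<..} t * (t powr (- s) * exp (- (\<rho> / t) - b * t)) \<partial>lborel)"

text \<open>Differentiation in \<rho> brings down - 1/t and so raises the index by 1; the integrand
  at \<rho>/2 dominates on the interval from \<rho>/2 to 2 \<rho>.\<close>

lemma macdonald_integral_has_derivative:
  assumes \<rho>: "\<rho> > 0" and b: "b > 0"
  shows "((\<lambda>\<rho>. macdonald_integral s \<rho> b) has_real_derivative - macdonald_integral (s + 1) \<rho> b) (at \<rho>)"
proof -
  have "((\<lambda>\<rho>. \<integral>t. indicator {0<..} t * (t powr (- s) * exp (- (\<rho> / t) - b * t)) \<partial>lborel) has_vector_derivative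
    (\<integral>t. indicator {0<..} t * - (t powr (- (s + 1)) * exp (- (\<rho> / t) - b * t)) \<partial>lborel)) (at \<rho>)"
  proof (rule has_vector_derivative_lebesgue_integral(2)[where a = "\<rho> / 2" and b = "2 * \<rho>"
        and g = "\<lambda>t. indicator {0<..} t * (t powr (- (s + 1)) * exp (- ((\<rho> / 2) / t) - b * t))"])
    fix r t assume r: "\<rho> / 2 < r" "r < 2 * \<rho>"
    show "integrable lborel (\<lambda>t. indicator {0<..} t * (t powr (- s) * exp (- (r / t) - b * t)))"
      by (rule powr_exp_half_line_integrable) (use r \<rho> b in auto)
    show "((\<lambda>r. indicator {0<..} t * (t powr (- s) * exp (- (r / t) - b * t))) has_vector_derivative
       indicator {0<..} t * - (t powr (- (s + 1)) * exp (- (r / t) - b * t))) (at r)"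
    proof (cases "t > 0")
      case True
      have e: "t powr (- (s + 1)) = t powr (- s) / t" using True powr_diff[of t "- s" 1] by simp
      have "((\<lambda>r. t powr (- s) * exp (- (r / t) - b * t)) has_real_derivative - (t powr (- s) / t * exp (- (r / t) - b * t))) (at r)"
        using True by (auto intro!: derivative_eq_intros)
      then show ?thesis using True unfolding e by (simp add: has_real_derivative_iff_has_vector_derivative)
    qed simp
    show "norm (indicator {0<..} t * - (t powr (- (s + 1)) * exp (- (r / t) - b * t)))
       \<le> indicator {0<..} t * (t powr (- (s + 1)) * exp (- ((\<rho> / 2) / t) - b * t))"
    proof (cases "t > 0")
      case True
      then have "\<rho> / (2 * t) \<le> r / t" using r by (simp add: field_simps)
      then show ?thesis using True by (auto simp: abs_mult intro!: mult_left_mono)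
    qed simp
  next
    show "integrable lborel (\<lambda>t. indicator {0<..} t * (t powr (- (s + 1)) * exp (- ((\<rho> / 2) / t) - b * t)))"
      by (rule powr_exp_half_line_integrable) (use \<rho> b in auto)
  qed (use \<rho> in auto)
  then show ?thesis unfolding macdonald_integral_def has_real_derivative_iff_has_vector_derivative by simp
qed

text \<open>Left unnormalised: the limit at infinity is sqrt pi.\<close>

definition gauss_cdf :: "real \<Rightarrow> real" where "gauss_cdf u = (\<integral>y. indicator {..u} y * exp (- y\<^sup>2) \<partial>lborel)"

section \<open>Gaussian integrals and the Laplace transform of the Levy density\<close>

lemma gauss_integrable: "integrable lborel (\<lambda>y::real. exp (- y\<^sup>2))" and gauss_total: "(\<integral>y. exp (- y\<^sup>2) \<partial>lborel) = sqrt pi"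
proof -
  have "complex_of_real (\<integral>y. exp (- y\<^sup>2) \<partial>lborel) = of_real (sqrt pi)"
    using gaussian_fourier_real(2)[of 1 0] by simp
  then show "(\<integral>y. exp (- y\<^sup>2) \<partial>lborel) = sqrt pi" by (simp only: of_real_eq_iff)
  show "integrable lborel (\<lambda>y::real. exp (- y\<^sup>2))"
    using gaussian_fourier_real(1)[of 1 0] by (simp add: complex_of_real_integrable_eq)
qed

lemma gauss_cdf_derivative: "(gauss_cdf has_real_derivative exp (- u\<^sup>2)) (at u)"
proof -
  have i: "integrable lborel (\<lambda>y. indicator A y * exp (- y\<^sup>2) :: real)" if "A \<in> sets borel" for A
    using integrable_mult_indicator[OF _ gauss_integrable, of A] that by simp
  have eq: "gauss_cdf v = gauss_cdf (u - 1) + (LBINT y=u - 1..v. exp (- y\<^sup>2))" if v: "u - 1 \<le> v" for v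
  proof -
    have "(LBINT y=u - 1..v. exp (- y\<^sup>2)) = (\<integral>y. indicator {u - 1<..v} y * exp (- y\<^sup>2) \<partial>lborel)"
      using v by (simp add: interval_integral_Ioc set_lebesgue_integral_def)
    moreover have "gauss_cdf v = (\<integral>y. indicator {..u - 1} y * exp (- y\<^sup>2) + indicator {u - 1<..v} y * exp (- y\<^sup>2) \<partial>lborel)"
      unfolding gauss_cdf_def using v by (intro Bochner_Integration.integral_cong) (auto simp: indicator_def)
    ultimately show ?thesis unfolding gauss_cdf_def by (simp add: i)
  qed
  have "((\<lambda>v. LBINT y=u - 1..v. exp (- y\<^sup>2)) has_vector_derivative exp (- u\<^sup>2)) (at u within {u - 1..u + 1})"
    by (rule interval_integral_FTC2) (auto intro!: continuous_intros)
  then have "((\<lambda>v. LBINT y=u - 1..v. exp (- y\<^sup>2)) has_vector_derivative exp (- u\<^sup>2)) (at u within {u - 1<..<u + 1})"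
    by (rule has_vector_derivative_within_subset) auto
  then have "((\<lambda>v. LBINT y=u - 1..v. exp (- y\<^sup>2)) has_real_derivative exp (- u\<^sup>2)) (at u)"
    by (subst (asm) has_vector_derivative_within_open) (auto simp: has_real_derivative_iff_has_vector_derivative)
  then have "((\<lambda>v. gauss_cdf (u - 1) + (LBINT y=u - 1..v. exp (- y\<^sup>2))) has_real_derivative exp (- u\<^sup>2)) (at u)"
    by (auto intro!: derivative_eq_intros)
  note D = this
  have "eventually (\<lambda>v. v \<in> {u - 1<..}) (nhds u)" by (intro eventually_nhds_in_open) auto
  then have ev: "eventually (\<lambda>v. gauss_cdf v = gauss_cdf (u - 1) + (LBINT y=u - 1..v. exp (- y\<^sup>2))) (nhds u)"
    by eventually_elim (rule eq, simp)
  show ?thesis by (rule iffD2[OF DERIV_cong_ev[OF refl ev refl] D])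
qed

lemma gauss_cdf_at_top: "(gauss_cdf \<longlongrightarrow> sqrt pi) at_top"
proof -
  have "((\<lambda>u::real. \<integral>y. indicator {..u} y * exp (- y\<^sup>2) \<partial>lborel) \<longlongrightarrow> (\<integral>y. exp (- y\<^sup>2) \<partial>lborel)) at_top"
  proof (rule integral_dominated_convergence_at_top[where w = "\<lambda>y. exp (- y\<^sup>2)"])
    show "AE y in lborel. ((\<lambda>u::real. indicator {..u} y * exp (- y\<^sup>2)) \<longlongrightarrow> (exp (- y\<^sup>2) :: real)) at_top" 
    proof (intro AE_I2 tendsto_eventually)
      fix y :: real
      show "\<forall>\<^sub>F u in at_top. indicator {..u} y * exp (- y\<^sup>2) = (exp (- y\<^sup>2) :: real)"
        using eventually_ge_at_top[of y] by eventually_elim auto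
    qed
    show "\<forall>\<^sub>F u in at_top. AE y in lborel. norm (indicator {..u} y * exp (- y\<^sup>2)) \<le> exp (- y\<^sup>2 :: real)"
      by (intro always_eventually allI AE_I2) (auto simp: indicator_def)
  qed (auto intro: gauss_integrable)
  then show ?thesis unfolding gauss_cdf_def[abs_def] gauss_total .
qed

lemma gauss_cdf_at_bot: "(gauss_cdf \<longlongrightarrow> 0) at_bot"
proof -
  have "((\<lambda>u::real. \<integral>y. indicator {..- u} y * exp (- y\<^sup>2) \<partial>lborel) \<longlongrightarrow> (\<integral>y. (0::real) \<partial>(lborel::real measure))) at_top"
  proof (rule integral_dominated_convergence_at_top[where w = "\<lambda>y. exp (- y\<^sup>2)"])
    show "AE y in lborel. ((\<lambda>u::real. indicator {..- u} y * exp (- y\<^sup>2)) \<longlongrightarrow> (0::real)) at_top"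
    proof (intro AE_I2 tendsto_eventually)
      fix y :: real
      show "\<forall>\<^sub>F u in at_top. indicator {..- u} y * exp (- y\<^sup>2) = (0::real)"
        using eventually_gt_at_top[of "- y"] by eventually_elim auto
    qed
    show "\<forall>\<^sub>F u in at_top. AE y in lborel. norm (indicator {..- u} y * exp (- y\<^sup>2)) \<le> exp (- y\<^sup>2 :: real)"
      by (intro always_eventually allI AE_I2) (auto simp: indicator_def)
  qed (auto intro: gauss_integrable)
  then show ?thesis unfolding gauss_cdf_def[abs_def] filterlim_at_bot_mirror by simp
qed

text \<open>The exponent a^2 t + h^2 / (4 t) is both (a sqrt t - h / (2 sqrt t))^2 + a h and (a sqrt
  t + h / (2 sqrt t))^2 - a h. Combining the two completed squares gives an explicit antiderivative:
  in its derivative the terms coming from a sqrt t cancel and those from h / (2 sqrt t) add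
  up.\<close>

lemma levy_integral:
  assumes h: "h > 0" and a: "a > 0"
  shows "macdonald_integral (3/2) (h\<^sup>2 / 4) (a\<^sup>2) = 2 * sqrt pi / h * exp (- (h * a))"
proof -
  define F where "F t = 2 / h * (exp (- (a * h)) * gauss_cdf (a * sqrt t - h / (2 * sqrt t)) + exp (a * h) * gauss_cdf (- (a * sqrt t + h / (2 * sqrt t))))" for t
  let ?f = "\<lambda>t. t powr (- (3/2)) * exp (- (h\<^sup>2 / 4 / t) - a\<^sup>2 * t)"
  have D: "(F has_real_derivative ?f t) (at t)" if t: "t > 0" for t
  proof -
    define r where "r = sqrt t"
    have r: "r > 0" "r\<^sup>2 = t" using t by (auto simp: r_def)
    have r3: "t powr (- (3/2)) = 1 / r ^ 3"
    proof -
      have "t powr (- (3/2)) = (r powr 2) powr (- (3/2))" using r by simp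
      also have "\<dots> = r powr (- 3)" by (simp only: powr_powr) simp
      also have "\<dots> = 1 / r ^ 3" using r by (simp add: powr_minus divide_inverse)
      finally show ?thesis .
    qed
    have dr: "(sqrt has_real_derivative 1 / (2 * r)) (at t)"
      using DERIV_real_sqrt[OF t] unfolding r_def by (simp add: inverse_eq_divide mult.commute)
    have dq: "((\<lambda>t. h / (2 * sqrt t)) has_real_derivative - (h / (4 * r ^ 3))) (at t)"
    proof -
      have "((\<lambda>t. h / (2 * sqrt t)) has_real_derivative (0 * (2 * sqrt t) - h * (2 * (1 / (2 * r)))) / (2 * sqrt t * (2 * sqrt t))) (at t)"
        by (intro DERIV_divide DERIV_cmult DERIV_const dr) (use r in \<open>simp add: r_def\<close>)
      also have "(0 * (2 * sqrt t) - h * (2 * (1 / (2 * r)))) / (2 * sqrt t * (2 * sqrt t)) = - (h / (4 * r ^ 3))"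
        unfolding r_def[symmetric] using r(1) by (simp add: field_simps power3_eq_cube)
      finally show ?thesis .
    qed
    have d1: "((\<lambda>t. a * sqrt t - h / (2 * sqrt t)) has_real_derivative (a * (1 / (2 * r)) - - (h / (4 * r ^ 3)))) (at t)"
      by (intro DERIV_diff DERIV_cmult dr dq)
    have d2: "((\<lambda>t. - (a * sqrt t + h / (2 * sqrt t))) has_real_derivative - (a * (1 / (2 * r)) + - (h / (4 * r ^ 3)))) (at t)"
      by (intro DERIV_minus DERIV_add DERIV_cmult dr dq)
    let ?e = "exp (- (h\<^sup>2 / 4 / t) - a\<^sup>2 * t)"
    have sq: "(a * r - h / (2 * r))\<^sup>2 = a\<^sup>2 * t + h\<^sup>2 / 4 / t - a * h" "(a * r + h / (2 * r))\<^sup>2 = a\<^sup>2 * t + h\<^sup>2 / 4 / t + a * h"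
      using r(1) unfolding r(2)[symmetric] by (simp_all add: field_simps power2_eq_square)
    have e1: "exp (- (a * h)) * exp (- (a * r - h / (2 * r))\<^sup>2) = ?e" unfolding sq exp_add[symmetric] by (simp add: algebra_simps)
    have e2: "exp (a * h) * exp (- (- (a * r + h / (2 * r)))\<^sup>2) = ?e" unfolding power2_minus sq exp_add[symmetric] by (simp add: algebra_simps)
    have "(F has_real_derivative 2 / h * (exp (- (a * h)) * (exp (- (a * r - h / (2 * r))\<^sup>2) * (a * (1 / (2 * r)) - - (h / (4 * r ^ 3))))
        + exp (a * h) * (exp (- (- (a * r + h / (2 * r)))\<^sup>2) * (- (a * (1 / (2 * r)) + - (h / (4 * r ^ 3))))))) (at t)"
      unfolding F_def r_def
      by (intro DERIV_cmult DERIV_add DERIV_chain2[OF gauss_cdf_derivative] d1[unfolded r_def] d2[unfolded r_def])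
    also have "2 / h * (exp (- (a * h)) * (exp (- (a * r - h / (2 * r))\<^sup>2) * (a * (1 / (2 * r)) - - (h / (4 * r ^ 3))))
        + exp (a * h) * (exp (- (- (a * r + h / (2 * r)))\<^sup>2) * (- (a * (1 / (2 * r)) + - (h / (4 * r ^ 3))))))
      = 2 / h * (?e * (a * (1 / (2 * r)) - - (h / (4 * r ^ 3))) + ?e * (- (a * (1 / (2 * r)) + - (h / (4 * r ^ 3)))))"
      by (simp only: mult.assoc[symmetric] e1 e2)
    also have "\<dots> = ?f t"
    proof -
      have "2 / h * (e * (A - - (h / (4 * q))) + e * (- (A + - (h / (4 * q))))) = 1 / q * e" if "q \<noteq> 0" for e A q
        using that h by (simp add: field_simps)
      then show ?thesis unfolding r3 using r(1) by simp
    qed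
    finally show ?thesis .
  qed
  \<comment> \<open>Of the four boundary contributions only the first summand at infinity survives,
    since every other argument of \<open>gauss_cdf\<close> tends to minus infinity.\<close>
  have "macdonald_integral (3/2) (h\<^sup>2 / 4) (a\<^sup>2) = 2 / h * (exp (- (a * h)) * sqrt pi + exp (a * h) * 0) - 2 / h * (exp (- (a * h)) * 0 + exp (a * h) * 0)"
    unfolding macdonald_integral_def
  proof (rule half_line_FTC[OF D])
    show "isCont ?f t" if "0 < t" for t using that by (auto intro!: continuous_intros)
    show "integrable lborel (\<lambda>t. indicator {0<..} t * ?f t)"
      by (rule powr_exp_half_line_integrable) (use h a in auto)
    have l1: "filterlim (\<lambda>t. a * sqrt t - h / (2 * sqrt t)) at_bot (at_right 0)" using a h by real_asymp
    have l2: "filterlim (\<lambda>t. - (a * sqrt t + h / (2 * sqrt t))) at_bot (at_right 0)" using a h by real_asymp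
    have l3: "filterlim (\<lambda>t. a * sqrt t - h / (2 * sqrt t)) at_top at_top" using a h by real_asymp
    have l4: "filterlim (\<lambda>t. - (a * sqrt t + h / (2 * sqrt t))) at_bot at_top" using a h by real_asymp
    show "(F \<longlongrightarrow> 2 / h * (exp (- (a * h)) * 0 + exp (a * h) * 0)) (at_right 0)"
      unfolding F_def by (intro tendsto_mult tendsto_add tendsto_const filterlim_compose[OF gauss_cdf_at_bot l1] filterlim_compose[OF gauss_cdf_at_bot l2])
    show "(F \<longlongrightarrow> 2 / h * (exp (- (a * h)) * sqrt pi + exp (a * h) * 0)) at_top"
      unfolding F_def by (intro tendsto_mult tendsto_add tendsto_const filterlim_compose[OF gauss_cdf_at_top l3] filterlim_compose[OF gauss_cdf_at_bot l4])
  qed auto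
  then show ?thesis by (simp add: mult_ac)
qed

section \<open>Fourier representation of the layer kernels\<close>

text \<open>The square root of k^2 - |\<xi>|^2 with nonnegative real and imaginary part: the branch
  for which exp(i Zk h) is outgoing or decaying as h grows.\<close>

definition Zk :: "real \<Rightarrow> 'a::euclidean_space \<Rightarrow> complex" where
  "Zk k \<xi> = (if norm \<xi> \<le> k then of_real (Dk k \<xi>) else \<i> * of_real (Dk k \<xi>))"

lemma Zk_measurable [measurable]: "Zk k \<in> borel_measurable borel"
  unfolding Zk_def[abs_def] by measurable

lemma cmod_Zk [simp]: "cmod (Zk k \<xi>) = Dk k \<xi>" by (simp add: Zk_def norm_mult)

lemma Re_i_Zk: "Re (\<i> * Zk k \<xi>) \<le> 0" by (simp add: Zk_def)

text \<open>Half the density of the first passage time to height \<open>h\<close> for the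
  one-dimensional process whose transition density is the heat kernel, damped by exp(- b t). Mixing
  with it turns exp(- t |\<xi>|^2) into exp(- h sqrt(b + |\<xi>|^2)) / 2.\<close>

definition levy_weight :: "real \<Rightarrow> real \<Rightarrow> real \<Rightarrow> real" where
  "levy_weight h b t = h / (4 * sqrt pi) * (indicator {0<..} t * (t powr (- (3/2)) * exp (- (h\<^sup>2 / 4 / t) - b * t)))"

lemma levy_weight_measurable [measurable]: "levy_weight h b \<in> borel_measurable borel"
  unfolding levy_weight_def[abs_def] by measurable

lemma levy_weight_nonneg: "h > 0 \<Longrightarrow> 0 \<le> levy_weight h b t"
  by (auto simp: levy_weight_def)

lemma levy_weight_integral:
  assumes "h > 0" "b > 0"
  shows "integrable lborel (levy_weight h b)" "(\<integral>t. levy_weight h b t \<partial>lborel) = exp (- (h * sqrt b)) / 2"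
proof -
  show "integrable lborel (levy_weight h b)"
    unfolding levy_weight_def[abs_def] using assms
    by (intro Bochner_Integration.integrable_mult_right powr_exp_half_line_integrable) auto
  have "(\<integral>t. levy_weight h b t \<partial>lborel) = h / (4 * sqrt pi) * macdonald_integral (3/2) (h\<^sup>2 / 4) ((sqrt b)\<^sup>2)"
    using assms by (simp add: levy_weight_def macdonald_integral_def)
  also have "\<dots> = exp (- (h * sqrt b)) / 2"
    using assms by (subst levy_integral) auto
  finally show "(\<integral>t. levy_weight h b t \<partial>lborel) = exp (- (h * sqrt b)) / 2" .
qed

lemma heat_measurable [measurable]:
  "(\<lambda>z. heat (f z) (g z)) \<in> borel_measurable M" 
  if [measurable]: "f \<in> borel_measurable M" "g \<in> borel_measurable M" for f and g :: "'x \<Rightarrow> 'a::euclidean_space"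
  unfolding heat_def by measurable

lemma heat_nonneg: "0 \<le> heat t z" by (simp add: heat_def)

text \<open>The Gaussian exponents add up to (|z|^2 + h^2) / (4 t), so the mixture, apart from the
  factor h, is a function of the distance to (z, h) in the full space. For k = i sqrt b it is the
  double layer kernel at height h, and the factor after \<open>2 * h\<close> is minus the derivative
  of the fundamental solution in the squared distance.\<close>

lemma levy_heat_integral:
  fixes z :: "'a::euclidean_space"
  assumes h: "h > 0" and b: "b > 0"
  shows "integrable lborel (\<lambda>t. levy_weight h b t * heat t z)"
    and "(\<integral>t. levy_weight h b t * heat t z \<partial>lborel)
      = 2 * h * (1 / 4 * (4 * pi) powr (- (real DIM('a) + 1) / 2) * macdonald_integral ((real DIM('a) + 3) / 2) (((norm z)\<^sup>2 + h\<^sup>2) / 4) b)"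
proof -
  let ?c = "2 * h * (1 / 4 * (4 * pi) powr (- (real DIM('a) + 1) / 2))"
  let ?f = "\<lambda>t. indicator {0<..} t * (t powr (- ((real DIM('a) + 3) / 2)) * exp (- (((norm z)\<^sup>2 + h\<^sup>2) / 4 / t) - b * t))"
  have eq: "levy_weight h b t * heat t z = ?c * ?f t" for t
  proof (cases "t > 0")
    case True
    have 1: "t powr (- (3/2)) * t powr (- real DIM('a) / 2) = t powr (- ((real DIM('a) + 3) / 2))"
      unfolding powr_add[symmetric] by (rule arg_cong[where f = "\<lambda>s. t powr s"]) (simp add: field_simps)
    have 2: "exp (- (h\<^sup>2 / 4 / t) - b * t) * exp (- (norm z)\<^sup>2 / (4 * t)) = exp (- (((norm z)\<^sup>2 + h\<^sup>2) / 4 / t) - b * t)"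
      unfolding exp_add[symmetric] by (simp add: add_divide_distrib)
    have 3: "h / (4 * sqrt pi) * (4 * pi) powr (- real DIM('a) / 2) = ?c"
    proof -
      have "(4 * pi) powr (- (real DIM('a) + 1) / 2) = (4 * pi) powr (- real DIM('a) / 2 + - (1/2))"
        by (simp add: field_simps)
      also have "\<dots> = (4 * pi) powr (- real DIM('a) / 2) * (1 / (2 * sqrt pi))"
        unfolding powr_add by (simp add: powr_minus powr_half_sqrt real_sqrt_mult inverse_eq_divide)
      finally show ?thesis by simp
    qed
    have 4: "(4 * pi * t) powr (- real DIM('a) / 2) = (4 * pi) powr (- real DIM('a) / 2) * t powr (- real DIM('a) / 2)"
      by (rule powr_mult)
    have "levy_weight h b t * heat t z = (h / (4 * sqrt pi) * (4 * pi) powr (- real DIM('a) / 2)) *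
       ((t powr (- (3/2)) * t powr (- real DIM('a) / 2)) * (exp (- (h\<^sup>2 / 4 / t) - b * t) * exp (- (norm z)\<^sup>2 / (4 * t))))"
      using True unfolding levy_weight_def heat_def 4 by (simp add: mult_ac)
    then show ?thesis unfolding 1 2 3 using True by simp
  qed (simp add: levy_weight_def)
  have p: "((norm z)\<^sup>2 + h\<^sup>2) / 4 > 0" using h by (simp add: add_nonneg_pos)
  show "integrable lborel (\<lambda>t. levy_weight h b t * heat t z)"
    unfolding eq by (intro Bochner_Integration.integrable_mult_right powr_exp_half_line_integrable p b)
  show "(\<integral>t. levy_weight h b t * heat t z \<partial>lborel)
      = 2 * h * (1 / 4 * (4 * pi) powr (- (real DIM('a) + 1) / 2) * macdonald_integral ((real DIM('a) + 3) / 2) (((norm z)\<^sup>2 + h\<^sup>2) / 4) b)"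
    unfolding eq macdonald_integral_def by simp
qed

text \<open>Fubini's theorem is used twice: y and t are exchanged to apply the heat kernel formula
  at each time, then t and \<xi> are exchanged to integrate out the time with the Levy integral at b
  + |\<xi>|^2.\<close>

lemma kernel_representation_real:
  fixes \<phi> :: "'a::euclidean_space \<Rightarrow> complex"
  assumes \<phi>: "\<phi> \<in> test_functions \<Omega>" and h: "h > 0" and b: "b > 0"
    and cont: "continuous_on UNIV (\<lambda>y. G (x - y))"
    and G: "\<And>z::'a. G z = (\<integral>t. levy_weight h b t * heat t z \<partial>lborel)"
  shows "(\<integral>y. of_real (G (x - y)) * \<phi> y \<partial>lborel)
    = 1/2 * (of_real (fourier_const TYPE('a)) * (\<integral>\<xi>. exp (\<i> * of_real (\<xi> \<bullet> x)) * of_real (exp (- (h * sqrt (b + (norm \<xi>)\<^sup>2)))) * fourier \<phi> \<xi> \<partial>lborel))"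
proof -
  let ?w = "levy_weight h b"
  let ?c = "complex_of_real (fourier_const TYPE('a))"
  have i\<phi>: "integrable lborel \<phi>" by (rule test_functions_integrable[OF \<phi>])
  have iF: "integrable lborel (fourier \<phi>)" by (rule fourier_test_integrable[OF \<phi>])
  have [measurable]: "\<phi> \<in> borel_measurable borel" using i\<phi> by auto
  let ?H = "\<lambda>y t. complex_of_real (?w t * heat t (x - y)) * \<phi> y"
  have iH: "integrable (lborel \<Otimes>\<^sub>M lborel) (\<lambda>(y, t). ?H y t)"
  proof (rule lborel_pair.Fubini_integrable)
    have 1: "(\<integral>t. norm (?H y t) \<partial>lborel) = norm (of_real (G (x - y)) * \<phi> y)" for y
    proof -
      have "norm (?H y t) = (?w t * heat t (x - y)) * cmod (\<phi> y)" for t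
        using levy_weight_nonneg[OF h, of b t] heat_nonneg[of t "x - y"] by (simp add: norm_mult abs_mult)
      moreover have "G (x - y) \<ge> 0" unfolding G
        by (intro integral_nonneg_AE AE_I2 mult_nonneg_nonneg levy_weight_nonneg heat_nonneg h)
      ultimately show ?thesis by (simp only: integral_mult_left_zero norm_mult norm_of_real G abs_of_nonneg)
    qed
    have "locally_integrable (\<lambda>y. complex_of_real (G (x - y)))"
      by (intro continuous_locally_integrable continuous_on_of_real cont)
    from integrable_norm[OF integrable_locally_integrable_mult[OF this \<phi>]]
    show "integrable lborel (\<lambda>y. \<integral>t. norm (case (y, t) of (y, t) \<Rightarrow> ?H y t) \<partial>lborel)" by (simp only: prod.case 1)
    show "AE y in lborel. integrable lborel (\<lambda>t. case (y, t) of (y, t) \<Rightarrow> ?H y t)"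
      unfolding prod.case
      by (intro AE_I2 integrable_mult_left integrable_of_real levy_heat_integral(1) h b)
  qed measurable
  \<comment> \<open>The indicator restricts to t > 0, where the Gaussian factor is at most 1;
    \<open>levy_weight\<close> is 0 elsewhere, so the integrand is unaffected.\<close>
  have iG: "integrable (lborel \<Otimes>\<^sub>M lborel) (\<lambda>(t, \<xi>). complex_of_real (?w t) * (exp (\<i> * of_real (\<xi> \<bullet> x)) * of_real (indicator {0<..} t * exp (- t * (norm \<xi>)\<^sup>2)) * fourier \<phi> \<xi>))"
  proof (rule integrable_product_bound)
    show "integrable lborel (\<lambda>t. complex_of_real (?w t))" by (intro integrable_of_real levy_weight_integral h b)
    show "integrable lborel (fourier \<phi>)" by (rule iF)
    show "cmod (complex_of_real (?w t) * (exp (\<i> * of_real (\<xi> \<bullet> x)) * of_real (indicator {0<..} t * exp (- t * (norm \<xi>)\<^sup>2)) * fourier \<phi> \<xi>))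
       \<le> cmod (complex_of_real (?w t)) * cmod (fourier \<phi> \<xi>)" for t \<xi>
    proof -
      have "\<bar>indicator {0<..} t * exp (- t * (norm \<xi>)\<^sup>2)\<bar> \<le> 1" by (auto simp: indicator_def)
      then have "\<bar>indicator {0<..} t * exp (- t * (norm \<xi>)\<^sup>2)\<bar> * cmod (fourier \<phi> \<xi>) \<le> 1 * cmod (fourier \<phi> \<xi>)" by (intro mult_right_mono) auto
      then show ?thesis unfolding norm_mult cmod_exp_i norm_of_real by (intro mult_left_mono) auto
    qed
  qed measurable
  have w0: "?w t = 0" if "\<not> t > 0" for t using that by (simp add: levy_weight_def)
  have "(\<integral>y. of_real (G (x - y)) * \<phi> y \<partial>lborel) = (\<integral>y. (\<integral>t. ?H y t \<partial>lborel) \<partial>lborel)"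
    by (simp add: G integral_complex_of_real[symmetric] del: integral_complex_of_real of_real_mult)
  also have "\<dots> = (\<integral>t. (\<integral>y. ?H y t \<partial>lborel) \<partial>lborel)"
    by (rule lborel_pair.Fubini_integral[OF iH, symmetric])
  also have "\<dots> = (\<integral>t. ?c * (\<integral>\<xi>. complex_of_real (?w t) * (exp (\<i> * of_real (\<xi> \<bullet> x)) * of_real (indicator {0<..} t * exp (- t * (norm \<xi>)\<^sup>2)) * fourier \<phi> \<xi>) \<partial>lborel) \<partial>lborel)"
  proof (rule Bochner_Integration.integral_cong[OF refl])
    fix t :: real
    show "(\<integral>y. ?H y t \<partial>lborel) = ?c * (\<integral>\<xi>. complex_of_real (?w t) * (exp (\<i> * of_real (\<xi> \<bullet> x)) * of_real (indicator {0<..} t * exp (- t * (norm \<xi>)\<^sup>2)) * fourier \<phi> \<xi>) \<partial>lborel)"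
    proof (cases "t > 0")
      case True
      have "(\<integral>y. ?H y t \<partial>lborel) = of_real (?w t) * (\<integral>y. of_real (heat t (x - y)) * \<phi> y \<partial>lborel)"
        by (simp add: mult.assoc)
      also have "\<dots> = of_real (?w t) * (?c * (\<integral>\<xi>. exp (\<i> * of_real (\<xi> \<bullet> x)) * of_real (exp (- t * (norm \<xi>)\<^sup>2)) * fourier \<phi> \<xi> \<partial>lborel))"
        unfolding fourier_heat[OF i\<phi> True] ..
      also have "\<dots> = ?c * (of_real (?w t) * (\<integral>\<xi>. exp (\<i> * of_real (\<xi> \<bullet> x)) * of_real (exp (- t * (norm \<xi>)\<^sup>2)) * fourier \<phi> \<xi> \<partial>lborel))"
        by (rule mult.left_commute)
      finally show ?thesis using True by simp
    qed (simp add: w0)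
  qed
  also have "\<dots> = ?c * (\<integral>t. (\<integral>\<xi>. complex_of_real (?w t) * (exp (\<i> * of_real (\<xi> \<bullet> x)) * of_real (indicator {0<..} t * exp (- t * (norm \<xi>)\<^sup>2)) * fourier \<phi> \<xi>) \<partial>lborel) \<partial>lborel)"
    by (rule integral_mult_right_zero)
  also have "(\<integral>t. (\<integral>\<xi>. complex_of_real (?w t) * (exp (\<i> * of_real (\<xi> \<bullet> x)) * of_real (indicator {0<..} t * exp (- t * (norm \<xi>)\<^sup>2)) * fourier \<phi> \<xi>) \<partial>lborel) \<partial>lborel)
     = (\<integral>\<xi>. (\<integral>t. complex_of_real (?w t) * (exp (\<i> * of_real (\<xi> \<bullet> x)) * of_real (indicator {0<..} t * exp (- t * (norm \<xi>)\<^sup>2)) * fourier \<phi> \<xi>) \<partial>lborel) \<partial>lborel)"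
    by (rule lborel_pair.Fubini_integral[OF iG, symmetric])
  also have "\<dots> = (\<integral>\<xi>. 1/2 * (exp (\<i> * of_real (\<xi> \<bullet> x)) * of_real (exp (- (h * sqrt (b + (norm \<xi>)\<^sup>2)))) * fourier \<phi> \<xi>) \<partial>lborel)"
  proof (rule Bochner_Integration.integral_cong[OF refl])
    fix \<xi> :: 'a
    have e: "?w t * (indicator {0<..} t * exp (- t * (norm \<xi>)\<^sup>2)) = levy_weight h (b + (norm \<xi>)\<^sup>2) t" for t
    proof -
      have "exp (- (h\<^sup>2 / 4 / t) - b * t) * exp (- t * (norm \<xi>)\<^sup>2) = exp (- (h\<^sup>2 / 4 / t) - (b + (norm \<xi>)\<^sup>2) * t)"
        unfolding exp_add[symmetric] by (simp add: algebra_simps)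
      then show ?thesis by (cases "t > 0") (simp_all add: levy_weight_def mult.assoc)
    qed
    have "(\<integral>t. complex_of_real (?w t) * (exp (\<i> * of_real (\<xi> \<bullet> x)) * of_real (indicator {0<..} t * exp (- t * (norm \<xi>)\<^sup>2)) * fourier \<phi> \<xi>) \<partial>lborel)
      = (\<integral>t. complex_of_real (?w t * (indicator {0<..} t * exp (- t * (norm \<xi>)\<^sup>2))) * (exp (\<i> * of_real (\<xi> \<bullet> x)) * fourier \<phi> \<xi>) \<partial>lborel)"
      by (simp add: mult_ac)
    also have "\<dots> = of_real (\<integral>t. levy_weight h (b + (norm \<xi>)\<^sup>2) t \<partial>lborel) * (exp (\<i> * of_real (\<xi> \<bullet> x)) * fourier \<phi> \<xi>)"
      unfolding e by simp
    also have "(\<integral>t. levy_weight h (b + (norm \<xi>)\<^sup>2) t \<partial>lborel) = exp (- (h * sqrt (b + (norm \<xi>)\<^sup>2))) / 2"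
      using b by (intro levy_weight_integral h) (simp add: add_pos_nonneg)
    finally show "(\<integral>t. complex_of_real (?w t) * (exp (\<i> * of_real (\<xi> \<bullet> x)) * of_real (indicator {0<..} t * exp (- t * (norm \<xi>)\<^sup>2)) * fourier \<phi> \<xi>) \<partial>lborel)
      = 1/2 * (exp (\<i> * of_real (\<xi> \<bullet> x)) * of_real (exp (- (h * sqrt (b + (norm \<xi>)\<^sup>2)))) * fourier \<phi> \<xi>)"
      by (simp add: mult_ac)
  qed
  finally show ?thesis by (simp add: mult_ac)
qed

text \<open>On the right half plane the imaginary part vanishes only for real
  \<open>\<kappa>\<close>, and there the sum is positive.\<close>

lemma csqrt_right_half_plane:
  assumes "Re \<kappa> > 0" shows "\<kappa>\<^sup>2 + of_real (r\<^sup>2) \<notin> \<real>\<^sub>\<le>\<^sub>0"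
proof
  assume "\<kappa>\<^sup>2 + of_real (r\<^sup>2) \<in> \<real>\<^sub>\<le>\<^sub>0"
  then have "Re (\<kappa>\<^sup>2 + of_real (r\<^sup>2)) \<le> 0" "Im (\<kappa>\<^sup>2 + of_real (r\<^sup>2)) = 0"
    by (auto simp: complex_nonpos_Reals_iff)
  moreover have "Re (\<kappa>\<^sup>2 + of_real (r\<^sup>2)) = (Re \<kappa>)\<^sup>2 - (Im \<kappa>)\<^sup>2 + r\<^sup>2" "Im (\<kappa>\<^sup>2 + of_real (r\<^sup>2)) = 2 * Re \<kappa> * Im \<kappa>"
    by (simp_all add: power2_eq_square)
  ultimately show False using assms by (auto simp: add_nonneg_eq_0_iff sum_power2_le_zero_iff)
qed

text \<open>As z n tends to - i k from the right half plane, its square plus r^2 tends to r^2 - k^2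
  from below the real axis. For r > k the root is continuous there; for r < k the limit lies on the
  branch cut, and the approach from below selects - i sqrt(k^2 - r^2).\<close>

lemma csqrt_limit:
  fixes k r :: real
  assumes k: "k > 0" and r: "r \<ge> 0"
  defines "z n \<equiv> Complex (1 / real (Suc n)) (- k)"
  shows "(\<lambda>n. csqrt ((z n)\<^sup>2 + of_real (r\<^sup>2))) \<longlonglongrightarrow> - \<i> * (if r \<le> k then of_real (sqrt \<bar>k\<^sup>2 - r\<^sup>2\<bar>) else \<i> * of_real (sqrt \<bar>k\<^sup>2 - r\<^sup>2\<bar>))"
proof -
  let ?w = "\<lambda>n. (z n)\<^sup>2 + of_real (r\<^sup>2)"
  have w: "?w n = Complex ((1 / real (Suc n))\<^sup>2 - k\<^sup>2 + r\<^sup>2) (- 2 * k / real (Suc n))" for n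
    by (simp add: z_def complex_eq_iff power2_eq_square)
  have wlim: "?w \<longlonglongrightarrow> of_real (r\<^sup>2 - k\<^sup>2)"
  proof -
    have "(\<lambda>n. Complex ((1 / real (Suc n))\<^sup>2 - k\<^sup>2 + r\<^sup>2) (- 2 * k / real (Suc n))) \<longlonglongrightarrow> Complex (r\<^sup>2 - k\<^sup>2) 0"
      by (intro tendsto_Complex) real_asymp+
    then show ?thesis unfolding w by (simp add: complex_of_real_def)
  qed
  consider "r > k" | "r < k" | "r = k" by linarith
  then show ?thesis
  proof cases
    case 1
    then have pos: "r\<^sup>2 - k\<^sup>2 > 0" using k by (simp add: power_strict_mono)
    then have "complex_of_real (r\<^sup>2 - k\<^sup>2) \<notin> \<real>\<^sub>\<le>\<^sub>0" by (simp add: complex_nonpos_Reals_iff)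
    from isCont_tendsto_compose[OF continuous_at_csqrt[OF this] wlim]
    have "(\<lambda>n. csqrt (?w n)) \<longlonglongrightarrow> csqrt (of_real (r\<^sup>2 - k\<^sup>2))" .
    also have "csqrt (of_real (r\<^sup>2 - k\<^sup>2)) = of_real (sqrt \<bar>k\<^sup>2 - r\<^sup>2\<bar>)" using pos by (subst csqrt_of_real) auto
    finally show ?thesis using 1 by (simp add: mult.assoc[symmetric])
  next
    case 2
    then have pos: "k\<^sup>2 - r\<^sup>2 > 0" using r by (simp add: power_strict_mono)
    then have "complex_of_real (k\<^sup>2 - r\<^sup>2) \<notin> \<real>\<^sub>\<le>\<^sub>0" by (simp add: complex_nonpos_Reals_iff)
    moreover have "(\<lambda>n. - ?w n) \<longlonglongrightarrow> of_real (k\<^sup>2 - r\<^sup>2)" using tendsto_minus[OF wlim] by simp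
    ultimately have "(\<lambda>n. csqrt (- ?w n)) \<longlonglongrightarrow> csqrt (of_real (k\<^sup>2 - r\<^sup>2))"
      by (intro isCont_tendsto_compose[OF continuous_at_csqrt])
    also have "csqrt (of_real (k\<^sup>2 - r\<^sup>2)) = of_real (sqrt \<bar>k\<^sup>2 - r\<^sup>2\<bar>)" using pos by (subst csqrt_of_real) auto
    finally have lim: "(\<lambda>n. csqrt (- ?w n)) \<longlonglongrightarrow> of_real (sqrt \<bar>k\<^sup>2 - r\<^sup>2\<bar>)" .
    \<comment> \<open>Changing the sign moves the limit off the cut; the negative imaginary part
      decides which root this is.\<close>
    have "csqrt (?w n) = - \<i> * csqrt (- ?w n)" for n
    proof -
      have "Im (?w n) < 0" unfolding w using k by (simp add: divide_neg_pos)
      then have "csqrt (- ?w n) = \<i> * csqrt (?w n)" by (intro csqrt_minus) auto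
      then show ?thesis by simp
    qed
    then have "(\<lambda>n. csqrt (?w n)) = (\<lambda>n. - \<i> * csqrt (- ?w n))" by blast
    then show ?thesis using tendsto_mult_left[OF lim, of "- \<i>"] 2 by simp
  next
    case 3
    have "(\<lambda>n. sqrt (norm (?w n))) \<longlonglongrightarrow> sqrt (norm (complex_of_real (r\<^sup>2 - k\<^sup>2)))"
      by (intro tendsto_real_sqrt tendsto_norm wlim)
    then have "(\<lambda>n. norm (csqrt (?w n))) \<longlonglongrightarrow> 0" using 3 by simp
    from tendsto_norm_zero_cancel[OF this] show ?thesis using 3 by simp
  qed
qed

text \<open>Here \<open>p\<close> is the derivative of the fundamental solution in the squared
  distance, with \<kappa> for - i k. The spatial side \<open>A\<close> is holomorphic on the slit
  plane, which contains - i k; the frequency side \<open>B\<close> is treated on the right half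
  plane, where the root stays off its cut. They agree on the positive reals, hence on the half
  plane, and the claim is the boundary limit: of \<open>A\<close> by continuity, of \<open>B\<close>
  by domination.\<close>

theorem kernel_representation:
  fixes \<phi> :: "'a::euclidean_space \<Rightarrow> complex" and p :: "complex \<Rightarrow> real \<Rightarrow> complex"
  assumes hol: "\<And>\<rho>. \<rho> > 0 \<Longrightarrow> (\<lambda>\<kappa>. p \<kappa> \<rho>) holomorphic_on (- \<real>\<^sub>\<le>\<^sub>0)"
    and cont: "continuous_on ((- \<real>\<^sub>\<le>\<^sub>0) \<times> {0<..}) (\<lambda>z. p (fst z) (snd z))"
    and val: "\<And>\<kappa> \<rho>. \<kappa> > 0 \<Longrightarrow> \<rho> > 0 \<Longrightarrow> p (of_real \<kappa>) \<rho> = - of_real (1 / 4 * (4 * pi) powr (- (real DIM('a) + 1) / 2) * macdonald_integral ((real DIM('a) + 3) / 2) (\<rho> / 4) (\<kappa>\<^sup>2))"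
    and \<phi>: "\<phi> \<in> test_functions \<Omega>" and h: "h > 0" and k: "k > 0"
  shows "(\<integral>y. - of_real (2 * h) * p (- \<i> * of_real k) ((norm (x - y))\<^sup>2 + h\<^sup>2) * \<phi> y \<partial>lborel)
    = 1/2 * (of_real (fourier_const TYPE('a)) * (\<integral>\<xi>. exp (\<i> * of_real (\<xi> \<bullet> x)) * exp (\<i> * Zk k \<xi> * of_real h) * fourier \<phi> \<xi> \<partial>lborel))"
proof -
  let ?U = "- \<real>\<^sub>\<le>\<^sub>0 :: complex set"
  let ?\<rho> = "\<lambda>y. (norm (x - y))\<^sup>2 + h\<^sup>2"
  have \<rho>: "?\<rho> y > 0" for y using h by (simp add: add_nonneg_pos)
  have Uo: "open ?U" by (simp add: open_Compl)
  have i\<phi>: "integrable lborel \<phi>" by (rule test_functions_integrable[OF \<phi>])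
  have iF: "integrable lborel (fourier \<phi>)" by (rule fourier_test_integrable[OF \<phi>])
  have [measurable]: "\<phi> \<in> borel_measurable borel" using i\<phi> by auto
  define A where "A \<kappa> = (\<integral>y. - of_real (2 * h) * p \<kappa> (?\<rho> y) * \<phi> y \<partial>lborel)" for \<kappa>
  define B where "B \<kappa> = 1/2 * (of_real (fourier_const TYPE('a)) * (\<integral>\<xi>. exp (\<i> * of_real (\<xi> \<bullet> x)) * exp (- of_real h * csqrt (\<kappa>\<^sup>2 + of_real ((norm \<xi>)\<^sup>2))) * fourier \<phi> \<xi> \<partial>lborel))" for \<kappa>
  have pc: "continuous_on UNIV (\<lambda>y. p \<kappa> (?\<rho> y))" if "\<kappa> \<in> ?U" for \<kappa>
  proof -
    have "continuous_on UNIV ((\<lambda>z. p (fst z) (snd z)) \<circ> (\<lambda>y. (\<kappa>, ?\<rho> y)))"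
      by (intro continuous_on_compose continuous_intros continuous_on_subset[OF cont]) (use that \<rho> in auto)
    then show ?thesis by (simp add: o_def)
  qed
  have Ahol: "A holomorphic_on ?U"
    unfolding A_def
  proof (rule holomorphic_on_lebesgue_integral[OF Uo])
    show "(\<lambda>\<kappa>. - of_real (2 * h) * p \<kappa> (?\<rho> y) * \<phi> y) holomorphic_on ?U" for y
      by (intro holomorphic_intros hol \<rho>)
    show "(\<lambda>y. - of_real (2 * h) * p \<kappa> (?\<rho> y) * \<phi> y) \<in> borel_measurable lborel" if "\<kappa> \<in> ?U" for \<kappa>
    proof -
      have [measurable]: "(\<lambda>y. p \<kappa> (?\<rho> y)) \<in> borel_measurable borel" by (rule borel_measurable_continuous_onI[OF pc[OF that]])
      show ?thesis by measurable
    qed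
    fix \<kappa>0 assume "\<kappa>0 \<in> ?U"
    then obtain r where r: "r > 0" "cball \<kappa>0 r \<subseteq> ?U" using Uo open_contains_cball by blast
    obtain R where R: "R > 0" "\<And>y. norm y > R \<Longrightarrow> \<phi> y = 0" by (rule test_functions_support[OF \<phi>], rule that)
    \<comment> \<open>Squared distances from (x, h) to the support of \<open>\<phi>\<close> lie in
      this interval, so continuity of \<open>p\<close> bounds the integrand uniformly near
      \<open>\<kappa>0\<close>.\<close>
    let ?K = "cball \<kappa>0 r \<times> {h\<^sup>2..(norm x + R)\<^sup>2 + h\<^sup>2}"
    have "compact ?K" by (intro compact_Times) auto
    moreover have pos: "0 < v" if "h\<^sup>2 \<le> v" for v using that zero_less_power[OF h, of 2] by linarith
    have "continuous_on ?K (\<lambda>z. p (fst z) (snd z))"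
      using r(2) pos by (intro continuous_on_subset[OF cont]) auto
    ultimately have "bounded ((\<lambda>z. p (fst z) (snd z)) ` ?K)" by (intro compact_imp_bounded compact_continuous_image)
    then obtain C where C: "\<forall>z\<in>?K. cmod (p (fst z) (snd z)) \<le> C" unfolding bounded_iff by auto
    show "\<exists>r>0. \<exists>g. cball \<kappa>0 r \<subseteq> ?U \<and> integrable lborel g \<and> (\<forall>\<kappa>\<in>cball \<kappa>0 r. \<forall>y\<in>space lborel. norm (- of_real (2 * h) * p \<kappa> (?\<rho> y) * \<phi> y) \<le> g y)"
    proof (intro exI[of _ r] exI[of _ "\<lambda>y. 2 * h * C * cmod (\<phi> y)"] conjI ballI)
      show "integrable lborel (\<lambda>y. 2 * h * C * cmod (\<phi> y))" using i\<phi> by simp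
      fix \<kappa> y assume \<kappa>: "\<kappa> \<in> cball \<kappa>0 r"
      show "norm (- of_real (2 * h) * p \<kappa> (?\<rho> y) * \<phi> y) \<le> 2 * h * C * cmod (\<phi> y)"
      proof (cases "norm y > R")
        case False
        have "norm (x - y) \<le> norm x + R" using False norm_triangle_ineq4[of x y] by linarith
        then have "(norm (x - y))\<^sup>2 \<le> (norm x + R)\<^sup>2" by (intro power_mono) auto
        then have "(\<kappa>, ?\<rho> y) \<in> ?K" using \<kappa> by auto
        then have "cmod (p \<kappa> (?\<rho> y)) \<le> C" using C by force
        then have "2 * h * cmod (p \<kappa> (?\<rho> y)) * cmod (\<phi> y) \<le> 2 * h * C * cmod (\<phi> y)"
          using h by (intro mult_right_mono mult_left_mono) auto
        then show ?thesis using h by (simp add: norm_mult)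
      qed (simp add: R)
    qed (use r in auto)
  qed
  have Bbd: "norm (exp (\<i> * of_real (\<xi> \<bullet> x)) * exp (- of_real h * csqrt z) * fourier \<phi> \<xi>) \<le> cmod (fourier \<phi> \<xi>)" for \<xi> z
  proof -
    have "cmod (exp (- of_real h * csqrt z)) \<le> 1" using h Re_csqrt[of z] by (simp add: norm_exp_eq_Re)
    then show ?thesis unfolding norm_mult cmod_exp_i by (simp add: mult_left_le_one_le)
  qed
  let ?R = "{\<kappa>. 0 < Re \<kappa>}"
  have Ro: "open ?R" by (rule open_halfspace_Re_gt)
  have csqrt_meas: "(\<lambda>\<xi>::'a. csqrt (\<kappa>\<^sup>2 + of_real ((norm \<xi>)\<^sup>2))) \<in> borel_measurable borel" if "\<kappa> \<in> ?R" for \<kappa>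
    by (intro borel_measurable_continuous_onI continuous_on_compose2[OF continuous_on_csqrt] continuous_intros)
      (use csqrt_right_half_plane that in auto)
  have Bmeas: "(\<lambda>\<xi>. exp (\<i> * of_real (\<xi> \<bullet> x)) * exp (- of_real h * csqrt (\<kappa>\<^sup>2 + of_real ((norm \<xi>)\<^sup>2))) * fourier \<phi> \<xi>) \<in> borel_measurable lborel"
    if "\<kappa> \<in> ?R" for \<kappa>
  proof -
    note [measurable] = csqrt_meas[OF that]
    show ?thesis by measurable
  qed
  have Bhol: "B holomorphic_on ?R"
    unfolding B_def
  proof (rule holomorphic_on_mult[OF holomorphic_on_const], rule holomorphic_on_mult[OF holomorphic_on_const], rule holomorphic_on_lebesgue_integral[OF Ro])
    show "(\<lambda>\<kappa>. exp (\<i> * of_real (\<xi> \<bullet> x)) * exp (- of_real h * csqrt (\<kappa>\<^sup>2 + of_real ((norm \<xi>)\<^sup>2))) * fourier \<phi> \<xi>) holomorphic_on ?R" for \<xi>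
      by (intro holomorphic_intros) (rule csqrt_right_half_plane, simp)
    show "(\<lambda>\<xi>. exp (\<i> * of_real (\<xi> \<bullet> x)) * exp (- of_real h * csqrt (\<kappa>\<^sup>2 + of_real ((norm \<xi>)\<^sup>2))) * fourier \<phi> \<xi>) \<in> borel_measurable lborel"
      if "\<kappa> \<in> ?R" for \<kappa> by (rule Bmeas[OF that])
    fix \<kappa>0 assume "\<kappa>0 \<in> ?R"
    then obtain r where r: "r > 0" "cball \<kappa>0 r \<subseteq> ?R" using Ro open_contains_cball by blast
    show "\<exists>r>0. \<exists>g. cball \<kappa>0 r \<subseteq> ?R \<and> integrable lborel g \<and> (\<forall>\<kappa>\<in>cball \<kappa>0 r. \<forall>\<xi>\<in>space lborel.
       norm (exp (\<i> * of_real (\<xi> \<bullet> x)) * exp (- of_real h * csqrt (\<kappa>\<^sup>2 + of_real ((norm \<xi>)\<^sup>2))) * fourier \<phi> \<xi>) \<le> g \<xi>)"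
      by (intro exI[of _ r] exI[of _ "\<lambda>\<xi>. cmod (fourier \<phi> \<xi>)"] conjI ballI Bbd integrable_norm iF r)
  qed
  have RU: "?R \<subseteq> ?U" by (auto simp: complex_nonpos_Reals_iff)
  have real: "A (of_real \<kappa>) = B (of_real \<kappa>)" if \<kappa>: "\<kappa> > 0" for \<kappa>
  proof -
    let ?G = "\<lambda>z::'a. \<integral>t. levy_weight h (\<kappa>\<^sup>2) t * heat t z \<partial>lborel"
    have Gp: "of_real (?G z) = - of_real (2 * h) * p (of_real \<kappa>) ((norm z)\<^sup>2 + h\<^sup>2)" for z :: 'a
    proof -
      have "(norm z)\<^sup>2 + h\<^sup>2 > 0" using h by (simp add: add_nonneg_pos)
      moreover have "\<kappa>\<^sup>2 > 0" using \<kappa> by simp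
      ultimately show ?thesis
        by (simp only: levy_heat_integral(2)[OF h] val[OF \<kappa>] minus_mult_minus of_real_mult[symmetric])
    qed
    \<comment> \<open>Continuity of the mixture of heat kernels in \<open>y\<close> is read off from
      \<open>p\<close>, with which it agrees up to the factor - 2 h.\<close>
    have "continuous_on UNIV (\<lambda>y. Re (- of_real (2 * h) * p (of_real \<kappa>) (?\<rho> y)))"
      by (intro continuous_intros pc) (use \<kappa> in \<open>auto simp: complex_nonpos_Reals_iff\<close>)
    then have "continuous_on UNIV (\<lambda>y. ?G (x - y))" unfolding Gp[symmetric] by simp
    from kernel_representation_real[OF \<phi> h _ this refl] \<kappa>
    have "(\<integral>y. of_real (?G (x - y)) * \<phi> y \<partial>lborel) = 1/2 * (of_real (fourier_const TYPE('a)) * (\<integral>\<xi>. exp (\<i> * of_real (\<xi> \<bullet> x)) * of_real (exp (- (h * sqrt (\<kappa>\<^sup>2 + (norm \<xi>)\<^sup>2)))) * fourier \<phi> \<xi> \<partial>lborel))"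
      by simp
    moreover have "complex_of_real (exp (- (h * sqrt (\<kappa>\<^sup>2 + (norm \<xi>)\<^sup>2)))) = exp (- of_real h * csqrt ((of_real \<kappa>)\<^sup>2 + of_real ((norm \<xi>)\<^sup>2)))" for \<xi> :: 'a
    proof -
      have "csqrt ((of_real \<kappa>)\<^sup>2 + of_real ((norm \<xi>)\<^sup>2)) = of_real (sqrt (\<kappa>\<^sup>2 + (norm \<xi>)\<^sup>2))"
        unfolding of_real_power[symmetric] of_real_add[symmetric] by (rule csqrt_of_real) simp
      then show ?thesis unfolding exp_of_real[symmetric] by simp
    qed
    ultimately show ?thesis unfolding A_def B_def Gp by (simp only:)
  qed
  have AB: "A w = B w" if w: "w \<in> ?R" for w
  proof -
    have "(\<lambda>w. A w - B w) w = 0"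
    proof (rule analytic_continuation[of "\<lambda>w. A w - B w" ?R "of_real ` {0<..}" 1])
      show "(\<lambda>w. A w - B w) holomorphic_on ?R"
        by (intro holomorphic_on_diff Bhol holomorphic_on_subset[OF Ahol RU])
      show "connected ?R" by (intro convex_connected convex_halfspace_Re_gt)
      show "1 islimpt complex_of_real ` {0<..}"
        unfolding islimpt_sequential
      proof (intro exI[of _ "\<lambda>n. of_real (1 + 1 / real (Suc n))"] conjI allI)
        show "complex_of_real (1 + 1 / real (Suc n)) \<in> of_real ` {0<..} - {1}" for n
        proof
          have "1 + 1 / real (Suc n) > 0" by (simp add: add_pos_nonneg)
          then show "complex_of_real (1 + 1 / real (Suc n)) \<in> of_real ` {0<..}" by blast
          show "complex_of_real (1 + 1 / real (Suc n)) \<notin> {1}"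
            using of_real_eq_iff[of "1 + 1 / real (Suc n)" 1, where 'a = complex] by simp
        qed
        have "(\<lambda>n. 1 + 1 / real (Suc n)) \<longlonglongrightarrow> 1" by real_asymp
        then have "(\<lambda>n. complex_of_real (1 + 1 / real (Suc n))) \<longlonglongrightarrow> complex_of_real 1" by (rule tendsto_of_real)
        then show "(\<lambda>n. complex_of_real (1 + 1 / real (Suc n))) \<longlonglongrightarrow> 1" by (simp only: of_real_1)
      qed
      show "open ?R" by (rule Ro)
      show "w \<in> ?R" by (rule w)
      show "complex_of_real ` {0<..} \<subseteq> ?R" by auto
      show "1 \<in> ?R" by simp
      show "A z - B z = 0" if "z \<in> complex_of_real ` {0<..}" for z
        using that by (elim imageE) (simp add: real)
    qed
    then show ?thesis by simp
  qed
  define z where "z n = Complex (1 / real (Suc n)) (- k)" for n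
  have zR: "z n \<in> ?R" for n by (simp add: z_def)
  have zlim: "z \<longlonglongrightarrow> - \<i> * of_real k"
  proof -
    have "(\<lambda>n. Complex (1 / real (Suc n)) (- k)) \<longlonglongrightarrow> Complex 0 (- k)" by (intro tendsto_Complex tendsto_const) real_asymp
    moreover have "Complex 0 (- k) = - \<i> * of_real k" by (simp add: complex_eq_iff)
    ultimately show ?thesis by (simp add: z_def[abs_def])
  qed
  have inU: "- \<i> * of_real k \<in> ?U" using k by (simp add: complex_nonpos_Reals_iff)
  have "isCont A (- \<i> * of_real k)"
    using holomorphic_on_imp_continuous_on[OF Ahol] Uo inU by (simp add: continuous_on_eq_continuous_at)
  from isCont_tendsto_compose[OF this zlim]
  have Alim: "(\<lambda>n. A (z n)) \<longlonglongrightarrow> A (- \<i> * of_real k)" .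
  have Blim: "(\<lambda>n. B (z n)) \<longlonglongrightarrow> 1/2 * (of_real (fourier_const TYPE('a)) * (\<integral>\<xi>. exp (\<i> * of_real (\<xi> \<bullet> x)) * exp (\<i> * Zk k \<xi> * of_real h) * fourier \<phi> \<xi> \<partial>lborel))"
    unfolding B_def
  proof (rule tendsto_mult_left, rule tendsto_mult_left, rule integral_dominated_convergence[where w = "\<lambda>\<xi>. cmod (fourier \<phi> \<xi>)"])
    show "(\<lambda>\<xi>. exp (\<i> * of_real (\<xi> \<bullet> x)) * exp (\<i> * Zk k \<xi> * of_real h) * fourier \<phi> \<xi>) \<in> borel_measurable lborel" by measurable
    show "(\<lambda>\<xi>. exp (\<i> * of_real (\<xi> \<bullet> x)) * exp (- of_real h * csqrt ((z n)\<^sup>2 + of_real ((norm \<xi>)\<^sup>2))) * fourier \<phi> \<xi>) \<in> borel_measurable lborel" for n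
      by (rule Bmeas[OF zR])
    show "integrable lborel (\<lambda>\<xi>. cmod (fourier \<phi> \<xi>))" by (rule integrable_norm[OF iF])
    show "AE \<xi> in lborel. norm (exp (\<i> * of_real (\<xi> \<bullet> x)) * exp (- of_real h * csqrt ((z n)\<^sup>2 + of_real ((norm \<xi>)\<^sup>2))) * fourier \<phi> \<xi>) \<le> cmod (fourier \<phi> \<xi>)" for n
      by (intro AE_I2 Bbd)
    show "AE \<xi> in lborel. (\<lambda>n. exp (\<i> * of_real (\<xi> \<bullet> x)) * exp (- of_real h * csqrt ((z n)\<^sup>2 + of_real ((norm \<xi>)\<^sup>2))) * fourier \<phi> \<xi>)
        \<longlonglongrightarrow> exp (\<i> * of_real (\<xi> \<bullet> x)) * exp (\<i> * Zk k \<xi> * of_real h) * fourier \<phi> \<xi>"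
    proof (rule AE_I2)
      fix \<xi> :: 'a
      have "(\<lambda>n. csqrt ((z n)\<^sup>2 + of_real ((norm \<xi>)\<^sup>2))) \<longlonglongrightarrow> - \<i> * Zk k \<xi>"
        using csqrt_limit[OF k norm_ge_zero[of \<xi>]] unfolding z_def Zk_def Dk_def .
      from tendsto_mult[OF tendsto_mult[OF tendsto_const tendsto_exp[OF tendsto_mult_left[OF this, of "- of_real h"]]] tendsto_const, of "exp (\<i> * of_real (\<xi> \<bullet> x))" "fourier \<phi> \<xi>"]
      show "(\<lambda>n. exp (\<i> * of_real (\<xi> \<bullet> x)) * exp (- of_real h * csqrt ((z n)\<^sup>2 + of_real ((norm \<xi>)\<^sup>2))) * fourier \<phi> \<xi>)
        \<longlonglongrightarrow> exp (\<i> * of_real (\<xi> \<bullet> x)) * exp (\<i> * Zk k \<xi> * of_real h) * fourier \<phi> \<xi>"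
        by (simp add: mult_ac)
    qed
  qed
  have "A (- \<i> * of_real k) = 1/2 * (of_real (fourier_const TYPE('a)) * (\<integral>\<xi>. exp (\<i> * of_real (\<xi> \<bullet> x)) * exp (\<i> * Zk k \<xi> * of_real h) * fourier \<phi> \<xi> \<partial>lborel))"
    using LIMSEQ_unique[OF Alim] Blim AB[OF zR] by simp
  then show ?thesis unfolding A_def .
qed

section \<open>The double layer potential\<close>

lemma radial_derivative:
  fixes P :: "real \<Rightarrow> complex"
  assumes P: "(P has_vector_derivative D) (at (a\<^sup>2 + h\<^sup>2))"
  shows "((\<lambda>t. P (a\<^sup>2 + (h - t)\<^sup>2)) has_vector_derivative - of_real (2 * h) * D) (at 0)"
proof -
  have "((\<lambda>t. a\<^sup>2 + (h - t)\<^sup>2) has_vector_derivative - (2 * h)) (at 0)"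
    by (auto intro!: derivative_eq_intros simp: has_real_derivative_iff_has_vector_derivative[symmetric])
  from vector_diff_chain_at[OF this, of P D] P show ?thesis by (simp add: o_def scaleR_conv_of_real)
qed

text \<open>The fundamental solution is a function \<open>P\<close> of the squared distance, and (h
  - t)^2 has derivative - 2 h at t = 0; h > 0 keeps the two points apart.\<close>

lemma fund_sol_derivative:
  fixes x y :: "'a::euclidean_space"
  assumes fund: "\<And>X Y :: 'a \<times> real. X \<noteq> Y \<Longrightarrow> fund_sol k X Y = P ((dist X Y)\<^sup>2)"
    and P: "(P has_vector_derivative D) (at ((norm (x - y))\<^sup>2 + h\<^sup>2))" and h: "h > 0"
  shows "vector_derivative (\<lambda>t. fund_sol k (x, h) (y, t)) (at 0) = - of_real (2 * h) * D"
proof (rule vector_derivative_at)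
  have "((\<lambda>t. P ((norm (x - y))\<^sup>2 + (h - t)\<^sup>2)) has_vector_derivative - of_real (2 * h) * D) (at 0)"
    by (rule radial_derivative[OF P])
  then show "((\<lambda>t. fund_sol k (x, h) (y, t)) has_vector_derivative - of_real (2 * h) * D) (at 0)"
  proof (rule has_vector_derivative_transform_within_open)
    show "open {..<h}" "0 \<in> {..<h}" using h by auto
    fix t assume t: "t \<in> {..<h}"
    have "(dist (x, h) (y, t))\<^sup>2 = (norm (x - y))\<^sup>2 + (h - t)\<^sup>2"
      by (simp add: dist_Pair_Pair dist_norm[of x y] dist_real_def)
    then show "P ((norm (x - y))\<^sup>2 + (h - t)\<^sup>2) = fund_sol k (x, h) (y, t)"
      using fund[of "(x, h)" "(y, t)"] t by simp
  qed
qed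

text \<open>The double layer potential at height \<open>h\<close> seen from the frequency side; the
  factor 1/2 is its jump from either face of the screen.\<close>

definition layer_transform :: "real \<Rightarrow> ('a::euclidean_space \<Rightarrow> complex) \<Rightarrow> 'a \<Rightarrow> real \<Rightarrow> complex" where
  "layer_transform k \<phi> x h = 1/2 * (of_real (fourier_const TYPE('a)) * (\<integral>\<xi>. exp (\<i> * of_real (\<xi> \<bullet> x)) * exp (\<i> * Zk k \<xi> * of_real h) * fourier \<phi> \<xi> \<partial>lborel))"

text \<open>Isolates what depends on the dimension: a kernel \<open>p\<close> that is holomorphic
  off the cut, has the Macdonald value on the positive reals, and at - i k is the derivative of the
  fundamental solution.\<close>

lemma double_layer_eq:
  fixes \<phi> :: "'a::euclidean_space \<Rightarrow> complex" and p :: "complex \<Rightarrow> real \<Rightarrow> complex"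
  assumes hol: "\<And>\<rho>. \<rho> > 0 \<Longrightarrow> (\<lambda>\<kappa>. p \<kappa> \<rho>) holomorphic_on (- \<real>\<^sub>\<le>\<^sub>0)"
    and cont: "continuous_on ((- \<real>\<^sub>\<le>\<^sub>0) \<times> {0<..}) (\<lambda>z. p (fst z) (snd z))"
    and val: "\<And>\<kappa> \<rho>. \<kappa> > 0 \<Longrightarrow> \<rho> > 0 \<Longrightarrow> p (of_real \<kappa>) \<rho> = - of_real (1 / 4 * (4 * pi) powr (- (real DIM('a) + 1) / 2) * macdonald_integral ((real DIM('a) + 3) / 2) (\<rho> / 4) (\<kappa>\<^sup>2))"
    and fund: "\<And>X Y :: 'a \<times> real. X \<noteq> Y \<Longrightarrow> fund_sol k X Y = P ((dist X Y)\<^sup>2)"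
    and P: "\<And>\<rho>. \<rho> > 0 \<Longrightarrow> (P has_vector_derivative p (- \<i> * of_real k) \<rho>) (at \<rho>)"
    and \<phi>: "\<phi> \<in> test_functions \<Omega>" and h: "h > 0" and k: "k > 0"
  shows "double_layer k \<Omega> \<phi> (x, h) = layer_transform k \<phi> x h"
proof -
  obtain S where S: "smooth \<phi>" "compact S" "S \<subseteq> \<Omega>" "\<And>x. x \<notin> S \<Longrightarrow> \<phi> x = 0"
    by (rule test_functionsE[OF \<phi>], rule that)
  have z: "\<phi> y = 0" if "y \<notin> \<Omega>" for y using S that by blast
  have "vector_derivative (\<lambda>t. fund_sol k (x, h) (y, t)) (at 0) = - of_real (2 * h) * p (- \<i> * of_real k) ((norm (x - y))\<^sup>2 + h\<^sup>2)" for y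
    using h by (intro fund_sol_derivative[OF fund] P) (auto simp: add_nonneg_pos)
  then have "double_layer k \<Omega> \<phi> (x, h) = (\<integral>y. indicator \<Omega> y *\<^sub>R (- of_real (2 * h) * p (- \<i> * of_real k) ((norm (x - y))\<^sup>2 + h\<^sup>2) * \<phi> y) \<partial>lborel)"
    by (simp only: double_layer_def set_lebesgue_integral_def)
  also have "\<dots> = (\<integral>y. - of_real (2 * h) * p (- \<i> * of_real k) ((norm (x - y))\<^sup>2 + h\<^sup>2) * \<phi> y \<partial>lborel)"
    by (rule Bochner_Integration.integral_cong) (auto simp: indicator_def z)
  also have "\<dots> = layer_transform k \<phi> x h"
    unfolding layer_transform_def by (rule kernel_representation[OF hol cont val \<phi> h k])
  finally show ?thesis .
qed

section \<open>The double layer potential in three dimensions\<close>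

text \<open>The derivative of exp(- \<kappa> sqrt \<rho>) / (4 pi sqrt \<rho>) in \<rho>.\<close>

definition kernel3 :: "complex \<Rightarrow> real \<Rightarrow> complex" where
  "kernel3 \<kappa> \<rho> = - exp (- \<kappa> * of_real (sqrt \<rho>)) * (1 + \<kappa> * of_real (sqrt \<rho>)) / of_real (8 * pi * (sqrt \<rho>) ^ 3)"

text \<open>Index 3/2 is the Levy integral with h = 2 sqrt v; differentiating it in \<open>v\<close>
  raises the index to 5/2.\<close>

lemma macdonald_integral_five_halves:
  assumes v: "v > 0" and b: "b > 0"
  shows "macdonald_integral (5/2) v b = sqrt pi * exp (- (2 * sqrt v * sqrt b)) * (1 + 2 * sqrt v * sqrt b) / (2 * sqrt v ^ 3)"
proof -
  let ?g = "\<lambda>v. sqrt pi * (exp (- (2 * sqrt v * sqrt b)) / sqrt v)"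
  have eq: "macdonald_integral (3/2) v b = ?g v" if "v > 0" for v
  proof -
    have "macdonald_integral (3/2) ((2 * sqrt v)\<^sup>2 / 4) ((sqrt b)\<^sup>2) = 2 * sqrt pi / (2 * sqrt v) * exp (- (2 * sqrt v * sqrt b))"
      using that b by (intro levy_integral) auto
    then show ?thesis using that b by (simp add: power_mult_distrib)
  qed
  define r where "r = sqrt v"
  have r: "r > 0" using v by (simp add: r_def)
  have dr: "(sqrt has_real_derivative 1 / (2 * r)) (at v)"
    using DERIV_real_sqrt[OF v] unfolding r_def by (simp add: inverse_eq_divide mult.commute)
  have de: "((\<lambda>v. exp (- (2 * sqrt v * sqrt b))) has_real_derivative exp (- (2 * sqrt v * sqrt b)) * - (2 * (1 / (2 * r)) * sqrt b)) (at v)"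
    by (intro DERIV_chain2[OF DERIV_exp] DERIV_minus DERIV_cmult_right DERIV_cmult dr)
  have "(?g has_real_derivative sqrt pi * ((exp (- (2 * sqrt v * sqrt b)) * - (2 * (1 / (2 * r)) * sqrt b) * sqrt v - exp (- (2 * sqrt v * sqrt b)) * (1 / (2 * r))) / (sqrt v * sqrt v))) (at v)"
    by (intro DERIV_cmult DERIV_divide de dr) (use v in simp)
  also have "sqrt pi * ((exp (- (2 * sqrt v * sqrt b)) * - (2 * (1 / (2 * r)) * sqrt b) * sqrt v - exp (- (2 * sqrt v * sqrt b)) * (1 / (2 * r))) / (sqrt v * sqrt v))
    = - (sqrt pi * exp (- (2 * sqrt v * sqrt b)) * (1 + 2 * sqrt v * sqrt b) / (2 * sqrt v ^ 3))"
  proof -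
    have "s * ((e * - (2 * (1 / (2 * r)) * c) * r - e * (1 / (2 * r))) / (r * r)) = - (s * e * (1 + 2 * r * c) / (2 * r ^ 3))" for s e c
      using r by (simp add: field_simps power3_eq_cube)
    then show ?thesis unfolding r_def[symmetric] .
  qed
  finally have Dg: "(?g has_real_derivative - (sqrt pi * exp (- (2 * sqrt v * sqrt b)) * (1 + 2 * sqrt v * sqrt b) / (2 * sqrt v ^ 3))) (at v)" .
  have "eventually (\<lambda>v. v \<in> {0<..}) (nhds v)" using v by (intro eventually_nhds_in_open) auto
  then have ev: "eventually (\<lambda>v. macdonald_integral (3/2) v b = ?g v) (nhds v)" by eventually_elim (rule eq, simp)
  have "((\<lambda>v. macdonald_integral (3/2) v b) has_real_derivative - (sqrt pi * exp (- (2 * sqrt v * sqrt b)) * (1 + 2 * sqrt v * sqrt b) / (2 * sqrt v ^ 3))) (at v)"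
    by (rule iffD2[OF DERIV_cong_ev[OF refl ev refl] Dg])
  from DERIV_unique[OF macdonald_integral_has_derivative[OF v b, of "3/2"] this] show ?thesis by simp
qed

lemma kernel3_value:
  assumes \<kappa>: "\<kappa> > 0" and \<rho>: "\<rho> > 0"
  shows "kernel3 (of_real \<kappa>) \<rho> = - of_real (1 / 4 * (4 * pi) powr (- 3 / 2) * macdonald_integral (5 / 2) (\<rho> / 4) (\<kappa>\<^sup>2))"
proof -
  define r where "r = sqrt \<rho>"
  have r: "r > 0" using \<rho> by (simp add: r_def)
  have s: "sqrt (\<rho> / 4) = r / 2" by (simp add: r_def real_sqrt_divide)
  have sp: "sqrt pi > 0" "sqrt pi * sqrt pi = pi" by simp_all
  have P: "(4 * pi) powr (- 3 / 2) = 1 / (8 * (sqrt pi * pi))"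
  proof -
    have "(4 * pi) powr (- 3 / 2) = ((2 * sqrt pi) powr 2) powr (- 3 / 2)" by (simp add: power_mult_distrib)
    also have "\<dots> = (2 * sqrt pi) powr (- 3)" by (simp only: powr_powr) simp
    also have "\<dots> = 1 / (2 * sqrt pi) ^ 3" by (simp add: powr_minus inverse_eq_divide)
    also have "(2 * sqrt pi) ^ 3 = 8 * (sqrt pi * pi)" by (simp add: power3_eq_cube)
    finally show ?thesis .
  qed
  have Jv: "macdonald_integral (5/2) (\<rho> / 4) (\<kappa>\<^sup>2) = sqrt pi * exp (- (\<kappa> * r)) * (1 + 2 * (r / 2) * \<kappa>) / (2 * (r / 2) ^ 3)"
    using macdonald_integral_five_halves[of "\<rho> / 4" "\<kappa>\<^sup>2"] \<kappa> \<rho> unfolding s by (simp add: mult.commute)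
  have A: "1 / 4 * (1 / (8 * (s * p))) * (s * e * (1 + 2 * (r / 2) * \<kappa>) / (2 * (r / 2) ^ 3)) = e * (1 + \<kappa> * r) / (8 * p * r ^ 3)"
    if "s > 0" "p > 0" for s p e :: real
    using r that by (simp add: field_simps power3_eq_cube)
  have "1 / 4 * (4 * pi) powr (- 3 / 2) * macdonald_integral (5 / 2) (\<rho> / 4) (\<kappa>\<^sup>2) = exp (- (\<kappa> * r)) * (1 + \<kappa> * r) / (8 * pi * r ^ 3)"
    unfolding P Jv by (rule A[OF sp(1) pi_gt_zero])
  then show ?thesis
    unfolding kernel3_def r_def[symmetric] by (simp add: exp_of_real[symmetric] mult_ac)
qed

lemma kernel3_holomorphic: "\<rho> > 0 \<Longrightarrow> (\<lambda>\<kappa>. kernel3 \<kappa> \<rho>) holomorphic_on A"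
  unfolding kernel3_def by (intro holomorphic_intros) auto

lemma kernel3_continuous: "continuous_on (A \<times> {0<..}) (\<lambda>z. kernel3 (fst z) (snd z))"
  unfolding kernel3_def by (intro continuous_intros) auto

lemma kernel3_derivative:
  assumes \<rho>: "\<rho> > 0"
  shows "((\<lambda>\<rho>. exp (\<i> * of_real (k * sqrt \<rho>)) / of_real (4 * pi * sqrt \<rho>)) has_vector_derivative kernel3 (- \<i> * of_real k) \<rho>) (at \<rho>)"
proof -
  define r where "r = sqrt \<rho>"
  have r: "r > 0" using \<rho> by (simp add: r_def)
  have dr: "(sqrt has_vector_derivative 1 / (2 * r)) (at \<rho>)"
    using DERIV_real_sqrt[OF \<rho>] unfolding r_def by (simp add: inverse_eq_divide mult.commute has_real_derivative_iff_has_vector_derivative)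
  have dz: "((\<lambda>z. exp (\<i> * of_real k * z) / (of_real (4 * pi) * z)) has_field_derivative
      (exp (\<i> * of_real k * of_real r) * (\<i> * of_real k) * (of_real (4 * pi) * of_real r) - exp (\<i> * of_real k * of_real r) * of_real (4 * pi)) / ((of_real (4 * pi) * of_real r) * (of_real (4 * pi) * of_real r))) (at (of_real r))"
    using r by (auto intro!: derivative_eq_intros)
  have "((\<lambda>r. exp (\<i> * of_real k * of_real r) / (of_real (4 * pi) * of_real r)) has_vector_derivative
      (exp (\<i> * of_real k * of_real r) * (\<i> * of_real k) * (of_real (4 * pi) * of_real r) - exp (\<i> * of_real k * of_real r) * of_real (4 * pi)) / ((of_real (4 * pi) * of_real r) * (of_real (4 * pi) * of_real r))) (at r)"
    by (rule has_vector_derivative_real_field[OF dz])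
  from vector_diff_chain_at[OF dr this[unfolded r_def]]
  have "((\<lambda>\<rho>. exp (\<i> * of_real k * of_real (sqrt \<rho>)) / (of_real (4 * pi) * of_real (sqrt \<rho>))) has_vector_derivative
      (1 / (2 * r)) *\<^sub>R ((exp (\<i> * of_real k * of_real r) * (\<i> * of_real k) * (of_real (4 * pi) * of_real r) - exp (\<i> * of_real k * of_real r) * of_real (4 * pi)) / ((of_real (4 * pi) * of_real r) * (of_real (4 * pi) * of_real r)))) (at \<rho>)"
    by (simp only: o_def r_def)
  also have "(1 / (2 * r)) *\<^sub>R ((exp (\<i> * of_real k * of_real r) * (\<i> * of_real k) * (of_real (4 * pi) * of_real r) - exp (\<i> * of_real k * of_real r) * of_real (4 * pi)) / ((of_real (4 * pi) * of_real r) * (of_real (4 * pi) * of_real r)))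
     = kernel3 (- \<i> * of_real k) \<rho>"
  proof -
    have nz: "complex_of_real r \<noteq> 0" "complex_of_real pi \<noteq> 0" using r by auto
    have "(1 / (2 * R)) * ((e * (\<i> * K) * (4 * p * R) - e * (4 * p)) / ((4 * p * R) * (4 * p * R))) = - e * (1 + - \<i> * K * R) / (8 * p * R ^ 3)"
      if "R \<noteq> 0" "p \<noteq> 0" for R e K p :: complex
      using that by (simp add: field_simps power3_eq_cube)
    from this[OF nz, of "exp (\<i> * of_real k * of_real r)" "of_real k"]
    show ?thesis unfolding kernel3_def r_def[symmetric] by (simp add: scaleR_conv_of_real)
  qed
  finally show ?thesis by (simp add: mult.assoc)
qed

lemma double_layer_3d:
  fixes \<phi> :: "real ^ 2 \<Rightarrow> complex"
  assumes \<phi>: "\<phi> \<in> test_functions \<Omega>" and h: "h > 0" and k: "k > 0"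
  shows "double_layer k \<Omega> \<phi> (x, h) = layer_transform k \<phi> x h"
proof (rule double_layer_eq[OF kernel3_holomorphic kernel3_continuous _ _ _ \<phi> h k])
  show "kernel3 (of_real \<kappa>) \<rho> = - of_real (1 / 4 * (4 * pi) powr (- (real DIM(real ^ 2) + 1) / 2) * macdonald_integral ((real DIM(real ^ 2) + 3) / 2) (\<rho> / 4) (\<kappa>\<^sup>2))"
    if "\<kappa> > 0" "\<rho> > 0" for \<kappa> \<rho>
    using kernel3_value[OF that] by simp
  show "fund_sol k X Y = (\<lambda>\<rho>. exp (\<i> * of_real (k * sqrt \<rho>)) / of_real (4 * pi * sqrt \<rho>)) ((dist X Y)\<^sup>2)" for X Y :: "(real ^ 2) \<times> real"
    by (simp add: fund_sol_def)
  show "((\<lambda>\<rho>. exp (\<i> * of_real (k * sqrt \<rho>)) / of_real (4 * pi * sqrt \<rho>)) has_vector_derivative kernel3 (- \<i> * of_real k) \<rho>) (at \<rho>)" if "\<rho> > 0" for \<rho>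
    by (rule kernel3_derivative[OF that])
qed

section \<open>The hypersingular operator and its form\<close>

text \<open>The derivative of exp(i Zk h) / 2 at h = 0.\<close>

definition hyp_symbol :: "real \<Rightarrow> 'a::euclidean_space \<Rightarrow> complex" where
  "hyp_symbol k \<xi> = \<i> / 2 * Zk k \<xi>"

lemma hyp_symbol_measurable [measurable]: "hyp_symbol k \<in> borel_measurable borel"
  unfolding hyp_symbol_def[abs_def] by measurable

lemma cmod_hyp_symbol: "cmod (hyp_symbol k \<xi>) = Dk k \<xi> / 2"
  by (simp add: hyp_symbol_def norm_mult)

lemma Dk_le_jb: "k > 0 \<Longrightarrow> Dk k \<xi> \<le> (1 + k) * jb \<xi>"
  using Dk_le_Wk Wk_le_jb order_trans by blast

lemma Zk_fourier_integrable:
  assumes k: "k > 0" and \<phi>: "\<phi> \<in> test_functions \<Omega>"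
  shows "integrable lborel (\<lambda>\<xi>. Zk k \<xi> * fourier \<phi> \<xi>)"
proof (rule Bochner_Integration.integrable_bound)
  have F: "fourier \<phi> \<in> schwartz" by (rule fourier_test_schwartz[OF \<phi>])
  have [measurable]: "fourier \<phi> \<in> borel_measurable borel" by (rule schwartz_measurable[OF F])
  show "integrable lborel (\<lambda>\<xi>. (1 + k) * ((1 + norm \<xi>) ^ 1 * cmod (fourier \<phi> \<xi>)))"
    by (intro Bochner_Integration.integrable_mult_right schwartz_integrable_weight F)
  show "AE \<xi> in lborel. norm (Zk k \<xi> * fourier \<phi> \<xi>) \<le> norm ((1 + k) * ((1 + norm \<xi>) ^ 1 * cmod (fourier \<phi> \<xi>)))"
  proof (rule AE_I2)
    fix \<xi> :: 'a
    have "Dk k \<xi> \<le> (1 + k) * (1 + norm \<xi>)"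
      by (rule order_trans[OF Dk_le_jb[OF k]]) (use k jb_le[of \<xi>] in \<open>simp add: mult_left_mono\<close>)
    from mult_right_mono[OF this, of "cmod (fourier \<phi> \<xi>)"]
    show "norm (Zk k \<xi> * fourier \<phi> \<xi>) \<le> norm ((1 + k) * ((1 + norm \<xi>) ^ 1 * cmod (fourier \<phi> \<xi>)))"
      using k by (simp add: norm_mult mult.assoc)
  qed
  show "(\<lambda>\<xi>. Zk k \<xi> * fourier \<phi> \<xi>) \<in> borel_measurable lborel" by measurable
qed

text \<open>The derivative in h and the limit h \<rightarrow> 0 both pass under the frequency
  integral with the single majorant \<open>cmod (Zk k \<xi> * fourier \<phi> \<xi>)\<close>, because
  exp(i Zk h) has modulus at most 1 for h \<ge> 0.\<close>

lemma hypersingular_test_eq: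
  fixes \<phi> :: "'a::euclidean_space \<Rightarrow> complex"
  assumes k: "k > 0" and \<phi>: "\<phi> \<in> test_functions \<Omega>"
    and DL: "\<And>x h. h > 0 \<Longrightarrow> double_layer k \<Omega> \<phi> (x, h) = layer_transform k \<phi> x h"
  shows "hypersingular_test k \<Omega> \<phi> x = fourier (\<lambda>\<xi>. hyp_symbol k \<xi> * fourier \<phi> \<xi>) (- x)"
proof -
  have iF: "integrable lborel (fourier \<phi>)" by (rule fourier_test_integrable[OF \<phi>])
  have [measurable]: "fourier \<phi> \<in> borel_measurable borel" using iF by auto
  note iZ = Zk_fourier_integrable[OF k \<phi>]
  let ?c = "complex_of_real (fourier_const TYPE('a))"
  let ?f = "\<lambda>h \<xi>. exp (\<i> * of_real (\<xi> \<bullet> x)) * exp (\<i> * Zk k \<xi> * of_real h) * fourier \<phi> \<xi>"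
  let ?d = "\<lambda>h \<xi>. exp (\<i> * of_real (\<xi> \<bullet> x)) * (exp (\<i> * Zk k \<xi> * of_real h) * (\<i> * Zk k \<xi>)) * fourier \<phi> \<xi>"
  have e1: "cmod (exp (\<i> * Zk k \<xi> * of_real h)) \<le> 1" if "h \<ge> 0" for h and \<xi> :: 'a
  proof -
    have "Re (\<i> * Zk k \<xi> * of_real h) = Re (\<i> * Zk k \<xi>) * h" by simp
    also have "\<dots> \<le> 0" using Re_i_Zk[of k \<xi>] that by (rule mult_nonpos_nonneg)
    finally show ?thesis by (simp only: norm_exp_eq_Re) simp
  qed
  have dbd: "cmod (?d h \<xi>) \<le> cmod (Zk k \<xi> * fourier \<phi> \<xi>)" if "h \<ge> 0" for h \<xi>
  proof -
    have "cmod (?d h \<xi>) = cmod (exp (\<i> * Zk k \<xi> * of_real h)) * cmod (Zk k \<xi> * fourier \<phi> \<xi>)"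
      unfolding norm_mult cmod_exp_i by simp
    also have "\<dots> \<le> 1 * cmod (Zk k \<xi> * fourier \<phi> \<xi>)" by (rule mult_right_mono[OF e1[OF that]]) simp
    finally show ?thesis by simp
  qed
  have der: "((\<lambda>t. double_layer k \<Omega> \<phi> (x, t)) has_vector_derivative 1/2 * (?c * (\<integral>\<xi>. ?d h \<xi> \<partial>lborel))) (at h)" if h: "h > 0" for h
  proof -
    have "((\<lambda>h. \<integral>\<xi>. ?f h \<xi> \<partial>lborel) has_vector_derivative (\<integral>\<xi>. ?d h \<xi> \<partial>lborel)) (at h)"
    proof (rule has_vector_derivative_lebesgue_integral(2)[where a = 0 and b = "h + 1" and g = "\<lambda>\<xi>. cmod (Zk k \<xi> * fourier \<phi> \<xi>)"])
      fix t \<xi> assume t: "0 < t" "t < h + 1"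
      show "integrable lborel (?f t)"
      proof (rule Bochner_Integration.integrable_bound[OF iF])
        show "AE \<xi> in lborel. norm (?f t \<xi>) \<le> norm (fourier \<phi> \<xi>)"
        proof (rule AE_I2)
          fix \<xi>
          have "norm (?f t \<xi>) = cmod (exp (\<i> * Zk k \<xi> * of_real t)) * cmod (fourier \<phi> \<xi>)" unfolding norm_mult cmod_exp_i by simp
          also have "\<dots> \<le> 1 * cmod (fourier \<phi> \<xi>)" using t by (intro mult_right_mono e1) auto
          finally show "norm (?f t \<xi>) \<le> norm (fourier \<phi> \<xi>)" by simp
        qed
      qed measurable
      show "((\<lambda>t. ?f t \<xi>) has_vector_derivative ?d t \<xi>) (at t)"
      proof (intro has_vector_derivative_mult_left has_vector_derivative_mult_right)
        have "((\<lambda>z. exp (\<i> * Zk k \<xi> * z)) has_field_derivative exp (\<i> * Zk k \<xi> * of_real t) * (\<i> * Zk k \<xi>)) (at (of_real t))"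
          by (auto intro!: derivative_eq_intros)
        then show "((\<lambda>t. exp (\<i> * Zk k \<xi> * of_real t)) has_vector_derivative exp (\<i> * Zk k \<xi> * of_real t) * (\<i> * Zk k \<xi>)) (at t)"
          by (rule has_vector_derivative_real_field)
      qed
      show "cmod (?d t \<xi>) \<le> cmod (Zk k \<xi> * fourier \<phi> \<xi>)" using t by (intro dbd) simp
    next
      show "integrable lborel (\<lambda>\<xi>. cmod (Zk k \<xi> * fourier \<phi> \<xi>))" by (rule integrable_norm[OF iZ])
    qed (use h in auto)
    then have "((\<lambda>h. layer_transform k \<phi> x h) has_vector_derivative 1/2 * (?c * (\<integral>\<xi>. ?d h \<xi> \<partial>lborel))) (at h)"
      unfolding layer_transform_def by (intro has_vector_derivative_mult_right)
    then show ?thesis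
      by (rule has_vector_derivative_transform_within_open[where S = "{0<..}"]) (use h DL in auto)
  qed
  have lim: "((\<lambda>h. vector_derivative (\<lambda>t. double_layer k \<Omega> \<phi> (x, t)) (at h)) \<longlongrightarrow> 1/2 * (?c * (\<integral>\<xi>. ?d 0 \<xi> \<partial>lborel))) (at_right 0)"
    unfolding tendsto_at_iff_sequentially
  proof (intro allI impI)
    fix X :: "nat \<Rightarrow> real" assume X: "\<forall>i. X i \<in> {0<..} - {0}" "X \<longlonglongrightarrow> 0"
    then have pos: "X i > 0" for i by auto
    have "(\<lambda>n. 1/2 * (?c * (\<integral>\<xi>. ?d (X n) \<xi> \<partial>lborel))) \<longlonglongrightarrow> 1/2 * (?c * (\<integral>\<xi>. ?d 0 \<xi> \<partial>lborel))"
    proof (rule tendsto_mult_left, rule tendsto_mult_left, rule integral_dominated_convergence[where w = "\<lambda>\<xi>. cmod (Zk k \<xi> * fourier \<phi> \<xi>)"])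
      show "integrable lborel (\<lambda>\<xi>. cmod (Zk k \<xi> * fourier \<phi> \<xi>))" by (rule integrable_norm[OF iZ])
      show "AE \<xi> in lborel. cmod (?d (X n) \<xi>) \<le> cmod (Zk k \<xi> * fourier \<phi> \<xi>)" for n
        by (intro AE_I2 dbd less_imp_le pos)
      show "AE \<xi> in lborel. (\<lambda>n. ?d (X n) \<xi>) \<longlonglongrightarrow> ?d 0 \<xi>"
        by (intro AE_I2 tendsto_intros X(2))
      show "?d 0 \<in> borel_measurable lborel" "\<And>n. ?d (X n) \<in> borel_measurable lborel" by measurable
    qed
    moreover have "vector_derivative (\<lambda>t. double_layer k \<Omega> \<phi> (x, t)) (at (X n)) = 1/2 * (?c * (\<integral>\<xi>. ?d (X n) \<xi> \<partial>lborel))" for n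
      by (rule vector_derivative_at[OF der[OF pos]])
    ultimately show "((\<lambda>h. vector_derivative (\<lambda>t. double_layer k \<Omega> \<phi> (x, t)) (at h)) \<circ> X) \<longlonglongrightarrow> 1/2 * (?c * (\<integral>\<xi>. ?d 0 \<xi> \<partial>lborel))"
      by (simp only: o_def)
  qed
  have "hypersingular_test k \<Omega> \<phi> x = 1/2 * (?c * (\<integral>\<xi>. ?d 0 \<xi> \<partial>lborel))"
    unfolding hypersingular_test_def by (rule tendsto_Lim[OF _ lim]) simp
  also have "\<dots> = ?c * (\<integral>\<xi>. 1/2 * ?d 0 \<xi> \<partial>lborel)" by simp
  also have "(\<integral>\<xi>. 1/2 * ?d 0 \<xi> \<partial>lborel) = (\<integral>\<xi>. exp (- \<i> * of_real (- x \<bullet> \<xi>)) * (hyp_symbol k \<xi> * fourier \<phi> \<xi>) \<partial>lborel)"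
    by (rule Bochner_Integration.integral_cong) (simp_all add: hyp_symbol_def inner_commute)
  finally show ?thesis unfolding fourier_def[of "\<lambda>\<xi>. hyp_symbol k \<xi> * fourier \<phi> \<xi>"] .
qed

text \<open>The multiplication formula and a reflection move the transform off
  \<open>\<psi>\<close>; what then stands against \<open>\<psi>\<close> is the pointwise
  operator.\<close>

lemma restrict_distr_of_symbol:
  fixes \<phi> :: "'a::euclidean_space \<Rightarrow> complex"
  assumes k: "k > 0" and \<phi>: "\<phi> \<in> test_functions \<Omega>"
    and DL: "\<And>x h. h > 0 \<Longrightarrow> double_layer k \<Omega> \<phi> (x, h) = layer_transform k \<phi> x h"
  shows "restrict_distr \<Omega> (distr_of_fourier (\<lambda>\<xi>. hyp_symbol k \<xi> * fourier \<phi> \<xi>)) = distr_of_fun_on \<Omega> (hypersingular_test k \<Omega> \<phi>)"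
proof
  fix \<psi> :: "'a \<Rightarrow> complex"
  let ?G = "\<lambda>\<xi>. hyp_symbol k \<xi> * fourier \<phi> \<xi>"
  show "restrict_distr \<Omega> (distr_of_fourier ?G) \<psi> = distr_of_fun_on \<Omega> (hypersingular_test k \<Omega> \<phi>) \<psi>"
  proof (cases "\<psi> \<in> test_functions \<Omega>")
    case True
    obtain S where S: "smooth \<psi>" "compact S" "S \<subseteq> \<Omega>" "\<And>x. x \<notin> S \<Longrightarrow> \<psi> x = 0"
      by (rule test_functionsE[OF True], rule that)
    have z: "\<psi> y = 0" if "y \<notin> \<Omega>" for y using S that by blast
    have i\<psi>: "integrable lborel \<psi>" by (rule test_functions_integrable[OF True])
    have i\<psi>r: "integrable lborel (\<lambda>x. \<psi> (- x))" using lborel_affine_integral(1)[of "-1" \<psi> 0] i\<psi> by simp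
    have iG: "integrable lborel ?G"
      using integrable_mult_right[OF Zk_fourier_integrable[OF k \<phi>], of "\<i> / 2"] by (simp add: hyp_symbol_def mult.assoc)
    then have [measurable]: "?G \<in> borel_measurable borel" by auto
    obtain M where M: "\<And>x. cmod (\<psi> x) \<le> M" by (rule test_functions_bounded[OF True], rule that)
    have "(\<integral>\<xi>. ?G \<xi> * fourier \<psi> (- \<xi>) \<partial>lborel) = (\<integral>x. fourier ?G x * \<psi> (- x) \<partial>lborel)"
      using fourier_multiplication[OF iG i\<psi>r] by (simp add: fourier_reflect[OF i\<psi>])
    also have "\<dots> = (\<integral>x. fourier ?G (- x) * \<psi> x \<partial>lborel)"
    proof -
      obtain C where C: "\<And>x. cmod (fourier ?G x) \<le> C" using fourier_bound by blast
      have [measurable]: "fourier ?G \<in> borel_measurable borel" "\<psi> \<in> borel_measurable borel" using i\<psi> by auto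
      have "integrable lborel (\<lambda>x. fourier ?G (- x) * \<psi> x)"
      proof (rule Bochner_Integration.integrable_bound)
        show "integrable lborel (\<lambda>x. of_real C * \<psi> x)" using i\<psi> by simp
        show "AE x in lborel. norm (fourier ?G (- x) * \<psi> x) \<le> norm (of_real C * \<psi> x)"
          unfolding norm_mult norm_of_real by (intro AE_I2 mult_right_mono order_trans[OF C]) auto
      qed measurable
      from lborel_affine_integral(2)[of "-1", OF _ this, of 0] show ?thesis by simp
    qed
    also have "\<dots> = (LINT x:\<Omega>|lborel. hypersingular_test k \<Omega> \<phi> x * \<psi> x)"
      unfolding set_lebesgue_integral_def
      by (rule Bochner_Integration.integral_cong) (auto simp: indicator_def z hypersingular_test_eq[OF k \<phi> DL])
    finally show ?thesis
      using True test_functions_schwartz[OF True] by (simp add: restrict_distr_def distr_of_fun_on_def distr_of_fourier_def)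
  qed (simp add: restrict_distr_def distr_of_fun_on_def)
qed

text \<open>The symbol is at most (1 + k) times \<open>jb\<close>, so multiplication by it costs one
  order: from 1/2 to -1/2.\<close>

lemma hyp_symbol_weighted:
  fixes f :: "'a::euclidean_space \<Rightarrow> complex"
  assumes k: "k > 0" and [measurable]: "f \<in> borel_measurable borel"
    and f: "integrable lborel (\<lambda>\<xi>. jb \<xi> * (cmod (f \<xi>))\<^sup>2)"
  shows "integrable lborel (\<lambda>\<xi>. inverse (jb \<xi>) * (cmod (hyp_symbol k \<xi> * f \<xi>))\<^sup>2)"
    and "(\<integral>\<xi>. inverse (jb \<xi>) * (cmod (hyp_symbol k \<xi> * f \<xi>))\<^sup>2 \<partial>lborel) \<le> (1 + k)\<^sup>2 * (\<integral>\<xi>. jb \<xi> * (cmod (f \<xi>))\<^sup>2 \<partial>lborel)"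
proof -
  have le: "inverse (jb \<xi>) * (cmod (hyp_symbol k \<xi> * f \<xi>))\<^sup>2 \<le> (1 + k)\<^sup>2 * (jb \<xi> * (cmod (f \<xi>))\<^sup>2)" for \<xi>
  proof -
    have "cmod (hyp_symbol k \<xi>) \<le> (1 + k) * jb \<xi>"
      unfolding cmod_hyp_symbol using Dk_le_jb[OF k, of \<xi>] Dk_nonneg[of k \<xi>] by linarith
    then have "(cmod (hyp_symbol k \<xi>))\<^sup>2 \<le> ((1 + k) * jb \<xi>)\<^sup>2" by (intro power_mono) auto
    then have "inverse (jb \<xi>) * ((cmod (hyp_symbol k \<xi>))\<^sup>2 * (cmod (f \<xi>))\<^sup>2) \<le> inverse (jb \<xi>) * (((1 + k) * jb \<xi>)\<^sup>2 * (cmod (f \<xi>))\<^sup>2)"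
      by (intro mult_left_mono mult_right_mono) auto
    also have "\<dots> = (1 + k)\<^sup>2 * (jb \<xi> * (cmod (f \<xi>))\<^sup>2)"
    proof -
      have "inverse j * ((c * j)\<^sup>2 * y) = c\<^sup>2 * (j * y)" if "j > 0" for j c y :: real
        using that by (simp add: power_mult_distrib power2_eq_square)
      from this[OF jb_pos] show ?thesis .
    qed
    finally show ?thesis by (simp only: norm_mult power_mult_distrib)
  qed
  have i: "integrable lborel (\<lambda>\<xi>. (1 + k)\<^sup>2 * (jb \<xi> * (cmod (f \<xi>))\<^sup>2))" using f by simp
  show 1: "integrable lborel (\<lambda>\<xi>. inverse (jb \<xi>) * (cmod (hyp_symbol k \<xi> * f \<xi>))\<^sup>2)"
  proof (rule Bochner_Integration.integrable_bound[OF i])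
    show "AE \<xi> in lborel. norm (inverse (jb \<xi>) * (cmod (hyp_symbol k \<xi> * f \<xi>))\<^sup>2) \<le> norm ((1 + k)\<^sup>2 * (jb \<xi> * (cmod (f \<xi>))\<^sup>2))"
      unfolding real_norm_def by (intro AE_I2 order_trans[OF _ abs_ge_self], subst abs_of_nonneg) (auto intro: le simp del: norm_mult)
  qed measurable
  show "(\<integral>\<xi>. inverse (jb \<xi>) * (cmod (hyp_symbol k \<xi> * f \<xi>))\<^sup>2 \<partial>lborel) \<le> (1 + k)\<^sup>2 * (\<integral>\<xi>. jb \<xi> * (cmod (f \<xi>))\<^sup>2 \<partial>lborel)"
    using Bochner_Integration.integral_mono[OF 1 i le] by simp
qed

text \<open>The multiplier acts on distributions of order 1/2 on the whole space; restricting its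
  values to \<open>\<Omega>\<close> gives the operator of the screen.\<close>

definition hyp_distr :: "real \<Rightarrow> 'a::euclidean_space distr \<Rightarrow> 'a distr" where
  "hyp_distr k u = distr_of_fourier (\<lambda>\<xi>. hyp_symbol k \<xi> * fourier_fun u \<xi>)"

lemma hyp_distr:
  assumes k: "k > 0" and u: "u \<in> sobolev (1/2)"
  shows "hyp_distr k u \<in> sobolev (- (1/2))"
    and "is_fourier_fun (hyp_distr k u) (\<lambda>\<xi>. hyp_symbol k \<xi> * fourier_fun u \<xi>)"
    and "sobolev_norm 1 (- (1/2)) (hyp_distr k u) \<le> (1 + k) * sobolev_norm 1 (1/2) u"
proof -
  have [measurable]: "fourier_fun u \<in> borel_measurable borel" by (rule sobolevD(3)[OF u])
  note w = hyp_symbol_weighted[OF k sobolevD(3)[OF u] sobolevD(4)[OF u refl]]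
  show 1: "hyp_distr k u \<in> sobolev (- (1/2))" unfolding hyp_distr_def by (rule distr_of_fourier(1)[OF _ w(1)]) measurable
  show 2: "is_fourier_fun (hyp_distr k u) (\<lambda>\<xi>. hyp_symbol k \<xi> * fourier_fun u \<xi>)"
    unfolding hyp_distr_def by (rule distr_of_fourier(2)[OF _ w(1)]) measurable
  have "sobolev_norm 1 (- (1/2)) (hyp_distr k u) \<le> sqrt ((1 + k)\<^sup>2 * (\<integral>\<xi>. jb \<xi> * (cmod (fourier_fun u \<xi>))\<^sup>2 \<partial>lborel))"
    unfolding sobolev_minus_half(2)[OF 2] by (rule real_sqrt_le_mono[OF w(2)])
  also have "\<dots> = (1 + k) * sobolev_norm 1 (1/2) u"
    unfolding sobolev_half(2)[OF sobolevD(2)[OF u]] using k by (simp add: real_sqrt_mult)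
  finally show "sobolev_norm 1 (- (1/2)) (hyp_distr k u) \<le> (1 + k) * sobolev_norm 1 (1/2) u" .
qed

lemma hyp_distr_test:
  assumes k: "k > 0" and u: "u \<in> sobolev (1/2)" and \<psi>: "\<psi> \<in> test_functions \<Omega>"
    and g: "AE \<xi> in lborel. fourier_fun u \<xi> = g \<xi>" "g \<in> borel_measurable borel"
  shows "integrable lborel (\<lambda>\<xi>. hyp_symbol k \<xi> * g \<xi> * fourier \<psi> (- \<xi>))"
    and "hyp_distr k u \<psi> = (\<integral>\<xi>. hyp_symbol k \<xi> * g \<xi> * fourier \<psi> (- \<xi>) \<partial>lborel)"
proof -
  have [measurable]: "fourier_fun u \<in> borel_measurable borel" "g \<in> borel_measurable borel" using sobolevD(3)[OF u] g by auto
  have [measurable]: "fourier \<psi> \<in> borel_measurable borel" using fourier_test_integrable[OF \<psi>] by auto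
  note w = hyp_symbol_weighted[OF k sobolevD(3)[OF u] sobolevD(4)[OF u refl]]
  have eqc: "cmod (fourier \<psi> (- \<xi>)) = cmod (fourier (\<lambda>x. cnj (\<psi> x)) \<xi>)" for \<xi> by (simp add: fourier_cnj)
  have i: "integrable lborel (\<lambda>\<xi>. jb \<xi> * (cmod (fourier \<psi> (- \<xi>)))\<^sup>2)"
    unfolding eqc by (rule test_sobolev(2)[OF test_functions_cnj[OF \<psi>]])
  have 1: "integrable lborel (\<lambda>\<xi>. hyp_symbol k \<xi> * fourier_fun u \<xi> * fourier \<psi> (- \<xi>))"
    by (rule weighted_cauchy_schwarz(1)[OF _ _ _ _ w(1) i]) auto
  have ae: "AE \<xi> in lborel. hyp_symbol k \<xi> * fourier_fun u \<xi> * fourier \<psi> (- \<xi>) = hyp_symbol k \<xi> * g \<xi> * fourier \<psi> (- \<xi>)"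
    using g(1) by eventually_elim simp
  show "integrable lborel (\<lambda>\<xi>. hyp_symbol k \<xi> * g \<xi> * fourier \<psi> (- \<xi>))"
    by (rule integrable_cong_AE_imp[OF 1]) (use ae in \<open>auto elim: eventually_mono\<close>)
  have "(\<integral>\<xi>. hyp_symbol k \<xi> * fourier_fun u \<xi> * fourier \<psi> (- \<xi>) \<partial>lborel) = (\<integral>\<xi>. hyp_symbol k \<xi> * g \<xi> * fourier \<psi> (- \<xi>) \<partial>lborel)"
    by (rule integral_cong_AE) (use ae in auto)
  then show "hyp_distr k u \<psi> = (\<integral>\<xi>. hyp_symbol k \<xi> * g \<xi> * fourier \<psi> (- \<xi>) \<partial>lborel)"
    using test_functions_schwartz[OF \<psi>] by (simp add: hyp_distr_def distr_of_fourier_def)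
qed

section \<open>Existence of the operator, uniqueness of its form, and the lower bound\<close>

lemma sobolev_linear:
  assumes u: "u \<in> sobolev (1/2)" and v: "v \<in> sobolev (1/2)"
  shows "(\<lambda>f. a * u f + b * v f) \<in> sobolev (1/2)"
    and "AE \<xi> in lborel. fourier_fun (\<lambda>f. a * u f + b * v f) \<xi> = a * fourier_fun u \<xi> + b * fourier_fun v \<xi>"
proof -
  note F = is_fourier_fun_linear[OF sobolevD(2)[OF u] sobolevD(2)[OF v], of a b]
  have [measurable]: "fourier_fun u \<in> borel_measurable borel" "fourier_fun v \<in> borel_measurable borel"
    using sobolevD(3)[OF u] sobolevD(3)[OF v] by auto
  show "AE \<xi> in lborel. fourier_fun (\<lambda>f. a * u f + b * v f) \<xi> = a * fourier_fun u \<xi> + b * fourier_fun v \<xi>"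
    by (rule is_fourier_fun_fourier_fun(2)[OF F])
  have s: "integrable lborel (\<lambda>\<xi>. jb \<xi> * (cmod (c * fourier_fun w \<xi>))\<^sup>2)" if w: "w \<in> sobolev (1/2)" for c w
    using Bochner_Integration.integrable_mult_right[of "(cmod c)\<^sup>2", OF sobolevD(4)[OF w refl]]
    by (simp add: norm_mult power_mult_distrib mult.left_commute)
  have "integrable lborel (\<lambda>\<xi>. jb \<xi> * (cmod (a * fourier_fun u \<xi> - (- b) * fourier_fun v \<xi>))\<^sup>2)"
    by (rule weighted_sq_diff(1)[OF _ _ _ _ s[OF u] s[OF v]]) auto
  then show "(\<lambda>f. a * u f + b * v f) \<in> sobolev (1/2)"
    by (intro sobolev_half(1)[OF F] tempered_linear sobolevD(1)[OF u] sobolevD(1)[OF v]) simp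
qed

text \<open>The existence that gives the choice in \<open>hypersingular\<close> a meaning. Linearity
  has content only on test functions, as restricted distributions are 0 elsewhere.\<close>

lemma is_hypersingular_hyp_distr:
  fixes \<Omega> :: "'a::euclidean_space set"
  assumes k: "k > 0"
    and DL: "\<And>\<phi> x h. \<phi> \<in> test_functions \<Omega> \<Longrightarrow> h > 0 \<Longrightarrow> double_layer k \<Omega> \<phi> (x, h) = layer_transform k \<phi> x h"
  shows "is_hypersingular k \<Omega> (\<lambda>u. restrict_distr \<Omega> (hyp_distr k u))"
  unfolding is_hypersingular_def
proof (intro conjI ballI allI)
  have m: "- 1 / 2 = - (1/2 :: real)" by simp
  show "restrict_distr \<Omega> (hyp_distr k u) \<in> sobolev_on (- 1 / 2) \<Omega>" if "u \<in> sobolev_tilde (1/2) \<Omega>" for u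
    unfolding m sobolev_on_def by (intro imageI hyp_distr(1)[OF k sobolev_tildeD[OF that]])
  show "\<exists>M. \<forall>u\<in>sobolev_tilde (1/2) \<Omega>. sobolev_on_norm (- 1 / 2) \<Omega> (restrict_distr \<Omega> (hyp_distr k u)) \<le> M * sobolev_norm 1 (1/2) u"
  proof (intro exI ballI)
    fix u assume "u \<in> sobolev_tilde (1/2) \<Omega>"
    then have u: "u \<in> sobolev (1/2)" by (rule sobolev_tildeD)
    show "sobolev_on_norm (- 1 / 2) \<Omega> (restrict_distr \<Omega> (hyp_distr k u)) \<le> (1 + k) * sobolev_norm 1 (1/2) u"
      unfolding m by (rule order_trans[OF sobolev_on_norm_le[OF hyp_distr(1)[OF k u]] hyp_distr(3)[OF k u]])
  qed
  fix u v a b assume "u \<in> sobolev_tilde (1/2) \<Omega>" "v \<in> sobolev_tilde (1/2) \<Omega>"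
  then have u: "u \<in> sobolev (1/2)" and v: "v \<in> sobolev (1/2)" by (auto dest: sobolev_tildeD)
  show "restrict_distr \<Omega> (hyp_distr k (\<lambda>f. a * u f + b * v f)) = (\<lambda>f. a * restrict_distr \<Omega> (hyp_distr k u) f + b * restrict_distr \<Omega> (hyp_distr k v) f)"
  proof
    fix f
    show "restrict_distr \<Omega> (hyp_distr k (\<lambda>f. a * u f + b * v f)) f = a * restrict_distr \<Omega> (hyp_distr k u) f + b * restrict_distr \<Omega> (hyp_distr k v) f"
    proof (cases "f \<in> test_functions \<Omega>")
      case True
      have [measurable]: "fourier_fun u \<in> borel_measurable borel" "fourier_fun v \<in> borel_measurable borel"
        using sobolevD(3)[OF u] sobolevD(3)[OF v] by auto
      note U = hyp_distr_test[OF k u True AE_I2[OF refl] sobolevD(3)[OF u]]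
      note V = hyp_distr_test[OF k v True AE_I2[OF refl] sobolevD(3)[OF v]]
      have "hyp_distr k (\<lambda>f. a * u f + b * v f) f = (\<integral>\<xi>. hyp_symbol k \<xi> * (a * fourier_fun u \<xi> + b * fourier_fun v \<xi>) * fourier f (- \<xi>) \<partial>lborel)"
        by (rule hyp_distr_test(2)[OF k sobolev_linear(1)[OF u v] True sobolev_linear(2)[OF u v]]) measurable
      also have "\<dots> = (\<integral>\<xi>. a * (hyp_symbol k \<xi> * fourier_fun u \<xi> * fourier f (- \<xi>)) + b * (hyp_symbol k \<xi> * fourier_fun v \<xi> * fourier f (- \<xi>)) \<partial>lborel)"
        by (simp add: algebra_simps)
      also have "\<dots> = a * hyp_distr k u f + b * hyp_distr k v f" using U V by simp
      finally show ?thesis using True by (simp add: restrict_distr_def)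
    qed (simp add: restrict_distr_def)
  qed
next
  fix \<phi> assume \<phi>: "\<phi> \<in> test_functions \<Omega>"
  have [measurable]: "fourier \<phi> \<in> borel_measurable borel" using fourier_test_integrable[OF \<phi>] by auto
  have "restrict_distr \<Omega> (hyp_distr k (tempered_of_fun \<phi>)) = restrict_distr \<Omega> (distr_of_fourier (\<lambda>\<xi>. hyp_symbol k \<xi> * fourier \<phi> \<xi>))"
  proof
    fix f
    show "restrict_distr \<Omega> (hyp_distr k (tempered_of_fun \<phi>)) f = restrict_distr \<Omega> (distr_of_fourier (\<lambda>\<xi>. hyp_symbol k \<xi> * fourier \<phi> \<xi>)) f"
    proof (cases "f \<in> test_functions \<Omega>")
      case True
      have "hyp_distr k (tempered_of_fun \<phi>) f = (\<integral>\<xi>. hyp_symbol k \<xi> * fourier \<phi> \<xi> * fourier f (- \<xi>) \<partial>lborel)"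
        by (rule hyp_distr_test(2)[OF k test_sobolev(1)[OF \<phi>] True is_fourier_fun_fourier_fun(2)[OF is_fourier_fun_test[OF \<phi>]]]) measurable
      then show ?thesis using test_functions_schwartz[OF True] by (simp add: restrict_distr_def distr_of_fourier_def)
    qed (simp add: restrict_distr_def)
  qed
  then show "restrict_distr \<Omega> (hyp_distr k (tempered_of_fun \<phi>)) = distr_of_fun_on \<Omega> (hypersingular_test k \<Omega> \<phi>)"
    using restrict_distr_of_symbol[OF k \<phi> DL[OF \<phi>]] by simp
qed

lemma sobolev_diff:
  assumes U: "U \<in> sobolev (- (1/2))" and V: "V \<in> sobolev (- (1/2))"
  shows "(\<lambda>f. U f - V f) \<in> sobolev (- (1/2))"
    and "AE \<xi> in lborel. fourier_fun (\<lambda>f. U f - V f) \<xi> = fourier_fun U \<xi> - fourier_fun V \<xi>"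
proof -
  note F = is_fourier_fun_diff[OF sobolevD(2)[OF U] sobolevD(2)[OF V]]
  have [measurable]: "fourier_fun U \<in> borel_measurable borel" "fourier_fun V \<in> borel_measurable borel"
    using sobolevD(3)[OF U] sobolevD(3)[OF V] by auto
  show "AE \<xi> in lborel. fourier_fun (\<lambda>f. U f - V f) \<xi> = fourier_fun U \<xi> - fourier_fun V \<xi>"
    by (rule is_fourier_fun_fourier_fun(2)[OF F])
  show "(\<lambda>f. U f - V f) \<in> sobolev (- (1/2))"
    by (intro sobolev_minus_half(1)[OF F] tempered_diff sobolevD(1)[OF U] sobolevD(1)[OF V]
        weighted_sq_diff(1) sobolevD(5)[OF U] sobolevD(5)[OF V]) auto
qed

lemma sobolev_pairing_diff:
  assumes U: "U \<in> sobolev (- (1/2))" and V: "V \<in> sobolev (- (1/2))" and [measurable]: "b \<in> borel_measurable borel"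
    and b: "integrable lborel (\<lambda>\<xi>. jb \<xi> * (cmod (b \<xi>))\<^sup>2)"
  shows "(\<integral>\<xi>. fourier_fun (\<lambda>f. U f - V f) \<xi> * b \<xi> \<partial>lborel) = (\<integral>\<xi>. fourier_fun U \<xi> * b \<xi> \<partial>lborel) - (\<integral>\<xi>. fourier_fun V \<xi> * b \<xi> \<partial>lborel)"
proof -
  have [measurable]: "fourier_fun U \<in> borel_measurable borel" "fourier_fun V \<in> borel_measurable borel"
    "fourier_fun (\<lambda>f. U f - V f) \<in> borel_measurable borel"
    using sobolevD(3)[OF U] sobolevD(3)[OF V] sobolevD(3)[OF sobolev_diff(1)[OF U V]] by auto
  have "(\<integral>\<xi>. fourier_fun (\<lambda>f. U f - V f) \<xi> * b \<xi> \<partial>lborel) = (\<integral>\<xi>. fourier_fun U \<xi> * b \<xi> - fourier_fun V \<xi> * b \<xi> \<partial>lborel)"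
    by (rule integral_cong_AE) (use sobolev_diff(2)[OF U V] in \<open>auto elim!: eventually_mono simp: left_diff_distrib\<close>)
  then show ?thesis using sobolev_pairing(1)[OF U _ b] sobolev_pairing(1)[OF V _ b] by simp
qed

text \<open>Two admissible operators agree on test functions, so by linearity they differ at
  \<open>u\<close> only through their values at u - \<phi> with \<open>\<phi>\<close> close to
  \<open>u\<close>. Those values have extensions of small norm, and the difference of the two forms
  is the pairing of \<open>u\<close> with the difference of these extensions.\<close>

lemma hypersingular_form_unique:
  assumes T: "is_hypersingular k \<Omega> T" and T': "is_hypersingular k \<Omega> T'" and u: "u \<in> sobolev_tilde (1/2) \<Omega>"
  shows "duality (1/2) \<Omega> (T u) u = duality (1/2) \<Omega> (T' u) u"
proof -
  have m: "- 1 / 2 = - (1/2 :: real)" by simp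
  let ?b = "\<lambda>\<xi>. cnj (fourier_fun u \<xi>)"
  have us: "u \<in> sobolev (1/2)" by (rule sobolev_tildeD[OF u])
  have b[measurable]: "?b \<in> borel_measurable borel" using sobolevD(3)[OF us] by measurable
  have bi: "integrable lborel (\<lambda>\<xi>. jb \<xi> * (cmod (?b \<xi>))\<^sup>2)" using sobolevD(4)[OF us refl] by simp
  define B where "B = sqrt (\<integral>\<xi>. jb \<xi> * (cmod (?b \<xi>))\<^sup>2 \<partial>lborel)"
  have B: "B \<ge> 0" by (auto simp: B_def intro!: Bochner_Integration.integral_nonneg)
  have on: "S v \<in> sobolev_on (- (1/2)) \<Omega>" if "is_hypersingular k \<Omega> S" "v \<in> sobolev_tilde (1/2) \<Omega>" for S v
    using that unfolding is_hypersingular_def m by blast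
  have bd: "\<exists>M. \<forall>v\<in>sobolev_tilde (1/2) \<Omega>. sobolev_on_norm (- (1/2)) \<Omega> (S v) \<le> M * sobolev_norm 1 (1/2) v" if "is_hypersingular k \<Omega> S" for S
    using that unfolding is_hypersingular_def m by blast
  \<comment> \<open>Boundedness is stated in the quotient norm; a near-minimal extension adds one
    more \<open>e\<close>, hence |M| + 1.\<close>
  have small: "\<exists>W. W \<in> sobolev (- (1/2)) \<and> restrict_distr \<Omega> W = S w \<and> sobolev_norm 1 (- (1/2)) W \<le> (\<bar>M\<bar> + 1) * e"
    if S: "is_hypersingular k \<Omega> S" and w: "w \<in> sobolev_tilde (1/2) \<Omega>" "sobolev_norm 1 (1/2) w < e" and e: "e > 0"
      and M: "\<forall>v\<in>sobolev_tilde (1/2) \<Omega>. sobolev_on_norm (- (1/2)) \<Omega> (S v) \<le> M * sobolev_norm 1 (1/2) v" for S w e M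
  proof -
    obtain W where W: "W \<in> sobolev (- (1/2))" "restrict_distr \<Omega> W = S w" "sobolev_norm 1 (- (1/2)) W < sobolev_on_norm (- (1/2)) \<Omega> (S w) + e"
      by (rule sobolev_on_norm_approx[OF on[OF S w(1)] e], rule that)
    have n: "sobolev_norm 1 (1/2) w \<ge> 0" unfolding sobolev_norm_def by (auto intro!: Bochner_Integration.integral_nonneg)
    have "M * sobolev_norm 1 (1/2) w \<le> \<bar>M\<bar> * sobolev_norm 1 (1/2) w" using n by (intro mult_right_mono) auto
    also have "\<dots> \<le> \<bar>M\<bar> * e" using w(2) by (intro mult_left_mono) auto
    finally have "sobolev_norm 1 (- (1/2)) W \<le> (\<bar>M\<bar> + 1) * e"
      using W(3) M w(1) by (fastforce simp: distrib_right)
    with W show ?thesis by blast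
  qed
  have lin: "S u = (\<lambda>f. S (\<lambda>f. u f - tempered_of_fun \<phi> f) f + S (tempered_of_fun \<phi>) f)"
    if S: "is_hypersingular k \<Omega> S" and \<phi>: "\<phi> \<in> test_functions \<Omega>" for S \<phi>
  proof -
    have "S (\<lambda>f. a * v f + b * w f) = (\<lambda>f. a * S v f + b * S w f)"
      if "v \<in> sobolev_tilde (1/2) \<Omega>" "w \<in> sobolev_tilde (1/2) \<Omega>" for v w a b
      using S that unfolding is_hypersingular_def by blast
    from this[OF sobolev_tilde_diff_test[OF u \<phi>] test_sobolev_tilde[OF \<phi>], of 1 1] show ?thesis by simp
  qed
  have test: "S (tempered_of_fun \<phi>) = distr_of_fun_on \<Omega> (hypersingular_test k \<Omega> \<phi>)" if "is_hypersingular k \<Omega> S" "\<phi> \<in> test_functions \<Omega>" for S \<phi>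
    using that unfolding is_hypersingular_def by blast
  obtain V where V: "V \<in> sobolev (- (1/2))" "T u = restrict_distr \<Omega> V" using on[OF T u] by (auto simp: sobolev_on_def)
  obtain M where M: "\<forall>v\<in>sobolev_tilde (1/2) \<Omega>. sobolev_on_norm (- (1/2)) \<Omega> (T v) \<le> M * sobolev_norm 1 (1/2) v" using bd[OF T] by blast
  obtain M' where M': "\<forall>v\<in>sobolev_tilde (1/2) \<Omega>. sobolev_on_norm (- (1/2)) \<Omega> (T' v) \<le> M' * sobolev_norm 1 (1/2) v" using bd[OF T'] by blast
  define d where "d = cmod (duality (1/2) \<Omega> (T u) u - duality (1/2) \<Omega> (T' u) u)"
  define K where "K = (\<bar>M\<bar> + 1 + (\<bar>M'\<bar> + 1)) * B"
  have K: "K \<ge> 0" using B by (simp add: K_def)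
  have le: "d \<le> K * e" if e: "e > 0" for e
  proof -
    obtain \<phi> where \<phi>: "\<phi> \<in> test_functions \<Omega>" "sobolev_norm 1 (1/2) (\<lambda>f. u f - tempered_of_fun \<phi> f) < e"
      using u e unfolding sobolev_tilde_def by blast
    let ?w = "\<lambda>f. u f - tempered_of_fun \<phi> f"
    note wt = sobolev_tilde_diff_test[OF u \<phi>(1)]
    obtain W where W: "W \<in> sobolev (- (1/2))" "restrict_distr \<Omega> W = T ?w" "sobolev_norm 1 (- (1/2)) W \<le> (\<bar>M\<bar> + 1) * e"
      using small[OF T wt \<phi>(2) e M] by blast
    obtain W' where W': "W' \<in> sobolev (- (1/2))" "restrict_distr \<Omega> W' = T' ?w" "sobolev_norm 1 (- (1/2)) W' \<le> (\<bar>M'\<bar> + 1) * e"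
      using small[OF T' wt \<phi>(2) e M'] by blast
    have D: "(\<lambda>f. W f - W' f) \<in> sobolev (- (1/2))" by (rule sobolev_diff(1)[OF W(1) W'(1)])
    \<comment> \<open>An explicit extension of \<open>T' u\<close>, obtained from that of
      \<open>T u\<close> by two small corrections, so that the pairings can be subtracted on the
      frequency side.\<close>
    have "T' u = restrict_distr \<Omega> (\<lambda>f. V f - (W f - W' f))"
    proof
      fix f
      have "T' u f = T u f - (T ?w f - T' ?w f)"
        using fun_cong[OF lin[OF T \<phi>(1)], of f] fun_cong[OF lin[OF T' \<phi>(1)], of f]
        by (simp add: test[OF T \<phi>(1)] test[OF T' \<phi>(1)])
      then show "T' u f = restrict_distr \<Omega> (\<lambda>f. V f - (W f - W' f)) f"
        unfolding V(2) W(2)[symmetric] W'(2)[symmetric] by (auto simp: restrict_distr_def)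
    qed
    then have "duality (1/2) \<Omega> (T' u) u = (\<integral>\<xi>. fourier_fun (\<lambda>f. V f - (W f - W' f)) \<xi> * ?b \<xi> \<partial>lborel)"
      by (simp only: duality_eq[OF sobolev_diff(1)[OF V(1) D] u])
    also have "\<dots> = (\<integral>\<xi>. fourier_fun V \<xi> * ?b \<xi> \<partial>lborel) - ((\<integral>\<xi>. fourier_fun W \<xi> * ?b \<xi> \<partial>lborel) - (\<integral>\<xi>. fourier_fun W' \<xi> * ?b \<xi> \<partial>lborel))"
      by (simp only: sobolev_pairing_diff[OF V(1) D b bi] sobolev_pairing_diff[OF W(1) W'(1) b bi])
    also have "(\<integral>\<xi>. fourier_fun V \<xi> * ?b \<xi> \<partial>lborel) = duality (1/2) \<Omega> (T u) u"
      unfolding V(2) by (rule duality_eq[OF V(1) u, symmetric])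
    finally have "d = cmod ((\<integral>\<xi>. fourier_fun W \<xi> * ?b \<xi> \<partial>lborel) - (\<integral>\<xi>. fourier_fun W' \<xi> * ?b \<xi> \<partial>lborel))"
      by (simp add: d_def)
    also have "\<dots> \<le> sobolev_norm 1 (- (1/2)) W * B + sobolev_norm 1 (- (1/2)) W' * B"
      unfolding B_def by (intro order_trans[OF norm_triangle_ineq4] add_mono sobolev_pairing(2) W W' b bi)
    also have "\<dots> \<le> (\<bar>M\<bar> + 1) * e * B + (\<bar>M'\<bar> + 1) * e * B"
      using B by (intro add_mono mult_right_mono W W')
    also have "\<dots> = K * e" by (simp add: K_def algebra_simps)
    finally show ?thesis .
  qed
  have "d \<le> 0"
  proof (rule ccontr)
    assume "\<not> d \<le> 0"
    then have d: "d > 0" by simp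
    \<comment> \<open>For this value of \<open>e\<close> the bound is strictly smaller than
      \<open>d\<close>.\<close>
    have "d \<le> K * (d / (K + 1))" using d K by (intro le) auto
    then have "d * (K + 1) \<le> K * d" using K by (simp add: field_simps)
    then show False using d by (simp add: algebra_simps)
  qed
  then show ?thesis by (simp add: d_def)
qed

text \<open>At each frequency \<open>Zk\<close> is real or purely imaginary with a nonnegative
  coefficient, so the real and the imaginary part of the integral are nonnegative and add up to the
  integral of \<open>Dk\<close>. Each is at most the modulus, which gives one factor 2; the 1/2 in
  the symbol gives the other.\<close>

lemma hypersingular_form_lower_bound:
  fixes \<Omega> :: "'a::euclidean_space set"
  assumes k: "k > 0"
    and DL: "\<And>\<phi> x h. \<phi> \<in> test_functions \<Omega> \<Longrightarrow> h > 0 \<Longrightarrow> double_layer k \<Omega> \<phi> (x, h) = layer_transform k \<phi> x h"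
    and u: "u \<in> sobolev_tilde (1/2) \<Omega>"
  shows "4 * cmod (hypersingular_form k \<Omega> u u) \<ge> (\<integral>\<xi>. Dk k \<xi> * (cmod (fourier_fun u \<xi>))\<^sup>2 \<partial>lborel)"
proof -
  let ?g = "fourier_fun u"
  have us: "u \<in> sobolev (1/2)" by (rule sobolev_tildeD[OF u])
  have [measurable]: "?g \<in> borel_measurable borel" by (rule sobolevD(3)[OF us])
  note H = is_hypersingular_hyp_distr[OF k DL]
  have "is_hypersingular k \<Omega> (hypersingular k \<Omega>)" unfolding hypersingular_def by (rule someI[of "is_hypersingular k \<Omega>", OF H])
  from hypersingular_form_unique[OF this H u]
  have "hypersingular_form k \<Omega> u u = duality (1/2) \<Omega> (restrict_distr \<Omega> (hyp_distr k u)) u"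
    by (simp add: hypersingular_form_def)
  also have "\<dots> = (\<integral>\<xi>. fourier_fun (hyp_distr k u) \<xi> * cnj (?g \<xi>) \<partial>lborel)"
    by (rule duality_eq[OF hyp_distr(1)[OF k us] u])
  also have "\<dots> = (\<integral>\<xi>. hyp_symbol k \<xi> * ?g \<xi> * cnj (?g \<xi>) \<partial>lborel)"
  proof (rule integral_cong_AE)
    have [measurable]: "fourier_fun (hyp_distr k u) \<in> borel_measurable borel" by (rule sobolevD(3)[OF hyp_distr(1)[OF k us]])
    show "(\<lambda>\<xi>. fourier_fun (hyp_distr k u) \<xi> * cnj (?g \<xi>)) \<in> borel_measurable lborel" by measurable
    show "(\<lambda>\<xi>. hyp_symbol k \<xi> * ?g \<xi> * cnj (?g \<xi>)) \<in> borel_measurable lborel" by measurable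
    show "AE \<xi> in lborel. fourier_fun (hyp_distr k u) \<xi> * cnj (?g \<xi>) = hyp_symbol k \<xi> * ?g \<xi> * cnj (?g \<xi>)"
      using is_fourier_fun_fourier_fun(2)[OF hyp_distr(2)[OF k us]] by eventually_elim simp
  qed
  also have "\<dots> = (\<integral>\<xi>. \<i> / 2 * (Zk k \<xi> * of_real ((cmod (?g \<xi>))\<^sup>2)) \<partial>lborel)"
    by (rule Bochner_Integration.integral_cong[OF refl]) (simp only: hyp_symbol_def mult.assoc complex_norm_square)
  also have "\<dots> = \<i> / 2 * (\<integral>\<xi>. Zk k \<xi> * of_real ((cmod (?g \<xi>))\<^sup>2) \<partial>lborel)" by simp
  finally have form: "hypersingular_form k \<Omega> u u = \<i> / 2 * (\<integral>\<xi>. Zk k \<xi> * of_real ((cmod (?g \<xi>))\<^sup>2) \<partial>lborel)" (is "_ = _ * ?I") .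
  have i: "integrable lborel (\<lambda>\<xi>. Zk k \<xi> * of_real ((cmod (?g \<xi>))\<^sup>2))"
  proof (rule Bochner_Integration.integrable_bound)
    show "integrable lborel (\<lambda>\<xi>. (1 + k) * (jb \<xi> * (cmod (?g \<xi>))\<^sup>2))" using sobolevD(4)[OF us refl] by simp
    show "AE \<xi> in lborel. norm (Zk k \<xi> * of_real ((cmod (?g \<xi>))\<^sup>2)) \<le> norm ((1 + k) * (jb \<xi> * (cmod (?g \<xi>))\<^sup>2))"
    proof (rule AE_I2)
      fix \<xi>
      show "norm (Zk k \<xi> * of_real ((cmod (?g \<xi>))\<^sup>2)) \<le> norm ((1 + k) * (jb \<xi> * (cmod (?g \<xi>))\<^sup>2))"
        using k mult_right_mono[OF Dk_le_jb[OF k, of \<xi>], of "(cmod (?g \<xi>))\<^sup>2"] by (simp add: norm_mult norm_power mult.assoc)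
    qed
  qed measurable
  have "(\<integral>\<xi>. Dk k \<xi> * (cmod (?g \<xi>))\<^sup>2 \<partial>lborel) = (\<integral>\<xi>. Re (Zk k \<xi> * of_real ((cmod (?g \<xi>))\<^sup>2)) + Im (Zk k \<xi> * of_real ((cmod (?g \<xi>))\<^sup>2)) \<partial>lborel)"
    by (rule Bochner_Integration.integral_cong) (simp_all add: Zk_def)
  also have "\<dots> = Re ?I + Im ?I" using i by (simp add: integral_Re integral_Im del: Re_complex_of_real Im_complex_of_real times_complex.sel of_real_power)
  also have "\<dots> \<le> 2 * cmod ?I" using complex_Re_le_cmod[of ?I] abs_Im_le_cmod[of ?I] by linarith
  also have "\<dots> = 4 * cmod (hypersingular_form k \<Omega> u u)" by (simp add: form norm_mult)
  finally show ?thesis .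
qed

text \<open>The 16 is 4 from the approximation by test functions times 4 from the lower bound for
  the form.\<close>

lemma hypersingular_form_coercive:
  fixes \<Omega> :: "'a::euclidean_space set"
  assumes k: "k > 0"
    and DL: "\<And>\<phi> x h. \<phi> \<in> test_functions \<Omega> \<Longrightarrow> h > 0 \<Longrightarrow> double_layer k \<Omega> \<phi> (x, h) = layer_transform k \<phi> x h"
    and u: "u \<in> sobolev_tilde (1/2) \<Omega>" and \<Omega>: "\<And>x. x \<in> \<Omega> \<Longrightarrow> norm (x - x0) \<le> L" and L: "L > 0"
    and \<tau>: "0 < \<tau>" "\<tau> \<le> k * L"
  shows "coercivity_const DIM('a) \<tau> / 16 * (k * L) powr (- (1/2)) * (sobolev_norm k (1/2) u)\<^sup>2 \<le> cmod (hypersingular_form k \<Omega> u u)"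
proof -
  have "(sobolev_norm k (1/2) u)\<^sup>2 = (\<integral>\<xi>. Wk k \<xi> * (cmod (fourier_fun u \<xi>))\<^sup>2 \<partial>lborel)"
    unfolding sobolev_norm_def Wk_def
    by (simp add: powr_half_sqrt Bochner_Integration.integral_nonneg)
  then show ?thesis
    using coercive_sobolev[OF u \<Omega> L \<tau>] hypersingular_form_lower_bound[OF k DL u] by simp
qed

section \<open>The integral representation of the Macdonald function\<close>

lemma Gamma_has_bochner_integral:
  fixes x :: real assumes x: "x > 0"
  shows "has_bochner_integral lborel (\<lambda>t. indicator {0<..} t * (t powr (x - 1) * exp (- t))) (Gamma x)"
proof (rule has_bochner_integral_nn_integral)
  have "((\<lambda>t. if t \<in> {0..} then t powr (x - 1) / exp t else 0) has_integral Gamma x) UNIV"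
    using Gamma_integral_real[OF x] by (simp only: has_integral_restrict_UNIV)
  also have "(\<lambda>t. if t \<in> {0..} then t powr (x - 1) / exp t else 0) = (\<lambda>t. indicator {0<..} t * (t powr (x - 1) * exp (- t)))"
    by (rule ext) (auto simp: indicator_def exp_minus divide_inverse)
  finally show "(\<integral>\<^sup>+t. ennreal (indicator {0<..} t * (t powr (x - 1) * exp (- t))) \<partial>lborel) = ennreal (Gamma x)"
    by (intro nn_integral_has_integral_lborel) auto
  show "Gamma x \<ge> 0" using Gamma_real_pos[OF x] by simp
qed auto

text \<open>From ln y \<le> y - 1 with y = t for large t and y = t^(-1/4) for small t; the small
  exponent leaves room for a further factor t^(-1/2).\<close>

lemma abs_ln_le:
  fixes t :: real assumes t: "t > 0" shows "\<bar>ln t\<bar> \<le> 4 * t powr (- (1/4)) + t"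
proof (cases "t \<ge> 1")
  case True
  then have "\<bar>ln t\<bar> \<le> t" using ln_le_minus_one[OF t] by simp
  moreover have "0 \<le> 4 * t powr (- (1/4))" by simp
  ultimately show ?thesis by linarith
next
  case False
  have "ln (t powr (- (1/4))) \<le> t powr (- (1/4)) - 1" using t by (intro ln_le_minus_one) simp
  then have "- ln t \<le> 4 * t powr (- (1/4))" using t by (simp add: ln_powr)
  moreover have "ln t \<le> 0" using False t by simp
  ultimately show ?thesis using t by simp
qed

text \<open>One majorant for two purposes: differentiating the Gamma integral near 1, and perturbing
  the integral of ln t exp(- t). Near 0 it grows like t^(-3/4), which is still integrable.\<close>

definition ln_majorant :: "real \<Rightarrow> real" where
  "ln_majorant t = indicator {0<..} t * ((4 * t powr (- (1/4)) + t) * (t powr (- (1/2)) + t) * exp (- t))"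

lemma ln_majorant_integrable: "integrable lborel ln_majorant"
proof -
  let ?G = "\<lambda>x t. indicator {0<..} t * (t powr (x - 1) * exp (- t)) :: real"
  have "integrable lborel (\<lambda>t. 4 * ?G (1/4) t + ?G (3/2) t + 4 * ?G (7/4) t + ?G 3 t)"
    by (intro Bochner_Integration.integrable_add Bochner_Integration.integrable_mult_right
        integrable.intros[OF Gamma_has_bochner_integral]) auto
  moreover have "4 * ?G (1/4) t + ?G (3/2) t + 4 * ?G (7/4) t + ?G 3 t = ln_majorant t" for t
  proof (cases "t > 0")
    case True
    have "t powr (- (1/4)) * t powr (- (1/2)) = t powr (- (3/4))" by (simp add: powr_add[symmetric])
    moreover have "t * t powr (- (1/4)) = t powr (3/4)" "t * t powr (- (1/2)) = t powr (1/2)" "t * t = t powr 2"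
      using powr_mult_base[of t "- (1/4)"] powr_mult_base[of t "- (1/2)"] True by (simp_all add: power2_eq_square)
    moreover have "(4 * a + t) * (b + t) = 4 * (a * b) + t * b + 4 * (t * a) + t * t" for a b :: real
      by (simp add: algebra_simps)
    ultimately have "(4 * t powr (- (1/4)) + t) * (t powr (- (1/2)) + t) = 4 * t powr (- (3/4)) + t powr (1/2) + 4 * t powr (3/4) + t powr 2"
      by (simp only:)
    then show ?thesis using True by (simp add: ln_majorant_def distrib_right)
  qed (simp add: ln_majorant_def)
  ultimately show ?thesis by simp
qed

lemma ln_majorant_bound:
  assumes t: "t > 0" and a: "\<bar>a\<bar> \<le> t powr (- (1/2)) + t"
  shows "\<bar>ln t * a * exp (- t)\<bar> \<le> ln_majorant t"
proof -
  have "\<bar>ln t\<bar> * \<bar>a\<bar> \<le> (4 * t powr (- (1/4)) + t) * (t powr (- (1/2)) + t)"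
    using t by (intro mult_mono abs_ln_le a) auto
  from mult_right_mono[OF this, of "exp (- t)"] show ?thesis using t by (simp add: ln_majorant_def abs_mult)
qed

lemma powr_between:
  fixes t :: real assumes t: "t > 0" and z: "- (1/2) \<le> z" "z \<le> 1"
  shows "t powr z \<le> t powr (- (1/2)) + t"
proof (cases "t \<ge> 1")
  case True
  then have "t powr z \<le> t powr 1" using z by (intro powr_mono) auto
  then show ?thesis using t by (simp add: add_increasing)
next
  case False
  then have "t powr z \<le> t powr (- (1/2))" using z t by (intro powr_mono') auto
  then show ?thesis using t by (simp add: add_increasing2)
qed

text \<open>The derivative of the Gamma function at 1, computed under the integral sign.\<close>

lemma has_bochner_integral_ln_exp:
  "has_bochner_integral lborel (\<lambda>t. indicator {0<..} t * (ln t * exp (- t))) (- euler_mascheroni :: real)"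
proof -
  let ?f = "\<lambda>z t. indicator {0<..} t * (t powr (z - 1) * exp (- t)) :: real"
  let ?f' = "\<lambda>z t. indicator {0<..} t * (t powr (z - 1) * ln t * exp (- t)) :: real"
  have prem: "integrable lborel (?f z)" "((\<lambda>z. ?f z t) has_vector_derivative ?f' z t) (at z)" "norm (?f' z t) \<le> ln_majorant t"
    if z: "1/2 < z" "z < 2" for z t
  proof -
    show "integrable lborel (?f z)" using z by (intro integrable.intros[OF Gamma_has_bochner_integral]) auto
    show "((\<lambda>z. ?f z t) has_vector_derivative ?f' z t) (at z)"
    proof (cases "t > 0")
      case True
      then have "((\<lambda>z. ?f z t) has_real_derivative ?f' z t) (at z)"
        by (auto intro!: derivative_eq_intros simp: powr_def)
      then show ?thesis by (simp add: has_real_derivative_iff_has_vector_derivative)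
    qed simp
    show "norm (?f' z t) \<le> ln_majorant t"
    proof (cases "t > 0")
      case True
      have "\<bar>t powr (z - 1)\<bar> \<le> t powr (- (1/2)) + t"
        using powr_between[OF True, of "z - 1"] z by simp
      from ln_majorant_bound[OF True this] show ?thesis using True by (simp add: mult_ac)
    qed (simp add: ln_majorant_def)
  qed
  have o: "1/2 < (1::real)" "(1::real) < 2" by simp_all
  note D = has_vector_derivative_lebesgue_integral[OF o, of lborel ?f ?f' ln_majorant, OF prem ln_majorant_integrable]
  have "eventually (\<lambda>z::real. z \<in> {0<..}) (nhds 1)" by (intro eventually_nhds_in_open) auto
  then have ev: "eventually (\<lambda>z. (\<integral>t. ?f z t \<partial>lborel) = Gamma z) (nhds 1)"
    by eventually_elim (use Gamma_has_bochner_integral in \<open>auto simp: has_bochner_integral_iff\<close>)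
  have "(Gamma has_real_derivative - euler_mascheroni) (at 1)"
    using has_field_derivative_Gamma[of "1::real" UNIV] by simp
  then have "((\<lambda>z. \<integral>t. ?f z t \<partial>lborel) has_real_derivative - euler_mascheroni) (at 1)"
    by (rule iffD2[OF DERIV_cong_ev[OF refl ev refl]])
  moreover have "((\<lambda>z. \<integral>t. ?f z t \<partial>lborel) has_real_derivative (\<integral>t. ?f' 1 t \<partial>lborel)) (at 1)"
    unfolding has_real_derivative_iff_has_vector_derivative by (rule D(2))
  ultimately have "- euler_mascheroni = (\<integral>t. ?f' 1 t \<partial>lborel)" by (rule DERIV_unique)
  then have "has_bochner_integral lborel (?f' 1) (- euler_mascheroni)" using D(1) by (simp only: has_bochner_integral_iff)
  moreover have "?f' 1 t = indicator {0<..} t * (ln t * exp (- t))" for t by (simp add: indicator_def)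
  ultimately show ?thesis by (simp only:)
qed

text \<open>The substitution of w/t for t maps the half line onto itself. It is carried out in terms
  of absolute gauge integrability; \<open>tr\<close> translates both sides there and back.\<close>

lemma inversion_integral:
  fixes f :: "real \<Rightarrow> real"
  assumes w: "w > 0" and f: "integrable lborel (\<lambda>t. indicator {0<..} t * f t)" and [measurable]: "f \<in> borel_measurable borel"
  shows "integrable lborel (\<lambda>t. indicator {0<..} t * (w / t\<^sup>2 * f (w / t)))"
    and "(\<integral>t. indicator {0<..} t * (w / t\<^sup>2 * f (w / t)) \<partial>lborel) = (\<integral>t. indicator {0<..} t * f t \<partial>lborel)"
proof -
  have tr: "h absolutely_integrable_on {0<..} \<longleftrightarrow> integrable lborel (\<lambda>t. indicator {0<..} t * h t)"
    "h absolutely_integrable_on {0<..} \<Longrightarrow> integral {0<..} h = (\<integral>t. indicator {0<..} t * h t \<partial>lborel)"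
    if [measurable]: "h \<in> borel_measurable borel" for h :: "real \<Rightarrow> real"
  proof -
    have [measurable]: "(\<lambda>t. indicator {0<..} t * h t) \<in> borel_measurable borel" by measurable
    show "h absolutely_integrable_on {0<..} \<longleftrightarrow> integrable lborel (\<lambda>t. indicator {0<..} t * h t)"
      by (simp add: set_integrable_def integrable_completion)
    assume "h absolutely_integrable_on {0<..}"
    from set_lebesgue_integral_eq_integral(2)[OF this]
    show "integral {0<..} h = (\<integral>t. indicator {0<..} t * h t \<partial>lborel)"
      by (simp add: set_lebesgue_integral_def integral_completion)
  qed
  have im: "(\<lambda>t. w / t) ` {0<..} = {0<..}"
  proof
    show "{0<..} \<subseteq> (\<lambda>t. w / t) ` {0<..}"
    proof
      fix y :: real assume "y \<in> {0<..}"
      then show "y \<in> (\<lambda>t. w / t) ` {0<..}" using w by (intro image_eqI[of _ _ "w / y"]) auto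
    qed
  qed (use w in auto)
  have "(\<lambda>t. \<bar>- (w / t\<^sup>2)\<bar> * f (w / t)) absolutely_integrable_on {0<..} \<and>
      integral {0<..} (\<lambda>t. \<bar>- (w / t\<^sup>2)\<bar> * f (w / t)) = integral {0<..} f"
  proof (rule iffD2[OF has_absolute_integral_change_of_variables_1'[of "{0<..}" "\<lambda>t. w / t" "\<lambda>t. - (w / t\<^sup>2)" f]])
    show "((\<lambda>t. w / t) has_real_derivative - (w / t\<^sup>2)) (at t within {0<..})" if "t \<in> {0<..}" for t
      using that by (auto intro!: derivative_eq_intros simp: power2_eq_square)
    show "inj_on (\<lambda>t. w / t) {0<..}" using w by (auto intro!: inj_onI)
    show "f absolutely_integrable_on (\<lambda>t. w / t) ` {0<..} \<and> integral ((\<lambda>t. w / t) ` {0<..}) f = integral {0<..} f"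
      unfolding im using tr(1)[of f] f by simp
  qed simp
  moreover have "\<bar>- (w / t\<^sup>2)\<bar> = w / t\<^sup>2" for t using w by simp
  ultimately have A: "(\<lambda>t. w / t\<^sup>2 * f (w / t)) absolutely_integrable_on {0<..}" "integral {0<..} (\<lambda>t. w / t\<^sup>2 * f (w / t)) = integral {0<..} f"
    by (simp_all only:)
  have [measurable]: "(\<lambda>t. w / t\<^sup>2 * f (w / t)) \<in> borel_measurable borel" by measurable
  show "integrable lborel (\<lambda>t. indicator {0<..} t * (w / t\<^sup>2 * f (w / t)))" using A(1) by (subst tr(1)[symmetric]) auto
  show "(\<integral>t. indicator {0<..} t * (w / t\<^sup>2 * f (w / t)) \<partial>lborel) = (\<integral>t. indicator {0<..} t * f t \<partial>lborel)"
    using A tr(2)[of "\<lambda>t. w / t\<^sup>2 * f (w / t)"] tr(2)[of f] tr(1)[of f] f by simp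
qed

text \<open>Substitute b t for t; index 1 means the measure dt/t, which is invariant under
  scaling.\<close>

lemma macdonald_integral_scale:
  assumes \<rho>: "\<rho> > 0" and b: "b > 0"
  shows "macdonald_integral 1 \<rho> b = macdonald_integral 1 (b * \<rho>) 1"
proof -
  let ?f = "\<lambda>t. indicator {0<..} t * (t powr (- 1) * exp (- (b * \<rho> / t) - 1 * t)) :: real"
  have i: "integrable lborel ?f" using \<rho> b by (intro powr_exp_half_line_integrable) auto
  have "(\<integral>t. ?f (0 + b *\<^sub>R t) \<partial>lborel) = 1 / b * macdonald_integral 1 (b * \<rho>) 1"
    using lborel_affine_integral(2)[OF _ i, of b 0] b by (simp add: macdonald_integral_def)
  moreover have "?f (0 + b *\<^sub>R t) = 1 / b * (indicator {0<..} t * (t powr (- 1) * exp (- (\<rho> / t) - b * t)))" for t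
    using b by (auto simp: indicator_def powr_minus field_simps zero_less_mult_iff)
  ultimately have "(\<integral>t. 1 / b * (indicator {0<..} t * (t powr (- 1) * exp (- (\<rho> / t) - b * t))) \<partial>lborel) = 1 / b * macdonald_integral 1 (b * \<rho>) 1"
    by (simp only:)
  then have "1 / b * macdonald_integral 1 \<rho> b = 1 / b * macdonald_integral 1 (b * \<rho>) 1" by (simp only: macdonald_integral_def integral_mult_right_zero)
  then show ?thesis using b by simp
qed

text \<open>Integrate the derivative of exp(- w/t - t), which vanishes at both ends of the half
  line.\<close>

lemma macdonald_integral_two_zero:
  assumes w: "w > 0" shows "w * macdonald_integral 2 w 1 = macdonald_integral 0 w 1"
proof -
  let ?F = "\<lambda>t. exp (- (w / t) - 1 * t)"
  have i: "integrable lborel (\<lambda>t. indicator {0<..} t * (t powr (- s) * ?F t))" for s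
    using w by (intro powr_exp_half_line_integrable) auto
  have eq: "indicator {0<..} t * ((w / t\<^sup>2 - 1) * ?F t) = w * (indicator {0<..} t * (t powr (- 2) * ?F t)) - indicator {0<..} t * (t powr (- 0) * ?F t)" for t
    by (auto simp: indicator_def powr_minus divide_inverse left_diff_distrib)
  have "(\<integral>t. indicator {0<..} t * ((w / t\<^sup>2 - 1) * ?F t) \<partial>lborel) = 0 - 0"
  proof (rule half_line_FTC[where F = ?F])
    show "(?F has_real_derivative (w / t\<^sup>2 - 1) * ?F t) (at t)" if "0 < t" for t
      using that by (auto intro!: derivative_eq_intros simp: power2_eq_square)
    show "isCont (\<lambda>t. (w / t\<^sup>2 - 1) * ?F t) t" if "0 < t" for t using that by (intro continuous_intros) auto
    show "(?F \<longlongrightarrow> 0) (at_right 0)" using w by real_asymp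
    show "(?F \<longlongrightarrow> 0) at_top" using w by real_asymp
    show "integrable lborel (\<lambda>t. indicator {0<..} t * ((w / t\<^sup>2 - 1) * ?F t))"
      unfolding eq by (intro Bochner_Integration.integrable_diff Bochner_Integration.integrable_mult_right i)
  qed
  moreover have "(\<integral>t. indicator {0<..} t * ((w / t\<^sup>2 - 1) * ?F t) \<partial>lborel) = w * macdonald_integral 2 w 1 - macdonald_integral 0 w 1"
    unfolding eq macdonald_integral_def by (simp only: Bochner_Integration.integral_diff[OF Bochner_Integration.integrable_mult_right[OF i] i] integral_mult_right_zero)
  ultimately show ?thesis by simp
qed

text \<open>As w tends to 0 this tends to minus Euler's constant, which is how that constant enters
  the expansion of the Macdonald function.\<close>

definition log_integral :: "real \<Rightarrow> real" where
  "log_integral w = (\<integral>t. indicator {0<..} t * (ln t * exp (- (w / t) - 1 * t)) \<partial>lborel)"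

lemma log_integral_integrable:
  assumes w: "w > 0" shows "integrable lborel (\<lambda>t. indicator {0<..} t * (ln t * exp (- (w / t) - 1 * t)) :: real)"
proof (rule Bochner_Integration.integrable_bound[OF integrable.intros[OF has_bochner_integral_ln_exp]])
  show "AE t in lborel. norm (indicator {0<..} t * (ln t * exp (- (w / t) - 1 * t)) :: real) \<le> norm (indicator {0<..} t * (ln t * exp (- t)) :: real)"
    using w by (intro AE_I2) (auto simp: indicator_def abs_mult intro!: mult_left_mono)
qed measurable

text \<open>Integration by parts against \<open>ln t\<close>; the substitution \<open>t \<mapsto> w / t\<close> maps one of the two resulting
  integrals to the other up to a multiple of \<open>ln w\<close>.\<close>

lemma macdonald_integral_one_log_integral:
  assumes w: "w > 0" shows "macdonald_integral 1 w 1 = 2 * log_integral w - ln w * macdonald_integral 0 w 1"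
proof -
  let ?F = "\<lambda>t. exp (- (w / t) - 1 * t)"
  have i: "integrable lborel (\<lambda>t. indicator {0<..} t * (t powr (- s) * ?F t))" for s
    using w by (intro powr_exp_half_line_integrable) auto
  note B = log_integral_integrable[OF w]
  \<comment> \<open>Chosen so that inversion leaves a pure logarithm: ln w - ln(w/t) = ln t, while
    \<open>?F\<close> is invariant under exchanging t and w/t.\<close>
  let ?f = "\<lambda>t. (ln w - ln t) * ?F t"
  have feq: "indicator {0<..} t * ?f t = ln w * (indicator {0<..} t * (t powr (- 0) * ?F t)) - indicator {0<..} t * (ln t * ?F t)" for t
    by (auto simp: indicator_def left_diff_distrib)
  have fi: "integrable lborel (\<lambda>t. indicator {0<..} t * ?f t)"
    unfolding feq by (intro Bochner_Integration.integrable_diff Bochner_Integration.integrable_mult_right i B)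
  have ind: "indicator {0<..} t * (w / t\<^sup>2 * ?f (w / t)) = indicator {0<..} t * (w / t\<^sup>2 * (ln t * ?F t))" for t
    using w by (auto simp: indicator_def ln_div)
  have fm: "?f \<in> borel_measurable borel" by measurable
  have C: "integrable lborel (\<lambda>t. indicator {0<..} t * (w / t\<^sup>2 * (ln t * ?F t)))"
    using inversion_integral(1)[OF w fi fm] unfolding ind .
  have "(\<integral>t. indicator {0<..} t * (w / t\<^sup>2 * (ln t * ?F t)) \<partial>lborel) = (\<integral>t. indicator {0<..} t * ?f t \<partial>lborel)"
    using inversion_integral(2)[OF w fi fm] unfolding ind .
  also have "\<dots> = ln w * macdonald_integral 0 w 1 - log_integral w"
    unfolding feq macdonald_integral_def log_integral_def by (simp only: Bochner_Integration.integral_diff[OF Bochner_Integration.integrable_mult_right[OF i] B] integral_mult_right_zero)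
  finally have Cv: "(\<integral>t. indicator {0<..} t * (w / t\<^sup>2 * (ln t * ?F t)) \<partial>lborel) = ln w * macdonald_integral 0 w 1 - log_integral w" .
  let ?g = "\<lambda>t. 1 / t * ?F t + ln t * ((w / t\<^sup>2 - 1) * ?F t)"
  have eq: "indicator {0<..} t * ?g t = indicator {0<..} t * (t powr (- 1) * ?F t) + (indicator {0<..} t * (w / t\<^sup>2 * (ln t * ?F t)) - indicator {0<..} t * (ln t * ?F t))" for t
    by (auto simp: indicator_def powr_minus inverse_eq_divide algebra_simps)
  have "(\<integral>t. indicator {0<..} t * ?g t \<partial>lborel) = 0 - 0"
  proof (rule half_line_FTC[where F = "\<lambda>t. ln t * ?F t"])
    show "((\<lambda>t. ln t * ?F t) has_real_derivative ?g t) (at t)" if "0 < t" for t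
      using that by (auto intro!: derivative_eq_intros simp: power2_eq_square)
    show "isCont ?g t" if "0 < t" for t using that by (intro continuous_intros) auto
    show "((\<lambda>t. ln t * ?F t) \<longlongrightarrow> 0) (at_right 0)" using w by real_asymp
    show "((\<lambda>t. ln t * ?F t) \<longlongrightarrow> 0) at_top" using w by real_asymp
    show "integrable lborel (\<lambda>t. indicator {0<..} t * ?g t)"
      unfolding eq by (intro Bochner_Integration.integrable_add Bochner_Integration.integrable_diff i B C)
  qed
  moreover have "(\<integral>t. indicator {0<..} t * ?g t \<partial>lborel) = macdonald_integral 1 w 1 + (ln w * macdonald_integral 0 w 1 - log_integral w - log_integral w)"
    unfolding eq
    by (simp only: Bochner_Integration.integral_add[OF i Bochner_Integration.integrable_diff[OF C B]] Bochner_Integration.integral_diff[OF C B] Cv) (simp add: macdonald_integral_def log_integral_def)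
  ultimately show ?thesis by simp
qed

text \<open>The square root, rather than \<open>x\<close>, is what lets the perturbation integrals
  converge: with x = w/t it leaves the factor t^(-1/2), which is integrable at 0, where 1/t would
  not be.\<close>

lemma one_minus_exp_le_sqrt:
  fixes x :: real assumes "x \<ge> 0" shows "\<bar>1 - exp (- x)\<bar> \<le> sqrt x"
proof (cases "x \<le> 1")
  case True
  have "x\<^sup>2 \<le> x" using True assms by (simp add: power2_eq_square mult_left_le)
  then have "x \<le> sqrt x" by (rule real_le_rsqrt)
  moreover have "1 - exp (- x) \<le> x" using exp_ge_add_one_self[of "- x"] by linarith
  ultimately show ?thesis using assms by simp
next
  case False
  have "1 \<le> sqrt x" using False by simp
  moreover have "exp (- x) > 0" "exp (- x) \<le> 1" using assms by simp_all
  ultimately show ?thesis by linarith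
qed

lemma exp_perturbation_bound:
  fixes a :: "real \<Rightarrow> real"
  assumes w: "w > 0" and a: "integrable lborel (\<lambda>t. indicator {0<..} t * (a t * exp (- t)))"
    and aw: "integrable lborel (\<lambda>t. indicator {0<..} t * (a t * exp (- (w / t) - 1 * t)))"
    and b: "integrable lborel (\<lambda>t. indicator {0<..} t * (\<bar>a t\<bar> * t powr (- (1/2)) * exp (- t)))"
  shows "\<bar>(\<integral>t. indicator {0<..} t * (a t * exp (- t)) \<partial>lborel) - (\<integral>t. indicator {0<..} t * (a t * exp (- (w / t) - 1 * t)) \<partial>lborel)\<bar>
    \<le> sqrt w * (\<integral>t. indicator {0<..} t * (\<bar>a t\<bar> * t powr (- (1/2)) * exp (- t)) \<partial>lborel)"
proof -
  have "\<bar>\<integral>t. indicator {0<..} t * (a t * exp (- t)) - indicator {0<..} t * (a t * exp (- (w / t) - 1 * t)) \<partial>lborel\<bar>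
      \<le> (\<integral>t. sqrt w * (indicator {0<..} t * (\<bar>a t\<bar> * t powr (- (1/2)) * exp (- t))) \<partial>lborel)"
    unfolding real_norm_def[symmetric]
  proof (rule Bochner_Integration.integral_norm_bound_integral)
    show "integrable lborel (\<lambda>t. indicator {0<..} t * (a t * exp (- t)) - indicator {0<..} t * (a t * exp (- (w / t) - 1 * t)))"
      by (rule Bochner_Integration.integrable_diff[OF a aw])
    show "integrable lborel (\<lambda>t. sqrt w * (indicator {0<..} t * (norm (a t) * t powr (- (1/2)) * exp (- t))))" using b by simp
    fix t :: real
    show "norm (indicator {0<..} t * (a t * exp (- t)) - indicator {0<..} t * (a t * exp (- (w / t) - 1 * t)))
      \<le> sqrt w * (indicator {0<..} t * (norm (a t) * t powr (- (1/2)) * exp (- t)))"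
    proof (cases "t > 0")
      case True
      have "a t * exp (- t) - a t * exp (- (w / t) - 1 * t) = a t * exp (- t) * (1 - exp (- (w / t)))"
      proof -
        have "exp (- (w / t) - 1 * t) = exp (- t) * exp (- (w / t))" by (simp add: exp_add[symmetric])
        then show ?thesis by (simp only: right_diff_distrib mult.assoc mult_1_right)
      qed
      also have "\<bar>\<dots>\<bar> = \<bar>a t\<bar> * exp (- t) * \<bar>1 - exp (- (w / t))\<bar>" by (simp add: abs_mult)
      also have "\<dots> \<le> \<bar>a t\<bar> * exp (- t) * sqrt (w / t)"
        using w True by (intro mult_left_mono one_minus_exp_le_sqrt) auto
      also have "sqrt (w / t) = sqrt w * t powr (- (1/2))"
        using True by (simp add: real_sqrt_divide powr_minus powr_half_sqrt inverse_eq_divide)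
      also have "\<bar>a t\<bar> * exp (- t) * (sqrt w * t powr (- (1/2))) = sqrt w * (\<bar>a t\<bar> * t powr (- (1/2)) * exp (- t))"
        by (simp only: mult_ac)
      finally show ?thesis using True by (simp only: indicator_simps greaterThan_iff mult_1_left real_norm_def)
    qed simp
  qed
  then show ?thesis by (simp only: Bochner_Integration.integral_diff[OF a aw] integral_mult_right_zero)
qed

text \<open>Replacing exp(- w/t) by 1 costs an error of order sqrt w, and this still beats the
  factor ln w in front of the index 0 integral in the formula for index 1.\<close>

lemma macdonald_integral_asymptotics:
  shows "((\<lambda>w. macdonald_integral 0 w 1 - 1) \<longlongrightarrow> 0) (at_right 0)"
    and "((\<lambda>w. macdonald_integral 1 w 1 + (ln w + 2 * euler_mascheroni)) \<longlongrightarrow> 0) (at_right 0)"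
proof -
  let ?G = "\<lambda>x t. indicator {0<..} t * (t powr (x - 1) * exp (- t)) :: real"
  define A where "A = (\<integral>t. indicator {0<..} t * (\<bar>1\<bar> * t powr (- (1/2)) * exp (- t)) \<partial>lborel :: real)"
  define B where "B = (\<integral>t. indicator {0<..} t * (\<bar>ln t\<bar> * t powr (- (1/2)) * exp (- t)) \<partial>lborel :: real)"
  have A: "\<bar>1 - macdonald_integral 0 w 1\<bar> \<le> sqrt w * A" if w: "w > 0" for w
  proof -
    have 1: "has_bochner_integral lborel (\<lambda>t. indicator {0<..} t * (1 * exp (- t))) (1::real)"
    proof -
      have eq: "?G 1 t = indicator {0<..} t * (1 * exp (- t))" for t by (simp add: indicator_def)
      show ?thesis using Gamma_has_bochner_integral[of 1] unfolding eq by simp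
    qed
    have 2: "indicator {0<..} t * (1 * exp (- (w / t) - 1 * t)) = indicator {0<..} t * (t powr (- 0) * exp (- (w / t) - 1 * t))" for t :: real
      by (simp add: indicator_def)
    have "\<bar>(\<integral>t. indicator {0<..} t * (1 * exp (- t)) \<partial>lborel) - (\<integral>t. indicator {0<..} t * (1 * exp (- (w / t) - 1 * t)) \<partial>lborel)\<bar> \<le> sqrt w * A"
      unfolding A_def
    proof (rule exp_perturbation_bound[OF w])
      show "integrable lborel (\<lambda>t. indicator {0<..} t * (1 * exp (- t)) :: real)" using 1 by (rule integrable.intros)
      show "integrable lborel (\<lambda>t. indicator {0<..} t * (1 * exp (- (w / t) - 1 * t)) :: real)"
        unfolding 2 using w by (intro powr_exp_half_line_integrable) auto
      show "integrable lborel (\<lambda>t. indicator {0<..} t * (\<bar>1\<bar> * t powr (- (1/2)) * exp (- t)) :: real)"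
        using integrable.intros[OF Gamma_has_bochner_integral[of "1/2"]] by simp
    qed
    then show ?thesis using has_bochner_integral_integral_eq[OF 1] unfolding 2 by (simp add: macdonald_integral_def)
  qed
  have B: "\<bar>- euler_mascheroni - log_integral w\<bar> \<le> sqrt w * B" if w: "w > 0" for w
  proof -
    have "\<bar>(\<integral>t. indicator {0<..} t * (ln t * exp (- t)) \<partial>lborel) - (\<integral>t. indicator {0<..} t * (ln t * exp (- (w / t) - 1 * t)) \<partial>lborel)\<bar> \<le> sqrt w * B"
      unfolding B_def
    proof (rule exp_perturbation_bound[OF w _ log_integral_integrable[OF w]])
      show "integrable lborel (\<lambda>t. indicator {0<..} t * (ln t * exp (- t)) :: real)"
        using has_bochner_integral_ln_exp by (rule integrable.intros)
      show "integrable lborel (\<lambda>t. indicator {0<..} t * (\<bar>ln t\<bar> * t powr (- (1/2)) * exp (- t)) :: real)"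
      proof (rule Bochner_Integration.integrable_bound[OF ln_majorant_integrable])
        show "AE t in lborel. norm (indicator {0<..} t * (\<bar>ln t\<bar> * t powr (- (1/2)) * exp (- t)) :: real) \<le> norm (ln_majorant t)"
        proof (rule AE_I2)
          fix t :: real
          show "norm (indicator {0<..} t * (\<bar>ln t\<bar> * t powr (- (1/2)) * exp (- t)) :: real) \<le> norm (ln_majorant t)"
          proof (cases "t > 0")
            case True
            have "\<bar>t powr (- (1/2))\<bar> \<le> t powr (- (1/2)) + t" using True by simp
            from ln_majorant_bound[OF True this] show ?thesis using True by (simp add: abs_mult)
          qed simp
        qed
      qed measurable
    qed
    then show ?thesis using has_bochner_integral_integral_eq[OF has_bochner_integral_ln_exp] by (simp add: log_integral_def)
  qed
  have ev: "eventually (\<lambda>w::real. w > 0) (at_right 0)" by (simp add: eventually_at_right_less)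
  show "((\<lambda>w. macdonald_integral 0 w 1 - 1) \<longlongrightarrow> 0) (at_right 0)"
  proof (rule Lim_null_comparison)
    show "eventually (\<lambda>w. norm (macdonald_integral 0 w 1 - 1) \<le> sqrt w * A) (at_right 0)"
      using ev by eventually_elim (use A in \<open>simp add: abs_minus_commute\<close>)
    show "((\<lambda>w. sqrt w * A) \<longlongrightarrow> 0) (at_right 0)" by (auto intro!: tendsto_eq_intros)
  qed
  show "((\<lambda>w. macdonald_integral 1 w 1 + (ln w + 2 * euler_mascheroni)) \<longlongrightarrow> 0) (at_right 0)"
  proof (rule Lim_null_comparison)
    show "eventually (\<lambda>w. norm (macdonald_integral 1 w 1 + (ln w + 2 * euler_mascheroni)) \<le> sqrt w * (2 * B) + \<bar>ln w\<bar> * (sqrt w * A)) (at_right 0)"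
      using ev
    proof eventually_elim
      case (elim w)
      have tri: "\<bar>x - 2 * y\<bar> \<le> \<bar>x\<bar> + 2 * \<bar>y\<bar>" for x y :: real by linarith
      have "macdonald_integral 1 w 1 + (ln w + 2 * euler_mascheroni) = ln w * (1 - macdonald_integral 0 w 1) - 2 * (- euler_mascheroni - log_integral w)"
        by (simp add: macdonald_integral_one_log_integral[OF elim] algebra_simps)
      also have "\<bar>\<dots>\<bar> \<le> \<bar>ln w\<bar> * \<bar>1 - macdonald_integral 0 w 1\<bar> + 2 * \<bar>- euler_mascheroni - log_integral w\<bar>"
        unfolding abs_mult[symmetric] by (rule tri)
      also have "\<dots> \<le> \<bar>ln w\<bar> * (sqrt w * A) + 2 * (sqrt w * B)"
        by (intro add_mono mult_left_mono A B elim) auto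
      finally show ?case by simp
    qed
    have "((\<lambda>w::real. \<bar>ln w\<bar> * sqrt w) \<longlongrightarrow> 0) (at_right 0)" by real_asymp
    moreover have "(sqrt \<longlongrightarrow> 0) (at_right 0)" by real_asymp
    ultimately have "((\<lambda>w. sqrt w * (2 * B) + \<bar>ln w\<bar> * sqrt w * A) \<longlongrightarrow> 0 * (2 * B) + 0 * A) (at_right 0)"
      by (intro tendsto_add tendsto_mult_right)
    then show "((\<lambda>w. sqrt w * (2 * B) + \<bar>ln w\<bar> * (sqrt w * A)) \<longlongrightarrow> 0) (at_right 0)"
      by (simp only: mult.assoc) simp
  qed
qed

section \<open>The ascending series\<close>

text \<open>The series of I_0(2 sqrt z) and, with harmonic numbers as weights, the series that
  accompanies the logarithm in the expansion of K_0(2 sqrt z).\<close>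

definition bessel_I_fps :: "'a::{banach, real_normed_field} fps" where "bessel_I_fps = Abs_fps (\<lambda>j. 1 / (fact j)\<^sup>2)"
definition bessel_S_fps :: "'a::{banach, real_normed_field} fps" where "bessel_S_fps = Abs_fps (\<lambda>j. harm j / (fact j)\<^sup>2)"

text \<open>A crude bound that already makes the coefficients at most those of the exponential
  series.\<close>

lemma norm_harm_le: "norm (harm j :: 'a::real_normed_field) \<le> fact j"
proof -
  have "norm (harm j :: 'a) = harm j" using norm_of_real[of "harm j", where 'a = 'a] harm_nonneg[of j, where 'a = real] by (simp add: of_real_harm)
  also have "harm j \<le> (fact j :: real)"
  proof (induction j)
    case (Suc j)
    have "inverse (real (Suc j)) \<le> 1" by (simp add: inverse_le_1_iff)
    moreover have "1 \<le> real j * fact j" if "j > 0" 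
      using mult_mono[of 1 "real j" 1 "fact j"] that fact_ge_1[of j, where 'a = real] by simp
    ultimately have "harm j + inverse (real (Suc j)) \<le> fact j + real j * fact j"
      using Suc by (cases "j > 0") (auto simp: harm_expand)
    then show ?case by (simp add: harm_Suc algebra_simps)
  qed (simp add: harm_expand)
  finally show ?thesis .
qed

lemma conv_radius_bessel_series [simp]:
  "fps_conv_radius (bessel_I_fps :: 'a::{banach, real_normed_field} fps) = \<infinity>" "fps_conv_radius (bessel_S_fps :: 'a fps) = \<infinity>"
proof -
  have *: "conv_radius (\<lambda>j. c j / (fact j)\<^sup>2) = \<infinity>" if c: "\<And>j. norm (c j) \<le> fact j" for c :: "nat \<Rightarrow> 'a"
  proof (rule conv_radius_inftyI'')
    fix z :: 'a
    show "summable (\<lambda>n. c n / (fact n)\<^sup>2 * z ^ n)"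
    proof (rule summable_comparison_test')
      show "summable (\<lambda>n. inverse (fact n) * norm z ^ n)" by (rule summable_exp)
      fix n
      have "norm (c n) / (fact n)\<^sup>2 * norm z ^ n \<le> fact n / (fact n)\<^sup>2 * norm z ^ n"
        by (intro mult_right_mono divide_right_mono c) auto
      then show "norm (c n / (fact n)\<^sup>2 * z ^ n) \<le> inverse (fact n) * norm z ^ n"
        by (simp add: norm_mult norm_divide norm_power power2_eq_square inverse_eq_divide)
    qed
  qed
  show "fps_conv_radius (bessel_I_fps :: 'a fps) = \<infinity>" "fps_conv_radius (bessel_S_fps :: 'a fps) = \<infinity>"
    unfolding fps_conv_radius_def bessel_I_fps_def bessel_S_fps_def using *[of "\<lambda>_. 1"] *[of harm, OF norm_harm_le]
    by (simp_all add: fps_nth_Abs_fps fact_ge_1)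
qed

lemma conv_radius_bessel_deriv [simp]:
  "fps_conv_radius (fps_deriv (bessel_I_fps :: 'a::{banach, real_normed_field} fps)) = \<infinity>" "fps_conv_radius (fps_deriv (bessel_S_fps :: 'a fps)) = \<infinity>"
  using fps_conv_radius_deriv[of "bessel_I_fps :: 'a fps"] fps_conv_radius_deriv[of "bessel_S_fps :: 'a fps"] by simp_all

text \<open>On coefficients F \<mapsto> (X F')' multiplies by n^2 and shifts, which cancels one step
  of the squared factorial; in the second series the increment of the harmonic number leaves the
  derivative of the first as an extra term.\<close>

lemma bessel_fps_ode:
  "fps_deriv (fps_X * fps_deriv bessel_I_fps) = (bessel_I_fps :: 'a::{banach, real_normed_field} fps)"
  "fps_deriv (fps_X * fps_deriv bessel_S_fps) = (bessel_S_fps + fps_deriv bessel_I_fps :: 'a fps)"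
proof -
  have k: "of_nat (Suc n) * (of_nat (Suc n) * (c / (fact (Suc n))\<^sup>2)) = c / (fact n)\<^sup>2" for c :: 'a and n
    by (simp add: power_mult_distrib power2_eq_square del: of_nat_Suc)
  have l: "of_nat (Suc n) * (1 / (fact (Suc n))\<^sup>2) = inverse (of_nat (Suc n)) / (fact n :: 'a)\<^sup>2" for n
    by (simp add: power_mult_distrib power2_eq_square inverse_eq_divide del: of_nat_Suc)
  have n: "fps_deriv (fps_X * fps_deriv F) $ n = of_nat (Suc n) * (of_nat (Suc n) * F $ Suc n)" for F :: "'a fps" and n
    by (simp add: fps_X_mult_nth del: of_nat_Suc fps_deriv_mult)
  show "fps_deriv (fps_X * fps_deriv bessel_I_fps) = (bessel_I_fps :: 'a fps)"
    by (rule fps_ext) (simp only: n bessel_I_fps_def fps_nth_Abs_fps k)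
  show "fps_deriv (fps_X * fps_deriv bessel_S_fps) = (bessel_S_fps + fps_deriv bessel_I_fps :: 'a fps)"
  proof (rule fps_ext)
    fix i
    have "fps_deriv bessel_I_fps $ i = of_nat (Suc i) * (1 / (fact (Suc i))\<^sup>2 :: 'a)" by (simp add: bessel_I_fps_def del: of_nat_Suc fact_Suc)
    then show "fps_deriv (fps_X * fps_deriv bessel_S_fps) $ i = (bessel_S_fps + fps_deriv bessel_I_fps :: 'a fps) $ i"
      by (simp only: n bessel_S_fps_def fps_nth_Abs_fps k l fps_add_nth harm_Suc) (simp only: add_divide_distrib)
  qed
qed

lemma bessel_series_derivative:
  fixes z :: "'a::{banach, real_normed_field}"
  shows "(eval_fps bessel_I_fps has_field_derivative eval_fps (fps_deriv bessel_I_fps) z) (at z within A)"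
    and "(eval_fps bessel_S_fps has_field_derivative eval_fps (fps_deriv bessel_S_fps) z) (at z within A)"
    and "((\<lambda>z. z * eval_fps (fps_deriv bessel_I_fps) z) has_field_derivative eval_fps bessel_I_fps z) (at z within A)"
    and "((\<lambda>z. z * eval_fps (fps_deriv bessel_S_fps) z) has_field_derivative eval_fps bessel_S_fps z + eval_fps (fps_deriv bessel_I_fps) z) (at z within A)"
proof -
  show "(eval_fps bessel_I_fps has_field_derivative eval_fps (fps_deriv bessel_I_fps) z) (at z within A)"
    "(eval_fps bessel_S_fps has_field_derivative eval_fps (fps_deriv bessel_S_fps) z) (at z within A)"
    by (rule has_field_derivative_eval_fps, simp)+
  have X: "fps_conv_radius (fps_X * fps_deriv F) = \<infinity>" "eval_fps (fps_X * fps_deriv F) = (\<lambda>z. z * eval_fps (fps_deriv F) z)"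
    if "fps_conv_radius (fps_deriv F) = \<infinity>" for F :: "'a fps"
    using fps_conv_radius_mult[of fps_X "fps_deriv F"] that by (auto simp: eval_fps_mult fun_eq_iff)
  show "((\<lambda>z. z * eval_fps (fps_deriv bessel_I_fps) z) has_field_derivative eval_fps bessel_I_fps z) (at z within A)"
    using has_field_derivative_eval_fps[of z "fps_X * fps_deriv bessel_I_fps" A] by (simp add: X bessel_fps_ode del: fps_deriv_mult)
  show "((\<lambda>z. z * eval_fps (fps_deriv bessel_S_fps) z) has_field_derivative eval_fps bessel_S_fps z + eval_fps (fps_deriv bessel_I_fps) z) (at z within A)"
    using has_field_derivative_eval_fps[of z "fps_X * fps_deriv bessel_S_fps" A] by (simp add: X bessel_fps_ode eval_fps_add del: fps_deriv_mult)
qed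

text \<open>All terms are nonnegative and the first is 1; this permits division by the regular
  solution.\<close>

lemma bessel_I_pos: assumes "w \<ge> 0" shows "eval_fps bessel_I_fps w > (0::real)"
proof -
  have s: "summable (\<lambda>n. fps_nth bessel_I_fps n * w ^ n :: real)" by (rule summable_fps) simp
  have "(\<Sum>n\<in>{0}. fps_nth bessel_I_fps n * w ^ n :: real) \<le> eval_fps bessel_I_fps w"
    unfolding eval_fps_def by (rule sum_le_suminf[OF s]) (use assms in \<open>auto simp: bessel_I_fps_def\<close>)
  then show ?thesis by (simp add: bessel_I_fps_def)
qed

text \<open>Both sides solve \<open>(w f')' = f\<close> on the half line; their difference has Wronskian 0 with the
  regular solution \<open>bessel_I_fps\<close>, hence is a multiple of it, and it vanishes at 0.\<close>

lemma macdonald_integral_one_series: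
  assumes w0: "w0 > 0"
  shows "macdonald_integral 1 w0 1 = - (ln w0 + 2 * euler_mascheroni) * eval_fps bessel_I_fps w0 + 2 * eval_fps bessel_S_fps w0"
proof -
  let ?I = "eval_fps bessel_I_fps :: real \<Rightarrow> real" and ?S = "eval_fps bessel_S_fps :: real \<Rightarrow> real"
  let ?I' = "eval_fps (fps_deriv bessel_I_fps) :: real \<Rightarrow> real" and ?S' = "eval_fps (fps_deriv bessel_S_fps) :: real \<Rightarrow> real"
  let ?l = "\<lambda>w. ln w + 2 * euler_mascheroni :: real"
  \<comment> \<open>\<open>u\<close> is the difference of the two sides and \<open>v\<close> turns
    out to be w u', so the second-order equation becomes the system u' = v / w, v' = u.\<close>
  define u where "u w = macdonald_integral 1 w 1 + ?l w * ?I w - 2 * ?S w" for w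
  define v where "v w = - macdonald_integral 0 w 1 + ?I w + ?l w * (w * ?I' w) - 2 * (w * ?S' w)" for w
  note d = bessel_series_derivative[where 'a = real]
  have Du: "(u has_real_derivative v w / w) (at w)" if w: "w > 0" for w
  proof -
    have J: "((\<lambda>w. macdonald_integral 1 w 1) has_real_derivative - macdonald_integral 2 w 1) (at w)" using macdonald_integral_has_derivative[OF w, of 1 1] by simp
    have "(u has_real_derivative - macdonald_integral 2 w 1 + (1 / w * ?I w + ?l w * ?I' w) - 2 * ?S' w) (at w)"
      unfolding u_def by (auto intro!: derivative_eq_intros J d simp: w)
    also have "- macdonald_integral 2 w 1 + (1 / w * ?I w + ?l w * ?I' w) - 2 * ?S' w = v w / w"
      using w macdonald_integral_two_zero[OF w, symmetric] by (simp add: v_def field_simps)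
    finally show ?thesis .
  qed
  have Dv: "(v has_real_derivative u w) (at w)" if w: "w > 0" for w
  proof -
    have J: "((\<lambda>w. macdonald_integral 0 w 1) has_real_derivative - macdonald_integral 1 w 1) (at w)" using macdonald_integral_has_derivative[OF w, of 1 0] by simp
    have "(v has_real_derivative - (- macdonald_integral 1 w 1) + ?I' w + (?l w * ?I w + (1 / w + 0) * (w * ?I' w)) - 2 * (?S w + ?I' w)) (at w)"
      unfolding v_def by (intro d J DERIV_diff DERIV_add DERIV_minus DERIV_cmult DERIV_mult' DERIV_ln_divide DERIV_const w)
    also have "- (- macdonald_integral 1 w 1) + ?I' w + (?l w * ?I w + (1 / w + 0) * (w * ?I' w)) - 2 * (?S w + ?I' w) = u w"
      using w by (simp add: u_def)
    finally show ?thesis .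
  qed
  have cI: "(?I \<longlongrightarrow> 1) (at_right 0)" and cS: "(?S \<longlongrightarrow> 0) (at_right 0)"
    and cI': "(?I' \<longlongrightarrow> ?I' 0) (at_right 0)" and cS': "(?S' \<longlongrightarrow> ?S' 0) (at_right 0)"
  proof -
    have e0: "?I 0 = 1" "?S 0 = 0" by (simp_all add: eval_fps_at_0 bessel_I_fps_def bessel_S_fps_def harm_expand)
    have c: "(eval_fps F \<longlongrightarrow> eval_fps F 0) (at_right 0)" if "fps_conv_radius F = \<infinity>" for F :: "real fps"
      using continuous_on_eval_fps[of F] that by (simp add: continuous_on_eq_continuous_within continuous_within tendsto_within_subset[of _ _ 0 UNIV])
    show "(?I \<longlongrightarrow> 1) (at_right 0)" "(?S \<longlongrightarrow> 0) (at_right 0)" "(?I' \<longlongrightarrow> ?I' 0) (at_right 0)" "(?S' \<longlongrightarrow> ?S' 0) (at_right 0)"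
      using c[OF conv_radius_bessel_series(1)] c[OF conv_radius_bessel_series(2)] c[OF conv_radius_bessel_deriv(1)] c[OF conv_radius_bessel_deriv(2)]
      by (simp_all only: e0)
  qed
  have wl: "((\<lambda>w. w * ?l w) \<longlongrightarrow> 0) (at_right 0)" by real_asymp
  have w0lim: "((\<lambda>w::real. w) \<longlongrightarrow> 0) (at_right 0)" by (rule tendsto_ident_at)
  \<comment> \<open>The logarithm is compensated because the series minus 1 vanishes to first order
    at 0.\<close>
  have qI: "((\<lambda>w. ?l w * (?I w - 1)) \<longlongrightarrow> 0) (at_right 0)"
  proof -
    have "(?I has_real_derivative ?I' 0) (at 0 within {0<..})" by (rule d)
    then have "((\<lambda>w. (?I w - ?I 0) / (w - 0)) \<longlongrightarrow> ?I' 0) (at_right 0)" by (simp add: has_field_derivative_iff)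
    from tendsto_mult[OF wl this]
    have "((\<lambda>w. w * ?l w * ((?I w - ?I 0) / (w - 0))) \<longlongrightarrow> 0) (at_right 0)" by simp
    then show ?thesis
    proof (rule Lim_transform_eventually)
      show "eventually (\<lambda>w. w * ?l w * ((?I w - ?I 0) / (w - 0)) = ?l w * (?I w - 1)) (at_right 0)"
        using eventually_at_right_less[of 0] by eventually_elim (simp add: eval_fps_at_0 bessel_I_fps_def)
    qed
  qed
  have u0: "(u \<longlongrightarrow> 0) (at_right 0)"
  proof -
    have "((\<lambda>w. (macdonald_integral 1 w 1 + ?l w) + ?l w * (?I w - 1) - 2 * ?S w) \<longlongrightarrow> 0 + 0 - 2 * 0) (at_right 0)"
      by (intro tendsto_intros macdonald_integral_asymptotics(2) qI cS)
    then show ?thesis unfolding u_def by (simp add: algebra_simps)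
  qed
  have v0: "(v \<longlongrightarrow> 0) (at_right 0)"
  proof -
    have "((\<lambda>w. - (macdonald_integral 0 w 1 - 1) + (?I w - 1) + w * ?l w * ?I' w - 2 * (w * ?S' w)) \<longlongrightarrow> - 0 + (1 - 1) + 0 * ?I' 0 - 2 * (0 * ?S' 0)) (at_right 0)"
      by (intro tendsto_diff tendsto_add tendsto_minus tendsto_mult tendsto_const macdonald_integral_asymptotics(1) wl cI cI' cS' w0lim)
    then show ?thesis unfolding v_def by (simp add: algebra_simps)
  qed
  \<comment> \<open>Applied first to the Wronskian of \<open>u\<close> with the regular solution,
    then to their quotient.\<close>
  have const0: "f w = 0" if D: "\<And>w. w > 0 \<Longrightarrow> (f has_real_derivative 0) (at w)" and l: "(f \<longlongrightarrow> 0) (at_right 0)" and w: "w > 0" for f and w :: real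
  proof -
    have "\<exists>c. \<forall>w\<in>{0<..}. f w = c"
      by (rule has_field_derivative_zero_constant) (use D in \<open>auto intro: DERIV_subset\<close>)
    then obtain c where c: "\<And>w. w \<in> {0<..} \<Longrightarrow> f w = c" by blast
    have "eventually (\<lambda>w. c = f w) (at_right 0)"
      using eventually_at_right_less[of "0::real"] by eventually_elim (simp add: c)
    from Lim_transform_eventually[OF tendsto_const this] have "(f \<longlongrightarrow> c) (at_right 0)" .
    then have "c = 0" using l tendsto_unique[of "at_right (0::real)"] by auto
    then show ?thesis using c w by simp
  qed
  have Q: "v w * ?I w - u w * (w * ?I' w) = 0" if "w > 0" for w
  proof (rule const0[OF _ _ that, of "\<lambda>w. v w * ?I w - u w * (w * ?I' w)"])
    fix w :: real assume w: "w > 0"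
    have "((\<lambda>w. v w * ?I w - u w * (w * ?I' w)) has_real_derivative (v w * ?I' w + u w * ?I w) - (u w * ?I w + v w / w * (w * ?I' w))) (at w)"
      by (intro DERIV_diff DERIV_mult' Du Dv w d)
    then show "((\<lambda>w. v w * ?I w - u w * (w * ?I' w)) has_real_derivative 0) (at w)" using w by simp
  next
    have "((\<lambda>w. v w * ?I w - u w * (w * ?I' w)) \<longlongrightarrow> 0 * 1 - 0 * (0 * ?I' 0)) (at_right 0)"
      by (intro tendsto_diff tendsto_mult v0 u0 cI cI' w0lim)
    then show "((\<lambda>w. v w * ?I w - u w * (w * ?I' w)) \<longlongrightarrow> 0) (at_right 0)" by simp
  qed
  have "u w0 / ?I w0 = 0"
  proof (rule const0[OF _ _ w0, of "\<lambda>w. u w / ?I w"])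
    fix w :: real assume w: "w > 0"
    have nz: "?I w \<noteq> 0" using bessel_I_pos[of w] w by simp
    have "((\<lambda>w. u w / ?I w) has_real_derivative (v w / w * ?I w - u w * ?I' w) / (?I w * ?I w)) (at w)"
      by (intro DERIV_divide Du w d nz)
    moreover have "v w / w * ?I w - u w * ?I' w = 0" using Q[OF w] w by (simp add: field_simps)
    ultimately show "((\<lambda>w. u w / ?I w) has_real_derivative 0) (at w)" by simp
  next
    have "((\<lambda>w. u w / ?I w) \<longlongrightarrow> 0 / 1) (at_right 0)" by (intro tendsto_divide u0 cI) simp
    then show "((\<lambda>w. u w / ?I w) \<longlongrightarrow> 0) (at_right 0)" by simp
  qed
  then have "u w0 = 0" using bessel_I_pos[of w0] w0 by simp
  then show ?thesis by (simp add: u_def algebra_simps)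
qed

section \<open>The double layer potential in two dimensions\<close>

text \<open>K_0(\<kappa> sqrt \<rho>) / (2 pi), with the logarithm split so that
  \<open>Ln \<kappa>\<close> carries all of the branching in \<kappa> and the remaining logarithm is
  that of the positive number \<rho>.\<close>

definition potential2 :: "complex \<Rightarrow> real \<Rightarrow> complex" where
  "potential2 \<kappa> \<rho> = of_real (1 / (2 * pi)) * (eval_fps bessel_S_fps (\<kappa>\<^sup>2 * (of_real \<rho> / 4))
     - (Ln \<kappa> + of_real (ln \<rho> / 2 - ln 2 + euler_mascheroni)) * eval_fps bessel_I_fps (\<kappa>\<^sup>2 * (of_real \<rho> / 4)))"

text \<open>The derivative of \<open>potential2\<close> in \<rho>, in the unsimplified form produced
  by the rules of differentiation.\<close>

definition kernel2 :: "complex \<Rightarrow> real \<Rightarrow> complex" where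
  "kernel2 \<kappa> \<rho> = of_real (1 / (2 * pi)) * (eval_fps (fps_deriv bessel_S_fps) (\<kappa>\<^sup>2 * (of_real \<rho> / 4)) * (\<kappa>\<^sup>2 * (1 / 4))
     - ((Ln \<kappa> + of_real (ln \<rho> / 2 - ln 2 + euler_mascheroni)) * (eval_fps (fps_deriv bessel_I_fps) (\<kappa>\<^sup>2 * (of_real \<rho> / 4)) * (\<kappa>\<^sup>2 * (1 / 4)))
       + of_real (1 / (2 * \<rho>)) * eval_fps bessel_I_fps (\<kappa>\<^sup>2 * (of_real \<rho> / 4))))"

lemma potential2_derivative:
  assumes \<rho>: "\<rho> > 0" shows "(potential2 \<kappa> has_vector_derivative kernel2 \<kappa> \<rho>) (at \<rho>)"
proof -
  have e: "((\<lambda>\<rho>. eval_fps F (\<kappa>\<^sup>2 * (of_real \<rho> / 4))) has_vector_derivative eval_fps (fps_deriv F) (\<kappa>\<^sup>2 * (of_real \<rho> / 4)) * (\<kappa>\<^sup>2 * (1 / 4))) (at \<rho>)"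
    if "fps_conv_radius F = \<infinity>" for F :: "complex fps"
  proof (rule has_vector_derivative_real_field)
    show "((\<lambda>z. eval_fps F (\<kappa>\<^sup>2 * (z / 4))) has_field_derivative eval_fps (fps_deriv F) (\<kappa>\<^sup>2 * (of_real \<rho> / 4)) * (\<kappa>\<^sup>2 * (1 / 4))) (at (of_real \<rho>))"
      by (rule DERIV_chain2[OF has_field_derivative_eval_fps DERIV_cmult[OF DERIV_cdivide[OF DERIV_ident]]]) (simp add: that)
  qed
  have "((\<lambda>\<rho>. ln \<rho> / 2 - ln 2 + euler_mascheroni) has_real_derivative 1 / (2 * \<rho>)) (at \<rho>)"
    using \<rho> by (auto intro!: derivative_eq_intros)
  from has_vector_derivative_add[OF has_vector_derivative_const[of "Ln \<kappa>"] has_vector_derivative_of_real[OF this]]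
  have l: "((\<lambda>\<rho>. Ln \<kappa> + of_real (ln \<rho> / 2 - ln 2 + euler_mascheroni)) has_vector_derivative complex_of_real (1 / (2 * \<rho>))) (at \<rho>)"
    by (simp only: add_0_left)
  show ?thesis
    unfolding potential2_def[abs_def] kernel2_def
    by (intro has_vector_derivative_mult_right has_vector_derivative_diff e has_vector_derivative_mult l) simp_all
qed

lemma eval_fps_bessel_of_real:
  "eval_fps bessel_I_fps (of_real x) = (of_real (eval_fps bessel_I_fps x) :: complex)"
  "eval_fps bessel_S_fps (of_real x) = (of_real (eval_fps bessel_S_fps x) :: complex)"
proof -
  have *: "eval_fps F (of_real x) = (of_real (eval_fps G x) :: complex)"
    if F: "\<And>n. F $ n = of_real (G $ n)" and G: "fps_conv_radius G = \<infinity>" for F :: "complex fps" and G :: "real fps"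
  proof -
    have "summable (\<lambda>n. G $ n * x ^ n)" by (rule summable_fps) (simp add: G)
    then have "of_real (\<Sum>n. G $ n * x ^ n) = (\<Sum>n. of_real (G $ n * x ^ n) :: complex)" by (rule suminf_of_real)
    then show ?thesis unfolding eval_fps_def F by simp
  qed
  show "eval_fps bessel_I_fps (of_real x) = (of_real (eval_fps bessel_I_fps x) :: complex)" by (rule *[OF _ conv_radius_bessel_series(1)]) (simp add: bessel_I_fps_def)
  show "eval_fps bessel_S_fps (of_real x) = (of_real (eval_fps bessel_S_fps x) :: complex)"
    by (rule *[OF _ conv_radius_bessel_series(2)]) (simp add: bessel_S_fps_def of_real_harm)
qed

text \<open>For positive \<kappa> the potential is the Macdonald integral of index 1 up to a
  constant; differentiating both in \<rho> identifies the kernel with index 2.\<close>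

lemma kernel2_value:
  assumes \<kappa>: "\<kappa> > 0" and \<rho>: "\<rho> > 0"
  shows "kernel2 (of_real \<kappa>) \<rho> = - of_real (1 / (16 * pi) * macdonald_integral 2 (\<rho> / 4) (\<kappa>\<^sup>2))"
proof -
  have v: "potential2 (of_real \<kappa>) r = of_real (1 / (4 * pi) * macdonald_integral 1 (r / 4) (\<kappa>\<^sup>2))" if r: "r > 0" for r
  proof -
    let ?w = "\<kappa>\<^sup>2 * (r / 4)"
    have w: "?w > 0" using \<kappa> r by simp
    have c: "(of_real \<kappa>)\<^sup>2 * (of_real r / 4) = complex_of_real ?w" by simp
    have "ln ?w = 2 * ln \<kappa> + ln r - 2 * ln 2"
    proof -
      have "ln (4::real) = 2 * ln 2" using ln_realpow[of 2 2] by simp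
      then show ?thesis using \<kappa> r by (simp add: ln_mult ln_div ln_realpow)
    qed
    moreover have "macdonald_integral 1 (r / 4) (\<kappa>\<^sup>2) = - (ln ?w + 2 * euler_mascheroni) * eval_fps bessel_I_fps ?w + 2 * eval_fps bessel_S_fps ?w"
      using macdonald_integral_scale[of "r / 4" "\<kappa>\<^sup>2"] macdonald_integral_one_series[OF w] \<kappa> r by simp
    ultimately have J: "1 / (4 * pi) * macdonald_integral 1 (r / 4) (\<kappa>\<^sup>2) = 1 / (2 * pi) * (eval_fps bessel_S_fps ?w - (ln \<kappa> + (ln r / 2 - ln 2 + euler_mascheroni)) * eval_fps bessel_I_fps ?w)"
      by (simp only:) (simp add: field_simps)
    show ?thesis
      unfolding J potential2_def c eval_fps_bessel_of_real Ln_of_real[OF \<kappa>] by simp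
  qed
  have "((\<lambda>\<rho>. 1 / (4 * pi) * macdonald_integral 1 (\<rho> / 4) (\<kappa>\<^sup>2)) has_real_derivative 1 / (4 * pi) * (- macdonald_integral (1 + 1) (\<rho> / 4) (\<kappa>\<^sup>2) * (1 / 4))) (at \<rho>)"
    by (intro DERIV_cmult DERIV_chain2[OF macdonald_integral_has_derivative] DERIV_cdivide DERIV_ident) (use \<kappa> \<rho> in auto)
  from has_vector_derivative_of_real[OF this]
  have d: "((\<lambda>\<rho>. complex_of_real (1 / (4 * pi) * macdonald_integral 1 (\<rho> / 4) (\<kappa>\<^sup>2))) has_vector_derivative of_real (1 / (4 * pi) * (- macdonald_integral (1 + 1) (\<rho> / 4) (\<kappa>\<^sup>2) * (1 / 4)))) (at \<rho>)" .
  have "(potential2 (of_real \<kappa>) has_vector_derivative of_real (1 / (4 * pi) * (- macdonald_integral (1 + 1) (\<rho> / 4) (\<kappa>\<^sup>2) * (1 / 4)))) (at \<rho>)"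
    by (rule has_vector_derivative_transform_within_open[OF d, of "{0<..}"]) (use v \<rho> in auto)
  from vector_derivative_unique_at[OF potential2_derivative[OF \<rho>] this]
  show ?thesis by simp
qed

lemma kernel2_holomorphic: "\<rho> > 0 \<Longrightarrow> (\<lambda>\<kappa>. kernel2 \<kappa> \<rho>) holomorphic_on (- \<real>\<^sub>\<le>\<^sub>0)"
proof -
  have e: "(\<lambda>\<kappa>. eval_fps F (\<kappa>\<^sup>2 * (of_real \<rho> / 4))) holomorphic_on A" if "fps_conv_radius F = \<infinity>" for F :: "complex fps" and A
  proof -
    have "eval_fps F \<circ> (\<lambda>\<kappa>. \<kappa>\<^sup>2 * (of_real \<rho> / 4)) holomorphic_on A"
      by (rule holomorphic_on_compose_gen[where t = UNIV]) (auto intro!: holomorphic_intros simp: that)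
    then show ?thesis by (simp add: o_def)
  qed
  show ?thesis unfolding kernel2_def by (intro holomorphic_intros e) auto
qed

lemma kernel2_continuous: "continuous_on ((- \<real>\<^sub>\<le>\<^sub>0) \<times> {0<..}) (\<lambda>z. kernel2 (fst z) (snd z))"
  unfolding kernel2_def by (intro continuous_intros) auto

text \<open>K_0(- i z) = (i pi / 2) H_0^(1)(z), read off from the series: squaring - i k turns I_0
  into J_0, and the imaginary part - pi/2 of Ln(- i k) supplies the J_0 term of the Hankel
  function.\<close>

lemma potential2_fund_sol:
  assumes k: "k > 0" and r: "r > 0"
  shows "potential2 (- \<i> * of_real k) (r\<^sup>2) = \<i> / 4 * hankel1_0 (k * r)"
proof -
  let ?z = "k * r" and ?w = "- ((k * r)\<^sup>2 / 4)"
  have w: "(- \<i> * of_real k)\<^sup>2 * (of_real (r\<^sup>2) / 4) = complex_of_real ?w" by (simp add: power_mult_distrib)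
  have J0: "bessel_J0 ?z = eval_fps bessel_I_fps ?w"
    unfolding bessel_J0_def eval_fps_def bessel_I_fps_def
    by (intro suminf_cong) (simp add: power_minus[of "(k * r)\<^sup>2 / 4"] del: power_divide)
  have S0: "(\<Sum>j. (- 1) ^ (j + 1) * harm j * (?z\<^sup>2 / 4) ^ j / (fact j)\<^sup>2) = - eval_fps bessel_S_fps ?w"
  proof -
    have s: "summable (\<lambda>j. bessel_S_fps $ j * ?w ^ j)" by (rule summable_fps) simp
    have "(- 1) ^ (j + 1) * harm j * (?z\<^sup>2 / 4) ^ j / (fact j)\<^sup>2 = - (bessel_S_fps $ j * ?w ^ j)" for j
      unfolding bessel_S_fps_def by (simp add: power_minus[of "(k * r)\<^sup>2 / 4"])
    then show ?thesis unfolding eval_fps_def by (simp only: suminf_minus[OF s])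
  qed
  have ln: "ln (?z / 2) + euler_mascheroni = ln k + (ln r - ln 2 + euler_mascheroni)" using k r by (simp add: ln_mult ln_div)
  have Y0: "bessel_Y0 ?z = 2 / pi * ((ln k + (ln r - ln 2 + euler_mascheroni)) * eval_fps bessel_I_fps ?w - eval_fps bessel_S_fps ?w)"
  proof -
    have "c * x * a + c * - b = c * (x * a - b)" for a b c x :: real by (simp add: right_diff_distrib)
    then show ?thesis unfolding bessel_Y0_def S0 J0 ln .
  qed
  have L: "Ln (- \<i> * of_real k) = Complex (ln k) (- pi / 2)"
  proof -
    have "Ln (of_real k * - \<i>) = of_real (ln k) + Ln (- \<i>)" using Ln_times_of_real[OF k, of "- \<i>"] k by (simp add: Ln_of_real)
    then show ?thesis by (simp add: mult.commute complex_eq_iff)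
  qed
  have lr: "ln (r\<^sup>2) / 2 = ln r" using r by (simp add: ln_realpow)
  have "of_real (1 / (2 * p)) * (of_real b - (Complex l (- p / 2) + of_real c) * of_real a) = \<i> / 4 * Complex a (2 / p * ((l + c) * a - b))"
    if "p > 0" for a b c l p :: real
    using that by (simp add: complex_eq_iff field_simps)
  from this[OF pi_gt_zero] show ?thesis
    unfolding potential2_def w eval_fps_bessel_of_real L lr hankel1_0_def J0 Y0 .
qed

lemma double_layer_2d:
  fixes \<phi> :: "real \<Rightarrow> complex"
  assumes \<phi>: "\<phi> \<in> test_functions \<Omega>" and h: "h > 0" and k: "k > 0"
  shows "double_layer k \<Omega> \<phi> (x, h) = layer_transform k \<phi> x h"
proof (rule double_layer_eq[OF kernel2_holomorphic kernel2_continuous _ _ _ \<phi> h k])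
  show "kernel2 (of_real \<kappa>) \<rho> = - of_real (1 / 4 * (4 * pi) powr (- (real DIM(real) + 1) / 2) * macdonald_integral ((real DIM(real) + 3) / 2) (\<rho> / 4) (\<kappa>\<^sup>2))"
    if "\<kappa> > 0" "\<rho> > 0" for \<kappa> \<rho>
    using kernel2_value[OF that] by (simp add: powr_minus inverse_eq_divide)
  show "fund_sol k X Y = potential2 (- \<i> * of_real k) ((dist X Y)\<^sup>2)" if "X \<noteq> Y" for X Y :: "real \<times> real"
  proof -
    have "dist X Y > 0" using that by simp
    from potential2_fund_sol[OF k this] show ?thesis by (simp add: fund_sol_def)
  qed
  show "(potential2 (- \<i> * of_real k) has_vector_derivative kernel2 (- \<i> * of_real k) \<rho>) (at \<rho>)" if "\<rho> > 0" for \<rho>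
    by (rule potential2_derivative[OF that])
qed

section \<open>Coercivity\<close>

text \<open>Relative openness allows a step of length e / 2 along a coordinate direction of the
  hyperplane without leaving \<Gamma>.\<close>

lemma screen_diameter_pos:
  fixes \<Gamma> :: "('a::euclidean_space \<times> real) set"
  assumes \<Gamma>: "bounded \<Gamma>" "\<Gamma> \<noteq> {}" "openin (top_of_set Gamma_inf) \<Gamma>"
  shows "diameter \<Gamma> > 0"
proof -
  obtain p where p: "p \<in> \<Gamma>" using \<Gamma> by blast
  have G: "\<Gamma> \<subseteq> Gamma_inf" using openin_imp_subset[OF \<Gamma>(3)] .
  obtain e where e: "e > 0" "\<And>y. y \<in> Gamma_inf \<Longrightarrow> dist y p < e \<Longrightarrow> y \<in> \<Gamma>"
    using \<Gamma>(3) p unfolding openin_euclidean_subtopology_iff by blast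
  obtain b :: 'a where b: "b \<in> Basis" using nonempty_Basis by blast
  define q where "q = (fst p + (e / 2) *\<^sub>R b, 0 :: real)"
  have "snd p = 0" using p G by (auto simp: Gamma_inf_def)
  then have d: "dist q p = e / 2"
    unfolding q_def using b e(1) by (simp add: dist_prod_def dist_norm[of "_ + _"] dist_real_def)
  have "q \<in> \<Gamma>" by (rule e(2)) (use d e(1) in \<open>simp_all add: q_def Gamma_inf_def\<close>)
  then have "dist q p \<le> diameter \<Gamma>" using p by (intro diameter_bounded_bound \<Gamma>(1))
  then show ?thesis using d e(1) by simp
qed

text \<open>Any point of \<Gamma> is the centre of a ball of radius the diameter L that contains
  \<Gamma>, and k0 L is the lower bound \<tau> for k L.\<close>

lemma screen_coercivity:
  fixes \<Gamma> :: "('a::euclidean_space \<times> real) set"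
  assumes \<Gamma>: "bounded \<Gamma>" "\<Gamma> \<noteq> {}" "openin (top_of_set Gamma_inf) \<Gamma>" and k: "0 < k0" "k0 \<le> k"
    and DL: "\<And>\<phi> x h. \<phi> \<in> test_functions (fst ` \<Gamma>) \<Longrightarrow> h > 0 \<Longrightarrow> double_layer k (fst ` \<Gamma>) \<phi> (x, h) = layer_transform k \<phi> x h"
    and u: "u \<in> sobolev_tilde (1/2) (fst ` \<Gamma>)"
  shows "coercivity_const DIM('a) (k0 * diameter \<Gamma>) / 16 * (k * diameter \<Gamma>) powr (- (1/2)) * (sobolev_norm k (1/2) u)\<^sup>2
    \<le> cmod (hypersingular_form k (fst ` \<Gamma>) u u)"
proof -
  note L = screen_diameter_pos[OF \<Gamma>]
  obtain p where p: "p \<in> \<Gamma>" using \<Gamma> by blast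
  have "norm (x - fst p) \<le> diameter \<Gamma>" if x: "x \<in> fst ` \<Gamma>" for x
  proof -
    obtain q where q: "q \<in> \<Gamma>" "x = fst q" using x by auto
    have "norm (x - fst p) \<le> dist q p" unfolding q(2) dist_norm[symmetric] by (rule dist_fst_le)
    also have "\<dots> \<le> diameter \<Gamma>" using p q by (intro diameter_bounded_bound \<Gamma>(1))
    finally show ?thesis .
  qed
  then show ?thesis
    using k L by (intro hypersingular_form_coercive[OF _ DL u]) auto
qed

theorem theorem6p2:
  shows "\<exists>C :: real \<Rightarrow> real. (\<forall>t>0. C t > 0) \<and>
    (\<forall>(\<Gamma> :: (real \<times> real) set) k0 k \<phi>.
       bounded \<Gamma> \<and> \<Gamma> \<noteq> {} \<and> openin (top_of_set Gamma_inf) \<Gamma> \<and>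
       0 < k0 \<and> k0 \<le> k \<and> \<phi> \<in> sobolev_tilde (1/2) (fst ` \<Gamma>) \<longrightarrow>
       cmod (hypersingular_form k (fst ` \<Gamma>) \<phi> \<phi>) \<ge>
         C (k0 * diameter \<Gamma>) * (k * diameter \<Gamma>) powr (- 1/2) * (sobolev_norm k (1/2) \<phi>)\<^sup>2) \<and>
    (\<forall>(\<Gamma> :: ((real ^ 2) \<times> real) set) k0 k \<phi>.
       bounded \<Gamma> \<and> \<Gamma> \<noteq> {} \<and> openin (top_of_set Gamma_inf) \<Gamma> \<and>
       0 < k0 \<and> k0 \<le> k \<and> \<phi> \<in> sobolev_tilde (1/2) (fst ` \<Gamma>) \<longrightarrow>
       cmod (hypersingular_form k (fst ` \<Gamma>) \<phi> \<phi>) \<ge>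
         C (k0 * diameter \<Gamma>) * (k * diameter \<Gamma>) powr (- 2/3) * (sobolev_norm k (1/2) \<phi>)\<^sup>2)"
proof -
  \<comment> \<open>The minimum serves both dimensions. With t = k0 L the factor
    \<open>t powr (1/6)\<close> is the least value of (k L)^(1/6), where 1/6 is the gap between the
    exponents -1/2 and -2/3.\<close>
  define C where "C t = min (coercivity_const 1 t / 16) (coercivity_const 2 t / 16 * t powr (1/6))" for t
  show ?thesis
  proof (intro exI[of _ C] conjI allI impI; (elim conjE)?)
    show "C t > 0" if "t > 0" for t using that by (simp add: C_def coercivity_const_pos)
  next
    fix \<Gamma> :: "(real \<times> real) set" and k0 k :: real and \<phi>
    assume \<Gamma>: "bounded \<Gamma>" "\<Gamma> \<noteq> {}" "openin (top_of_set Gamma_inf) \<Gamma>" and k: "0 < k0" "k0 \<le> k"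
      and \<phi>: "\<phi> \<in> sobolev_tilde (1/2) (fst ` \<Gamma>)"
    let ?L = "diameter \<Gamma>"
    have "C (k0 * ?L) \<le> coercivity_const DIM(real) (k0 * ?L) / 16" by (simp add: C_def)
    from mult_right_mono[OF mult_right_mono[OF this, of "(k * ?L) powr (- (1/2))"], of "(sobolev_norm k (1/2) \<phi>)\<^sup>2"]
    have "C (k0 * ?L) * (k * ?L) powr (- 1/2) * (sobolev_norm k (1/2) \<phi>)\<^sup>2
        \<le> coercivity_const DIM(real) (k0 * ?L) / 16 * (k * ?L) powr (- (1/2)) * (sobolev_norm k (1/2) \<phi>)\<^sup>2"
      by simp
    also have "\<dots> \<le> cmod (hypersingular_form k (fst ` \<Gamma>) \<phi> \<phi>)"
      using k by (intro screen_coercivity[OF \<Gamma> k _ \<phi>] double_layer_2d) auto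
    finally show "C (k0 * ?L) * (k * ?L) powr (- 1/2) * (sobolev_norm k (1/2) \<phi>)\<^sup>2 \<le> cmod (hypersingular_form k (fst ` \<Gamma>) \<phi> \<phi>)" .
  next
    fix \<Gamma> :: "((real ^ 2) \<times> real) set" and k0 k :: real and \<phi>
    assume \<Gamma>: "bounded \<Gamma>" "\<Gamma> \<noteq> {}" "openin (top_of_set Gamma_inf) \<Gamma>" and k: "0 < k0" "k0 \<le> k"
      and \<phi>: "\<phi> \<in> sobolev_tilde (1/2) (fst ` \<Gamma>)"
    let ?L = "diameter \<Gamma>" and ?c = "coercivity_const 2 (k0 * diameter \<Gamma>) / 16"
    have t: "0 < k0 * ?L" "k0 * ?L \<le> k * ?L" using screen_diameter_pos[OF \<Gamma>] k by (auto intro: mult_right_mono)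
    have c: "0 \<le> ?c" using coercivity_const_pos[of 2, OF _ t(1)] by simp
    have "C (k0 * ?L) * (k * ?L) powr (- 2/3) \<le> ?c * (k0 * ?L) powr (1/6) * (k * ?L) powr (- 2/3)"
      by (intro mult_right_mono) (simp_all add: C_def)
    also have "\<dots> \<le> ?c * (k * ?L) powr (1/6) * (k * ?L) powr (- 2/3)"
      using t c k screen_diameter_pos[OF \<Gamma>] by (intro mult_right_mono mult_left_mono powr_mono2) auto
    also have "\<dots> = ?c * (k * ?L) powr (- (1/2))"
      by (simp only: mult.assoc powr_add[symmetric]) simp
    finally have "C (k0 * ?L) * (k * ?L) powr (- 2/3) * (sobolev_norm k (1/2) \<phi>)\<^sup>2
        \<le> coercivity_const DIM(real ^ 2) (k0 * ?L) / 16 * (k * ?L) powr (- (1/2)) * (sobolev_norm k (1/2) \<phi>)\<^sup>2"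
      by (intro mult_right_mono) simp_all
    also have "\<dots> \<le> cmod (hypersingular_form k (fst ` \<Gamma>) \<phi> \<phi>)"
      using k by (intro screen_coercivity[OF \<Gamma> k _ \<phi>] double_layer_3d) auto
    finally show "C (k0 * ?L) * (k * ?L) powr (- 2/3) * (sobolev_norm k (1/2) \<phi>)\<^sup>2 \<le> cmod (hypersingular_form k (fst ` \<Gamma>) \<phi> \<phi>)" .
  qed
qed

end
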